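(* Let $v:\mathbb{R}_+\times\mathbb{R}^3\to\mathbb{R}^3$ be a divergence-free vector field ($\nabla\cdot v=0$ in the sense of distributions) with $v\in L^2(\mathbb{R}_+,\dot{H}^1(\mathbb{R}^3))$, and let $a\in L^2(\mathbb{R}_+\times\mathbb{R}^3)$ be a scalar function. Assume that $a$ is a distributional solution of the Cauchy problem $$\partial_t a+\nabla\cdot(a v)-\Delta a=0,\qquad a(0)=0,$$ where the initial condition is understood in the distributional sense. Then $a$ is identically zero on $\mathbb{R}_+\times\mathbb{R}^3$.
   Context: $\dot{H}^1(\mathbb{R}^3)$ denotes the homogeneous Sobolev space of (vector-valued) functions with gradient in $L^2(\mathbb{R}^3)$ (which embeds into $L^6(\mathbb{R}^3)$), so that $a v\in L^1_{loc}(\mathbb{R}_+\times\mathbb{R}^3)$ and the equation makes sense in $\mathcal{D}'((0,\infty)\times\mathbb{R}^3)$. Under these assumptions $\partial_t a\in L^1_{loc}(\mathbb{R}_+,H^{-2}(\mathbb{R}^3))$, so $a\in\mathcal{C}(\mathbb{R}_+,\mathcal{D}'(\mathbb{R}^3))$; the condition $a(0)=0$ means that this continuous representative takes the value $0\in\mathcal{D}'(\mathbb{R}^3)$ at $t=0$. *)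

theory Defs
  imports "HOL-Analysis.Analysis"
begin

definition dderiv :: "('a::euclidean_space \<Rightarrow> real) \<Rightarrow> 'a \<Rightarrow> 'a \<Rightarrow> real" where
  "dderiv f e = (\<lambda>p. frechet_derivative f (at p) e)"

fun iter_pd :: "('a::euclidean_space \<Rightarrow> real) \<Rightarrow> 'a list \<Rightarrow> 'a \<Rightarrow> real" where
  "iter_pd f [] = f"
| "iter_pd f (e # es) = dderiv (iter_pd f es) e"

definition smooth_fn :: "('a::euclidean_space \<Rightarrow> real) \<Rightarrow> bool" where
  "smooth_fn f \<longleftrightarrow> (\<forall>es. set es \<subseteq> Basis \<longrightarrow> (\<forall>p. iter_pd f es differentiable (at p)))"

definition test_fn :: "'a::euclidean_space set \<Rightarrow> ('a \<Rightarrow> real) \<Rightarrow> bool" where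
  "test_fn U \<phi> \<longleftrightarrow> smooth_fn \<phi> \<and> compact (closure {p. \<phi> p \<noteq> 0})
      \<and> closure {p. \<phi> p \<noteq> 0} \<subseteq> U"

definition half_space :: "(real \<times> (real^3)) set" where
  "half_space = {0<..} \<times> UNIV"

definition dt :: "(real \<times> (real^3) \<Rightarrow> real) \<Rightarrow> real \<times> (real^3) \<Rightarrow> real" where
  "dt \<phi> = dderiv \<phi> (1, 0)"

definition grad_x :: "(real \<times> (real^3) \<Rightarrow> real) \<Rightarrow> real \<times> (real^3) \<Rightarrow> real^3" where
  "grad_x \<phi> = (\<lambda>p. \<chi> j. dderiv \<phi> (0, axis j 1) p)"

definition lap_x :: "(real \<times> (real^3) \<Rightarrow> real) \<Rightarrow> real \<times> (real^3) \<Rightarrow> real" where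
  "lap_x \<phi> = (\<lambda>p. \<Sum>j\<in>UNIV. dderiv (dderiv \<phi> (0, axis j 1)) (0, axis j 1) p)"

section \<open>Homogeneous Sobolev space H-dot-1 (realised inside L^6) and L^2(R_+, H-dot-1)\<close>

definition weak_grad :: "(real^3 \<Rightarrow> real) \<Rightarrow> (real^3 \<Rightarrow> real^3) \<Rightarrow> bool" where
  "weak_grad u g \<longleftrightarrow> (\<forall>\<psi>. test_fn UNIV \<psi> \<longrightarrow> (\<forall>j.
      (\<integral>x. u x * dderiv \<psi> (axis j 1) x \<partial>lebesgue) = - (\<integral>x. g x $ j * \<psi> x \<partial>lebesgue)))"

definition Hdot1_grad :: "(real^3 \<Rightarrow> real^3) \<Rightarrow> (real^3 \<Rightarrow> real^3^3) \<Rightarrow> bool" where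
  "Hdot1_grad u G \<longleftrightarrow>
     u \<in> borel_measurable lebesgue \<and> G \<in> borel_measurable lebesgue \<and>
     integrable lebesgue (\<lambda>x. norm (u x) ^ 6) \<and>
     integrable lebesgue (\<lambda>x. norm (G x) ^ 2) \<and>
     (\<forall>i. weak_grad (\<lambda>x. u x $ i) (\<lambda>x. G x $ i))"

definition L2_Hdot1 :: "(real \<Rightarrow> real^3 \<Rightarrow> real^3) \<Rightarrow> bool" where
  "L2_Hdot1 v \<longleftrightarrow> (\<exists>G :: real \<Rightarrow> real^3 \<Rightarrow> real^3^3.
     set_borel_measurable lebesgue half_space (\<lambda>(t, x). v t x) \<and>
     set_borel_measurable lebesgue half_space (\<lambda>(t, x). G t x) \<and>
     (AE t in lborel. t > 0 \<longrightarrow> Hdot1_grad (v t) (G t)) \<and>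
     set_integrable lebesgue half_space (\<lambda>(t, x). norm (G t x) ^ 2))"

definition div_free :: "(real \<Rightarrow> real^3 \<Rightarrow> real^3) \<Rightarrow> bool" where
  "div_free v \<longleftrightarrow> (\<forall>\<phi>. test_fn half_space \<phi> \<longrightarrow>
     (\<integral>p. v (fst p) (snd p) \<bullet> grad_x \<phi> p \<partial>lebesgue) = 0)"

definition L2_spacetime :: "(real \<Rightarrow> real^3 \<Rightarrow> real) \<Rightarrow> bool" where
  "L2_spacetime a \<longleftrightarrow> set_borel_measurable lebesgue half_space (\<lambda>(t, x). a t x) \<and>
     set_integrable lebesgue half_space (\<lambda>(t, x). (a t x) ^ 2)"

definition weak_solution :: "(real \<Rightarrow> real^3 \<Rightarrow> real) \<Rightarrow> (real \<Rightarrow> real^3 \<Rightarrow> real^3) \<Rightarrow> bool" where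
  "weak_solution a v \<longleftrightarrow> (\<forall>\<phi>. test_fn half_space \<phi> \<longrightarrow>
     (\<integral>p. a (fst p) (snd p) * (dt \<phi> p + v (fst p) (snd p) \<bullet> grad_x \<phi> p + lap_x \<phi> p) \<partial>lebesgue) = 0)"

text \<open>a(0) = 0: a has a representative A in C([0,inf), D'(R^3)) (weak-star continuity,
  i.e. t -> A t psi continuous for every test function psi), agreeing with a(t) for a.e. t > 0,
  whose value at t = 0 is the zero distribution.\<close>
definition zero_initial_value :: "(real \<Rightarrow> real^3 \<Rightarrow> real) \<Rightarrow> bool" where
  "zero_initial_value a \<longleftrightarrow> (\<exists>A :: real \<Rightarrow> (real^3 \<Rightarrow> real) \<Rightarrow> real.
     (\<forall>\<psi>. test_fn UNIV \<psi> \<longrightarrow> continuous_on {0..} (\<lambda>t. A t \<psi>) \<and> A 0 \<psi> = 0) \<and>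
     (AE t in lborel. t > 0 \<longrightarrow>
        (\<forall>\<psi>. test_fn UNIV \<psi> \<longrightarrow> A t \<psi> = (\<integral>x. a t x * \<psi> x \<partial>lebesgue))))"

end

theory Submission
  imports Defs "HOL-Computational_Algebra.Polynomial"
begin

text \<open>
  The proof renormalises the equation, after DiPerna and Lions. Mollify \<open>a\<close> in space only: \<open>a\<^sub>k\<close>
  is absolutely continuous in time with \<open>a\<^sub>k(0) = 0\<close> and solves the equation up to the commutator
  \<open>r\<^sub>k = div (v a\<^sub>k) - div (v a) * \<rho>\<^sub>k\<close>. This commutator involves only difference quotients of \<open>v\<close>,
  so that it is bounded in \<open>L\<^sup>1\<close> by the \<open>L\<^sup>2\<close> norms of \<open>a\<close> and of the gradient of \<open>v\<close>, and it tends to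
  \<open>a div v = 0\<close>. Multiply by \<open>\<beta>'(a\<^sub>k)\<close>, where \<open>\<beta>(s) = sqrt (1 + s\<^sup>2) - 1\<close>: since \<open>\<beta>\<close> is convex
  with a bounded derivative, the diffusion has the good sign and the commutator vanishes in the limit.
  Thus \<open>\<beta>(a)\<close>, which is at most \<open>a\<^sup>2\<close> and \<open>\<bar>a\<bar>\<close>, is a subsolution with initial value \<open>0\<close>. Test it
  with a cut-off at radius \<open>R\<close>, whose gradient is of order \<open>1 / (1 + \<bar>x\<bar>)\<close>: Hardy's inequality puts
  \<open>v / (1 + \<bar>x\<bar>)\<close> into \<open>L\<^sup>2\<close>, so the flux term tends to \<open>0\<close> as \<open>R\<close> grows. Hence the integral of
  \<open>\<beta>(a)\<close> vanishes at almost every time.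
\<close>

section \<open>Smooth functions\<close>

text \<open>The energy method, which multiplies by the mollified \<open>a\<close> itself, fails
  because the commutator is small only in L^1 and \<open>a\<close> need not be bounded. This forces
  a bounded multiplier, hence a function \<open>renorm\<close> of linear growth. Near 0 it has to be
  quadratic, since \<open>a\<close> is only square integrable on an unbounded domain: with both
  properties \<open>renorm (a p)\<close> and its product with |v| / (1 + |x|) are integrable over
  space-time, and the cut-off can be removed by dominated convergence. The commutator does not see
  the scale of the mollifier \<rho>, because v(x) - v(x - h) is a sum of weights h_j times averaged
  derivatives, and the L^1 norms of the products h_j d_i \<rho>(h) are invariant under rescaling.
  The mollifier is removed at fixed R, and only then R grows. Time is not mollified: tested with a
  translate of \<rho>, the equation is an integral equation in time, whose initial value is supplied
  by the continuous representative. All this is done for Borel representatives that vanish for t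
  \<le> 0, with test functions that are products of a function of time and a function of
  space.\<close>

primrec smooth_upto :: "nat \<Rightarrow> ('a::euclidean_space \<Rightarrow> real) \<Rightarrow> bool" where
  "smooth_upto 0 f \<longleftrightarrow> True"
| "smooth_upto (Suc n) f \<longleftrightarrow> (\<forall>p. f differentiable (at p)) \<and> (\<forall>e\<in>Basis. smooth_upto n (dderiv f e))"

lemma iter_pd_snoc: "iter_pd f (es @ [e]) = iter_pd (dderiv f e) es"
  by (induction es) auto

text \<open>\<open>iter_pd\<close> applies the head of the list last, so the derivative that
  \<open>smooth_upto\<close> takes first is the last entry of the list; hence the case distinction
  on the end of \<open>es\<close>. Counting orders allows the closure properties below to be proved
  by induction.\<close>

lemma smooth_upto_iff:
  "smooth_upto n f \<longleftrightarrow> (\<forall>es. set es \<subseteq> Basis \<and> length es < n \<longrightarrow> (\<forall>p. iter_pd f es differentiable (at p)))"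
proof (induction n arbitrary: f)
  case 0
  then show ?case by simp
next
  case (Suc n)
  show ?case
  proof
    assume L: "smooth_upto (Suc n) f"
    show "\<forall>es. set es \<subseteq> Basis \<and> length es < Suc n \<longrightarrow> (\<forall>p. iter_pd f es differentiable (at p))"
    proof (intro allI impI)
      fix es :: "'a list" and p
      assume es: "set es \<subseteq> Basis \<and> length es < Suc n"
      show "iter_pd f es differentiable (at p)"
      proof (cases es rule: rev_cases)
        case Nil
        then show ?thesis using L by simp
      next
        case (snoc ys y)
        with es L Suc[of "dderiv f y"] show ?thesis by (auto simp: iter_pd_snoc)
      qed
    qed
  next
    assume R: "\<forall>es. set es \<subseteq> Basis \<and> length es < Suc n \<longrightarrow> (\<forall>p. iter_pd f es differentiable (at p))"
    have "f differentiable (at p)" for p using R[rule_format, of "[]"] by simp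
    moreover have "smooth_upto n (dderiv f e)" if "e \<in> Basis" for e
      unfolding Suc
    proof (intro allI impI)
      fix es :: "'a list" and p
      assume "set es \<subseteq> Basis \<and> length es < n"
      then show "iter_pd (dderiv f e) es differentiable (at p)"
        using R[rule_format, of "es @ [e]"] that by (simp add: iter_pd_snoc)
    qed
    ultimately show "smooth_upto (Suc n) f" by simp
  qed
qed

lemma smooth_fn_iff: "smooth_fn f \<longleftrightarrow> (\<forall>n. smooth_upto n f)"
  unfolding smooth_fn_def smooth_upto_iff by blast

lemma smooth_fn_unfold:
  "smooth_fn f \<longleftrightarrow> (\<forall>p. f differentiable (at p)) \<and> (\<forall>e\<in>Basis. smooth_fn (dderiv f e))"
proof -
  have "smooth_fn f \<longleftrightarrow> (\<forall>n. smooth_upto (Suc n) f)"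
    unfolding smooth_fn_iff by (metis not0_implies_Suc smooth_upto.simps(1))
  then show ?thesis by (auto simp: smooth_fn_iff)
qed

lemma smooth_upto_Suc_imp: "smooth_upto (Suc n) f \<Longrightarrow> smooth_upto n f"
  unfolding smooth_upto_iff by auto

lemma dderiv_eq:
  assumes "(f has_derivative f') (at p)"
  shows "dderiv f e p = f' e"
  unfolding dderiv_def using frechet_derivative_at[OF assms] by simp

lemma has_derivative_frechet:
  "f differentiable (at p) \<Longrightarrow> (f has_derivative frechet_derivative f (at p)) (at p)"
  by (simp add: frechet_derivative_works)

lemma dderiv_const: "dderiv (\<lambda>_. c) e = (\<lambda>_. 0)"
  by (rule ext, rule dderiv_eq[THEN trans]) (rule derivative_intros, simp)

lemma smooth_upto_const: "smooth_upto n (\<lambda>_. c)"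
  by (induction n arbitrary: c) (auto simp: dderiv_const)

lemma smooth_upto_add:
  "smooth_upto n f \<Longrightarrow> smooth_upto n g \<Longrightarrow> smooth_upto n (\<lambda>x. f x + g x)"
proof (induction n arbitrary: f g)
  case (Suc n)
  have "dderiv (\<lambda>x. f x + g x) e = (\<lambda>x. dderiv f e x + dderiv g e x)" for e
    using Suc.prems
    by (intro ext, subst dderiv_eq[OF has_derivative_add[OF has_derivative_frechet has_derivative_frechet]])
       (auto simp: dderiv_def)
  with Suc show ?case by (auto intro: differentiable_add)
qed simp

lemma dderiv_mult:
  assumes "f differentiable (at x)" "g differentiable (at x)"
  shows "dderiv (\<lambda>x. f x * g x) e x = f x * dderiv g e x + dderiv f e x * g x"
  using assms
  by (subst dderiv_eq[OF has_derivative_mult[OF has_derivative_frechet has_derivative_frechet]])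
     (auto simp: dderiv_def)

lemma smooth_upto_mult:
  "smooth_upto n f \<Longrightarrow> smooth_upto n g \<Longrightarrow> smooth_upto n (\<lambda>x. f x * g x)"
proof (induction n arbitrary: f g)
  case (Suc n)
  have "dderiv (\<lambda>x. f x * g x) e = (\<lambda>x. f x * dderiv g e x + dderiv f e x * g x)" for e
    using Suc.prems by (intro ext dderiv_mult) auto
  moreover have "smooth_upto n f" "smooth_upto n g"
    using Suc.prems by (auto intro: smooth_upto_Suc_imp simp del: smooth_upto.simps)
  ultimately show ?case
    using Suc.prems by (simp add: differentiable_mult smooth_upto_add Suc.IH)
qed simp

lemma smooth_upto_prod:
  "(\<And>i. i \<in> I \<Longrightarrow> smooth_upto n (f i)) \<Longrightarrow> smooth_upto n (\<lambda>x. \<Prod>i\<in>I. f i x)"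
  by (induction I rule: infinite_finite_induct) (auto intro: smooth_upto_const smooth_upto_mult)

text \<open>The outer function comes with its whole tower of derivatives \<open>h k\<close>, because
  a derivative of the composition involves \<open>h (Suc k)\<close>: the induction runs over the
  order with \<open>k\<close> arbitrary. The tower used later is \<open>flat\<close>.\<close>

lemma smooth_upto_compose_real:
  assumes h: "\<And>k x. (h k has_real_derivative h (Suc k) x) (at x)"
  shows "smooth_upto n f \<Longrightarrow> smooth_upto n (\<lambda>x. h k (f x))"
proof (induction n arbitrary: f k)
  case (Suc n)
  have D: "((\<lambda>x. h k (f x)) has_derivative (\<lambda>y. frechet_derivative f (at x) y * h (Suc k) (f x))) (at x)" for x
    using Suc.prems
    by (intro DERIV_compose_FDERIV[where f="h k", OF h has_derivative_frechet]) auto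
  have "dderiv (\<lambda>x. h k (f x)) e = (\<lambda>x. dderiv f e x * h (Suc k) (f x))" for e
    by (rule ext, subst dderiv_eq[OF D]) (simp add: dderiv_def)
  moreover have "smooth_upto n f" using Suc.prems by (rule smooth_upto_Suc_imp)
  ultimately show ?case
    using Suc.prems D Suc.IH[OF \<open>smooth_upto n f\<close>]
    by (auto intro!: smooth_upto_mult simp: differentiable_def)
qed simp

lemma smooth_upto_inner: "smooth_upto n (\<lambda>x. x \<bullet> i)"
proof (cases n)
  case (Suc m)
  have D: "((\<lambda>x. x \<bullet> i) has_derivative (\<lambda>x. x \<bullet> i)) (at x)" for x :: 'a
    by (auto intro!: derivative_eq_intros)
  have "dderiv (\<lambda>x. x \<bullet> i) e = (\<lambda>_. e \<bullet> i)" for e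
    by (rule ext, rule dderiv_eq[OF D])
  with D Suc show ?thesis by (auto simp: smooth_upto_const differentiable_def)
qed simp

text \<open>Smoothness is tested on basis directions only, so \<open>L\<close> has to send them to
  multiples of basis vectors or to 0. Dilations, reflections and the two projections of a product
  are of this kind.\<close>

lemma smooth_upto_compose_linear:
  fixes L :: "'a::euclidean_space \<Rightarrow> 'b::euclidean_space"
  assumes L: "bounded_linear L" and B: "\<And>e. e \<in> Basis \<Longrightarrow> L e = 0 \<or> (\<exists>c. \<exists>b\<in>Basis. L e = c *\<^sub>R b)"
  shows "smooth_upto n f \<Longrightarrow> smooth_upto n (\<lambda>x. f (L x + d))"
proof (induction n arbitrary: f)
  case (Suc n)
  have D: "((\<lambda>x. f (L x + d)) has_derivative (\<lambda>y. frechet_derivative f (at (L x + d)) (L y))) (at x)" for x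
    using Suc.prems
    by (intro has_derivative_compose[where g=f, of "\<lambda>x. L x + d" L x UNIV])
       (auto intro!: has_derivative_frechet derivative_eq_intros L[THEN bounded_linear.has_derivative] )
  have "smooth_upto n (dderiv (\<lambda>x. f (L x + d)) e)" if "e \<in> Basis" for e
  proof -
    have *: "dderiv (\<lambda>x. f (L x + d)) e = (\<lambda>x. dderiv f (L e) (L x + d))"
      by (rule ext, subst dderiv_eq[OF D]) (simp add: dderiv_def)
    have lin: "linear (frechet_derivative f (at y))" for y
      using Suc.prems by (intro linear_frechet_derivative) auto
    from B[OF that] show ?thesis
    proof
      assume "L e = 0"
      then have "dderiv f (L e) = (\<lambda>_. 0)"
        using lin by (auto simp: dderiv_def linear_0)
      then show ?thesis using * by (simp add: smooth_upto_const)
    next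
      assume "\<exists>c. \<exists>b\<in>Basis. L e = c *\<^sub>R b"
      then obtain c b where b: "b \<in> Basis" "L e = c *\<^sub>R b" by blast
      have "dderiv f (L e) = (\<lambda>x. c * dderiv f b x)"
        using lin by (auto simp: dderiv_def b linear_cmul)
      with * show ?thesis
        using b Suc by (auto intro!: smooth_upto_mult smooth_upto_const)
    qed
  qed
  with D show ?case by (auto simp: differentiable_def)
qed simp

lemma smooth_fn_const: "smooth_fn (\<lambda>_. c)"
  by (simp add: smooth_fn_iff smooth_upto_const)

lemma smooth_fn_mult: "smooth_fn f \<Longrightarrow> smooth_fn g \<Longrightarrow> smooth_fn (\<lambda>x. f x * g x)"
  by (simp add: smooth_fn_iff smooth_upto_mult)

lemma smooth_fn_add: "smooth_fn f \<Longrightarrow> smooth_fn g \<Longrightarrow> smooth_fn (\<lambda>x. f x + g x)"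
  by (simp add: smooth_fn_iff smooth_upto_add)

lemma smooth_fn_affine: "smooth_fn f \<Longrightarrow> smooth_fn (\<lambda>x. f (c *\<^sub>R x + d))"
  unfolding smooth_fn_iff
  by (intro allI smooth_upto_compose_linear bounded_linear_scaleR_right disjI2) auto

lemma smooth_fn_fst:
  fixes f :: "'a::euclidean_space \<Rightarrow> real"
  shows "smooth_fn f \<Longrightarrow> smooth_fn (\<lambda>x::'a \<times> 'b::euclidean_space. f (fst x))"
  unfolding smooth_fn_iff
proof
  fix n assume f: "\<forall>n. smooth_upto n f"
  have "fst e = 0 \<or> (\<exists>c. \<exists>b\<in>Basis. fst e = c *\<^sub>R b)" if "e \<in> Basis" for e :: "'a \<times> 'b"
  proof -
    have "fst e = 0 \<or> fst e \<in> Basis" using that by (auto simp: Basis_prod_def)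
    then show ?thesis by (metis scaleR_one)
  qed
  from smooth_upto_compose_linear[OF bounded_linear_fst this, of n f 0] f
  show "smooth_upto n (\<lambda>x::'a \<times> 'b. f (fst x))" by simp
qed

lemma smooth_fn_snd:
  fixes f :: "'b::euclidean_space \<Rightarrow> real"
  shows "smooth_fn f \<Longrightarrow> smooth_fn (\<lambda>x::'a::euclidean_space \<times> 'b. f (snd x))"
  unfolding smooth_fn_iff
proof
  fix n assume f: "\<forall>n. smooth_upto n f"
  have "snd e = 0 \<or> (\<exists>c. \<exists>b\<in>Basis. snd e = c *\<^sub>R b)" if "e \<in> Basis" for e :: "'a \<times> 'b"
  proof -
    have "snd e = 0 \<or> snd e \<in> Basis" using that by (auto simp: Basis_prod_def)
    then show ?thesis by (metis scaleR_one)
  qed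
  from smooth_upto_compose_linear[OF bounded_linear_snd this, of n f 0] f
  show "smooth_upto n (\<lambda>x::'a \<times> 'b. f (snd x))" by simp
qed

lemma smooth_fn_differentiable: "smooth_fn f \<Longrightarrow> f differentiable (at p)"
  using smooth_fn_unfold by blast

lemma smooth_fn_dderiv: "smooth_fn f \<Longrightarrow> e \<in> Basis \<Longrightarrow> smooth_fn (dderiv f e)"
  using smooth_fn_unfold by blast

lemma smooth_fn_continuous: "smooth_fn f \<Longrightarrow> continuous_on UNIV f"
  by (intro continuous_at_imp_continuous_on ballI differentiable_imp_continuous_within smooth_fn_differentiable)

section \<open>Bump functions\<close>

text \<open>The derivatives of \<open>exp (- 1 / x)\<close> have the form \<open>P (1 / x) * exp (- 1 / x)\<close> with a polynomial \<open>P\<close>.\<close>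

primrec flat_poly :: "nat \<Rightarrow> real poly" where
  "flat_poly 0 = 1"
| "flat_poly (Suc k) = monom 1 2 * (flat_poly k - pderiv (flat_poly k))"

definition flat :: "nat \<Rightarrow> real \<Rightarrow> real" where
  "flat k x = (if x > 0 then poly (flat_poly k) (1 / x) * exp (- (1 / x)) else 0)"

lemma poly_times_exp_neg: "((\<lambda>y. poly p y * exp (- y)) \<longlongrightarrow> (0::real)) at_top"
proof -
  have "((\<lambda>y. \<Sum>i\<le>degree p. coeff p i * (y ^ i / exp y)) \<longlongrightarrow> (\<Sum>i\<le>degree p. coeff p i * 0)) at_top"
    by (intro tendsto_intros tendsto_power_div_exp_0)
  moreover have "(\<Sum>i\<le>degree p. coeff p i * (y ^ i / exp y)) = poly p y * exp (- y)" for y :: real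
    unfolding poly_altdef sum_distrib_right
    by (rule sum.cong) (simp_all add: exp_minus field_simps)
  ultimately show ?thesis by simp
qed

lemma flat_has_derivative: "(flat k has_real_derivative flat (Suc k) x) (at x)"
proof (cases x "0::real" rule: linorder_cases)
  case less
  have "((\<lambda>_. 0) has_real_derivative flat (Suc k) x) (at x)"
    using less by (simp add: flat_def)
  then show ?thesis
    by (rule has_field_derivative_transform_within_open[where S="{..<0}"])
       (use less in \<open>auto simp: flat_def\<close>)
next
  case greater
  have "((\<lambda>x. poly (flat_poly k) (1 / x) * exp (- (1 / x))) has_real_derivative flat (Suc k) x) (at x)"
    using greater
    by (auto intro!: derivative_eq_intros DERIV_chain2[OF poly_DERIV]
             simp: flat_def poly_monom power2_eq_square field_simps)
  then show ?thesis
    by (rule has_field_derivative_transform_within_open[where S="{0<..}"])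
       (use greater in \<open>auto simp: flat_def\<close>)
next
  case equal
  \<comment> \<open>With y = 1/h the difference quotient \<open>flat k h / h\<close> becomes y P(y)
    exp(-y); the extra factor y is what \<open>pCons 0\<close> supplies.\<close>
  have lim: "((\<lambda>h. poly (pCons 0 (flat_poly k)) (inverse h) * exp (- inverse h)) \<longlongrightarrow> 0) (at_right (0::real))"
    by (rule filterlim_compose[OF poly_times_exp_neg filterlim_inverse_at_top_right])
  have "((\<lambda>h. flat k h / h) \<longlongrightarrow> 0) (at_right 0)"
    by (rule tendsto_cong[THEN iffD1, OF _ lim])
       (auto simp: eventually_at_right_field flat_def field_simps intro!: exI[of _ 1])
  moreover have "((\<lambda>h. flat k h / h) \<longlongrightarrow> 0) (at_left 0)"
    by (rule tendsto_eventually) (auto simp: eventually_at_left_field flat_def intro!: exI[of _ "-1"])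
  ultimately have "((\<lambda>h. flat k h / h) \<longlongrightarrow> 0) (at 0)"
    by (simp add: filterlim_split_at)
  then show ?thesis
    using equal by (simp add: DERIV_def flat_def)
qed

lemma flat_pos: "x > 0 \<Longrightarrow> flat 0 x > 0" and flat_nonneg: "flat 0 x \<ge> 0"
  and flat_le_1: "flat 0 x \<le> 1" and flat_eq_0: "x \<le> 0 \<Longrightarrow> flat 0 x = 0"
  by (auto simp: flat_def)

lemma flat_tendsto_indicator: "(\<lambda>n. flat 0 (real n * x)) \<longlonglongrightarrow> (if x > 0 then 1 else 0)"
proof (cases "x > 0")
  case True
  have "(\<lambda>n. exp (- (1 / x) * (1 / real n))) \<longlonglongrightarrow> exp (- (1 / x) * 0)"
    by (intro tendsto_intros lim_1_over_n)
  then have "(\<lambda>n. exp (- (1 / x) * (1 / real n))) \<longlonglongrightarrow> 1" by simp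
  then have "(\<lambda>n. flat 0 (real n * x)) \<longlonglongrightarrow> 1"
    by (rule Lim_transform_eventually)
       (use True in \<open>auto simp: flat_def eventually_sequentially mult.commute intro!: exI[of _ 1]\<close>)
  with True show ?thesis by simp
next
  case False
  then have "real n * x \<le> 0" for n by (simp add: mult_nonneg_nonpos)
  with False show ?thesis by (simp add: flat_eq_0)
qed

text \<open>The box does not move with \<open>n\<close>; only the walls get steeper. Test functions
  thereby converge to the indicator of the open box, and open boxes generate the Borel sets.\<close>

definition box_bump :: "'a::euclidean_space \<Rightarrow> 'a \<Rightarrow> nat \<Rightarrow> 'a \<Rightarrow> real" where
  "box_bump a b n x = (\<Prod>i\<in>Basis. flat 0 (real n * (x \<bullet> i - a \<bullet> i)) * flat 0 (real n * (b \<bullet> i - x \<bullet> i)))"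

lemma smooth_box_bump: "smooth_fn (box_bump a b n)"
proof -
  have "smooth_upto m (\<lambda>x. flat 0 (real n * (x \<bullet> i + (- a \<bullet> i))) * flat 0 (real n * (b \<bullet> i + (-1) * (x \<bullet> i))))" for i m
    by (intro smooth_upto_mult smooth_upto_compose_real[where h=flat, OF flat_has_derivative]
              smooth_upto_add smooth_upto_const smooth_upto_inner)
  then show ?thesis
    unfolding smooth_fn_iff box_bump_def[abs_def] by (intro allI smooth_upto_prod) simp
qed

lemma box_bump_nonneg: "box_bump a b n x \<ge> 0"
  by (simp add: box_bump_def prod_nonneg flat_nonneg)

lemma box_bump_le_1: "box_bump a b n x \<le> 1"
  unfolding box_bump_def by (intro prod_le_1) (auto simp: flat_nonneg flat_le_1 mult_le_one)

lemma box_bump_eq_0: "x \<notin> box a b \<Longrightarrow> box_bump a b n x = 0"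
proof -
  assume "x \<notin> box a b"
  then obtain i where "i \<in> Basis" "x \<bullet> i \<le> a \<bullet> i \<or> b \<bullet> i \<le> x \<bullet> i"
    by (auto simp: mem_box not_less)
  then have "flat 0 (real n * (x \<bullet> i - a \<bullet> i)) * flat 0 (real n * (b \<bullet> i - x \<bullet> i)) = 0"
    by (auto intro!: flat_eq_0 mult_nonneg_nonpos)
  with \<open>i \<in> Basis\<close> show ?thesis unfolding box_bump_def by (simp add: prod_zero_iff) blast
qed

lemma box_bump_pos: "x \<in> box a b \<Longrightarrow> n > 0 \<Longrightarrow> box_bump a b n x > 0"
  unfolding box_bump_def by (intro prod_pos) (auto simp: mem_box intro!: mult_pos_pos flat_pos)

lemma box_bump_tendsto: "(\<lambda>n. box_bump a b n x) \<longlonglongrightarrow> indicat_real (box a b) x"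
proof -
  have "(\<lambda>n. box_bump a b n x) \<longlonglongrightarrow>
     (\<Prod>i\<in>Basis. (if x \<bullet> i - a \<bullet> i > 0 then 1 else 0) * (if b \<bullet> i - x \<bullet> i > 0 then 1 else 0))"
    unfolding box_bump_def by (intro tendsto_intros flat_tendsto_indicator)
  also have "(\<Prod>i\<in>Basis. (if x \<bullet> i - a \<bullet> i > 0 then 1 else 0) * (if b \<bullet> i - x \<bullet> i > 0 then 1 else 0)) = indicat_real (box a b) x"
    by (auto simp: indicator_def mem_box intro!: prod.neutral)
  finally show ?thesis .
qed

lemma test_fn_supportI:
  assumes "smooth_fn \<phi>" "compact K" "K \<subseteq> U" "\<And>x. x \<notin> K \<Longrightarrow> \<phi> x = 0"
  shows "test_fn U \<phi>"
proof -
  have "{p. \<phi> p \<noteq> 0} \<subseteq> K" using assms(4) by auto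
  then have "closure {p. \<phi> p \<noteq> 0} \<subseteq> K"
    using closure_minimal compact_imp_closed[OF assms(2)] by blast
  then show ?thesis unfolding test_fn_def
    using assms by (metis (no_types, lifting) bounded_subset closed_closure compact_eq_bounded_closed subset_trans)
qed

lemma test_fn_support:
  assumes "test_fn U \<phi>"
  obtains K where "compact K" "K \<subseteq> U" "\<And>x. x \<notin> K \<Longrightarrow> \<phi> x = 0"
  using assms that[of "closure {p. \<phi> p \<noteq> 0}"] closure_subset[of "{p. \<phi> p \<noteq> 0}"]
  unfolding test_fn_def by blast

lemma test_fn_smooth: "test_fn U \<phi> \<Longrightarrow> smooth_fn \<phi>"
  by (simp add: test_fn_def)

lemma test_fn_box_bump: "cbox a b \<subseteq> U \<Longrightarrow> test_fn U (box_bump a b n)"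
  by (rule test_fn_supportI[of _ "cbox a b"])
     (auto intro: smooth_box_bump intro!: box_bump_eq_0 dest: subsetD[OF box_subset_cbox])

lemma dderiv_eq_0:
  assumes "\<And>x. x \<notin> K \<Longrightarrow> \<phi> x = 0" "closed K" "x \<notin> K"
  shows "dderiv \<phi> e x = 0"
proof -
  have "(\<phi> has_derivative (\<lambda>_. 0)) (at x)"
    by (rule has_derivative_transform_within_open[OF has_derivative_const, of "-K"])
       (use assms in auto)
  then show ?thesis by (simp add: dderiv_eq)
qed

lemma test_fn_dderiv:
  assumes "test_fn U \<phi>" "e \<in> Basis"
  shows "test_fn U (dderiv \<phi> e)"
proof -
  obtain K where K: "compact K" "K \<subseteq> U" "\<And>x. x \<notin> K \<Longrightarrow> \<phi> x = 0"
    using test_fn_support[OF assms(1)] by blast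
  show ?thesis
    using K assms by (intro test_fn_supportI[of _ K])
      (auto simp: test_fn_smooth smooth_fn_dderiv intro!: dderiv_eq_0[of K] compact_imp_closed)
qed

lemma test_fn_affine:
  fixes \<phi> :: "'a::euclidean_space \<Rightarrow> real"
  assumes "test_fn UNIV \<phi>" "c \<noteq> 0"
  shows "test_fn UNIV (\<lambda>x. \<phi> (c *\<^sub>R x + d))"
proof -
  obtain K where K': "compact K" "K \<subseteq> UNIV" "\<And>x. x \<notin> K \<Longrightarrow> \<phi> x = 0"
    using test_fn_support[OF assms(1)] by blast
  note K = K'(1,3)
  let ?K = "(\<lambda>x. (1 / c) *\<^sub>R x + (- (1 / c) *\<^sub>R d)) ` K"
  have "compact ?K" using K by (intro compact_continuous_image continuous_intros)
  have z: "\<phi> (c *\<^sub>R x + d) = 0" if "x \<notin> ?K" for x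
  proof (rule K(2))
    show "c *\<^sub>R x + d \<notin> K"
    proof
      assume *: "c *\<^sub>R x + d \<in> K"
      have "x = (1 / c) *\<^sub>R (c *\<^sub>R x + d) + (- (1 / c) *\<^sub>R d)"
        using assms(2) by (simp add: scaleR_right_distrib)
      with * that show False by blast
    qed
  qed
  show ?thesis
    by (rule test_fn_supportI[OF smooth_fn_affine[OF test_fn_smooth[OF assms(1)]] \<open>compact ?K\<close> subset_UNIV z])
qed

lemma test_fn_fst_snd:
  fixes \<theta> :: "'a::euclidean_space \<Rightarrow> real" and \<psi> :: "'b::euclidean_space \<Rightarrow> real"
  assumes "test_fn U \<theta>" "test_fn V \<psi>"
  shows "test_fn (U \<times> V) (\<lambda>p. \<theta> (fst p) * \<psi> (snd p))"
proof -
  obtain K where K: "compact K" "K \<subseteq> U" "\<And>x. x \<notin> K \<Longrightarrow> \<theta> x = 0"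
    using test_fn_support[OF assms(1)] by blast
  obtain L where L: "compact L" "L \<subseteq> V" "\<And>x. x \<notin> L \<Longrightarrow> \<psi> x = 0"
    using test_fn_support[OF assms(2)] by blast
  show ?thesis
    using K L assms
    by (intro test_fn_supportI[of _ "K \<times> L"] smooth_fn_mult smooth_fn_fst smooth_fn_snd compact_Times)
       (auto simp: test_fn_smooth mem_Times_iff)
qed

section \<open>Integration over Euclidean space\<close>

lemma null_sandwich:
  fixes f g :: "nat \<Rightarrow> real"
  assumes "g \<longlonglongrightarrow> 0" "\<And>n. 0 \<le> f n" "\<And>n. f n \<le> g n"
  shows "f \<longlonglongrightarrow> 0"
  by (rule Lim_null_comparison[OF _ assms(1)]) (use assms in auto)

lemma null_sandwich_mult:
  fixes f g :: "nat \<Rightarrow> real"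
  assumes "g \<longlonglongrightarrow> 0" "\<And>n. 0 \<le> f n" "\<And>n. f n \<le> c * g n"
  shows "f \<longlonglongrightarrow> 0"
  by (rule null_sandwich[OF tendsto_mult_right_zero[OF assms(1)] assms(2,3)])

lemma distr_lborel_translate: "distr lborel borel (\<lambda>x::'a::euclidean_space. x + h) = lborel"
proof -
  have "(\<lambda>x. x + h) = (+) h" by (simp add: fun_eq_iff add.commute)
  then show ?thesis by (simp only: lborel_distr_plus)
qed

lemma distr_lborel_reflect: "distr lborel borel (\<lambda>x::'a::euclidean_space. h - x) = lborel"
proof -
  have "(lborel :: 'a measure) = density (distr lborel borel (\<lambda>x. h + (- 1) *\<^sub>R x)) (\<lambda>_. 1)"
    using lborel_affine[of "- 1" h] by simp
  then show ?thesis by (simp add: density_1)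
qed

lemma
  fixes f :: "'a::euclidean_space \<Rightarrow> 'b::{banach, second_countable_topology}"
  assumes [measurable]: "f \<in> borel_measurable borel"
  shows integral_translate: "(\<integral>x. f (x + h) \<partial>lborel) = (\<integral>x. f x \<partial>lborel)"
    and integrable_translate: "integrable lborel (\<lambda>x. f (x + h)) \<longleftrightarrow> integrable lborel f"
    and integral_reflect: "(\<integral>x. f (h - x) \<partial>lborel) = (\<integral>x. f x \<partial>lborel)"
    and integrable_reflect: "integrable lborel (\<lambda>x. f (h - x)) \<longleftrightarrow> integrable lborel f"
  using integral_distr[of "\<lambda>x. x + h" lborel borel f] integral_distr[of "\<lambda>x. h - x" lborel borel f]
    integrable_distr_eq[of "\<lambda>x. x + h" lborel borel f] integrable_distr_eq[of "\<lambda>x. h - x" lborel borel f]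
  by (simp_all add: distr_lborel_translate distr_lborel_reflect)

lemma nn_integral_translate:
  fixes f :: "'a::euclidean_space \<Rightarrow> ennreal"
  assumes [measurable]: "f \<in> borel_measurable borel"
  shows "(\<integral>\<^sup>+x. f (x + h) \<partial>lborel) = (\<integral>\<^sup>+x. f x \<partial>lborel)"
  using nn_integral_distr[of "\<lambda>x. x + h" lborel borel f] by (simp add: distr_lborel_translate)

lemma integral_Cauchy_Schwarz:
  fixes f g :: "'a \<Rightarrow> real"
  assumes [measurable]: "f \<in> borel_measurable M" "g \<in> borel_measurable M"
    and f2: "integrable M (\<lambda>x. (f x)\<^sup>2)" and g2: "integrable M (\<lambda>x. (g x)\<^sup>2)"
  shows integrable_mult_L2: "integrable M (\<lambda>x. f x * g x)"
    and "(\<integral>x. \<bar>f x * g x\<bar> \<partial>M) \<le> sqrt (\<integral>x. (f x)\<^sup>2 \<partial>M) * sqrt (\<integral>x. (g x)\<^sup>2 \<partial>M)"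
proof -
  have bd: "\<bar>f x * g x\<bar> \<le> (f x)\<^sup>2 + (g x)\<^sup>2" for x
  proof -
    have "\<bar>f x * g x\<bar> \<le> 2 * \<bar>f x\<bar> * \<bar>g x\<bar>" by (simp add: abs_mult)
    also have "\<dots> \<le> \<bar>f x\<bar>\<^sup>2 + \<bar>g x\<bar>\<^sup>2" by (rule sum_squares_bound)
    finally show ?thesis by simp
  qed
  show int: "integrable M (\<lambda>x. f x * g x)"
    by (rule Bochner_Integration.integrable_bound[OF Bochner_Integration.integrable_add[OF f2 g2]])
       (use bd in auto)
  define A B C where "A = (\<integral>x. (f x)\<^sup>2 \<partial>M)" and "B = (\<integral>x. (g x)\<^sup>2 \<partial>M)" and "C = (\<integral>x. \<bar>f x * g x\<bar> \<partial>M)"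
  have A0: "A \<ge> 0" and B0: "B \<ge> 0" and C0: "C \<ge> 0" by (auto simp: A_def B_def C_def)
  \<comment> \<open>A nonnegative quadratic polynomial in t; its value at the minimum
    \<open>C / A\<close> gives the inequality.\<close>
  have q: "0 \<le> t\<^sup>2 * A - 2 * t * C + B" for t
  proof -
    have "0 \<le> (\<integral>x. (t * \<bar>f x\<bar> - \<bar>g x\<bar>)\<^sup>2 \<partial>M)" by simp
    also have "\<dots> = (\<integral>x. t\<^sup>2 * (f x)\<^sup>2 - 2 * t * \<bar>f x * g x\<bar> + (g x)\<^sup>2 \<partial>M)"
      by (rule arg_cong[where f="integral\<^sup>L M"]) (auto simp: power2_diff power_mult_distrib abs_mult)
    also have "\<dots> = t\<^sup>2 * A - 2 * t * C + B"
      using f2 g2 int by (simp add: A_def B_def C_def)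
    finally show ?thesis .
  qed
  have "C\<^sup>2 \<le> A * B"
  proof (cases "A = 0")
    case True
    show ?thesis
    proof (rule ccontr)
      assume "\<not> ?thesis"
      with True C0 have "C > 0" by (cases "C = 0") auto
      \<comment> \<open>Without the quadratic term the polynomial is affine, and at this point it
        equals -1.\<close>
      with q[of "(B + 1) / (2 * C)"] True show False by simp
    qed
  next
    case False
    with A0 have "A > 0" by simp
    with q[of "C / A"] show ?thesis by (simp add: field_simps power2_eq_square)
  qed
  then have "C \<le> sqrt (A * B)" by (rule real_le_rsqrt)
  then show "(\<integral>x. \<bar>f x * g x\<bar> \<partial>M) \<le> sqrt (\<integral>x. (f x)\<^sup>2 \<partial>M) * sqrt (\<integral>x. (g x)\<^sup>2 \<partial>M)"
    by (simp add: A_def B_def C_def real_sqrt_mult)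
qed

section \<open>Continuity of translations in L^1 and L^2\<close>

lemma L1_translation_indicator_open:
  fixes U :: "'a::euclidean_space set"
  assumes U: "open U" "emeasure lborel U < \<infinity>" and X: "X \<longlonglongrightarrow> 0"
  shows "(\<lambda>n. \<integral>x. \<bar>indicat_real U (x + X n) - indicat_real U x\<bar> \<partial>lborel) \<longlonglongrightarrow> 0"
proof -
  have [measurable]: "U \<in> sets borel" using U by simp
  \<comment> \<open>Only the part of the difference inside \<open>U\<close> can be handled
    pointwise: there it tends to 0 because \<open>U\<close> is open, and it is dominated by the
    indicator of \<open>U\<close>. The points that enter \<open>U\<close> have the same measure as
    those that leave it, by translation invariance, which accounts for the factor 2 below.\<close>
  let ?p = "\<lambda>n x. max 0 (indicat_real U x - indicat_real U (x + X n))"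
  have iU: "integrable lborel (indicat_real U)" using U by simp
  have iUX: "integrable lborel (\<lambda>x. indicat_real U (x + h))" for h
    using integrable_translate[of "indicat_real U" h] iU by simp
  have "(\<lambda>n. \<integral>x. ?p n x \<partial>lborel) \<longlonglongrightarrow> (\<integral>x. 0 \<partial>(lborel :: 'a measure))"
  proof (rule integral_dominated_convergence[where w="indicat_real U"])
    show "AE x in lborel. (\<lambda>n. ?p n x) \<longlonglongrightarrow> 0"
    proof (rule AE_I2)
      fix x :: 'a
      show "(\<lambda>n. ?p n x) \<longlonglongrightarrow> 0"
      proof (cases "x \<in> U")
        case True
        have "(\<lambda>n. x + X n) \<longlonglongrightarrow> x + 0" by (intro tendsto_intros X)
        then have "eventually (\<lambda>n. x + X n \<in> U) sequentially"
          using U(1) True by (auto dest: topological_tendstoD)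
        then show ?thesis
          by (intro tendsto_eventually) (auto elim!: eventually_mono simp: indicator_def)
      next
        case False
        then have "?p n x = 0" for n by (simp add: indicator_def)
        then show ?thesis by simp
      qed
    qed
  qed (use iU in \<open>auto simp: indicator_def\<close>)
  moreover have "(\<integral>x. \<bar>indicat_real U (x + X n) - indicat_real U x\<bar> \<partial>lborel) = 2 * (\<integral>x. ?p n x \<partial>lborel)" for n
  proof -
    have ip: "integrable lborel (?p n)"
      by (rule Bochner_Integration.integrable_bound[OF iU]) (auto simp: indicator_def)
    have "(\<integral>x. \<bar>indicat_real U (x + X n) - indicat_real U x\<bar> \<partial>lborel)
        = (\<integral>x. 2 * ?p n x + (indicat_real U (x + X n) - indicat_real U x) \<partial>lborel)"
      by (rule arg_cong[where f="integral\<^sup>L lborel"]) (auto simp: max_def)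
    also have "\<dots> = 2 * (\<integral>x. ?p n x \<partial>lborel) + ((\<integral>x. indicat_real U (x + X n) \<partial>lborel) - (\<integral>x. indicat_real U x \<partial>lborel))"
      using ip iU iUX[of "X n"] by simp
    finally show ?thesis using integral_translate[of "indicat_real U" "X n"] by simp
  qed
  ultimately show ?thesis by (auto intro: tendsto_mult_right_zero)
qed

text \<open>Translation is an isometry of L^1, so the functions with continuous translations are
  closed under L^1 limits: a third of the error goes to \<open>f - g\<close>, a third to its
  translate and a third to \<open>g\<close>.\<close>

lemma L1_translation_approx:
  fixes f :: "'a::euclidean_space \<Rightarrow> real"
  assumes f: "integrable lborel f"
    and approx: "\<And>\<epsilon>. \<epsilon> > 0 \<Longrightarrow> \<exists>g. integrable lborel g \<and> (\<integral>x. \<bar>f x - g x\<bar> \<partial>lborel) \<le> \<epsilon> \<and>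
        (\<lambda>n. \<integral>x. \<bar>g (x + X n) - g x\<bar> \<partial>lborel) \<longlonglongrightarrow> 0"
  shows "(\<lambda>n. \<integral>x. \<bar>f (x + X n) - f x\<bar> \<partial>lborel) \<longlonglongrightarrow> 0"
proof (rule LIMSEQ_I)
  fix r :: real assume "r > 0"
  obtain g where g: "integrable lborel g" "(\<integral>x. \<bar>f x - g x\<bar> \<partial>lborel) \<le> r / 3"
      "(\<lambda>n. \<integral>x. \<bar>g (x + X n) - g x\<bar> \<partial>lborel) \<longlonglongrightarrow> 0"
    using approx[of "r / 3"] \<open>r > 0\<close> by auto
  have [measurable]: "f \<in> borel_measurable borel" "g \<in> borel_measurable borel"
    using f g by (simp_all add: borel_measurable_integrable)
  obtain N where N: "\<And>n. n \<ge> N \<Longrightarrow> (\<integral>x. \<bar>g (x + X n) - g x\<bar> \<partial>lborel) < r / 3"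
    using LIMSEQ_D[OF g(3), of "r / 3"] \<open>r > 0\<close> by auto
  have "norm ((\<integral>x. \<bar>f (x + X n) - f x\<bar> \<partial>lborel) - 0) < r" if "n \<ge> N" for n
  proof -
    have i: "integrable lborel (\<lambda>x. f (x + X n))" "integrable lborel (\<lambda>x. g (x + X n))"
      using f g(1) by (simp_all add: integrable_translate)
    have "(\<integral>x. \<bar>f (x + X n) - f x\<bar> \<partial>lborel) \<le> (\<integral>x. \<bar>f (x + X n) - g (x + X n)\<bar> + \<bar>g (x + X n) - g x\<bar> + \<bar>f x - g x\<bar> \<partial>lborel)"
      using f g(1) i by (intro integral_mono) (auto intro!: integrable_abs)
    also have "\<dots> = (\<integral>x. \<bar>f (x + X n) - g (x + X n)\<bar> \<partial>lborel) + (\<integral>x. \<bar>g (x + X n) - g x\<bar> \<partial>lborel) + (\<integral>x. \<bar>f x - g x\<bar> \<partial>lborel)"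
      using f g(1) i by (subst Bochner_Integration.integral_add; (intro integrable_abs Bochner_Integration.integrable_add Bochner_Integration.integrable_diff)?; simp)+
    also have "(\<integral>x. \<bar>f (x + X n) - g (x + X n)\<bar> \<partial>lborel) = (\<integral>x. \<bar>f x - g x\<bar> \<partial>lborel)"
      by (rule integral_translate[of "\<lambda>x. \<bar>f x - g x\<bar>"]) simp
    finally show ?thesis using N[OF that] g(2) by simp
  qed
  then show "\<exists>no. \<forall>n\<ge>no. norm ((\<integral>x. \<bar>f (x + X n) - f x\<bar> \<partial>lborel) - 0) < r" by blast
qed

lemma L1_translation:
  fixes f :: "'a::euclidean_space \<Rightarrow> real"
  assumes f: "integrable lborel f" and X: "X \<longlonglongrightarrow> 0"
  shows "(\<lambda>n. \<integral>x. \<bar>f (x + X n) - f x\<bar> \<partial>lborel) \<longlonglongrightarrow> 0"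
  using f
proof (induction rule: integrable_induct)
  case (base A c)
  have A[measurable]: "A \<in> sets borel" using base by simp
  have iA: "integrable lborel (indicat_real A)" using base by simp
  have "(\<lambda>n. \<integral>x. \<bar>indicat_real A (x + X n) - indicat_real A x\<bar> \<partial>lborel) \<longlonglongrightarrow> 0"
  proof (rule L1_translation_approx[OF iA])
    fix \<epsilon> :: real assume "\<epsilon> > 0"
    \<comment> \<open>Outer regularity: the difference to an open superset has arbitrarily small
      measure, so the case of open sets suffices.\<close>
    obtain U where U: "open U" "A \<subseteq> U" "emeasure lborel (U - A) < \<epsilon>"
      using outer_regular_lborel[OF A \<open>\<epsilon> > 0\<close>] by blast
    have [measurable]: "U \<in> sets borel" using U by simp
    have "emeasure lborel U = emeasure lborel A + emeasure lborel (U - A)"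
      using U by (subst plus_emeasure) (auto simp: Un_absorb1)
    then have fU: "emeasure lborel U < \<infinity>"
      using base(2) U(3) by (metis ennreal_add_less_top ennreal_less_top infinity_ennreal_def less_trans)
    have "(\<integral>x. \<bar>indicat_real A x - indicat_real U x\<bar> \<partial>lborel) = (\<integral>x. indicat_real (U - A) x \<partial>lborel)"
      using U(2) by (intro arg_cong[where f="integral\<^sup>L lborel"]) (auto simp: indicator_def fun_eq_iff)
    also have "\<dots> = measure lborel (U - A)" by simp
    also have "\<dots> \<le> \<epsilon>"
      using U(3) \<open>\<epsilon> > 0\<close> by (simp add: measure_def enn2real_leI)
    finally show "\<exists>g. integrable lborel g \<and> (\<integral>x. \<bar>indicat_real A x - g x\<bar> \<partial>lborel) \<le> \<epsilon> \<and>
        (\<lambda>n. \<integral>x. \<bar>g (x + X n) - g x\<bar> \<partial>lborel) \<longlonglongrightarrow> 0"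
      using fU L1_translation_indicator_open[OF U(1) fU X] by (intro exI[of _ "indicat_real U"]) auto
  qed
  then have "(\<lambda>n. (\<integral>x. \<bar>indicat_real A (x + X n) - indicat_real A x\<bar> \<partial>lborel) * \<bar>c\<bar>) \<longlonglongrightarrow> 0"
    by (rule tendsto_mult_left_zero)
  then show ?case
    by (simp flip: integral_mult_left_zero add: left_diff_distrib[symmetric] abs_mult)
next
  case (add f g)
  have [measurable]: "f \<in> borel_measurable borel" "g \<in> borel_measurable borel"
    using add by (simp_all add: borel_measurable_integrable)
  have i: "integrable lborel (\<lambda>x. f (x + h))" "integrable lborel (\<lambda>x. g (x + h))" for h
    using add by (simp_all add: integrable_translate)
  have lim0: "(\<lambda>n. (\<integral>x. \<bar>f (x + X n) - f x\<bar> \<partial>lborel) + (\<integral>x. \<bar>g (x + X n) - g x\<bar> \<partial>lborel)) \<longlonglongrightarrow> 0"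
    by (rule tendsto_add_zero[OF add(3,4)])
  have "(\<integral>x. \<bar>f (x + X n) + g (x + X n) - (f x + g x)\<bar> \<partial>lborel)
      \<le> (\<integral>x. \<bar>f (x + X n) - f x\<bar> \<partial>lborel) + (\<integral>x. \<bar>g (x + X n) - g x\<bar> \<partial>lborel)" for n
  proof -
    note ii = add(1,2) i[of "X n"]
    have j: "integrable lborel (\<lambda>x. \<bar>f (x + X n) - f x\<bar>)" "integrable lborel (\<lambda>x. \<bar>g (x + X n) - g x\<bar>)"
      using ii by auto
    have "(\<integral>x. \<bar>f (x + X n) + g (x + X n) - (f x + g x)\<bar> \<partial>lborel)
        \<le> (\<integral>x. \<bar>f (x + X n) - f x\<bar> + \<bar>g (x + X n) - g x\<bar> \<partial>lborel)"
      using ii j by (intro integral_mono) auto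
    also have "\<dots> = (\<integral>x. \<bar>f (x + X n) - f x\<bar> \<partial>lborel) + (\<integral>x. \<bar>g (x + X n) - g x\<bar> \<partial>lborel)"
      by (rule Bochner_Integration.integral_add[OF j])
    finally show ?thesis .
  qed
  note bd = this
  show ?case
    by (rule null_sandwich[OF lim0 _ bd]) simp
next
  case (lim f s)
  show ?case
  proof (rule L1_translation_approx[OF lim(4)])
    fix \<epsilon> :: real assume "\<epsilon> > 0"
    have "(\<lambda>i. \<integral>x. \<bar>f x - s i x\<bar> \<partial>lborel) \<longlonglongrightarrow> (\<integral>x. 0 \<partial>(lborel :: 'a measure))"
    proof (rule integral_dominated_convergence[where w="\<lambda>x. 3 * \<bar>f x\<bar>"])
      show "AE x in lborel. (\<lambda>i. \<bar>f x - s i x\<bar>) \<longlonglongrightarrow> 0"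
        using lim(2) by (intro AE_I2 tendsto_rabs_zero) (auto intro!: tendsto_eq_intros)
      show "AE x in lborel. norm \<bar>f x - s i x\<bar> \<le> 3 * \<bar>f x\<bar>" for i
        using lim(3) by (intro AE_I2) (smt (verit) real_norm_def space_lborel UNIV_I)
    qed (use lim(1,4) in \<open>auto intro!: borel_measurable_integrable\<close>)
    then have "eventually (\<lambda>i. (\<integral>x. \<bar>f x - s i x\<bar> \<partial>lborel) < \<epsilon>) sequentially"
      using order_tendstoD(2)[of _ 0] \<open>\<epsilon> > 0\<close> by fastforce
    then obtain i where "(\<integral>x. \<bar>f x - s i x\<bar> \<partial>lborel) < \<epsilon>"
      by (auto simp: eventually_sequentially)
    then show "\<exists>g. integrable lborel g \<and> (\<integral>x. \<bar>f x - g x\<bar> \<partial>lborel) \<le> \<epsilon> \<and>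
        (\<lambda>n. \<integral>x. \<bar>g (x + X n) - g x\<bar> \<partial>lborel) \<longlonglongrightarrow> 0"
      using lim(1,5) by (intro exI[of _ "s i"]) auto
  qed
qed

text \<open>Reduces L^2 to L^1: the signed square s |s| of a square integrable function is
  integrable and determines s, which the plain square does not. The constant 2 is attained when b =
  -a.\<close>

lemma square_diff_le_signed_squares: "(a - b)\<^sup>2 \<le> 2 * \<bar>a * \<bar>a\<bar> - b * \<bar>b\<bar>\<bar>" for a b :: real
proof -
  have *: "(a - b)\<^sup>2 \<le> 2 * \<bar>a\<^sup>2 - b\<^sup>2\<bar>" if "a \<ge> 0" "b \<ge> 0" for a b :: real
  proof -
    have "(a - b)\<^sup>2 = \<bar>a - b\<bar> * \<bar>a - b\<bar>" by (simp add: power2_eq_square)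
    also have "\<dots> \<le> \<bar>a - b\<bar> * \<bar>a + b\<bar>" using that by (intro mult_left_mono) auto
    also have "\<dots> = \<bar>a\<^sup>2 - b\<^sup>2\<bar>" by (simp add: abs_mult[symmetric] power2_eq_square algebra_simps)
    also have "\<dots> \<le> 2 * \<bar>a\<^sup>2 - b\<^sup>2\<bar>" by simp
    finally show ?thesis .
  qed
  have sq: "(a + b)\<^sup>2 \<le> 2 * (a\<^sup>2 + b\<^sup>2)" for a b :: real
    using sum_squares_bound[of a b] by (simp add: power2_sum)
  consider "a \<ge> 0" "b \<ge> 0" | "a < 0" "b < 0" | "a \<ge> 0" "b < 0" | "a < 0" "b \<ge> 0" by linarith
  then show ?thesis
  proof cases
    case 1 then show ?thesis using *[of a b] by (simp add: power2_eq_square)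
  next
    case 2 then show ?thesis using *[of "-a" "-b"] abs_minus_commute[of "b * b" "a * a"]
      by (simp add: power2_eq_square algebra_simps)
  next
    case 3 then show ?thesis using sq[of a "-b"] by (simp add: power2_eq_square)
  next
    case 4 then show ?thesis using sq[of "-a" b]
      by (simp add: power2_eq_square abs_if algebra_simps)
  qed
qed

lemma L2_translation:
  fixes f :: "'a::euclidean_space \<Rightarrow> real"
  assumes [measurable]: "f \<in> borel_measurable borel"
    and f: "integrable lborel (\<lambda>x. (f x)\<^sup>2)" and X: "X \<longlonglongrightarrow> 0"
  shows "(\<lambda>n. \<integral>x. (f (x + X n) - f x)\<^sup>2 \<partial>lborel) \<longlonglongrightarrow> 0"
proof -
  let ?g = "\<lambda>x. f x * \<bar>f x\<bar>"
  have g: "integrable lborel ?g"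
    by (rule Bochner_Integration.integrable_bound[OF f]) (auto simp: power2_eq_square abs_mult)
  have gX: "integrable lborel (\<lambda>x. ?g (x + h))" for h
    using integrable_translate[of ?g h] g by simp
  show ?thesis
  proof (rule null_sandwich_mult[OF L1_translation[OF g X], of _ 2])
    fix n
    show "(\<integral>x. (f (x + X n) - f x)\<^sup>2 \<partial>lborel) \<le> 2 * (\<integral>x. \<bar>?g (x + X n) - ?g x\<bar> \<partial>lborel)"
  proof -
    have i: "integrable lborel (\<lambda>x. 2 * \<bar>?g (x + X n) - ?g x\<bar>)" using g gX by auto
    have "(\<integral>x. (f (x + X n) - f x)\<^sup>2 \<partial>lborel) \<le> (\<integral>x. 2 * \<bar>?g (x + X n) - ?g x\<bar> \<partial>lborel)"
      by (rule integral_mono'[OF i]) (use square_diff_le_signed_squares in auto)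
    then show ?thesis by simp
  qed
  qed simp
qed

section \<open>Local integrability and compactly supported functions\<close>

definition locally_integrable :: "('a::euclidean_space \<Rightarrow> real) \<Rightarrow> bool" where
  "locally_integrable f \<longleftrightarrow> f \<in> borel_measurable borel \<and>
     (\<forall>r. integrable lborel (\<lambda>x. indicat_real (cball 0 r) x * f x))"

text \<open>Test functions with fewer derivatives: the cut-offs below are only finitely often
  differentiable, and their products with functions of a mollified \<open>a\<close> are integrated
  by parts. Together with \<open>has_pderiv\<close>, which records one directional derivative at a
  time, this class avoids approximating such products by smooth functions.\<close>

definition cc_fn :: "('a::euclidean_space \<Rightarrow> real) \<Rightarrow> bool" where
  "cc_fn \<Phi> \<longleftrightarrow> continuous_on UNIV \<Phi> \<and> (\<exists>r. \<forall>x. norm x > r \<longrightarrow> \<Phi> x = 0)"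

definition has_pderiv :: "('a::euclidean_space \<Rightarrow> real) \<Rightarrow> 'a \<Rightarrow> ('a \<Rightarrow> real) \<Rightarrow> bool" where
  "has_pderiv f e f' \<longleftrightarrow> (\<forall>x. ((\<lambda>\<tau>. f (x + \<tau> *\<^sub>R e)) has_real_derivative f' x) (at 0))"

lemma locally_integrable_measurable: "locally_integrable f \<Longrightarrow> f \<in> borel_measurable borel"
  by (simp add: locally_integrable_def)

lemma cc_fn_continuous: "cc_fn f \<Longrightarrow> continuous_on UNIV f"
  by (simp add: cc_fn_def)

lemma cc_fn_measurable: "cc_fn f \<Longrightarrow> f \<in> borel_measurable borel"
  by (intro borel_measurable_continuous_onI cc_fn_continuous)

lemma cc_fn_support:
  assumes "cc_fn f"
  obtains r where "r \<ge> 0" "\<And>x. norm x > r \<Longrightarrow> f x = 0"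
proof -
  obtain r where "\<And>x. norm x > r \<Longrightarrow> f x = 0" using assms by (auto simp: cc_fn_def)
  then show thesis by (intro that[of "max r 0"]) auto
qed

lemma cc_fn_bounded:
  assumes "cc_fn f"
  obtains B where "B \<ge> 0" "\<And>x. \<bar>f x\<bar> \<le> B"
proof -
  obtain r where r: "\<And>x. norm x > r \<Longrightarrow> f x = 0" using cc_fn_support[OF assms] by blast
  have "bounded (f ` cball 0 r)"
    using assms by (intro compact_imp_bounded compact_continuous_image)
      (auto simp: cc_fn_def intro: continuous_on_subset)
  then have "\<exists>B. \<forall>x\<in>cball 0 r. \<bar>f x\<bar> \<le> B"
    unfolding bounded_iff by auto
  then obtain B where B: "\<And>x. x \<in> cball 0 r \<Longrightarrow> \<bar>f x\<bar> \<le> B" by blast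
  show thesis
  proof (rule that[of "max B 0"])
    show "\<bar>f x\<bar> \<le> max B 0" for x using B[of x] r[of x] by (cases "norm x \<le> r") auto
  qed simp
qed

lemma cc_fn_mult:
  assumes "continuous_on UNIV f" "cc_fn g"
  shows "cc_fn (\<lambda>x. f x * g x)"
  using assms by (auto simp: cc_fn_def intro!: continuous_intros)

lemma cc_fn_abs: "cc_fn f \<Longrightarrow> cc_fn (\<lambda>x. \<bar>f x\<bar>)"
  by (auto simp: cc_fn_def intro!: continuous_intros)

lemma cc_fn_add: "cc_fn f \<Longrightarrow> cc_fn g \<Longrightarrow> cc_fn (\<lambda>x. f x + g x)"
proof -
  assume f: "cc_fn f" and g: "cc_fn g"
  obtain r s where "\<And>x. norm x > r \<Longrightarrow> f x = 0" "\<And>x. norm x > s \<Longrightarrow> g x = 0"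
    using cc_fn_support[OF f] cc_fn_support[OF g] by metis
  then show ?thesis using f g unfolding cc_fn_def
    by (intro conjI exI[of _ "max r s"]) (auto intro!: continuous_intros)
qed

lemma cc_fn_minus: "cc_fn f \<Longrightarrow> cc_fn (\<lambda>x. - f x)"
  by (auto simp: cc_fn_def intro!: continuous_intros)

lemma cc_fn_zero: "cc_fn (\<lambda>_. 0)"
  by (simp add: cc_fn_def)

lemma cc_fn_sum: "(\<And>i. i \<in> I \<Longrightarrow> cc_fn (f i)) \<Longrightarrow> cc_fn (\<lambda>x. \<Sum>i\<in>I. f i x)"
  by (induction I rule: infinite_finite_induct) (auto intro: cc_fn_add simp: cc_fn_zero)

lemma cc_fn_shift:
  assumes "cc_fn f"
  shows "cc_fn (\<lambda>x. f (x + h))"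
proof -
  obtain r where "\<And>x. norm x > r \<Longrightarrow> f x = 0" using cc_fn_support[OF assms] by blast
  then have "f (x + h) = 0" if "norm x > r + norm h" for x
    using that norm_diff_ineq[of x h] by force
  with assms show ?thesis unfolding cc_fn_def
    by (intro conjI exI[of _ "r + norm h"]) (auto intro!: continuous_on_compose2[of UNIV f] continuous_intros)
qed

lemma cc_fn_reflect:
  assumes "cc_fn f"
  shows "cc_fn (\<lambda>x. f (h - x))"
proof -
  obtain r where "\<And>x. norm x > r \<Longrightarrow> f x = 0" using cc_fn_support[OF assms] by blast
  then have "f (h - x) = 0" if "norm x > r + norm h" for x
    using that norm_triangle_ineq2[of x h] by (auto simp: norm_minus_commute)
  with assms show ?thesis unfolding cc_fn_def
    by (intro conjI exI[of _ "r + norm h"]) (auto intro!: continuous_on_compose2[of UNIV f] continuous_intros)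
qed

lemma test_fn_cc:
  assumes "test_fn U \<phi>"
  shows "cc_fn \<phi>"
proof -
  obtain K where K: "compact K" "K \<subseteq> U" "\<And>x. x \<notin> K \<Longrightarrow> \<phi> x = 0"
    using test_fn_support[OF assms] by blast
  obtain r where "\<And>x. x \<in> K \<Longrightarrow> norm x \<le> r"
    using compact_imp_bounded[OF K(1)] by (auto simp: bounded_iff)
  then have "\<phi> x = 0" if "norm x > r" for x using K(3) that by force
  then show ?thesis
    using smooth_fn_continuous[OF test_fn_smooth[OF assms]] by (auto simp: cc_fn_def)
qed

lemma smooth_fn_has_pderiv:
  assumes "smooth_fn \<phi>"
  shows "has_pderiv \<phi> e (dderiv \<phi> e)"
  unfolding has_pderiv_def
proof
  fix x
  have lin: "linear (frechet_derivative \<phi> (at x))"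
    by (rule linear_frechet_derivative[OF smooth_fn_differentiable[OF assms]])
  have "(\<phi> has_derivative frechet_derivative \<phi> (at (x + 0 *\<^sub>R e))) (at (x + 0 *\<^sub>R e))"
    using has_derivative_frechet[OF smooth_fn_differentiable[OF assms]] by simp
  moreover have "((\<lambda>\<tau>. x + \<tau> *\<^sub>R e) has_derivative (\<lambda>\<tau>. \<tau> *\<^sub>R e)) (at 0)"
    by (auto intro!: derivative_eq_intros)
  ultimately have "((\<lambda>\<tau>. \<phi> (x + \<tau> *\<^sub>R e)) has_derivative (\<lambda>\<tau>. frechet_derivative \<phi> (at (x + 0 *\<^sub>R e)) (\<tau> *\<^sub>R e))) (at 0)"
    using diff_chain_at[of "\<lambda>\<tau>. x + \<tau> *\<^sub>R e" "\<lambda>\<tau>. \<tau> *\<^sub>R e" 0 \<phi>] by (simp only: o_def)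
  moreover have "(\<lambda>\<tau>. frechet_derivative \<phi> (at (x + 0 *\<^sub>R e)) (\<tau> *\<^sub>R e)) = (*) (dderiv \<phi> e x)"
    by (rule ext) (simp add: dderiv_def linear_cmul[OF lin])
  ultimately show "((\<lambda>\<tau>. \<phi> (x + \<tau> *\<^sub>R e)) has_real_derivative dderiv \<phi> e x) (at 0)"
    by (simp only: has_field_derivative_def)
qed

lemma smooth_fn_dderiv_sum:
  assumes "smooth_fn \<phi>"
  shows "dderiv \<phi> h x = (\<Sum>j\<in>Basis. (h \<bullet> j) * dderiv \<phi> j x)"
proof -
  have lin: "linear (frechet_derivative \<phi> (at x))"
    by (rule linear_frechet_derivative[OF smooth_fn_differentiable[OF assms]])
  have "frechet_derivative \<phi> (at x) (\<Sum>j\<in>Basis. (h \<bullet> j) *\<^sub>R j) = (\<Sum>j\<in>Basis. (h \<bullet> j) * dderiv \<phi> j x)"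
    by (subst linear_sum[OF lin], rule sum.cong) (simp_all add: dderiv_def linear_cmul[OF lin])
  then show ?thesis by (simp add: dderiv_def euclidean_representation)
qed

lemma has_pderiv_at:
  assumes "has_pderiv f e f'"
  shows "((\<lambda>\<tau>. f (x + \<tau> *\<^sub>R e)) has_real_derivative f' (x + \<sigma> *\<^sub>R e)) (at \<sigma>)"
proof -
  have "((\<lambda>\<tau>. f ((x + \<sigma> *\<^sub>R e) + \<tau> *\<^sub>R e)) has_real_derivative f' (x + \<sigma> *\<^sub>R e)) (at 0)"
    using assms by (simp add: has_pderiv_def)
  then have "((\<lambda>\<tau>. f ((x + \<sigma> *\<^sub>R e) + (\<tau> - \<sigma>) *\<^sub>R e)) has_real_derivative f' (x + \<sigma> *\<^sub>R e)) (at (0 + \<sigma>))"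
    by (subst DERIV_shift) simp
  then show ?thesis by (simp add: algebra_simps)
qed

lemma has_pderiv_lipschitz:
  assumes "has_pderiv f e f'" and B: "\<And>x. \<bar>f' x\<bar> \<le> B"
  shows "\<bar>f (x + \<tau> *\<^sub>R e) - f x\<bar> \<le> B * \<bar>\<tau>\<bar>"
  using field_differentiable_bound[OF convex_UNIV, of "\<lambda>\<tau>. f (x + \<tau> *\<^sub>R e)" "\<lambda>\<sigma>. f' (x + \<sigma> *\<^sub>R e)" B \<tau> 0]
    has_pderiv_at[OF assms(1), of x] B by simp

lemma locally_integrable_mult_bound:
  assumes f: "locally_integrable f" and [measurable]: "\<Phi> \<in> borel_measurable borel"
    and B: "\<And>x. \<bar>\<Phi> x\<bar> \<le> B" and r: "\<And>x. norm x > r \<Longrightarrow> \<Phi> x = 0"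
  shows "integrable lborel (\<lambda>x. f x * \<Phi> x)"
proof -
  have [measurable]: "f \<in> borel_measurable borel" by (rule locally_integrable_measurable[OF f])
  have "integrable lborel (\<lambda>x. (indicat_real (cball 0 r) x * f x) * B)"
    using f by (simp add: locally_integrable_def)
  then show ?thesis
  proof (rule Bochner_Integration.integrable_bound)
    have "norm (f x * \<Phi> x) \<le> norm (indicat_real (cball 0 r) x * f x * B)" for x
      using B[of x] r[of x] by (cases "norm x \<le> r") (auto simp: abs_mult intro!: mult_left_mono)
    then show "AE x in lborel. norm (f x * \<Phi> x) \<le> norm (indicat_real (cball 0 r) x * f x * B)" by simp
  qed simp
qed

lemma integrable_mult_cc:
  assumes f: "locally_integrable f" and \<Phi>: "cc_fn \<Phi>"
  shows "integrable lborel (\<lambda>x. f x * \<Phi> x)"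
proof -
  obtain r where r: "\<And>x. norm x > r \<Longrightarrow> \<Phi> x = 0" using cc_fn_support[OF \<Phi>] by blast
  obtain B where B: "\<And>x. \<bar>\<Phi> x\<bar> \<le> B" using cc_fn_bounded[OF \<Phi>] by blast
  show ?thesis by (rule locally_integrable_mult_bound[OF f cc_fn_measurable[OF \<Phi>] B r])
qed

lemma integral_tendsto_locally_integrable:
  assumes f: "locally_integrable f" and [measurable]: "\<And>n. \<Phi> n \<in> borel_measurable borel"
    and lim: "\<And>x. (\<lambda>n. \<Phi> n x) \<longlonglongrightarrow> \<Psi> x"
    and B: "\<And>n x. \<bar>\<Phi> n x\<bar> \<le> B" and r: "\<And>n x. norm x > r \<Longrightarrow> \<Phi> n x = 0"
  shows "(\<lambda>n. \<integral>x. f x * \<Phi> n x \<partial>lborel) \<longlonglongrightarrow> (\<integral>x. f x * \<Psi> x \<partial>lborel)"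
proof (rule integral_dominated_convergence[where w="\<lambda>x. \<bar>indicat_real (cball 0 r) x * f x\<bar> * B"])
  have [measurable]: "f \<in> borel_measurable borel" by (rule locally_integrable_measurable[OF f])
  have [measurable]: "\<Psi> \<in> borel_measurable borel"
    by (rule borel_measurable_LIMSEQ_real[OF lim]) auto
  show "(\<lambda>x. f x * \<Psi> x) \<in> borel_measurable lborel" by measurable
  show "(\<lambda>x. f x * \<Phi> n x) \<in> borel_measurable lborel" for n by measurable
  show "integrable lborel (\<lambda>x. \<bar>indicat_real (cball 0 r) x * f x\<bar> * B)"
    using f by (auto simp: locally_integrable_def)
  show "AE x in lborel. (\<lambda>n. f x * \<Phi> n x) \<longlonglongrightarrow> f x * \<Psi> x"
    by (intro AE_I2 tendsto_intros lim)
  have "norm (f x * \<Phi> n x) \<le> \<bar>indicat_real (cball 0 r) x * f x\<bar> * B" for x n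
    using B[of n x] r[of x n] by (cases "norm x \<le> r") (auto simp: abs_mult intro!: mult_left_mono)
  then show "AE x in lborel. norm (f x * \<Phi> n x) \<le> \<bar>indicat_real (cball 0 r) x * f x\<bar> * B" for n by simp
qed

lemma integral_shift_continuous:
  fixes f :: "'a::euclidean_space \<Rightarrow> real"
  assumes f: "locally_integrable f" and \<Phi>: "cc_fn \<Phi>"
  shows "continuous_on UNIV (\<lambda>h. \<integral>x. f x * \<Phi> (x + h) \<partial>lborel)"
  unfolding continuous_on_sequentially
proof (intro allI ballI impI, elim conjE)
  fix X :: "nat \<Rightarrow> 'a" and h assume X: "X \<longlonglongrightarrow> h"
  obtain r where r: "\<And>x. norm x > r \<Longrightarrow> \<Phi> x = 0" using cc_fn_support[OF \<Phi>] by blast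
  obtain B where B: "\<And>x. \<bar>\<Phi> x\<bar> \<le> B" using cc_fn_bounded[OF \<Phi>] by blast
  have "Bseq X" using X[THEN convergentI] by (rule convergent_imp_Bseq)
  then obtain M where M: "\<And>n. norm (X n) \<le> M" by (elim BseqE) auto
  have [measurable]: "\<Phi> \<in> borel_measurable borel" by (rule cc_fn_measurable[OF \<Phi>])
  have "(\<lambda>n. \<integral>x. f x * \<Phi> (x + X n) \<partial>lborel) \<longlonglongrightarrow> (\<integral>x. f x * \<Phi> (x + h) \<partial>lborel)"
  proof (rule integral_tendsto_locally_integrable[OF f])
    show "(\<lambda>n. \<Phi> (x + X n)) \<longlonglongrightarrow> \<Phi> (x + h)" for x
      by (rule continuous_on_tendsto_compose[OF cc_fn_continuous[OF \<Phi>]]) (auto intro!: tendsto_intros X)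
    show "\<Phi> (x + X n) = 0" if "norm x > r + M" for n x
      using that M[of n] norm_diff_ineq[of x "X n"] by (intro r) linarith
  qed (use B in auto)
  then show "((\<lambda>h. \<integral>x. f x * \<Phi> (x + h) \<partial>lborel) \<circ> X) \<longlonglongrightarrow> (\<integral>x. f x * \<Phi> (x + h) \<partial>lborel)"
    by (simp add: o_def)
qed

text \<open>The derivative falls on the test function: its difference quotients are bounded by the
  supremum of \<open>\<Phi>'\<close> and, for bounded increments, vanish outside one ball. Dominated
  convergence then asks only for local integrability of \<open>f\<close>.\<close>

lemma integral_shift_has_derivative:
  assumes f: "locally_integrable f" and \<Phi>: "cc_fn \<Phi>" "cc_fn \<Phi>'" "has_pderiv \<Phi> e \<Phi>'"
  shows "((\<lambda>\<tau>. \<integral>x. f x * \<Phi> (x + \<tau> *\<^sub>R e) \<partial>lborel) has_real_derivative (\<integral>x. f x * \<Phi>' x \<partial>lborel)) (at 0)"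
  unfolding DERIV_def tendsto_at_iff_sequentially
proof (intro allI impI)
  fix X :: "nat \<Rightarrow> real" assume X0: "\<forall>i. X i \<in> UNIV - {0}" and X: "X \<longlonglongrightarrow> 0"
  obtain r where r: "r \<ge> 0" "\<And>x. norm x > r \<Longrightarrow> \<Phi> x = 0" using cc_fn_support[OF \<Phi>(1)] by blast
  obtain B where B: "B \<ge> 0" "\<And>x. \<bar>\<Phi>' x\<bar> \<le> B" using cc_fn_bounded[OF \<Phi>(2)] by blast
  have "Bseq X" using X[THEN convergentI] by (rule convergent_imp_Bseq)
  then obtain M where M: "\<And>n. \<bar>X n\<bar> \<le> M" by (elim BseqE) auto
  have [measurable]: "\<Phi> \<in> borel_measurable borel" by (rule cc_fn_measurable[OF \<Phi>(1)])
  have "(\<lambda>n. \<integral>x. f x * ((\<Phi> (x + X n *\<^sub>R e) - \<Phi> x) / X n) \<partial>lborel) \<longlonglongrightarrow> (\<integral>x. f x * \<Phi>' x \<partial>lborel)"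
  proof (rule integral_tendsto_locally_integrable[OF f])
    show "(\<lambda>n. (\<Phi> (x + X n *\<^sub>R e) - \<Phi> x) / X n) \<longlonglongrightarrow> \<Phi>' x" for x
    proof -
      have "((\<lambda>\<tau>. \<Phi> (x + \<tau> *\<^sub>R e)) has_real_derivative \<Phi>' x) (at 0)"
        using \<Phi>(3) by (simp add: has_pderiv_def)
      then show ?thesis using X0 X unfolding DERIV_def tendsto_at_iff_sequentially
        by (auto simp: o_def)
    qed
    show "\<bar>(\<Phi> (x + X n *\<^sub>R e) - \<Phi> x) / X n\<bar> \<le> B" for n x
      using has_pderiv_lipschitz[OF \<Phi>(3) B(2), of x "X n"] X0 by (simp add: abs_divide divide_le_eq)
    show "(\<Phi> (x + X n *\<^sub>R e) - \<Phi> x) / X n = 0" if x: "norm x > r + M * norm e" for n x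
    proof -
      have "norm (X n *\<^sub>R e) \<le> M * norm e" using M[of n] by (simp add: mult_right_mono)
      then have "norm (x + X n *\<^sub>R e) > r"
        using x norm_diff_ineq[of x "X n *\<^sub>R e"] by linarith
      moreover have "norm x > r" using x \<open>norm (X n *\<^sub>R e) \<le> M * norm e\<close> norm_ge_zero[of "X n *\<^sub>R e"] by linarith
      ultimately show ?thesis by (simp add: r(2))
    qed
  qed auto
  moreover have eq: "(\<integral>x. f x * ((\<Phi> (x + X n *\<^sub>R e) - \<Phi> x) / X n) \<partial>lborel)
      = ((\<integral>x. f x * \<Phi> (x + (0 + X n) *\<^sub>R e) \<partial>lborel) - (\<integral>x. f x * \<Phi> (x + 0 *\<^sub>R e) \<partial>lborel)) / X n" for n
  proof -
    have i: "integrable lborel (\<lambda>x. f x * \<Phi> (x + X n *\<^sub>R e))" "integrable lborel (\<lambda>x. f x * \<Phi> x)"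
      by (intro integrable_mult_cc f cc_fn_shift \<Phi>)+
    have "(\<integral>x. f x * ((\<Phi> (x + X n *\<^sub>R e) - \<Phi> x) / X n) \<partial>lborel)
        = (\<integral>x. (f x * \<Phi> (x + X n *\<^sub>R e) - f x * \<Phi> x) / X n \<partial>lborel)"
      by (simp add: right_diff_distrib)
    also have "\<dots> = ((\<integral>x. f x * \<Phi> (x + X n *\<^sub>R e) \<partial>lborel) - (\<integral>x. f x * \<Phi> x \<partial>lborel)) / X n"
      using i by simp
    finally show ?thesis by simp
  qed
  ultimately show "((\<lambda>h. ((\<integral>x. f x * \<Phi> (x + (0 + h) *\<^sub>R e) \<partial>lborel) - (\<integral>x. f x * \<Phi> (x + 0 *\<^sub>R e) \<partial>lborel)) / h) \<circ> X)
      \<longlonglongrightarrow> (\<integral>x. f x * \<Phi>' x \<partial>lborel)"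
    by (simp only: o_def eq)
qed

lemma locally_integrable_const: "locally_integrable (\<lambda>_. c)"
proof -
  have "integrable lborel (\<lambda>x. indicat_real (cball 0 r) x * c)" for r
    by (intro integrable_mult_left integrable_real_indicator emeasure_lborel_cball_finite) simp
  then show ?thesis unfolding locally_integrable_def by (intro conjI allI) simp_all
qed

lemma integrable_cc: "cc_fn \<Phi> \<Longrightarrow> integrable lborel \<Phi>"
  using integrable_mult_cc[OF locally_integrable_const, of \<Phi> 1] by simp

text \<open>By translation invariance the integral of a shifted \<open>W\<close> is constant in the
  shift; differentiated under the integral sign, it gives the integral of \<open>W'\<close>. This
  replaces an iterated integral along \<open>e\<close>.\<close>

lemma integral_pderiv_eq_0:
  assumes W: "cc_fn W" "cc_fn W'" "has_pderiv W e W'"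
  shows "(\<integral>x. W' x \<partial>lborel) = 0"
proof -
  have "((\<lambda>\<tau>. \<integral>x. 1 * W (x + \<tau> *\<^sub>R e) \<partial>lborel) has_real_derivative (\<integral>x. 1 * W' x \<partial>lborel)) (at 0)"
    by (rule integral_shift_has_derivative[OF locally_integrable_const W])
  then have "((\<lambda>\<tau>. \<integral>x. W x \<partial>lborel) has_real_derivative (\<integral>x. W' x \<partial>lborel)) (at (0::real))"
    using integral_translate[OF cc_fn_measurable[OF W(1)]] by simp
  then show ?thesis using DERIV_unique DERIV_const by blast
qed

section \<open>Convolution of a locally integrable function with a compactly supported
  kernel\<close>

definition conv :: "('a::euclidean_space \<Rightarrow> real) \<Rightarrow> ('a \<Rightarrow> real) \<Rightarrow> 'a \<Rightarrow> real" where
  "conv f \<rho> x = (\<integral>y. f y * \<rho> (x - y) \<partial>lborel)"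

lemma conv_continuous:
  assumes f: "locally_integrable f" and \<rho>: "cc_fn \<rho>"
  shows "continuous_on UNIV (conv f \<rho>)"
proof -
  have "cc_fn (\<lambda>y. \<rho> (0 - y))" by (rule cc_fn_reflect[OF \<rho>])
  from integral_shift_continuous[OF f this]
  have "continuous_on UNIV (\<lambda>x. \<integral>y. f y * \<rho> (0 - (y + (- x))) \<partial>lborel)"
    by (rule continuous_on_compose2[of UNIV _ UNIV "\<lambda>x. - x"]) (auto intro!: continuous_intros)
  then show ?thesis by (simp add: conv_def[abs_def])
qed

lemma conv_has_pderiv:
  assumes f: "locally_integrable f" and \<rho>: "cc_fn \<rho>" "cc_fn \<rho>'" "has_pderiv \<rho> e \<rho>'"
  shows "has_pderiv (conv f \<rho>) e (conv f \<rho>')"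
  unfolding has_pderiv_def
proof
  fix x
  have *: "has_pderiv (\<lambda>y. \<rho> (x - y)) (- e) (\<lambda>y. \<rho>' (x - y))"
    unfolding has_pderiv_def
  proof
    fix y
    have "x - (y + \<tau> *\<^sub>R - e) = (x - y) + \<tau> *\<^sub>R e" for \<tau> by simp
    then show "((\<lambda>\<tau>. \<rho> (x - (y + \<tau> *\<^sub>R - e))) has_real_derivative \<rho>' (x - y)) (at 0)"
      using \<rho>(3) by (simp only: has_pderiv_def)
  qed
  have "((\<lambda>\<tau>. \<integral>y. f y * \<rho> (x - (y + \<tau> *\<^sub>R (- e))) \<partial>lborel) has_real_derivative (\<integral>y. f y * \<rho>' (x - y) \<partial>lborel)) (at 0)"
    by (rule integral_shift_has_derivative[OF f cc_fn_reflect[OF \<rho>(1)] cc_fn_reflect[OF \<rho>(2)] *])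
  then show "((\<lambda>\<tau>. conv f \<rho> (x + \<tau> *\<^sub>R e)) has_real_derivative conv f \<rho>' x) (at 0)"
    by (simp add: conv_def algebra_simps)
qed

section \<open>The fundamental lemma of the calculus of variations\<close>

text \<open>The positive and the negative part of \<open>f\<close>, taken as densities, define two
  measures that agree on open boxes, an intersection-stable generator of the Borel sets, and are
  finite there. The measures are thus equal, and so are their densities almost everywhere.\<close>

lemma AE_eq_0_if_box_integrals_eq_0:
  fixes f :: "'a::euclidean_space \<Rightarrow> real"
  assumes f: "locally_integrable f" and z: "\<And>a b. (\<integral>x. f x * indicat_real (box a b) x \<partial>lborel) = 0"
  shows "AE x in lborel. f x = 0"
proof -
  have [measurable]: "f \<in> borel_measurable borel" by (rule locally_integrable_measurable[OF f])
  let ?P = "density lborel (\<lambda>x. ennreal (f x))" and ?N = "density lborel (\<lambda>x. ennreal (- f x))"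
  have int: "integrable lborel (\<lambda>x. f x * indicat_real (box a b) x)" for a b
  proof -
    obtain r where r: "box a b \<subseteq> cball 0 r"
      using bounded_box[of a b] unfolding bounded_iff by fastforce
    show ?thesis
      by (rule locally_integrable_mult_bound[OF f, of _ 1 r]) (use r in \<open>auto simp: indicator_def\<close>)
  qed
  have P: "emeasure ?P (box a b) = ennreal (\<integral>x. max 0 (f x * indicat_real (box a b) x) \<partial>lborel)" for a b
    using int[of a b]
    by (subst emeasure_density, simp, simp, subst nn_integral_eq_integral[symmetric])
       (auto intro!: nn_integral_cong integrable_max split: split_indicator simp: ennreal_max_0)
  have N: "emeasure ?N (box a b) = ennreal (\<integral>x. max 0 (- (f x * indicat_real (box a b) x)) \<partial>lborel)" for a b
    using int[of a b]
    by (subst emeasure_density, simp, simp, subst nn_integral_eq_integral[symmetric])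
       (auto intro!: nn_integral_cong integrable_max split: split_indicator simp: ennreal_max_0)
  have "emeasure ?P (box a b) = emeasure ?N (box a b)" for a b
  proof -
    let ?h = "\<lambda>x. f x * indicat_real (box a b) x"
    have "(\<integral>x. max 0 (?h x) \<partial>lborel) - (\<integral>x. max 0 (- ?h x) \<partial>lborel) = (\<integral>x. max 0 (?h x) - max 0 (- ?h x) \<partial>lborel)"
      using int[of a b] by (intro Bochner_Integration.integral_diff[symmetric] integrable_max) auto
    also have "\<dots> = (\<integral>x. ?h x \<partial>lborel)"
      by (rule arg_cong[where f="integral\<^sup>L lborel"]) (auto simp: fun_eq_iff max_def)
    finally show ?thesis using z[of a b] by (simp add: P N)
  qed
  then have "?P = ?N"
  proof (intro measure_eqI_generator_eq)
    let ?E = "range (\<lambda>(a, b). box a b::'a set)"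
    show "Int_stable ?E" by (auto simp: Int_stable_def box_Int_box)
    show "?E \<subseteq> Pow UNIV" "sets ?P = sigma_sets UNIV ?E" "sets ?N = sigma_sets UNIV ?E"
      by (simp_all add: borel_eq_box)
    let ?A = "\<lambda>n::nat. box (- (real n *\<^sub>R One)) (real n *\<^sub>R One) :: 'a set"
    show "range ?A \<subseteq> ?E" "(\<Union>i. ?A i) = UNIV" unfolding UN_box_eq_UNIV by auto
    show "emeasure ?P (?A i) \<noteq> \<infinity>" for i by (simp add: P)
  qed auto
  then have "AE x in lborel. ennreal (f x) = ennreal (- f x)"
    by (intro sigma_finite_measure.density_unique[OF sigma_finite_lborel]) auto
  then show ?thesis
  proof (rule AE_mp, intro AE_I2 impI)
    fix x assume *: "ennreal (f x) = ennreal (- f x)"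
    show "f x = 0"
    proof (cases "f x \<ge> 0")
      case True
      then have "ennreal (- f x) = 0" by (simp add: ennreal_neg)
      with * True show ?thesis by (simp add: ennreal_eq_0_iff)
    next
      case False
      then have "ennreal (f x) = 0" by (simp add: ennreal_neg)
      with *[symmetric] False show ?thesis by (simp only: ennreal_eq_0_iff)
    qed
  qed
qed

lemma AE_eq_0_if_bump_integrals_eq_0:
  fixes f :: "'a::euclidean_space \<Rightarrow> real"
  assumes f: "locally_integrable f" and z: "\<And>a b n. (\<integral>x. f x * box_bump a b n x \<partial>lborel) = 0"
  shows "AE x in lborel. f x = 0"
proof (rule AE_eq_0_if_box_integrals_eq_0[OF f])
  fix a b :: 'a
  obtain r where r: "box a b \<subseteq> cball 0 r"
    using bounded_box[of a b] unfolding bounded_iff by fastforce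
  have "(\<lambda>n. \<integral>x. f x * box_bump a b n x \<partial>lborel) \<longlonglongrightarrow> (\<integral>x. f x * indicat_real (box a b) x \<partial>lborel)"
  proof (rule integral_tendsto_locally_integrable[OF f])
    show "box_bump a b n \<in> borel_measurable borel" for n
      by (intro borel_measurable_continuous_onI smooth_fn_continuous smooth_box_bump)
    show "\<bar>box_bump a b n x\<bar> \<le> 1" for n x
      using box_bump_nonneg[of a b n x] box_bump_le_1[of a b n x] by simp
    show "box_bump a b n x = 0" if "norm x > r" for n x
      using that r by (intro box_bump_eq_0) auto
  qed (rule box_bump_tendsto)
  then show "(\<integral>x. f x * indicat_real (box a b) x \<partial>lborel) = 0"
    by (simp add: z LIMSEQ_const_iff)
qed

section \<open>Weak directional derivatives\<close>

text \<open>Integral form of the mean value theorem: with \<open>g\<close> the derivative of u along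
  \<open>h\<close>, this is u(x + h) - u(x). For almost every x that makes sense for weak
  derivatives too; where the integral over the segment does not exist it has the default value
  0.\<close>

definition segment_avg :: "('a::euclidean_space \<Rightarrow> real) \<Rightarrow> 'a \<Rightarrow> 'a \<Rightarrow> real" where
  "segment_avg g h x = (\<integral>s. indicat_real {0..1} s * g (x + s *\<^sub>R h) \<partial>lborel)"

lemma segment_avg_measurable[measurable]:
  assumes [measurable]: "g \<in> borel_measurable borel"
  shows "segment_avg g h \<in> borel_measurable borel"
proof -
  have "(\<lambda>x. \<integral>s. indicat_real {0..1} s * g (x + s *\<^sub>R h) \<partial>lborel) \<in> borel_measurable lborel"
    by (rule lborel.borel_measurable_lebesgue_integral) (simp add: case_prod_beta')
  then show ?thesis by (simp add: segment_avg_def[abs_def])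
qed

lemma locally_integrable_ball_nn_integral:
  assumes "locally_integrable g"
  shows "(\<integral>\<^sup>+x. ennreal (indicat_real (cball 0 r) x * \<bar>g x\<bar>) \<partial>lborel) < \<infinity>"
proof -
  have "integrable lborel (\<lambda>x. indicat_real (cball 0 r) x * g x)"
    using assms by (simp add: locally_integrable_def)
  then show ?thesis by (simp add: integrable_iff_bounded abs_mult)
qed

lemma segment_avg_Fubini_integrable:
  fixes g :: "'a::euclidean_space \<Rightarrow> real"
  assumes g: "locally_integrable g" and [measurable]: "\<Phi> \<in> borel_measurable borel"
    and B: "\<And>x. \<bar>\<Phi> x\<bar> \<le> B" and r: "\<And>x. norm x > r \<Longrightarrow> \<Phi> x = 0"
  shows "integrable (lborel \<Otimes>\<^sub>M lborel) (\<lambda>(x, s). indicat_real {0..1} s * g (x + s *\<^sub>R h) * \<Phi> x)"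
proof -
  have [measurable]: "g \<in> borel_measurable borel" by (rule locally_integrable_measurable[OF g])
  have B0: "B \<ge> 0" using B[of 0] by simp
  let ?C = "\<integral>\<^sup>+x. ennreal (indicat_real (cball 0 (r + norm h)) x * \<bar>g x\<bar>) \<partial>lborel"
  have m[measurable]: "(\<lambda>x. indicat_real (cball 0 (r + norm h)) x * \<bar>g x\<bar>) \<in> borel_measurable borel"
  proof -
    have "integrable lborel (\<lambda>x. indicat_real (cball 0 (r + norm h)) x * g x)"
      using g by (simp add: locally_integrable_def)
    from borel_measurable_integrable[OF integrable_abs[OF this]]
    show ?thesis by (simp add: abs_mult)
  qed
  \<comment> \<open>Integrating over x first lets translation invariance remove the dependence on s;
    shifts of length at most |h| enlarge the ball to radius r + |h|.\<close>
  have bound: "(\<integral>\<^sup>+x. norm (indicat_real {0..1} s * g (x + s *\<^sub>R h) * \<Phi> x) \<partial>lborel)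
      \<le> ennreal B * ?C * indicator {0..1} s" for s :: real
  proof (cases "s \<in> {0..1}")
    case True
    have "norm (indicat_real {0..1} s * g (x + s *\<^sub>R h) * \<Phi> x)
       \<le> B * (indicat_real (cball 0 (r + norm h)) (x + s *\<^sub>R h) * \<bar>g (x + s *\<^sub>R h)\<bar>)" for x
    proof (cases "norm x \<le> r")
      case T: True
      have "norm (s *\<^sub>R h) \<le> norm h" using True by (simp add: mult_left_le_one_le)
      then have "norm (x + s *\<^sub>R h) \<le> r + norm h" using T norm_triangle_ineq[of x "s *\<^sub>R h"] by linarith
      then show ?thesis using True B[of x]
        by (simp add: abs_mult mult.commute[of _ "\<bar>\<Phi> x\<bar>"] mult_right_mono)
    qed (use r[of x] B0 in auto)
    then have "(\<integral>\<^sup>+x. norm (indicat_real {0..1} s * g (x + s *\<^sub>R h) * \<Phi> x) \<partial>lborel)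
      \<le> (\<integral>\<^sup>+x. ennreal B * ennreal (indicat_real (cball 0 (r + norm h)) (x + s *\<^sub>R h) * \<bar>g (x + s *\<^sub>R h)\<bar>) \<partial>lborel)"
      using B0 by (intro nn_integral_mono) (simp add: ennreal_mult'[symmetric])
    also have "\<dots> = ennreal B * ?C"
      using measurable_compose[OF _ m, of "\<lambda>x. x + s *\<^sub>R h" lborel]
      by (subst nn_integral_cmult, simp)
         (subst nn_integral_translate[of "\<lambda>x. ennreal (indicat_real (cball 0 (r + norm h)) x * \<bar>g x\<bar>)" "s *\<^sub>R h"], auto)
    finally show ?thesis using True by simp
  qed simp
  have "(\<integral>\<^sup>+p. norm (case p of (x, s) \<Rightarrow> indicat_real {0..1} s * g (x + s *\<^sub>R h) * \<Phi> x) \<partial>(lborel \<Otimes>\<^sub>M lborel))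
      = (\<integral>\<^sup>+s. \<integral>\<^sup>+x. norm (indicat_real {0..1} s * g (x + s *\<^sub>R h) * \<Phi> x) \<partial>lborel \<partial>lborel)"
    by (subst lborel_pair.nn_integral_snd[symmetric]) (simp_all add: case_prod_beta')
  also have "\<dots> \<le> (\<integral>\<^sup>+s. ennreal B * ?C * indicator {0..1} (s::real) \<partial>lborel)"
    by (intro nn_integral_mono bound)
  also have "\<dots> < \<infinity>"
    using locally_integrable_ball_nn_integral[OF g, of "r + norm h"]
    by (simp add: nn_integral_cmult ennreal_mult_less_top)
  finally show ?thesis
    unfolding integrable_iff_bounded by (simp add: case_prod_beta')
qed

lemma locally_integrable_segment_avg:
  assumes g: "locally_integrable g"
  shows "locally_integrable (segment_avg g h)"
  unfolding locally_integrable_def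
proof (intro conjI allI)
  have [measurable]: "g \<in> borel_measurable borel" by (rule locally_integrable_measurable[OF g])
  show "segment_avg g h \<in> borel_measurable borel" by simp
  fix r :: real
  have "integrable (lborel \<Otimes>\<^sub>M lborel) (\<lambda>(x, s). indicat_real {0..1} s * g (x + s *\<^sub>R h) * indicat_real (cball 0 r) x)"
    by (rule segment_avg_Fubini_integrable[OF g, of _ 1 r]) (auto simp: indicator_def)
  from lborel_pair.integrable_fst[OF this]
  show "integrable lborel (\<lambda>x. indicat_real (cball 0 r) x * segment_avg g h x)"
    by (simp add: segment_avg_def mult.commute)
qed

lemma segment_avg_Fubini:
  fixes g :: "'a::euclidean_space \<Rightarrow> real"
  assumes g: "locally_integrable g" and \<Phi>: "cc_fn \<Phi>"
  shows "(\<integral>x. segment_avg g h x * \<Phi> x \<partial>lborel) =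
    (\<integral>s. indicat_real {0..1} s * (\<integral>x. g x * \<Phi> (x - s *\<^sub>R h) \<partial>lborel) \<partial>lborel)"
proof -
  obtain r where r: "\<And>x. norm x > r \<Longrightarrow> \<Phi> x = 0" using cc_fn_support[OF \<Phi>] by blast
  obtain B where B: "\<And>x. \<bar>\<Phi> x\<bar> \<le> B" using cc_fn_bounded[OF \<Phi>] by blast
  have [measurable]: "g \<in> borel_measurable borel" by (rule locally_integrable_measurable[OF g])
  have [measurable]: "\<Phi> \<in> borel_measurable borel" by (rule cc_fn_measurable[OF \<Phi>])
  have "(\<integral>x. segment_avg g h x * \<Phi> x \<partial>lborel) =
     (\<integral>x. (\<integral>s. indicat_real {0..1} s * g (x + s *\<^sub>R h) * \<Phi> x \<partial>lborel) \<partial>lborel)"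
    by (simp add: segment_avg_def)
  also have "\<dots> = (\<integral>s. (\<integral>x. indicat_real {0..1} s * g (x + s *\<^sub>R h) * \<Phi> x \<partial>lborel) \<partial>lborel)"
    using lborel_pair.Fubini_integral[OF segment_avg_Fubini_integrable[OF g _ B r]] by simp
  also have "\<dots> = (\<integral>s. indicat_real {0..1} s * (\<integral>x. g x * \<Phi> (x - s *\<^sub>R h) \<partial>lborel) \<partial>lborel)"
  proof (rule arg_cong[where f="integral\<^sup>L lborel"], rule ext)
    fix s :: real
    have "(\<integral>x. g (x + s *\<^sub>R h) * \<Phi> x \<partial>lborel) = (\<integral>x. g x * \<Phi> (x - s *\<^sub>R h) \<partial>lborel)"
      using integral_translate[of "\<lambda>x. g x * \<Phi> (x - s *\<^sub>R h)" "s *\<^sub>R h"] by simp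
    then show "(\<integral>x. indicat_real {0..1} s * g (x + s *\<^sub>R h) * \<Phi> x \<partial>lborel)
      = indicat_real {0..1} s * (\<integral>x. g x * \<Phi> (x - s *\<^sub>R h) \<partial>lborel)"
      by (simp add: mult.assoc)
  qed
  finally show ?thesis .
qed

definition weak_pderiv :: "('a::euclidean_space \<Rightarrow> real) \<Rightarrow> 'a \<Rightarrow> ('a \<Rightarrow> real) \<Rightarrow> bool" where
  "weak_pderiv u h g \<longleftrightarrow> (\<forall>\<psi>. test_fn UNIV \<psi> \<longrightarrow>
     (\<integral>x. u x * dderiv \<psi> h x \<partial>lborel) = - (\<integral>x. g x * \<psi> x \<partial>lborel))"

lemma test_fn_shift: "test_fn UNIV \<psi> \<Longrightarrow> test_fn UNIV (\<lambda>x. \<psi> (x + d))"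
  using test_fn_affine[of \<psi> 1 d] by simp

lemma smooth_dderiv_linear:
  assumes "smooth_fn \<psi>" shows "linear (\<lambda>h. dderiv \<psi> h x)"
  unfolding dderiv_def by (simp add: linear_frechet_derivative smooth_fn_differentiable[OF assms])

lemma test_fn_dderiv_cc:
  assumes "test_fn UNIV \<psi>" shows "cc_fn (dderiv \<psi> h)"
proof -
  have "cc_fn (\<lambda>x. (h \<bullet> j) * dderiv \<psi> j x)" if "j \<in> Basis" for j
    by (intro cc_fn_mult test_fn_cc[OF test_fn_dderiv[OF assms that]] continuous_intros)
  then have "cc_fn (\<lambda>x. \<Sum>j\<in>Basis. (h \<bullet> j) * dderiv \<psi> j x)" by (rule cc_fn_sum)
  moreover have "dderiv \<psi> h = (\<lambda>x. \<Sum>j\<in>Basis. (h \<bullet> j) * dderiv \<psi> j x)"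
    by (rule ext) (rule smooth_fn_dderiv_sum[OF test_fn_smooth[OF assms]])
  ultimately show ?thesis by (simp only:)
qed

lemma locally_integrable_translate:
  fixes u :: "'a::euclidean_space \<Rightarrow> real"
  assumes u: "locally_integrable u"
  shows "locally_integrable (\<lambda>x. u (x + h))"
  unfolding locally_integrable_def
proof (intro conjI allI)
  have [measurable]: "u \<in> borel_measurable borel" by (rule locally_integrable_measurable[OF u])
  show "(\<lambda>x. u (x + h)) \<in> borel_measurable borel" by simp
  fix r :: real
  have "integrable lborel (\<lambda>x. u x * indicat_real (cball 0 r) (x - h))"
  proof (rule locally_integrable_mult_bound[OF u, of _ 1 "r + norm h"])
    show "indicat_real (cball 0 r) (x - h) = 0" if "norm x > r + norm h" for x
      using that norm_triangle_ineq2[of x h] by (auto simp: indicator_def)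
  qed (auto simp: indicator_def)
  then have "integrable lborel (\<lambda>x. u (x + h) * indicat_real (cball 0 r) (x + h - h))"
    by (subst integrable_translate[of "\<lambda>x. u x * indicat_real (cball 0 r) (x - h)"]) auto
  then show "integrable lborel (\<lambda>x. indicat_real (cball 0 r) x * u (x + h))"
    by (simp add: mult.commute)
qed

lemma locally_integrable_add:
  assumes "locally_integrable f" "locally_integrable g"
  shows "locally_integrable (\<lambda>x. f x + g x)"
  using assms by (auto simp: locally_integrable_def distrib_left)

lemma locally_integrable_cmult:
  assumes "locally_integrable f"
  shows "locally_integrable (\<lambda>x. c * f x)"
  using assms by (auto simp: locally_integrable_def mult.left_commute)

lemma locally_integrable_diff:
  assumes "locally_integrable f" "locally_integrable g"
  shows "locally_integrable (\<lambda>x. f x - g x)"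
  using locally_integrable_add[OF assms(1) locally_integrable_cmult[OF assms(2), of "-1"]] by simp

lemma weak_pderiv_cmult:
  assumes "weak_pderiv u h g"
  shows "weak_pderiv u (c *\<^sub>R h) (\<lambda>x. c * g x)"
  unfolding weak_pderiv_def
proof (intro allI impI)
  fix \<psi> :: "'a \<Rightarrow> real" assume t: "test_fn UNIV \<psi>"
  have "dderiv \<psi> (c *\<^sub>R h) x = c * dderiv \<psi> h x" for x
    using linear_cmul[OF smooth_dderiv_linear[OF test_fn_smooth[OF t]]] by simp
  then show "(\<integral>x. u x * dderiv \<psi> (c *\<^sub>R h) x \<partial>lborel) = - (\<integral>x. c * g x * \<psi> x \<partial>lborel)"
    using assms t by (simp add: weak_pderiv_def mult.left_commute[of _ c] mult.assoc)
qed

lemma weak_pderiv_sum: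
  assumes u: "locally_integrable u" and "finite I"
    and g: "\<And>i. i \<in> I \<Longrightarrow> locally_integrable (g i)" "\<And>i. i \<in> I \<Longrightarrow> weak_pderiv u (h i) (g i)"
  shows "weak_pderiv u (\<Sum>i\<in>I. h i) (\<lambda>x. \<Sum>i\<in>I. g i x)"
  unfolding weak_pderiv_def
proof (intro allI impI)
  fix \<psi> :: "'a \<Rightarrow> real" assume t: "test_fn UNIV \<psi>"
  have "(\<integral>x. u x * dderiv \<psi> (\<Sum>i\<in>I. h i) x \<partial>lborel) = (\<integral>x. (\<Sum>i\<in>I. u x * dderiv \<psi> (h i) x) \<partial>lborel)"
    by (simp add: linear_sum[OF smooth_dderiv_linear[OF test_fn_smooth[OF t]]] sum_distrib_left)
  also have "\<dots> = (\<Sum>i\<in>I. \<integral>x. u x * dderiv \<psi> (h i) x \<partial>lborel)"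
    by (intro Bochner_Integration.integral_sum integrable_mult_cc[OF u] test_fn_dderiv_cc t)
  also have "\<dots> = - (\<Sum>i\<in>I. \<integral>x. g i x * \<psi> x \<partial>lborel)"
    using g(2) t by (simp add: weak_pderiv_def sum_negf)
  also have "(\<Sum>i\<in>I. \<integral>x. g i x * \<psi> x \<partial>lborel) = (\<integral>x. (\<Sum>i\<in>I. g i x * \<psi> x) \<partial>lborel)"
    by (intro Bochner_Integration.integral_sum[symmetric] integrable_mult_cc[OF g(1)] test_fn_cc[OF t])
  finally show "(\<integral>x. u x * dderiv \<psi> (\<Sum>i\<in>I. h i) x \<partial>lborel) = - (\<integral>x. (\<Sum>i\<in>I. g i x) * \<psi> x \<partial>lborel)"
    by (simp add: sum_distrib_right)
qed

text \<open>Paired with a test function, u translated by s h gives \<open>?F\<close>, whose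
  derivative in s is \<open>?G\<close> by the definition of the weak derivative. The fundamental
  theorem of calculus on {0..1} and Fubini yield the identity in duality with every test function,
  hence almost everywhere.\<close>

lemma weak_pderiv_difference:
  fixes u :: "'a::euclidean_space \<Rightarrow> real"
  assumes u: "locally_integrable u" and g: "locally_integrable g" and w: "weak_pderiv u h g"
  shows "AE x in lborel. u (x + h) - u x = segment_avg g h x"
proof -
  have [measurable]: "u \<in> borel_measurable borel" by (rule locally_integrable_measurable[OF u])
  let ?f = "\<lambda>x. (u (x + h) - u x) - segment_avg g h x"
  have f: "locally_integrable ?f"
    by (intro locally_integrable_diff locally_integrable_translate locally_integrable_segment_avg u g)
  have key: "(\<integral>x. ?f x * \<psi> x \<partial>lborel) = 0" if t: "test_fn UNIV \<psi>" for \<psi>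
  proof -
    note s = test_fn_smooth[OF t] and cc = test_fn_cc[OF t]
    have [measurable]: "\<psi> \<in> borel_measurable borel" by (rule cc_fn_measurable[OF cc])
    let ?F = "\<lambda>s. \<integral>x. u x * \<psi> (x - s *\<^sub>R h) \<partial>lborel" and ?G = "\<lambda>s. \<integral>x. g x * \<psi> (x - s *\<^sub>R h) \<partial>lborel"
    have D: "(?F has_real_derivative ?G s) (at s)" for s
    proof -
      have t': "test_fn UNIV (\<lambda>x. \<psi> (x + (- (s *\<^sub>R h))))" by (rule test_fn_shift[OF t])
      have "((\<lambda>\<tau>. \<integral>x. u x * \<psi> (x + \<tau> *\<^sub>R (- h) + (- (s *\<^sub>R h))) \<partial>lborel) has_real_derivative
          (\<integral>x. u x * dderiv (\<lambda>x. \<psi> (x + (- (s *\<^sub>R h)))) (- h) x \<partial>lborel)) (at 0)"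
        by (rule integral_shift_has_derivative[OF u test_fn_cc[OF t'] test_fn_dderiv_cc[OF t'] smooth_fn_has_pderiv[OF test_fn_smooth[OF t']]])
      moreover have "(\<integral>x. u x * dderiv (\<lambda>x. \<psi> (x + (- (s *\<^sub>R h)))) (- h) x \<partial>lborel) = ?G s"
      proof -
        have "weak_pderiv u (- h) (\<lambda>x. - g x)" using weak_pderiv_cmult[OF w, of "-1"] by simp
        then show ?thesis using t' unfolding weak_pderiv_def by simp
      qed
      ultimately have "((\<lambda>\<tau>. ?F (\<tau> + s)) has_real_derivative ?G s) (at 0)"
        by (simp add: algebra_simps)
      then show ?thesis using DERIV_shift[of ?F "?G s" 0 s] by simp
    qed
    have cont: "continuous_on S ?G" for S
    proof -
      have "continuous_on UNIV (\<lambda>s. \<integral>x. g x * \<psi> (x + (- (s *\<^sub>R h))) \<partial>lborel)"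
        by (rule continuous_on_compose2[OF integral_shift_continuous[OF g cc]]) (auto intro!: continuous_intros)
      then show ?thesis by (auto intro: continuous_on_subset)
    qed
    have "(\<integral>s. indicat_real {0..1} s *\<^sub>R ?G s \<partial>lborel) = ?F 1 - ?F 0"
      by (rule integral_FTC_atLeastAtMost)
         (auto intro!: cont has_vector_derivative_at_within D[THEN has_real_derivative_iff_has_vector_derivative[THEN iffD1]])
    then have 1: "(\<integral>x. segment_avg g h x * \<psi> x \<partial>lborel) = ?F 1 - ?F 0"
      by (simp add: segment_avg_Fubini[OF g cc])
    have 2: "?F 1 = (\<integral>x. u (x + h) * \<psi> x \<partial>lborel)"
      using integral_translate[of "\<lambda>x. u x * \<psi> (x - h)" h] by simp
    have "(\<integral>x. ?f x * \<psi> x \<partial>lborel) = (\<integral>x. u (x + h) * \<psi> x - u x * \<psi> x - segment_avg g h x * \<psi> x \<partial>lborel)"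
      by (simp add: left_diff_distrib)
    also have "\<dots> = (\<integral>x. u (x + h) * \<psi> x \<partial>lborel) - (\<integral>x. u x * \<psi> x \<partial>lborel) - (\<integral>x. segment_avg g h x * \<psi> x \<partial>lborel)"
      using integrable_mult_cc[OF u cc] integrable_mult_cc[OF locally_integrable_translate[OF u] cc]
        integrable_mult_cc[OF locally_integrable_segment_avg[OF g] cc] by simp
    finally show ?thesis using 1 2 by simp
  qed
  have "AE x in lborel. ?f x = 0"
    by (rule AE_eq_0_if_bump_integrals_eq_0[OF f]) (intro key test_fn_box_bump subset_UNIV)
  then show ?thesis by (rule AE_mp) (intro AE_I2, simp)
qed

text \<open>Integration by parts against a function that is only continuously differentiable along
  \<open>e\<close>. The increment of \<open>\<Psi>\<close> is shifted onto \<open>u\<close>, where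
  it is a segment average of \<open>g\<close>; letting the step tend to 0 gives the claim.\<close>

lemma weak_pderiv_integral:
  fixes u :: "'a::euclidean_space \<Rightarrow> real"
  assumes u: "locally_integrable u" and g: "locally_integrable g" and w: "weak_pderiv u e g"
    and \<Psi>: "cc_fn \<Psi>" "cc_fn \<Psi>'" "has_pderiv \<Psi> e \<Psi>'"
  shows "(\<integral>x. u x * \<Psi>' x \<partial>lborel) = - (\<integral>x. g x * \<Psi> x \<partial>lborel)"
proof -
  have [measurable]: "u \<in> borel_measurable borel" by (rule locally_integrable_measurable[OF u])
  have [measurable]: "g \<in> borel_measurable borel" by (rule locally_integrable_measurable[OF g])
  have [measurable]: "\<Psi> \<in> borel_measurable borel" by (rule cc_fn_measurable[OF \<Psi>(1)])
  define F where "F \<tau> = (\<integral>x. u x * \<Psi> (x + \<tau> *\<^sub>R e) \<partial>lborel)" for \<tau>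
  define H where "H \<tau> = (\<integral>x. g x * \<Psi> (x + \<tau> *\<^sub>R e) \<partial>lborel)" for \<tau>
  have cH: "continuous_on UNIV H"
    unfolding H_def by (rule continuous_on_compose2[OF integral_shift_continuous[OF g \<Psi>(1)]]) (auto intro!: continuous_intros)
  then have [measurable]: "H \<in> borel_measurable borel" by (rule borel_measurable_continuous_onI)
  have quot: "F \<tau> - F 0 = - \<tau> * (\<integral>s. indicat_real {0..1} s * H (s * \<tau>) \<partial>lborel)" for \<tau>
  proof -
    let ?g = "\<lambda>x. - \<tau> * g x" and ?h = "(- \<tau>) *\<^sub>R e"
    have g': "locally_integrable ?g" by (rule locally_integrable_cmult[OF g])
    have ae: "AE x in lborel. u (x + ?h) - u x = segment_avg ?g ?h x"
      by (rule weak_pderiv_difference[OF u g' weak_pderiv_cmult[OF w]])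
    have "F \<tau> = (\<integral>x. u (x + ?h) * \<Psi> x \<partial>lborel)"
      using integral_translate[of "\<lambda>x. u x * \<Psi> (x + \<tau> *\<^sub>R e)" ?h] by (simp add: F_def)
    then have "F \<tau> - F 0 = (\<integral>x. u (x + ?h) * \<Psi> x - u x * \<Psi> x \<partial>lborel)"
      using integrable_mult_cc[OF u \<Psi>(1)] integrable_mult_cc[OF locally_integrable_translate[OF u] \<Psi>(1), of ?h]
      by (simp add: F_def)
    also have "\<dots> = (\<integral>x. segment_avg ?g ?h x * \<Psi> x \<partial>lborel)"
      using ae by (intro integral_cong_AE) (auto simp: left_diff_distrib[symmetric])
    also have "\<dots> = (\<integral>s. indicat_real {0..1} s * (\<integral>x. ?g x * \<Psi> (x - s *\<^sub>R ?h) \<partial>lborel) \<partial>lborel)"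
      by (rule segment_avg_Fubini[OF g' \<Psi>(1)])
    also have "\<dots> = (\<integral>s. - \<tau> * (indicat_real {0..1} s * H (s * \<tau>)) \<partial>lborel)"
      by (rule arg_cong[where f="integral\<^sup>L lborel"]) (simp add: fun_eq_iff H_def mult.assoc)
    finally show ?thesis by simp
  qed
  have DF: "(F has_real_derivative (\<integral>x. u x * \<Psi>' x \<partial>lborel)) (at 0)"
    unfolding F_def[abs_def] by (rule integral_shift_has_derivative[OF u \<Psi>])
  let ?X = "\<lambda>n. 1 / real (Suc n)"
  have X: "?X \<longlonglongrightarrow> 0" using LIMSEQ_Suc[OF lim_1_over_n] by simp
  have "(\<lambda>n. (F (0 + ?X n) - F 0) / ?X n) \<longlonglongrightarrow> (\<integral>x. u x * \<Psi>' x \<partial>lborel)"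
    using DF[unfolded DERIV_def tendsto_at_iff_sequentially, rule_format, of ?X] X by (simp add: o_def)
  then have L1: "(\<lambda>n. - (\<integral>s. indicat_real {0..1} s * H (s * ?X n) \<partial>lborel)) \<longlonglongrightarrow> (\<integral>x. u x * \<Psi>' x \<partial>lborel)"
    by (simp add: quot)
  have "bounded (H ` {0..1})"
    by (intro compact_imp_bounded compact_continuous_image continuous_on_subset[OF cH]) auto
  then have "\<exists>B. \<forall>s\<in>{0..1}. \<bar>H s\<bar> \<le> B" unfolding bounded_iff by auto
  then obtain B where B: "\<And>s. 0 \<le> s \<Longrightarrow> s \<le> 1 \<Longrightarrow> \<bar>H s\<bar> \<le> B"
    by (metis atLeastAtMost_iff)
  have "(\<lambda>n. \<integral>s. indicat_real {0..1} s * H (s * ?X n) \<partial>lborel) \<longlonglongrightarrow> (\<integral>s. indicat_real {0..1::real} s * H 0 \<partial>lborel)"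
  proof (rule integral_dominated_convergence[where w="\<lambda>s::real. indicat_real {0..1} s * B"])
    show "AE s in lborel. (\<lambda>n. indicat_real {0..1} s * H (s * ?X n)) \<longlonglongrightarrow> indicat_real {0..1} s * H 0"
    proof (rule AE_I2)
      fix s :: real
      have "(\<lambda>n. s * ?X n) \<longlonglongrightarrow> 0" by (rule tendsto_mult_right_zero[OF X])
      then show "(\<lambda>n. indicat_real {0..1} s * H (s * ?X n)) \<longlonglongrightarrow> indicat_real {0..1} s * H 0"
        by (intro tendsto_mult_left continuous_on_tendsto_compose[OF cH]) auto
    qed
    show "AE s in lborel. norm (indicat_real {0..1} s * H (s * ?X n)) \<le> indicat_real {0..1} s * B" for n
    proof (rule AE_I2)
      fix s :: real
      show "norm (indicat_real {0..1} s * H (s * ?X n)) \<le> indicat_real {0..1} s * B"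
      proof (cases "s \<in> {0..1}")
        case True
        then have "s * ?X n \<le> 1 * 1" by (intro mult_mono) auto
        with True B[of "s * ?X n"] show ?thesis by simp
      qed simp
    qed
  qed auto
  then have "(\<lambda>n. - (\<integral>s. indicat_real {0..1} s * H (s * ?X n) \<partial>lborel)) \<longlonglongrightarrow> - H 0"
    by (intro tendsto_minus) simp
  from LIMSEQ_unique[OF L1 this] show ?thesis by (simp add: H_def)
qed

section \<open>Square-integrable functions\<close>

definition L2_fn :: "('a::euclidean_space \<Rightarrow> real) \<Rightarrow> bool" where
  "L2_fn f \<longleftrightarrow> f \<in> borel_measurable borel \<and> integrable lborel (\<lambda>x. (f x)\<^sup>2)"

definition L2_norm :: "('a::euclidean_space \<Rightarrow> real) \<Rightarrow> real" where
  "L2_norm f = sqrt (\<integral>x. (f x)\<^sup>2 \<partial>lborel)"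

lemma L2_fn_measurable: "L2_fn f \<Longrightarrow> f \<in> borel_measurable borel"
  by (simp add: L2_fn_def)

lemma L2_fn_integrable: "L2_fn f \<Longrightarrow> integrable lborel (\<lambda>x. (f x)\<^sup>2)"
  by (simp add: L2_fn_def)

lemma L2_norm_nonneg: "L2_norm f \<ge> 0"
  by (simp add: L2_norm_def)

lemma L2_norm_power2: "(L2_norm f)\<^sup>2 = (\<integral>x. (f x)\<^sup>2 \<partial>lborel)"
  by (simp add: L2_norm_def)

lemma L2_mult:
  assumes "L2_fn f" "L2_fn g"
  shows L2_mult_integrable: "integrable lborel (\<lambda>x. f x * g x)"
    and L2_mult_le: "(\<integral>x. \<bar>f x * g x\<bar> \<partial>lborel) \<le> L2_norm f * L2_norm g"
  using integral_Cauchy_Schwarz[of f lborel g] assms by (simp_all add: L2_fn_def L2_norm_def)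

lemma L2_fn_bound:
  assumes "L2_fn f" "g \<in> borel_measurable borel" "\<And>x. \<bar>g x\<bar> \<le> c * \<bar>f x\<bar>"
  shows "L2_fn g"
proof -
  note [measurable] = assms(2)
  have "integrable lborel (\<lambda>x. c\<^sup>2 * (f x)\<^sup>2)" using assms(1) by (simp add: L2_fn_def)
  moreover have "norm ((g x)\<^sup>2) \<le> norm (c\<^sup>2 * (f x)\<^sup>2)" for x
    using power_mono[OF assms(3)[of x], of 2] by (simp add: power_mult_distrib)
  ultimately have "integrable lborel (\<lambda>x. (g x)\<^sup>2)"
    by (intro Bochner_Integration.integrable_bound[of lborel "\<lambda>x. c\<^sup>2 * (f x)\<^sup>2" "\<lambda>x. (g x)\<^sup>2"] AE_I2) simp_all
  with assms(2) show ?thesis by (simp only: L2_fn_def)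
qed

lemma L2_fn_add:
  assumes "L2_fn f" "L2_fn g"
  shows "L2_fn (\<lambda>x. f x + g x)"
proof -
  have "(\<lambda>x. (f x + g x)\<^sup>2) = (\<lambda>x. (f x)\<^sup>2 + (g x)\<^sup>2 + 2 * (f x * g x))"
    by (simp add: power2_sum fun_eq_iff)
  then show ?thesis using assms L2_mult_integrable[OF assms] by (auto simp: L2_fn_def)
qed

lemma L2_fn_cmult: "L2_fn f \<Longrightarrow> L2_fn (\<lambda>x. c * f x)"
  by (auto simp: L2_fn_def power_mult_distrib)

lemma L2_fn_diff: "L2_fn f \<Longrightarrow> L2_fn g \<Longrightarrow> L2_fn (\<lambda>x. f x - g x)"
  using L2_fn_add[of f "\<lambda>x. -1 * g x"] L2_fn_cmult[of g "-1"] by simp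

lemma L2_fn_sum: "finite I \<Longrightarrow> (\<And>i. i \<in> I \<Longrightarrow> L2_fn (f i)) \<Longrightarrow> L2_fn (\<lambda>x. \<Sum>i\<in>I. f i x)"
proof (induction I rule: finite_induct)
  case empty
  then show ?case by (simp add: L2_fn_def)
qed (auto intro: L2_fn_add)

lemma L2_fn_translate: "L2_fn f \<Longrightarrow> L2_fn (\<lambda>x. f (x + h))"
  using integrable_translate[of "\<lambda>x. (f x)\<^sup>2" h] by (auto simp: L2_fn_def)

lemma L2_norm_translate: "f \<in> borel_measurable borel \<Longrightarrow> L2_norm (\<lambda>x. f (x + h)) = L2_norm f"
  using integral_translate[of "\<lambda>x. (f x)\<^sup>2" h] by (simp add: L2_norm_def)

lemma cc_fn_L2: "cc_fn f \<Longrightarrow> L2_fn f"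
  using integrable_cc[OF cc_fn_mult[OF cc_fn_continuous]] cc_fn_measurable[of f]
  by (simp add: L2_fn_def power2_eq_square)

lemma locally_integrable_power_bound:
  fixes f :: "'a::euclidean_space \<Rightarrow> real"
  assumes [measurable]: "f \<in> borel_measurable borel" "g \<in> borel_measurable borel"
    and "integrable lborel g" "\<And>x. \<bar>f x\<bar> \<le> 1 + g x"
  shows "locally_integrable f"
  unfolding locally_integrable_def
proof (intro conjI allI)
  fix r :: real
  let ?B = "cball 0 r :: 'a set"
  have [measurable]: "?B \<in> sets borel" by simp
  have "integrable lborel (indicat_real ?B)"
    by (intro integrable_real_indicator emeasure_lborel_cball_finite) simp
  then have i: "integrable lborel (\<lambda>x. indicat_real ?B x + \<bar>g x\<bar>)"
    using assms(3) by (intro Bochner_Integration.integrable_add integrable_abs)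
  have le: "norm (indicat_real ?B x * f x) \<le> norm (indicat_real ?B x + \<bar>g x\<bar>)" for x
    using assms(4)[of x] by (cases "x \<in> ?B") simp_all
  have m: "(\<lambda>x. indicat_real ?B x * f x) \<in> borel_measurable lborel" by measurable
  show "integrable lborel (\<lambda>x. indicat_real ?B x * f x)"
    by (rule Bochner_Integration.integrable_bound[OF i m AE_I2[OF le]])
qed simp

lemma L2_fn_locally_integrable:
  assumes "L2_fn f" shows "locally_integrable f"
proof (rule locally_integrable_power_bound)
  show "\<bar>f x\<bar> \<le> 1 + (f x)\<^sup>2" for x
    using power2_diff[of "\<bar>f x\<bar>" 1] zero_le_power2[of "\<bar>f x\<bar> - 1"] by simp
qed (use assms in \<open>auto simp: L2_fn_def\<close>)

lemma L2_fn_nn_integral: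
  "f \<in> borel_measurable borel \<Longrightarrow> L2_fn f \<longleftrightarrow> (\<integral>\<^sup>+x. ennreal ((f x)\<^sup>2) \<partial>lborel) < \<infinity>"
  by (simp add: L2_fn_def integrable_iff_bounded)

lemma L2_norm_nn_integral: "L2_fn f \<Longrightarrow> (\<integral>\<^sup>+x. ennreal ((f x)\<^sup>2) \<partial>lborel) = ennreal ((L2_norm f)\<^sup>2)"
  unfolding L2_norm_power2 by (rule nn_integral_eq_integral) (auto simp: L2_fn_def)

text \<open>Cauchy-Schwarz with the density split as sqrt \<rho> times sqrt \<rho>. The right side
  is a nonnegative integral, so the inequality can be applied before anything is known to be
  finite.\<close>

lemma square_integral_Jensen:
  fixes f \<rho> :: "'a \<Rightarrow> real"
  assumes [measurable]: "f \<in> borel_measurable M" and \<rho>: "integrable M \<rho>" "\<And>x. 0 \<le> \<rho> x" "(\<integral>x. \<rho> x \<partial>M) = 1"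
  shows "ennreal ((\<integral>x. \<rho> x * f x \<partial>M)\<^sup>2) \<le> (\<integral>\<^sup>+x. ennreal (\<rho> x * (f x)\<^sup>2) \<partial>M)"
proof (cases "(\<integral>\<^sup>+x. ennreal (\<rho> x * (f x)\<^sup>2) \<partial>M) < \<infinity>")
  case True
  have [measurable]: "\<rho> \<in> borel_measurable M" using \<rho>(1) by simp
  have i: "integrable M (\<lambda>x. \<rho> x * (f x)\<^sup>2)"
    using True \<rho>(2) by (intro integrableI_nonneg) auto
  have sq: "sqrt (\<rho> x) * sqrt (\<rho> x) = \<rho> x" for x using \<rho>(2) by simp
  have eq: "(\<lambda>x. (sqrt (\<rho> x) * f x)\<^sup>2) = (\<lambda>x. \<rho> x * (f x)\<^sup>2)" "(\<lambda>x. (sqrt (\<rho> x))\<^sup>2) = \<rho>"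
    using \<rho>(2) by (auto simp: power_mult_distrib)
  have "\<bar>\<integral>x. sqrt (\<rho> x) * (sqrt (\<rho> x) * f x) \<partial>M\<bar> \<le> (\<integral>x. \<bar>sqrt (\<rho> x) * (sqrt (\<rho> x) * f x)\<bar> \<partial>M)"
    by (rule integral_abs_bound)
  also have "\<dots> \<le> sqrt (\<integral>x. (sqrt (\<rho> x))\<^sup>2 \<partial>M) * sqrt (\<integral>x. (sqrt (\<rho> x) * f x)\<^sup>2 \<partial>M)"
    by (rule integral_Cauchy_Schwarz) (simp_all only: eq i \<rho>(1), simp_all)
  also have "\<dots> = sqrt (\<integral>x. \<rho> x * (f x)\<^sup>2 \<partial>M)" by (simp only: eq \<rho>(3)) simp
  also have "(\<lambda>x. sqrt (\<rho> x) * (sqrt (\<rho> x) * f x)) = (\<lambda>x. \<rho> x * f x)"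
    by (simp only: mult.assoc[symmetric] sq)
  finally have "\<bar>\<integral>x. \<rho> x * f x \<partial>M\<bar>\<^sup>2 \<le> (sqrt (\<integral>x. \<rho> x * (f x)\<^sup>2 \<partial>M))\<^sup>2"
    by (intro power_mono) auto
  then have "(\<integral>x. \<rho> x * f x \<partial>M)\<^sup>2 \<le> (\<integral>x. \<rho> x * (f x)\<^sup>2 \<partial>M)"
    using \<rho>(2) by simp
  moreover have "ennreal (\<integral>x. \<rho> x * (f x)\<^sup>2 \<partial>M) = (\<integral>\<^sup>+x. ennreal (\<rho> x * (f x)\<^sup>2) \<partial>M)"
    by (rule nn_integral_eq_integral[symmetric, OF i]) (use \<rho>(2) in auto)
  ultimately show ?thesis by (metis ennreal_leI)
qed (simp flip: less_top)

lemma unit_interval_Jensen: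
  fixes f :: "real \<Rightarrow> real"
  assumes "f \<in> borel_measurable borel"
  shows "ennreal ((\<integral>s. indicat_real {0..1} s * f s \<partial>lborel)\<^sup>2) \<le> (\<integral>\<^sup>+s. ennreal (indicat_real {0..1} s * (f s)\<^sup>2) \<partial>lborel)"
  by (rule square_integral_Jensen) (use assms in auto)

text \<open>Fubini needs integrability on the product, which local integrability gives for x in a
  ball; countably many balls exhaust the space.\<close>

lemma AE_integrable_segment:
  fixes g :: "'a::euclidean_space \<Rightarrow> real"
  assumes g: "locally_integrable g"
  shows "AE x in lborel. integrable lborel (\<lambda>s. indicat_real {0..1} s * g (x + s *\<^sub>R h))"
proof -
  have "AE x in lborel. \<forall>n::nat. integrable lborel (\<lambda>s. indicat_real {0..1} s * g (x + s *\<^sub>R h) * indicat_real (cball 0 (real n)) x)"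
    unfolding AE_all_countable
  proof
    fix n :: nat
    have "integrable (lborel \<Otimes>\<^sub>M lborel) (\<lambda>(x, s). indicat_real {0..1} s * g (x + s *\<^sub>R h) * indicat_real (cball 0 (real n)) x)"
      by (rule segment_avg_Fubini_integrable[OF g, of _ 1 "real n"]) (auto simp: indicator_def)
    from lborel_pair.AE_integrable_fst[OF this]
    show "AE x in lborel. integrable lborel (\<lambda>s. indicat_real {0..1} s * g (x + s *\<^sub>R h) * indicat_real (cball 0 (real n)) x)" .
  qed
  then show ?thesis
  proof (rule AE_mp, intro AE_I2 impI)
    fix x :: 'a
    assume *: "\<forall>n::nat. integrable lborel (\<lambda>s. indicat_real {0..1} s * g (x + s *\<^sub>R h) * indicat_real (cball 0 (real n)) x)"
    obtain n :: nat where "norm x \<le> real n" using real_arch_simple by blast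
    with *[rule_format, of n] show "integrable lborel (\<lambda>s. indicat_real {0..1} s * g (x + s *\<^sub>R h))" by simp
  qed
qed

text \<open>Jensen for the mean over the segment, then Tonelli: at fixed s the translate has the
  norm of \<open>g\<close>.\<close>

lemma segment_avg_L2:
  fixes g :: "'a::euclidean_space \<Rightarrow> real"
  assumes g: "L2_fn g"
  shows L2_fn_segment_avg: "L2_fn (segment_avg g h)"
    and L2_norm_segment_avg_le: "L2_norm (segment_avg g h) \<le> L2_norm g"
proof -
  have [measurable]: "g \<in> borel_measurable borel" by (rule L2_fn_measurable[OF g])
  have "(\<integral>\<^sup>+x. ennreal ((segment_avg g h x)\<^sup>2) \<partial>lborel)
      \<le> (\<integral>\<^sup>+x. (\<integral>\<^sup>+s. ennreal (indicat_real {0..1} s * (g (x + s *\<^sub>R h))\<^sup>2) \<partial>lborel) \<partial>lborel)"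
    unfolding segment_avg_def by (intro nn_integral_mono unit_interval_Jensen) simp
  also have "\<dots> = (\<integral>\<^sup>+s. (\<integral>\<^sup>+x. ennreal (indicat_real {0..1} s * (g (x + s *\<^sub>R h))\<^sup>2) \<partial>lborel) \<partial>lborel)"
    by (rule lborel_pair.Fubini') (simp add: case_prod_beta')
  also have "\<dots> = (\<integral>\<^sup>+s. indicator {0..1} (s::real) * (\<integral>\<^sup>+x. ennreal ((g x)\<^sup>2) \<partial>lborel) \<partial>lborel)"
  proof (rule nn_integral_cong)
    fix s :: real
    have "(\<integral>\<^sup>+x. ennreal ((g (x + s *\<^sub>R h))\<^sup>2) \<partial>lborel) = (\<integral>\<^sup>+x. ennreal ((g x)\<^sup>2) \<partial>lborel)"
      by (rule nn_integral_translate[of "\<lambda>x. ennreal ((g x)\<^sup>2)"]) simp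
    then show "(\<integral>\<^sup>+x. ennreal (indicat_real {0..1} s * (g (x + s *\<^sub>R h))\<^sup>2) \<partial>lborel)
        = indicator {0..1} s * (\<integral>\<^sup>+x. ennreal ((g x)\<^sup>2) \<partial>lborel)"
      by (cases "s \<in> {0..1}") auto
  qed
  also have "\<dots> = ennreal ((L2_norm g)\<^sup>2)"
    by (simp add: nn_integral_multc L2_norm_nn_integral[OF g])
  finally have le: "(\<integral>\<^sup>+x. ennreal ((segment_avg g h x)\<^sup>2) \<partial>lborel) \<le> ennreal ((L2_norm g)\<^sup>2)" .
  show L: "L2_fn (segment_avg g h)"
    using le by (subst L2_fn_nn_integral) (auto intro: le_less_trans)
  show "L2_norm (segment_avg g h) \<le> L2_norm g"
    using le unfolding L2_norm_nn_integral[OF L]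
    by (simp add: ennreal_le_iff L2_norm_nonneg power_mono_iff)
qed

lemma segment_avg_diff_L2:
  fixes g :: "'a::euclidean_space \<Rightarrow> real"
  assumes g: "L2_fn g"
    and \<epsilon>: "\<And>s. 0 \<le> s \<Longrightarrow> s \<le> 1 \<Longrightarrow> L2_norm (\<lambda>x. g (x + s *\<^sub>R h) - g x) \<le> \<epsilon>"
  shows "L2_norm (\<lambda>x. segment_avg g h x - g x) \<le> \<epsilon>"
proof -
  have [measurable]: "g \<in> borel_measurable borel" by (rule L2_fn_measurable[OF g])
  have e0: "\<epsilon> \<ge> 0" by (rule order_trans[OF L2_norm_nonneg \<epsilon>[of 0]]) simp_all
  have L: "L2_fn (\<lambda>x. segment_avg g h x - g x)"
    by (intro L2_fn_diff L2_fn_segment_avg g)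
  \<comment> \<open>Subtracting \<open>g x\<close> inside the integral over s requires that integral
    to exist; on the exceptional null set \<open>segment_avg\<close> is a default value.\<close>
  have "AE x in lborel. integrable lborel (\<lambda>s. indicat_real {0..1} s * g (x + s *\<^sub>R h))"
    by (intro AE_integrable_segment L2_fn_locally_integrable g)
  then have ae: "AE x in lborel. segment_avg g h x - g x = (\<integral>s. indicat_real {0..1} s * (g (x + s *\<^sub>R h) - g x) \<partial>lborel)"
  proof (rule AE_mp, intro AE_I2 impI)
    fix x assume i: "integrable lborel (\<lambda>s. indicat_real {0..1} s * g (x + s *\<^sub>R h))"
    have "integrable lborel (\<lambda>s. indicat_real {0..1::real} s * g x)"
      by (intro integrable_mult_left integrable_real_indicator) auto
    with i show "segment_avg g h x - g x = (\<integral>s. indicat_real {0..1} s * (g (x + s *\<^sub>R h) - g x) \<partial>lborel)"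
      by (simp add: segment_avg_def right_diff_distrib)
  qed
  have "(\<integral>\<^sup>+x. ennreal ((segment_avg g h x - g x)\<^sup>2) \<partial>lborel)
      \<le> (\<integral>\<^sup>+x. (\<integral>\<^sup>+s. ennreal (indicat_real {0..1} s * (g (x + s *\<^sub>R h) - g x)\<^sup>2) \<partial>lborel) \<partial>lborel)"
  proof (rule nn_integral_mono_AE, rule AE_mp[OF ae], intro AE_I2 impI)
    fix x assume "segment_avg g h x - g x = (\<integral>s. indicat_real {0..1} s * (g (x + s *\<^sub>R h) - g x) \<partial>lborel)"
    then show "ennreal ((segment_avg g h x - g x)\<^sup>2) \<le> (\<integral>\<^sup>+s. ennreal (indicat_real {0..1} s * (g (x + s *\<^sub>R h) - g x)\<^sup>2) \<partial>lborel)"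
      using unit_interval_Jensen[of "\<lambda>s. g (x + s *\<^sub>R h) - g x"] by simp
  qed
  also have "\<dots> = (\<integral>\<^sup>+s. (\<integral>\<^sup>+x. ennreal (indicat_real {0..1} s * (g (x + s *\<^sub>R h) - g x)\<^sup>2) \<partial>lborel) \<partial>lborel)"
    by (rule lborel_pair.Fubini') (simp add: case_prod_beta')
  also have "\<dots> \<le> (\<integral>\<^sup>+s. indicator {0..1} (s::real) * ennreal (\<epsilon>\<^sup>2) \<partial>lborel)"
  proof (rule nn_integral_mono)
    fix s :: real
    have Ls: "L2_fn (\<lambda>x. g (x + s *\<^sub>R h) - g x)" by (intro L2_fn_diff L2_fn_translate g)
    show "(\<integral>\<^sup>+x. ennreal (indicat_real {0..1} s * (g (x + s *\<^sub>R h) - g x)\<^sup>2) \<partial>lborel)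
        \<le> indicator {0..1} s * ennreal (\<epsilon>\<^sup>2)"
      using \<epsilon>[of s] e0 by (cases "s \<in> {0..1}") (auto simp: L2_norm_nn_integral[OF Ls] L2_norm_nonneg intro!: ennreal_leI power_mono)
  qed
  also have "\<dots> = ennreal (\<epsilon>\<^sup>2)" by (simp add: nn_integral_multc)
  finally show ?thesis
    unfolding L2_norm_nn_integral[OF L] using e0
    by (simp add: ennreal_le_iff L2_norm_nonneg power_mono_iff)
qed

text \<open>Sequential continuity of translations at 0, restated with one radius for all shifts: if
  no radius worked, shifts of size at most 1/(n+1) would form a counterexample.\<close>

lemma L2_translation_eps:
  fixes f :: "'a::euclidean_space \<Rightarrow> real"
  assumes f: "L2_fn f" and "\<epsilon> > 0"
  obtains \<delta> where "\<delta> > 0" "\<And>h. norm h \<le> \<delta> \<Longrightarrow> L2_norm (\<lambda>x. f (x + h) - f x) \<le> \<epsilon>"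
proof (rule ccontr)
  assume *: "\<not> thesis"
  have "\<exists>h. norm h \<le> 1 / real (Suc n) \<and> L2_norm (\<lambda>x. f (x + h) - f x) > \<epsilon>" for n
    using * that[of "1 / real (Suc n)"] by (force simp: not_le)
  then obtain X where X: "\<And>n. norm (X n) \<le> 1 / real (Suc n)" "\<And>n. L2_norm (\<lambda>x. f (x + X n) - f x) > \<epsilon>"
    by metis
  have "X \<longlonglongrightarrow> 0"
    by (rule Lim_null_comparison[OF _ LIMSEQ_Suc[OF lim_1_over_n]]) (use X(1) in auto)
  then have "(\<lambda>n. \<integral>x. (f (x + X n) - f x)\<^sup>2 \<partial>lborel) \<longlonglongrightarrow> 0"
    using f by (intro L2_translation) (auto simp: L2_fn_def)
  then have "(\<lambda>n. L2_norm (\<lambda>x. f (x + X n) - f x)) \<longlonglongrightarrow> sqrt 0"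
    unfolding L2_norm_def by (rule tendsto_real_sqrt)
  then have "eventually (\<lambda>n. L2_norm (\<lambda>x. f (x + X n) - f x) < \<epsilon>) sequentially"
    using \<open>\<epsilon> > 0\<close> by (auto dest: order_tendstoD(2))
  then show False using X(2) by (auto simp: eventually_sequentially dest: less_asym)
qed

section \<open>Hardy's inequality\<close>

lemma L2_norm_cong_AE:
  assumes "AE x in lborel. f x = g x" "f \<in> borel_measurable borel" "L2_fn g"
  shows "L2_fn f" "L2_norm f = L2_norm g"
proof -
  have m: "(\<lambda>x. (f x)\<^sup>2) \<in> borel_measurable lborel" "(\<lambda>x. (g x)\<^sup>2) \<in> borel_measurable lborel"
    using assms(2) L2_fn_measurable[OF assms(3)] by simp_all
  have ae: "AE x in lborel. (f x)\<^sup>2 = (g x)\<^sup>2" using assms(1) by (rule AE_mp) (intro AE_I2, simp)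
  show "L2_norm f = L2_norm g" unfolding L2_norm_def by (simp only: integral_cong_AE[OF m ae])
  show "L2_fn f" using integrable_cong_AE[OF m ae] assms by (simp add: L2_fn_def)
qed

lemma integral_mult_L2_le:
  assumes "L2_fn f" "L2_fn g"
  shows "\<bar>\<integral>x. f x * g x \<partial>lborel\<bar> \<le> L2_norm f * L2_norm g"
  using integral_abs_bound[of lborel "\<lambda>x. f x * g x"] L2_mult_le[OF assms] by (rule order_trans)

text \<open>Stands in for the product rule d(u^2) = 2 u g. The shift is moved from \<open>Y\<close>
  onto u^2 and the difference of squares is factored: the difference of u has L^2 norm at most
  |\<tau>| times that of \<open>g\<close>, and the sum of u and its translate is paired with
  \<open>Y\<close>.\<close>

lemma weak_pderiv_square_bound:
  fixes u :: "'a::euclidean_space \<Rightarrow> real"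
  assumes u: "locally_integrable u" and u2: "locally_integrable (\<lambda>x. (u x)\<^sup>2)"
    and g: "L2_fn g" and w: "weak_pderiv u e g"
    and Y: "cc_fn Y" "cc_fn Y'" "has_pderiv Y e Y'"
  shows "\<bar>\<integral>x. (u x)\<^sup>2 * Y' x \<partial>lborel\<bar> \<le> 2 * L2_norm g * L2_norm (\<lambda>x. u x * Y x)"
proof -
  have [measurable]: "u \<in> borel_measurable borel" by (rule locally_integrable_measurable[OF u])
  have [measurable]: "Y \<in> borel_measurable borel" by (rule cc_fn_measurable[OF Y(1)])
  define F where "F \<tau> = (\<integral>x. (u x)\<^sup>2 * Y (x + \<tau> *\<^sub>R e) \<partial>lborel)" for \<tau>
  define N where "N \<tau> = L2_norm (\<lambda>x. u x * Y (x + \<tau> *\<^sub>R e))" for \<tau>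
  have cY2: "cc_fn (\<lambda>x. (Y x)\<^sup>2)"
    using cc_fn_mult[OF cc_fn_continuous[OF Y(1)] Y(1)] by (simp add: power2_eq_square)
  \<comment> \<open>The bound at step \<tau> contains the norm of u times a translate of
    \<open>Y\<close>; its continuity lets \<tau> tend to 0.\<close>
  have contN: "continuous_on UNIV N"
  proof -
    have "continuous_on UNIV (\<lambda>\<tau>. \<integral>x. (u x)\<^sup>2 * (Y (x + \<tau> *\<^sub>R e))\<^sup>2 \<partial>lborel)"
      by (rule continuous_on_compose2[OF integral_shift_continuous[OF u2 cY2]]) (auto intro!: continuous_intros)
    then have "continuous_on UNIV (\<lambda>\<tau>. sqrt (\<integral>x. (u x)\<^sup>2 * (Y (x + \<tau> *\<^sub>R e))\<^sup>2 \<partial>lborel))"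
      by (rule continuous_on_real_sqrt)
    then show ?thesis by (simp add: N_def[abs_def] L2_norm_def power_mult_distrib)
  qed
  have L2Y: "L2_fn (\<lambda>x. u x * Y (x + k))" for k
    using integrable_mult_cc[OF u2 cc_fn_shift[OF cY2], of k]
    by (auto simp: L2_fn_def power_mult_distrib)
  have bound: "\<bar>F \<tau> - F 0\<bar> \<le> \<bar>\<tau>\<bar> * (L2_norm g * (N \<tau> + N 0))" for \<tau>
  proof -
    let ?k = "(- \<tau>) *\<^sub>R e" and ?g = "\<lambda>x. - \<tau> * g x"
    let ?D = "\<lambda>x. u (x + ?k) - u x"
    have gl: "L2_fn ?g" by (rule L2_fn_cmult[OF g])
    have ae: "AE x in lborel. ?D x = segment_avg ?g ?k x"
      by (rule weak_pderiv_difference[OF u L2_fn_locally_integrable[OF gl] weak_pderiv_cmult[OF w]])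
    have D: "L2_fn ?D" "L2_norm ?D = L2_norm (segment_avg ?g ?k)"
      using L2_norm_cong_AE[OF ae _ L2_fn_segment_avg[OF gl]] by auto
    have "L2_norm ?g = \<bar>\<tau>\<bar> * L2_norm g"
      by (simp add: L2_norm_def power_mult_distrib real_sqrt_mult)
    then have Dle: "L2_norm ?D \<le> \<bar>\<tau>\<bar> * L2_norm g"
      using L2_norm_segment_avg_le[OF gl, of ?k] D(2) by simp
    have Z1: "L2_fn (\<lambda>x. u (x + ?k) * Y x)"
      using L2_fn_translate[OF L2Y[of "- ?k"], of ?k] by simp
    have Z1n: "L2_norm (\<lambda>x. u (x + ?k) * Y x) = N \<tau>"
      using L2_norm_translate[of "\<lambda>x. u x * Y (x + \<tau> *\<^sub>R e)" ?k] by (simp add: N_def)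
    have Z0: "L2_fn (\<lambda>x. u x * Y x)" "L2_norm (\<lambda>x. u x * Y x) = N 0"
      using L2Y[of 0] by (simp_all add: N_def)
    have "F \<tau> = (\<integral>x. (u (x + ?k))\<^sup>2 * Y x \<partial>lborel)"
      using integral_translate[of "\<lambda>x. (u x)\<^sup>2 * Y (x + \<tau> *\<^sub>R e)" ?k] by (simp add: F_def)
    then have "F \<tau> - F 0 = (\<integral>x. (u (x + ?k))\<^sup>2 * Y x - (u x)\<^sup>2 * Y x \<partial>lborel)"
      using integrable_mult_cc[OF u2 Y(1)] integrable_mult_cc[OF locally_integrable_translate[OF u2, of ?k] Y(1)]
      by (simp add: F_def)
    also have "\<dots> = (\<integral>x. ?D x * (u (x + ?k) * Y x) + ?D x * (u x * Y x) \<partial>lborel)"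
      by (rule arg_cong[where f="integral\<^sup>L lborel"]) (auto simp: fun_eq_iff power2_eq_square algebra_simps)
    also have "\<dots> = (\<integral>x. ?D x * (u (x + ?k) * Y x) \<partial>lborel) + (\<integral>x. ?D x * (u x * Y x) \<partial>lborel)"
      by (intro Bochner_Integration.integral_add L2_mult_integrable D Z1 Z0)
    finally have eq: "F \<tau> - F 0 = (\<integral>x. ?D x * (u (x + ?k) * Y x) \<partial>lborel) + (\<integral>x. ?D x * (u x * Y x) \<partial>lborel)" .
    have "\<bar>F \<tau> - F 0\<bar> \<le> L2_norm ?D * N \<tau> + L2_norm ?D * N 0"
      using integral_mult_L2_le[OF D(1) Z1, unfolded Z1n] integral_mult_L2_le[OF D(1) Z0(1), unfolded Z0(2)]
      unfolding eq by linarith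
    also have "\<dots> = L2_norm ?D * (N \<tau> + N 0)" by (simp add: distrib_left)
    also have "\<dots> \<le> (\<bar>\<tau>\<bar> * L2_norm g) * (N \<tau> + N 0)"
      by (intro mult_right_mono Dle) (simp add: N_def L2_norm_nonneg)
    finally show ?thesis by (simp add: mult.assoc)
  qed
  have DF: "(F has_real_derivative (\<integral>x. (u x)\<^sup>2 * Y' x \<partial>lborel)) (at 0)"
    unfolding F_def[abs_def] by (rule integral_shift_has_derivative[OF u2 Y])
  let ?X = "\<lambda>n. 1 / real (Suc n)"
  have X: "?X \<longlonglongrightarrow> 0" using LIMSEQ_Suc[OF lim_1_over_n] by simp
  have L1: "(\<lambda>n. \<bar>(F (0 + ?X n) - F 0) / ?X n\<bar>) \<longlonglongrightarrow> \<bar>\<integral>x. (u x)\<^sup>2 * Y' x \<partial>lborel\<bar>"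
    using DF[unfolded DERIV_def tendsto_at_iff_sequentially, rule_format, of ?X] X
    by (intro tendsto_rabs) (simp add: o_def)
  have "(\<lambda>n. N (?X n)) \<longlonglongrightarrow> N 0"
    by (rule continuous_on_tendsto_compose[OF contN X]) auto
  then have L2: "(\<lambda>n. L2_norm g * (N (?X n) + N 0)) \<longlonglongrightarrow> L2_norm g * (N 0 + N 0)"
    by (intro tendsto_intros)
  have "\<bar>(F (0 + ?X n) - F 0) / ?X n\<bar> \<le> L2_norm g * (N (?X n) + N 0)" for n
  proof -
    have "\<bar>q / X\<bar> \<le> K" if "X > 0" "\<bar>q\<bar> \<le> \<bar>X\<bar> * K" for q X K :: real
      using that by (simp add: abs_divide pos_divide_le_eq mult.commute)
    from this[OF _ bound[of "?X n"]] show ?thesis by simp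
  qed
  then have "\<bar>\<integral>x. (u x)\<^sup>2 * Y' x \<partial>lborel\<bar> \<le> L2_norm g * (N 0 + N 0)"
    by (intro LIMSEQ_le[OF L1 L2]) auto
  then show ?thesis by (simp add: N_def)
qed

section \<open>Rules for directional derivatives\<close>

lemma has_pderiv_const: "has_pderiv (\<lambda>_. c) e (\<lambda>_. 0)"
  by (simp add: has_pderiv_def)

lemma has_pderiv_add:
  "has_pderiv f e f' \<Longrightarrow> has_pderiv g e g' \<Longrightarrow> has_pderiv (\<lambda>x. f x + g x) e (\<lambda>x. f' x + g' x)"
  by (auto simp: has_pderiv_def intro!: derivative_eq_intros)

lemma has_pderiv_mult:
  "has_pderiv f e f' \<Longrightarrow> has_pderiv g e g' \<Longrightarrow> has_pderiv (\<lambda>x. f x * g x) e (\<lambda>x. f' x * g x + f x * g' x)"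
  unfolding has_pderiv_def
proof
  fix x
  assume "\<forall>x. ((\<lambda>\<tau>. f (x + \<tau> *\<^sub>R e)) has_real_derivative f' x) (at 0)"
    "\<forall>x. ((\<lambda>\<tau>. g (x + \<tau> *\<^sub>R e)) has_real_derivative g' x) (at 0)"
  from DERIV_mult[OF this[rule_format, of x]]
  show "((\<lambda>\<tau>. f (x + \<tau> *\<^sub>R e) * g (x + \<tau> *\<^sub>R e)) has_real_derivative f' x * g x + f x * g' x) (at 0)"
    by (simp add: algebra_simps)
qed

lemma has_pderiv_compose:
  assumes "\<And>y. (h has_real_derivative h' y) (at y)" "has_pderiv f e f'"
  shows "has_pderiv (\<lambda>x. h (f x)) e (\<lambda>x. h' (f x) * f' x)"
  unfolding has_pderiv_def
proof
  fix x
  have "((\<lambda>\<tau>. f (x + \<tau> *\<^sub>R e)) has_real_derivative f' x) (at 0)"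
    using assms(2) by (simp add: has_pderiv_def)
  from DERIV_chain2[OF assms(1) this] show "((\<lambda>\<tau>. h (f (x + \<tau> *\<^sub>R e))) has_real_derivative h' (f x) * f' x) (at 0)"
    by simp
qed

lemma has_pderiv_coord: "has_pderiv (\<lambda>x::real^'n. x $ i) (axis j 1) (\<lambda>_. if i = j then 1 else 0)"
  by (auto simp: has_pderiv_def axis_def intro!: derivative_eq_intros)

lemma has_pderiv_norm2: "has_pderiv (\<lambda>x::real^'n. (norm x)\<^sup>2) (axis j 1) (\<lambda>x. 2 * x $ j)"
  unfolding has_pderiv_def
proof
  fix x :: "real^'n"
  have "(norm (x + \<tau> *\<^sub>R axis j 1))\<^sup>2 = (norm x)\<^sup>2 + 2 * \<tau> * x $ j + \<tau>\<^sup>2" for \<tau> :: real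
    unfolding power2_norm_eq_inner
    by (simp add: inner_add_left inner_add_right inner_axis inner_axis' power2_eq_square[of \<tau>] algebra_simps)
  then show "((\<lambda>\<tau>. (norm (x + \<tau> *\<^sub>R axis j 1))\<^sup>2) has_real_derivative 2 * x $ j) (at 0)"
    by (auto intro!: derivative_eq_intros)
qed

lemma DERIV_max_0_power:
  "((\<lambda>y. max 0 y ^ Suc (Suc n)) has_real_derivative real (Suc (Suc n)) * max 0 y ^ Suc n) (at (y::real))"
proof (cases y "0::real" rule: linorder_cases)
  case less
  have "((\<lambda>_. 0) has_real_derivative real (Suc (Suc n)) * max 0 y ^ Suc n) (at y)" using less by simp
  then show ?thesis
    by (rule has_field_derivative_transform_within_open[where S="{..<0}"]) (use less in auto)
next
  case greater
  have "((\<lambda>y. y ^ Suc (Suc n)) has_real_derivative real (Suc (Suc n)) * max 0 y ^ Suc n) (at y)"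
    using greater by (auto intro!: derivative_eq_intros simp del: power_Suc)
  then show ?thesis
    by (rule has_field_derivative_transform_within_open[where S="{0<..}"]) (use greater in auto)
next
  case equal
  have "(\<lambda>h::real. max 0 h ^ Suc n) \<midarrow>0\<rightarrow> max 0 0 ^ Suc n"
    by (intro tendsto_intros)
  moreover have "\<bar>max 0 h ^ Suc (Suc n) / h\<bar> \<le> max 0 h ^ Suc n" for h :: real by (cases "h > 0") auto
  ultimately have "(\<lambda>h::real. max 0 h ^ Suc (Suc n) / h) \<midarrow>0\<rightarrow> 0"
    by (intro Lim_null_comparison[of "\<lambda>h. max 0 h ^ Suc (Suc n) / h" "\<lambda>h. max 0 h ^ Suc n"]) (auto intro!: always_eventually)
  then show ?thesis using equal by (simp add: DERIV_def)
qed

section \<open>A cut-off at radius R with two continuous derivatives\<close>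

definition bell :: "real \<Rightarrow> real^'n \<Rightarrow> real" where
  "bell R x = max 0 (1 - (norm x)\<^sup>2 / R\<^sup>2)"

text \<open>The third power is the smallest for which the truncated parabola \<open>bell\<close>
  becomes twice continuously differentiable, as the Laplacian falling on it demands. In the
  derivatives \<open>dcutoff\<close> and \<open>ddcutoff\<close> the factor 6 is 3 from the cube
  times 2 from the square of the norm.\<close>

definition cutoff :: "real \<Rightarrow> real^'n \<Rightarrow> real" where
  "cutoff R x = bell R x ^ 3"

definition dcutoff :: "real \<Rightarrow> 'n \<Rightarrow> real^'n \<Rightarrow> real" where
  "dcutoff R j x = - (6 / R\<^sup>2) * (x $ j * bell R x ^ 2)"

definition ddcutoff :: "real \<Rightarrow> 'n \<Rightarrow> real^'n \<Rightarrow> real" where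
  "ddcutoff R j x = - (6 / R\<^sup>2) * (bell R x ^ 2 - 4 / R\<^sup>2 * (x $ j)\<^sup>2 * bell R x)"

lemma bell_nonneg: "bell R x \<ge> 0" and bell_le_1: "bell R x \<le> 1"
  by (auto simp: bell_def)

lemma bell_eq_0: "R > 0 \<Longrightarrow> norm x > R \<Longrightarrow> bell R x = 0"
  using power_strict_mono[of R "norm x" 2] by (simp add: bell_def)

lemma bell_continuous: "continuous_on UNIV (bell R)"
  unfolding bell_def[abs_def] divide_inverse by (intro continuous_intros continuous_on_max)

lemma has_pderiv_bell_arg: "has_pderiv (\<lambda>x::real^'n. 1 - (norm x)\<^sup>2 / R\<^sup>2) (axis j 1) (\<lambda>x. - (2 * x $ j / R\<^sup>2))"
  using has_pderiv_add[OF has_pderiv_const[of 1] has_pderiv_mult[OF has_pderiv_const[of "- (1 / R\<^sup>2)"] has_pderiv_norm2]]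
  by simp

lemma has_pderiv_cutoff: "has_pderiv (cutoff R) (axis j 1) (dcutoff R j)"
proof -
  have "has_pderiv (\<lambda>x. max 0 (1 - (norm x)\<^sup>2 / R\<^sup>2) ^ Suc (Suc 1)) (axis j 1)
    (\<lambda>x. real (Suc (Suc 1)) * max 0 (1 - (norm x)\<^sup>2 / R\<^sup>2) ^ Suc 1 * (- (2 * x $ j / R\<^sup>2)))"
    by (rule has_pderiv_compose[OF DERIV_max_0_power has_pderiv_bell_arg])
  then show ?thesis
    by (simp add: cutoff_def[abs_def] dcutoff_def[abs_def] bell_def numeral_eq_Suc mult_ac del: power_Suc)
qed

lemma has_pderiv_dcutoff: "has_pderiv (dcutoff R j) (axis j 1) (ddcutoff R j)"
proof -
  have "has_pderiv (\<lambda>x. max 0 (1 - (norm x)\<^sup>2 / R\<^sup>2) ^ Suc (Suc 0)) (axis j 1)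
    (\<lambda>x. real (Suc (Suc 0)) * max 0 (1 - (norm x)\<^sup>2 / R\<^sup>2) ^ Suc 0 * (- (2 * x $ j / R\<^sup>2)))"
    by (rule has_pderiv_compose[OF DERIV_max_0_power has_pderiv_bell_arg])
  then have "has_pderiv (\<lambda>x. bell R x ^ 2) (axis j 1) (\<lambda>x. 2 * bell R x * (- (2 * x $ j / R\<^sup>2)))"
    by (simp add: bell_def numeral_eq_Suc)
  from has_pderiv_mult[OF has_pderiv_const[of "- (6 / R\<^sup>2)"] has_pderiv_mult[OF has_pderiv_coord[of j j] this]]
  show ?thesis
    by (simp add: dcutoff_def[abs_def] ddcutoff_def[abs_def] power2_eq_square mult_ac)
qed

lemma cc_fn_mult_bell:
  assumes "R > 0" "continuous_on UNIV f"
  shows "cc_fn (\<lambda>x. f x * bell R x)"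
  using assms bell_eq_0[OF assms(1)] by (auto simp: cc_fn_def intro!: continuous_intros bell_continuous exI[of _ R])

lemma cc_fn_cutoff:
  assumes "R > 0"
  shows "cc_fn (cutoff R :: real^'n \<Rightarrow> real)"
proof -
  have "continuous_on UNIV (\<lambda>x::real^'n. bell R x * bell R x)"
    by (intro continuous_intros bell_continuous)
  from cc_fn_mult_bell[OF assms this] show ?thesis
    by (simp add: cutoff_def[abs_def] power3_eq_cube)
qed

lemma cc_fn_dcutoff: "R > 0 \<Longrightarrow> cc_fn (dcutoff R j)"
  using cc_fn_mult_bell[of R "\<lambda>x. - (6 / R\<^sup>2) * (x $ j * bell R x)"]
  by (simp add: dcutoff_def[abs_def] continuous_intros bell_continuous power2_eq_square mult.assoc)

lemma cc_fn_ddcutoff: "R > 0 \<Longrightarrow> cc_fn (ddcutoff R j)"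
  using cc_fn_mult_bell[of R "\<lambda>x. - (6 / R\<^sup>2) * (bell R x - 4 / R\<^sup>2 * (x $ j)\<^sup>2)"]
  by (simp add: ddcutoff_def[abs_def] continuous_intros bell_continuous power2_eq_square left_diff_distrib mult.assoc)

lemma cutoff_nonneg: "cutoff R x \<ge> 0" and cutoff_le_1: "cutoff R x \<le> 1"
  by (simp_all add: cutoff_def bell_nonneg bell_le_1 power_le_one)

lemma abs_dcutoff_le: "\<bar>dcutoff R j x\<bar> \<le> 6 / R\<^sup>2 * norm x * indicat_real (cball 0 R) x" if "R > 0"
proof (cases "norm x \<le> R")
  case True
  have "\<bar>x $ j\<bar> * bell R x ^ 2 \<le> norm x * 1"
    by (intro mult_mono component_le_norm_cart power_le_one bell_nonneg bell_le_1) auto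
  then have "6 / R\<^sup>2 * (\<bar>x $ j\<bar> * bell R x ^ 2) \<le> 6 / R\<^sup>2 * (norm x * 1)" by (intro mult_left_mono) auto
  with True show ?thesis by (simp add: dcutoff_def abs_mult bell_nonneg)
qed (simp add: dcutoff_def bell_eq_0 that)

text \<open>Where the bell does not vanish the coordinate is at most R, so the bracket is at most 1
  + 4 in modulus; 30 is 6 times 5.\<close>

lemma abs_ddcutoff_le: "\<bar>ddcutoff R j x\<bar> \<le> 30 / R\<^sup>2" if "R > 0"
proof (cases "norm x \<le> R")
  case True
  have "\<bar>x $ j\<bar> \<le> R" using True component_le_norm_cart[of x j] by simp
  then have "(x $ j)\<^sup>2 \<le> R\<^sup>2" using that by (simp add: abs_le_square_iff[symmetric])
  then have "4 / R\<^sup>2 * (x $ j)\<^sup>2 \<le> 4" using that by (simp add: field_simps)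
  then have "4 / R\<^sup>2 * (x $ j)\<^sup>2 * bell R x \<le> 4 * 1"
    by (intro mult_mono bell_le_1) (auto simp: bell_nonneg)
  moreover have "bell R x ^ 2 \<le> 1" by (simp add: power_le_one bell_nonneg bell_le_1)
  moreover have "0 \<le> 4 / R\<^sup>2 * (x $ j)\<^sup>2 * bell R x" "0 \<le> bell R x ^ 2" by (simp_all add: bell_nonneg)
  ultimately have "\<bar>bell R x ^ 2 - 4 / R\<^sup>2 * (x $ j)\<^sup>2 * bell R x\<bar> \<le> 5" by linarith
  then have "6 / R\<^sup>2 * \<bar>bell R x ^ 2 - 4 / R\<^sup>2 * (x $ j)\<^sup>2 * bell R x\<bar> \<le> 6 / R\<^sup>2 * 5"
    by (intro mult_left_mono) auto
  moreover have "\<bar>- (6 / R\<^sup>2)\<bar> = 6 / R\<^sup>2" by simp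
  ultimately show ?thesis unfolding ddcutoff_def abs_mult by simp
qed (simp add: ddcutoff_def bell_eq_0 that)

lemma cutoff_tendsto_1: "(\<lambda>n. cutoff (real (Suc n)) x) \<longlonglongrightarrow> 1"
proof -
  have "(\<lambda>n. max 0 (1 - (norm x)\<^sup>2 * (1 / real (Suc n)) ^ 2) ^ 3) \<longlonglongrightarrow> max 0 (1 - (norm x)\<^sup>2 * 0 ^ 2) ^ 3"
    by (intro tendsto_intros LIMSEQ_Suc[OF lim_1_over_n])
  then show ?thesis by (simp add: cutoff_def bell_def power_divide)
qed

text \<open>The excess of u^2 / R^2 over \<kappa> / R^3 is dominated by u^6 / \<kappa>^2 and tends
  to 0 pointwise, so its integral tends to 0. What remains, \<kappa> / R^3 over a ball of volume at
  most 8 R^3, is of the size of \<kappa>. Hoelder's inequality on the whole ball would give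
  boundedness only.\<close>

lemma ball_average_tendsto_0:
  fixes u :: "real^3 \<Rightarrow> real"
  assumes [measurable]: "u \<in> borel_measurable borel" and u6: "integrable lborel (\<lambda>x. (u x) ^ 6)"
  shows "(\<lambda>n. (\<integral>x. (u x)\<^sup>2 * indicat_real (cball 0 (real (Suc n))) x \<partial>lborel) / (real (Suc n))\<^sup>2) \<longlonglongrightarrow> 0"
proof (rule LIMSEQ_I)
  fix r :: real assume r: "r > 0"
  \<comment> \<open>The ball contributes at most \<open>8 * \<kappa>\<close>, that is r / 4, beside
    less than r / 2 from the excess.\<close>
  define \<kappa> where "\<kappa> = r / 32"
  have \<kappa>: "\<kappa> > 0" using r by (simp add: \<kappa>_def)
  let ?R = "\<lambda>n. real (Suc n)"
  let ?B = "\<lambda>n. cball 0 (?R n) :: (real^3) set"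
  let ?p = "\<lambda>n x. max 0 ((u x)\<^sup>2 / (?R n)\<^sup>2 - \<kappa> / (?R n) ^ 3)"
  have [measurable]: "?B n \<in> sets borel" for n by simp
  have u6': "integrable lborel (\<lambda>x. (u x) ^ 6 / \<kappa>\<^sup>2)" using u6 by simp
  have pb: "?p n x \<le> (u x) ^ 6 / \<kappa>\<^sup>2" for n x
  proof (cases "(u x)\<^sup>2 / (?R n)\<^sup>2 \<le> \<kappa> / (?R n) ^ 3")
    case False
    have R: "?R n > 0" by simp
    \<comment> \<open>Where the excess is positive, u^2 R / \<kappa> exceeds 1; inserting its square
      turns u^2 / R^2 into u^6 / \<kappa>^2, without R.\<close>
    have "\<kappa> / (?R n) ^ 3 < (u x)\<^sup>2 / (?R n)\<^sup>2" using False by simp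
    then have "\<kappa> / (?R n) ^ 3 * (?R n) ^ 3 < (u x)\<^sup>2 / (?R n)\<^sup>2 * (?R n) ^ 3"
      using R by (intro mult_strict_right_mono) auto
    moreover have "\<kappa> / (?R n) ^ 3 * (?R n) ^ 3 = \<kappa>" by simp
    moreover have "(u x)\<^sup>2 / (?R n)\<^sup>2 * (?R n) ^ 3 = (u x)\<^sup>2 * ?R n"
      by (simp add: power2_eq_square power3_eq_cube del: of_nat_Suc)
    ultimately have "\<kappa> < (u x)\<^sup>2 * ?R n" by simp
    then have "\<kappa>\<^sup>2 \<le> ((u x)\<^sup>2 * ?R n)\<^sup>2" using \<kappa> by (intro power_mono) auto
    then have "(u x)\<^sup>2 * \<kappa>\<^sup>2 \<le> (u x)\<^sup>2 * ((u x)\<^sup>2 * ?R n)\<^sup>2" by (intro mult_left_mono) auto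
    also have "\<dots> = (u x) ^ 6 * (?R n)\<^sup>2" by (simp add: power_mult_distrib power_even_eq[symmetric] flip: power_add power_mult)
    finally have "(u x)\<^sup>2 / (?R n)\<^sup>2 \<le> (u x) ^ 6 / \<kappa>\<^sup>2"
      using R \<kappa> by (simp add: divide_le_eq le_divide_eq mult.commute)
    moreover have "0 \<le> \<kappa> / (?R n) ^ 3" using \<kappa> by simp
    moreover have "0 \<le> (u x) ^ 6 / \<kappa>\<^sup>2" by simp
    ultimately show ?thesis by simp
  qed simp
  have pint: "integrable lborel (?p n)" for n
    by (rule Bochner_Integration.integrable_bound[OF u6' _ AE_I2]) (use pb in \<open>simp_all\<close>)
  have "(\<lambda>n. \<integral>x. ?p n x \<partial>lborel) \<longlonglongrightarrow> (\<integral>x. 0 \<partial>(lborel :: (real^3) measure))"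
  proof (rule integral_dominated_convergence[OF _ _ u6'])
    show "AE x in lborel. (\<lambda>n. ?p n x) \<longlonglongrightarrow> 0"
    proof (rule AE_I2)
      fix x
      have "(\<lambda>n. max 0 ((u x)\<^sup>2 * (1 / ?R n) ^ 2 - \<kappa> * (1 / ?R n) ^ 3)) \<longlonglongrightarrow> max 0 ((u x)\<^sup>2 * 0 ^ 2 - \<kappa> * 0 ^ 3)"
        by (intro tendsto_intros LIMSEQ_Suc[OF lim_1_over_n])
      then show "(\<lambda>n. ?p n x) \<longlonglongrightarrow> 0" by (simp add: power_divide)
    qed
    show "AE x in lborel. norm (?p n x) \<le> (u x) ^ 6 / \<kappa>\<^sup>2" for n
      by (rule AE_I2) (use pb in simp)
  qed simp_all
  then have "(\<lambda>n. \<integral>x. ?p n x \<partial>lborel) \<longlonglongrightarrow> 0" by simp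
  then have "eventually (\<lambda>n. (\<integral>x. ?p n x \<partial>lborel) < r / 2) sequentially"
    using r by (intro order_tendstoD(2)) auto
  then obtain N where N: "\<And>n. n \<ge> N \<Longrightarrow> (\<integral>x. ?p n x \<partial>lborel) < r / 2"
    by (auto simp: eventually_sequentially)
  have main: "(\<integral>x. (u x)\<^sup>2 * indicat_real (?B n) x \<partial>lborel) / (?R n)\<^sup>2 \<le> (\<integral>x. ?p n x \<partial>lborel) + 8 * \<kappa>" for n
  proof -
    have R: "?R n > 0" by simp
    have iB: "integrable lborel (\<lambda>x. \<kappa> / (?R n) ^ 3 * indicat_real (?B n) x)"
      by (intro integrable_mult_right integrable_real_indicator emeasure_lborel_cball_finite) simp
    have "(\<integral>x. (u x)\<^sup>2 * indicat_real (?B n) x \<partial>lborel) / (?R n)\<^sup>2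
        = (\<integral>x. (u x)\<^sup>2 * indicat_real (?B n) x / (?R n)\<^sup>2 \<partial>lborel)" by simp
    also have "\<dots> \<le> (\<integral>x. ?p n x + \<kappa> / (?R n) ^ 3 * indicat_real (?B n) x \<partial>lborel)"
    proof (rule integral_mono')
      show "(u x)\<^sup>2 * indicat_real (?B n) x / (?R n)\<^sup>2 \<le> ?p n x + \<kappa> / (?R n) ^ 3 * indicat_real (?B n) x" for x
        by (cases "x \<in> ?B n") simp_all
      show "0 \<le> ?p n x + \<kappa> / (?R n) ^ 3 * indicat_real (?B n) x" for x
        using \<kappa> by (intro add_nonneg_nonneg mult_nonneg_nonneg) auto
    qed (intro Bochner_Integration.integrable_add pint iB)
    also have "\<dots> = (\<integral>x. ?p n x \<partial>lborel) + (\<integral>x. \<kappa> / (?R n) ^ 3 * indicat_real (?B n) x \<partial>lborel)"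
      by (rule Bochner_Integration.integral_add[OF pint iB])
    also have "(\<integral>x. \<kappa> / (?R n) ^ 3 * indicat_real (?B n) x \<partial>lborel) = \<kappa> / (?R n) ^ 3 * measure lborel (?B n)"
      by simp
    also have "\<dots> \<le> \<kappa> / (?R n) ^ 3 * (8 * (?R n) ^ 3)"
    proof (rule mult_left_mono)
      \<comment> \<open>The enclosing cube has side 2 R and volume 8 R^3, an easy bound for the
        volume of the ball.\<close>
      have sub: "?B n \<subseteq> cbox (\<chi> i. - ?R n) (\<chi> i. ?R n)"
      proof
        fix x assume "x \<in> ?B n"
        then have "\<bar>x $ i\<bar> \<le> ?R n" for i using component_le_norm_cart[of x i] by simp
        then show "x \<in> cbox (\<chi> i. - ?R n) (\<chi> i. ?R n)"
          by (auto simp: mem_box_cart abs_le_iff minus_le_iff simp del: of_nat_Suc)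
      qed
      have "measure lborel (?B n) \<le> measure lborel (cbox (\<chi> i. - ?R n) (\<chi> i. ?R n) :: (real^3) set)"
        by (intro measure_mono_fmeasurable sub fmeasurableI) (simp_all only: emeasure_lborel_cbox_finite, simp_all)
      also have "\<dots> = (\<Prod>i\<in>(UNIV :: 3 set). (\<chi> i. ?R n) $ i - (\<chi> i. - ?R n) $ i)"
        by (rule content_cbox_cart) (simp add: interval_ne_empty_cart)
      also have "\<dots> = (2 * ?R n) ^ 3" by (simp del: of_nat_Suc)
      also have "\<dots> = 8 * (?R n) ^ 3" by (simp add: power_mult_distrib del: of_nat_Suc)
      finally show "measure lborel (?B n) \<le> 8 * (?R n) ^ 3" .
    qed (use \<kappa> in simp)
    also have "\<dots> = 8 * \<kappa>" using R by simp
    finally show ?thesis by simp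
  qed
  have "norm ((\<integral>x. (u x)\<^sup>2 * indicat_real (?B n) x \<partial>lborel) / (?R n)\<^sup>2 - 0) < r" if "n \<ge> N" for n
  proof -
    have "0 \<le> (\<integral>x. (u x)\<^sup>2 * indicat_real (?B n) x \<partial>lborel) / (?R n)\<^sup>2"
      by (intro divide_nonneg_nonneg integral_nonneg_AE AE_I2) auto
    then show ?thesis using main[of n] N[OF that] r unfolding \<kappa>_def by simp
  qed
  then show "\<exists>no. \<forall>n\<ge>no. norm ((\<integral>x. (u x)\<^sup>2 * indicat_real (?B n) x \<partial>lborel) / (?R n)\<^sup>2 - 0) < r" by blast
qed

text \<open>The inverse square of the Japanese bracket sqrt(1 + |x|^2): a Hardy weight that is
  regular at the origin.\<close>

definition japanese :: "real^'n \<Rightarrow> real" where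
  "japanese x = inverse (1 + (norm x)\<^sup>2)"

lemma japanese_pos: "japanese x > 0" and japanese_le_1: "japanese x \<le> 1"
  and norm2_japanese: "(norm x)\<^sup>2 * japanese x = 1 - japanese x"
proof -
  have "1 + (norm x)\<^sup>2 > 0" by (simp add: add_pos_nonneg)
  then show "japanese x > 0" "japanese x \<le> 1" "(norm x)\<^sup>2 * japanese x = 1 - japanese x"
    by (simp_all add: japanese_def field_simps)
qed

lemma japanese_continuous: "continuous_on UNIV japanese"
  unfolding japanese_def[abs_def]
  by (intro continuous_intros) (metis add_pos_nonneg less_irrefl zero_le_power2 zero_less_one)

lemma has_pderiv_japanese: "has_pderiv japanese (axis j 1) (\<lambda>x. - (2 * x $ j) * (japanese x)\<^sup>2)"
  unfolding has_pderiv_def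
proof
  fix x :: "real^'a"
  have "((\<lambda>\<tau>. 1 + (norm (x + \<tau> *\<^sub>R axis j 1))\<^sup>2) has_real_derivative 2 * x $ j) (at 0)"
    using has_pderiv_add[OF has_pderiv_const[of 1] has_pderiv_norm2[of j]] by (simp add: has_pderiv_def)
  from DERIV_inverse'[OF this]
  have "((\<lambda>\<tau>. inverse (1 + (norm (x + \<tau> *\<^sub>R axis j 1))\<^sup>2)) has_real_derivative
      - (inverse (1 + (norm x)\<^sup>2) * (2 * x $ j) * inverse (1 + (norm x)\<^sup>2))) (at 0)"
    by (simp add: add_nonneg_eq_0_iff)
  then show "((\<lambda>\<tau>. japanese (x + \<tau> *\<^sub>R axis j 1)) has_real_derivative - (2 * x $ j) * (japanese x)\<^sup>2) (at 0)"
    by (simp add: japanese_def power2_eq_square mult_ac)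
qed

lemma norm2_eq_sum: "(norm x)\<^sup>2 = (\<Sum>j\<in>UNIV. (x $ j)\<^sup>2)" for x :: "real^'n"
  unfolding power2_norm_eq_inner inner_vec_def by (simp add: power2_eq_square)

text \<open>The field Y, the cut-off times x / (1 + |x|^2), satisfies |Y_j|^2 \<le>
  \<open>cutoff R x * japanese x\<close>, and its divergence dominates this weight up to an error of
  size 1 / R^2 on the ball. Hence the weighted integral I is at most 2 \<Gamma> sqrt I plus the
  error, and the square root is absorbed. Dimension three enters through the divergence, which would
  be too small in dimension two.\<close>

lemma Hardy_cutoff:
  fixes u :: "real^3 \<Rightarrow> real" and g :: "3 \<Rightarrow> real^3 \<Rightarrow> real"
  assumes u: "locally_integrable u" and u2: "locally_integrable (\<lambda>x. (u x)\<^sup>2)"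
    and g: "\<And>j. L2_fn (g j)" and w: "\<And>j. weak_pderiv u (axis j 1) (g j)" and R: "R > 0"
  shows "(\<integral>x. (u x)\<^sup>2 * (cutoff R x * japanese x) \<partial>lborel)
    \<le> 4 * (\<Sum>j\<in>UNIV. L2_norm (g j))\<^sup>2 + 12 * ((\<integral>x. (u x)\<^sup>2 * indicat_real (cball 0 R) x \<partial>lborel) / R\<^sup>2)"
proof -
  define \<Gamma> where "\<Gamma> = (\<Sum>j\<in>UNIV. L2_norm (g j))"
  define I where "I = (\<integral>x. (u x)\<^sup>2 * (cutoff R x * japanese x) \<partial>lborel)"
  define E where "E = (\<integral>x. (u x)\<^sup>2 * indicat_real (cball 0 R) x \<partial>lborel) / R\<^sup>2"
  define Y where "Y j x = cutoff R x * (x $ j * japanese x)" for j :: 3 and x :: "real^3"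
  define Y' where "Y' j x = dcutoff R j x * (x $ j * japanese x)
      + cutoff R x * (japanese x + x $ j * (- (2 * x $ j) * (japanese x)\<^sup>2))" for j :: 3 and x :: "real^3"
  have [measurable]: "u \<in> borel_measurable borel" by (rule locally_integrable_measurable[OF u])
  have Y: "has_pderiv (Y j) (axis j 1) (Y' j)" for j
    using has_pderiv_mult[OF has_pderiv_cutoff has_pderiv_mult[OF has_pderiv_coord[of j j] has_pderiv_japanese], of R]
    by (simp add: Y_def[abs_def] Y'_def[abs_def])
  have ccY: "cc_fn (Y j)" for j
    using cc_fn_mult[of "\<lambda>x. x $ j * japanese x", OF _ cc_fn_cutoff[OF R]]
    by (simp add: Y_def[abs_def] continuous_intros japanese_continuous mult.commute)
  have ccY': "cc_fn (Y' j)" for j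
  proof -
    have "cc_fn (\<lambda>x. (x $ j * japanese x) * dcutoff R j x +
       (japanese x + x $ j * (- (2 * x $ j) * (japanese x)\<^sup>2)) * cutoff R x)"
      by (intro cc_fn_add cc_fn_mult cc_fn_cutoff cc_fn_dcutoff R continuous_intros japanese_continuous)
    then show ?thesis by (simp add: Y'_def[abs_def] mult.commute)
  qed
  have ccq: "cc_fn (\<lambda>x::real^3. cutoff R x * japanese x)"
    using cc_fn_mult[OF japanese_continuous cc_fn_cutoff[OF R]] by (simp add: mult.commute)
  have I0: "I \<ge> 0"
    unfolding I_def by (intro integral_nonneg_AE AE_I2 mult_nonneg_nonneg) (simp_all add: cutoff_nonneg japanese_pos less_imp_le)
  have G0: "\<Gamma> \<ge> 0" unfolding \<Gamma>_def by (intro sum_nonneg L2_norm_nonneg)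
  have LY: "L2_norm (\<lambda>x. u x * Y j x) \<le> sqrt I" for j
    unfolding L2_norm_def I_def
  proof (intro real_sqrt_le_mono integral_mono')
    show "integrable lborel (\<lambda>x. (u x)\<^sup>2 * (cutoff R x * japanese x))" by (rule integrable_mult_cc[OF u2 ccq])
    fix x :: "real^3"
    have "(x $ j)\<^sup>2 \<le> (norm x)\<^sup>2" using component_le_norm_cart[of x j] by (simp add: abs_le_square_iff[symmetric])
    then have "(x $ j)\<^sup>2 * japanese x \<le> (norm x)\<^sup>2 * japanese x"
      by (intro mult_right_mono) (simp_all add: japanese_pos less_imp_le)
    then have a: "(x $ j)\<^sup>2 * japanese x \<le> 1" using japanese_pos[of x] by (simp add: norm2_japanese)
    have "(Y j x)\<^sup>2 = (cutoff R x * japanese x) * (cutoff R x * ((x $ j)\<^sup>2 * japanese x))"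
      by (simp add: Y_def power2_eq_square mult_ac)
    also have "\<dots> \<le> (cutoff R x * japanese x) * (1 * 1)"
      by (intro mult_left_mono mult_mono a cutoff_le_1 mult_nonneg_nonneg) (simp_all add: cutoff_nonneg japanese_pos less_imp_le)
    finally show "(u x * Y j x)\<^sup>2 \<le> (u x)\<^sup>2 * (cutoff R x * japanese x)"
      by (simp add: power_mult_distrib mult_left_mono)
    show "0 \<le> (u x)\<^sup>2 * (cutoff R x * japanese x)"
      by (simp add: cutoff_nonneg japanese_pos less_imp_le)
  qed
  have iB: "integrable lborel (\<lambda>x. (u x)\<^sup>2 * indicat_real (cball 0 R) x)"
    using u2 by (simp add: locally_integrable_def mult.commute)
  have pt: "(u x)\<^sup>2 * (cutoff R x * japanese x) \<le> (\<Sum>j\<in>UNIV. (u x)\<^sup>2 * Y' j x) + 6 / R\<^sup>2 * ((u x)\<^sup>2 * indicat_real (cball 0 R) x)" for x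
  proof -
    let ?q = "japanese x"
    have nq: "(norm x)\<^sup>2 * ?q = 1 - ?q" by (rule norm2_japanese)
    have s1: "(\<Sum>j\<in>UNIV. dcutoff R j x * (x $ j * ?q)) = - (6 / R\<^sup>2) * (bell R x ^ 2 * ((norm x)\<^sup>2 * ?q))"
      unfolding norm2_eq_sum sum_distrib_left sum_distrib_right
      by (rule sum.cong) (simp_all add: dcutoff_def power2_eq_square)
    have s2: "(\<Sum>j\<in>UNIV. cutoff R x * (?q + x $ j * (- (2 * x $ j) * ?q\<^sup>2))) = cutoff R x * (3 * ?q - 2 * ((norm x)\<^sup>2 * ?q) * ?q)"
    proof -
      have "(\<Sum>j\<in>UNIV. cutoff R x * (?q + x $ j * (- (2 * x $ j) * ?q\<^sup>2)))
          = cutoff R x * (\<Sum>j\<in>(UNIV::3 set). ?q + (- 2 * ?q\<^sup>2) * (x $ j)\<^sup>2)"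
        unfolding sum_distrib_left by (rule sum.cong) (simp_all add: power2_eq_square)
      also have "(\<Sum>j\<in>(UNIV::3 set). ?q + (- 2 * ?q\<^sup>2) * (x $ j)\<^sup>2) = 3 * ?q + (- 2 * ?q\<^sup>2) * (norm x)\<^sup>2"
        unfolding sum.distrib norm2_eq_sum sum_distrib_left by simp
      finally show ?thesis by (simp add: power2_eq_square mult_ac)
    qed
    have "bell R x ^ 2 * ((norm x)\<^sup>2 * ?q) \<le> indicat_real (cball 0 R) x"
    proof (cases "norm x \<le> R")
      case True
      have "bell R x ^ 2 * ((norm x)\<^sup>2 * ?q) \<le> 1 * 1"
        unfolding nq by (intro mult_mono power_le_one) (simp_all add: bell_nonneg bell_le_1 japanese_pos less_imp_le japanese_le_1)
      with True show ?thesis by simp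
    qed (simp add: bell_eq_0 R)
    then have "6 / R\<^sup>2 * (bell R x ^ 2 * ((norm x)\<^sup>2 * ?q)) \<le> 6 / R\<^sup>2 * indicat_real (cball 0 R) x"
      by (intro mult_left_mono) auto
    then have l1: "- (6 / R\<^sup>2 * indicat_real (cball 0 R) x) \<le> (\<Sum>j\<in>UNIV. dcutoff R j x * (x $ j * ?q))"
      unfolding s1 by simp
    \<comment> \<open>With |x|^2 q = 1 - q the right side is q + 2 q^2; in dimension d the first
      coefficient would be d - 2.\<close>
    have "?q \<le> 3 * ?q - 2 * ((norm x)\<^sup>2 * ?q) * ?q"
      using japanese_pos[of x] unfolding nq by (simp add: algebra_simps)
    then have l2: "cutoff R x * ?q \<le> (\<Sum>j\<in>UNIV. cutoff R x * (?q + x $ j * (- (2 * x $ j) * ?q\<^sup>2)))"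
      unfolding s2 by (intro mult_left_mono cutoff_nonneg)
    have "(\<Sum>j\<in>UNIV. Y' j x) \<ge> cutoff R x * ?q - 6 / R\<^sup>2 * indicat_real (cball 0 R) x"
      using l1 l2 by (simp add: Y'_def sum.distrib)
    then have "(u x)\<^sup>2 * (cutoff R x * ?q - 6 / R\<^sup>2 * indicat_real (cball 0 R) x) \<le> (u x)\<^sup>2 * (\<Sum>j\<in>UNIV. Y' j x)"
      by (intro mult_left_mono) auto
    moreover have "(u x)\<^sup>2 * (\<Sum>j\<in>UNIV. Y' j x) = (\<Sum>j\<in>UNIV. (u x)\<^sup>2 * Y' j x)" by (rule sum_distrib_left)
    ultimately show ?thesis by (simp add: right_diff_distrib mult_ac)
  qed
  have iY: "integrable lborel (\<lambda>x. (u x)\<^sup>2 * Y' j x)" for j by (rule integrable_mult_cc[OF u2 ccY'])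
  have "I \<le> (\<integral>x. (\<Sum>j\<in>UNIV. (u x)\<^sup>2 * Y' j x) + 6 / R\<^sup>2 * ((u x)\<^sup>2 * indicat_real (cball 0 R) x) \<partial>lborel)"
    unfolding I_def
    by (intro integral_mono integrable_mult_cc[OF u2 ccq] Bochner_Integration.integrable_add Bochner_Integration.integrable_sum integrable_mult_right iY iB pt)
  also have "\<dots> = (\<Sum>j\<in>UNIV. \<integral>x. (u x)\<^sup>2 * Y' j x \<partial>lborel) + 6 * E"
    using iY iB by (simp add: E_def)
  also have "(\<Sum>j\<in>UNIV. \<integral>x. (u x)\<^sup>2 * Y' j x \<partial>lborel) \<le> (\<Sum>j\<in>UNIV. 2 * L2_norm (g j) * sqrt I)"
  proof (rule sum_mono)
    fix j :: 3
    have "(\<integral>x. (u x)\<^sup>2 * Y' j x \<partial>lborel) \<le> 2 * L2_norm (g j) * L2_norm (\<lambda>x. u x * Y j x)"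
      using weak_pderiv_square_bound[OF u u2 g w ccY ccY' Y, of j] by linarith
    also have "\<dots> \<le> 2 * L2_norm (g j) * sqrt I"
      by (intro mult_left_mono LY) (simp add: L2_norm_nonneg)
    finally show "(\<integral>x. (u x)\<^sup>2 * Y' j x \<partial>lborel) \<le> 2 * L2_norm (g j) * sqrt I" .
  qed
  also have "(\<Sum>j\<in>UNIV. 2 * L2_norm (g j) * sqrt I) = 2 * \<Gamma> * sqrt I"
    by (simp add: \<Gamma>_def sum_distrib_left sum_distrib_right)
  finally have 1: "I \<le> 2 * \<Gamma> * sqrt I + 6 * E" by simp
  \<comment> \<open>Young's inequality, with weights that leave half of I on the left.\<close>
  have "0 \<le> (2 * \<Gamma> - sqrt I)\<^sup>2" by simp
  also have "(2 * \<Gamma> - sqrt I)\<^sup>2 = 4 * \<Gamma>\<^sup>2 + I - 2 * (2 * \<Gamma> * sqrt I)"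
    using I0 by (simp add: power2_diff power_mult_distrib)
  finally have "I \<le> 4 * \<Gamma>\<^sup>2 + 12 * E" using 1 by linarith
  then show ?thesis by (simp only: I_def \<Gamma>_def E_def)
qed

text \<open>A nonzero constant has zero gradient and an infinite left side. Integrability of the
  sixth power excludes it: this makes the error of the cut-off version vanish along integer radii,
  and Fatou's lemma does the rest.\<close>

theorem Hardy:
  fixes u :: "real^3 \<Rightarrow> real" and g :: "3 \<Rightarrow> real^3 \<Rightarrow> real"
  assumes u[measurable]: "u \<in> borel_measurable borel" and u6: "integrable lborel (\<lambda>x. (u x) ^ 6)"
    and g: "\<And>j. L2_fn (g j)" and w: "\<And>j. weak_pderiv u (axis j 1) (g j)"
  shows "(\<integral>\<^sup>+x. ennreal ((u x)\<^sup>2 * japanese x) \<partial>lborel) \<le> ennreal (4 * (\<Sum>j\<in>UNIV. L2_norm (g j))\<^sup>2)"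
proof -
  have [measurable]: "japanese \<in> borel_measurable (borel :: (real^3) measure)"
    by (rule borel_measurable_continuous_onI[OF japanese_continuous])
  have [measurable]: "cutoff (real (Suc n)) \<in> borel_measurable (borel :: (real^3) measure)" for n
    by (rule cc_fn_measurable[OF cc_fn_cutoff]) simp
  have pw: "\<bar>t\<bar> \<le> 1 + t ^ 6" "t\<^sup>2 \<le> 1 + t ^ 6" for t :: real
  proof -
    have t6: "t ^ 6 = \<bar>t\<bar> ^ 6" by simp
    show "\<bar>t\<bar> \<le> 1 + t ^ 6"
      using self_le_power[of "\<bar>t\<bar>" 6] unfolding t6 by (cases "\<bar>t\<bar> \<le> 1") (simp_all add: add_increasing2)
    show "t\<^sup>2 \<le> 1 + t ^ 6"
      using power_increasing[of 2 6 "\<bar>t\<bar>"] power_le_one[of "\<bar>t\<bar>" 2] unfolding t6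
      by (cases "\<bar>t\<bar> \<le> 1") (simp_all add: add_increasing2)
  qed
  have ul: "locally_integrable u" by (rule locally_integrable_power_bound[OF _ _ u6]) (use pw(1) in auto)
  have u2l: "locally_integrable (\<lambda>x. (u x)\<^sup>2)" by (rule locally_integrable_power_bound[OF _ _ u6]) (use pw(2) in auto)
  let ?R = "\<lambda>n. real (Suc n)"
  let ?E = "\<lambda>n. (\<integral>x. (u x)\<^sup>2 * indicat_real (cball 0 (?R n)) x \<partial>lborel) / (?R n)\<^sup>2"
  let ?C = "4 * (\<Sum>j\<in>UNIV. L2_norm (g j))\<^sup>2"
  let ?f = "\<lambda>n x. ennreal ((u x)\<^sup>2 * (cutoff (?R n) x * japanese x))"
  have le: "(\<integral>\<^sup>+x. ?f n x \<partial>lborel) \<le> ennreal (?C + 12 * ?E n)" for n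
  proof -
    have "cc_fn (\<lambda>x::real^3. cutoff (?R n) x * japanese x)"
      using cc_fn_mult[OF japanese_continuous cc_fn_cutoff[of "?R n"]] by (simp add: mult.commute)
    from integrable_mult_cc[OF u2l this]
    have "(\<integral>\<^sup>+x. ?f n x \<partial>lborel) = ennreal (\<integral>x. (u x)\<^sup>2 * (cutoff (?R n) x * japanese x) \<partial>lborel)"
      by (intro nn_integral_eq_integral AE_I2 mult_nonneg_nonneg) (simp_all add: cutoff_nonneg japanese_pos less_imp_le)
    also have "\<dots> \<le> ennreal (?C + 12 * ?E n)"
      by (intro ennreal_leI Hardy_cutoff[OF ul u2l g w]) simp
    finally show ?thesis .
  qed
  have "(\<lambda>n. ?C + 12 * ?E n) \<longlonglongrightarrow> ?C + 12 * 0"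
    by (intro tendsto_intros ball_average_tendsto_0[OF u u6])
  then have lim: "(\<lambda>n. ennreal (?C + 12 * ?E n)) \<longlonglongrightarrow> ennreal ?C"
    by (intro tendsto_ennrealI) simp
  have "(\<integral>\<^sup>+x. ennreal ((u x)\<^sup>2 * japanese x) \<partial>lborel) = (\<integral>\<^sup>+x. liminf (\<lambda>n. ?f n x) \<partial>lborel)"
  proof (rule nn_integral_cong)
    fix x :: "real^3"
    have "(\<lambda>n. ?f n x) \<longlonglongrightarrow> ennreal ((u x)\<^sup>2 * (1 * japanese x))"
      by (intro tendsto_ennrealI tendsto_intros cutoff_tendsto_1)
    from lim_imp_Liminf[OF _ this] show "ennreal ((u x)\<^sup>2 * japanese x) = liminf (\<lambda>n. ?f n x)" by simp
  qed
  also have "\<dots> \<le> liminf (\<lambda>n. \<integral>\<^sup>+x. ?f n x \<partial>lborel)"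
    by (rule nn_integral_liminf) (simp del: of_nat_Suc)
  also have "\<dots> \<le> liminf (\<lambda>n. ennreal (?C + 12 * ?E n))"
    by (intro Liminf_mono always_eventually allI le)
  also have "\<dots> = ennreal ?C" by (rule lim_imp_Liminf[OF _ lim]) simp
  finally show ?thesis .
qed

section \<open>The renormalising function\<close>

definition renorm :: "real \<Rightarrow> real" where
  "renorm s = sqrt (1 + s\<^sup>2) - 1"

definition renorm' :: "real \<Rightarrow> real" where
  "renorm' s = s / sqrt (1 + s\<^sup>2)"

definition renorm'' :: "real \<Rightarrow> real" where
  "renorm'' s = 1 / ((1 + s\<^sup>2) * sqrt (1 + s\<^sup>2))"

lemma one_plus_square_pos: "1 + s\<^sup>2 > (0::real)"
  by (simp add: add_pos_nonneg)

lemma DERIV_renorm: "(renorm has_real_derivative renorm' s) (at s)"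
  unfolding renorm_def[abs_def] renorm'_def
  using one_plus_square_pos[of s] by (auto intro!: derivative_eq_intros simp: divide_simps)

lemma DERIV_renorm': "(renorm' has_real_derivative renorm'' s) (at s)"
proof -
  let ?q = "sqrt (1 + s\<^sup>2)"
  have q: "?q > 0" "?q * ?q = 1 + s\<^sup>2" using one_plus_square_pos[of s] by (simp_all add: less_imp_le)
  have "((\<lambda>s. sqrt (1 + s\<^sup>2)) has_real_derivative s / ?q) (at s)"
    using one_plus_square_pos[of s] by (auto intro!: derivative_eq_intros simp: divide_simps)
  from DERIV_divide[OF DERIV_ident this]
  have "((\<lambda>s. s / sqrt (1 + s\<^sup>2)) has_real_derivative (1 * ?q - s * (s / ?q)) / (?q * ?q)) (at s)"
    using q(1) by simp
  moreover have "(1 * ?q - s * (s / ?q)) / (?q * ?q) = renorm'' s"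
  proof -
    have "1 * ?q - s * (s / ?q) = (?q * ?q - s * s) / ?q" using q(1) by (simp add: field_simps)
    also have "\<dots> = 1 / ?q" unfolding q(2) by (simp add: power2_eq_square)
    finally show ?thesis unfolding q(2) renorm''_def by (simp add: mult.commute)
  qed
  ultimately show ?thesis by (simp add: renorm'_def[abs_def])
qed

lemma continuous_renorm: "continuous_on UNIV renorm" "continuous_on UNIV renorm'" "continuous_on UNIV renorm''"
proof -
  show "continuous_on UNIV renorm" "continuous_on UNIV renorm'"
    using DERIV_renorm DERIV_renorm' by (auto intro!: continuous_at_imp_continuous_on DERIV_isCont)
  show "continuous_on UNIV renorm''"
    unfolding renorm''_def[abs_def] using one_plus_square_pos
    by (intro continuous_intros) (metis less_irrefl mult_eq_0_iff real_sqrt_eq_zero_cancel_iff)+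
qed

lemma renorm_measurable[measurable]:
  "renorm \<in> borel_measurable borel" "renorm' \<in> borel_measurable borel" "renorm'' \<in> borel_measurable borel"
  by (intro borel_measurable_continuous_onI continuous_renorm)+

lemma renorm''_nonneg: "renorm'' s \<ge> 0"
  using one_plus_square_pos[of s] by (simp add: renorm''_def)

lemma abs_renorm'_le: "\<bar>renorm' s\<bar> \<le> 1"
proof -
  have "\<bar>s\<bar> = sqrt (s\<^sup>2)" by simp
  also have "\<dots> \<le> sqrt (1 + s\<^sup>2)" by (rule real_sqrt_le_mono) simp
  finally show ?thesis using one_plus_square_pos[of s] by (simp add: renorm'_def)
qed

lemma renorm_nonneg: "renorm s \<ge> 0"
  by (simp add: renorm_def)

lemma renorm_0: "renorm 0 = 0"
  by (simp add: renorm_def)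

lemma renorm_eq_0: "renorm s = 0 \<longleftrightarrow> s = 0"
  by (simp add: renorm_def)

lemma renorm_lipschitz: "\<bar>renorm x - renorm y\<bar> \<le> \<bar>x - y\<bar>"
  using field_differentiable_bound[OF convex_UNIV, of renorm renorm' 1 x y] DERIV_renorm abs_renorm'_le by simp

lemma renorm_le_abs: "renorm s \<le> \<bar>s\<bar>"
  using renorm_lipschitz[of s 0] by (simp add: renorm_0)

lemma renorm_le_square: "renorm s \<le> s\<^sup>2"
proof -
  have "sqrt (1 + s\<^sup>2) \<le> 1 + s\<^sup>2"
  proof (rule real_le_lsqrt)
    have "(1 + s\<^sup>2) * 1 \<le> (1 + s\<^sup>2) * (1 + s\<^sup>2)" by (intro mult_left_mono) auto
    then show "1 + s\<^sup>2 \<le> (1 + s\<^sup>2)\<^sup>2" by (simp add: power2_eq_square)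
  qed simp_all
  then show ?thesis by (simp add: renorm_def)
qed

text \<open>Convexity, with the slope at the end point \<open>y\<close>. After multiplication by
  sqrt (1 + y^2) it is the Cauchy-Schwarz inequality for the plane vectors (1, x) and (1,
  y).\<close>

lemma renorm_tangent: "renorm y - renorm x \<le> renorm' y * (y - x)"
proof -
  let ?p = "sqrt (1 + x\<^sup>2)" and ?q = "sqrt (1 + y\<^sup>2)"
  have q: "?q > 0" "?q * ?q = 1 + y\<^sup>2" using one_plus_square_pos[of y] by (simp_all add: less_imp_le)
  have "(1 + x * y)\<^sup>2 \<le> (1 + x\<^sup>2) * (1 + y\<^sup>2)"
    using zero_le_power2[of "x - y"] by (simp add: power2_eq_square algebra_simps)
  then have "1 + x * y \<le> ?p * ?q"
    unfolding real_sqrt_mult[symmetric] by (rule real_le_rsqrt)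
  then have "?q * ?q - ?p * ?q \<le> y * (y - x)"
    unfolding q(2) by (simp add: power2_eq_square algebra_simps)
  then have "?q * (?q - ?p) \<le> y * (y - x)" by (simp add: algebra_simps)
  then have "?q - ?p \<le> y * (y - x) / ?q" using q(1) by (simp add: pos_le_divide_eq mult.commute)
  then show ?thesis by (simp add: renorm_def renorm'_def)
qed

section \<open>The commutator at a fixed time\<close>

lemma integrable_imp_locally_integrable:
  assumes "integrable lborel f"
  shows "locally_integrable f"
proof -
  have [measurable]: "f \<in> borel_measurable borel" using borel_measurable_integrable[OF assms] by simp
  show ?thesis
    by (rule locally_integrable_power_bound[OF _ _ integrable_abs[OF assms]]) auto
qed

lemma locally_integrable_mult_L2loc:
  assumes [measurable]: "f \<in> borel_measurable borel" "g \<in> borel_measurable borel"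
    and f: "locally_integrable (\<lambda>x. (f x)\<^sup>2)" and g: "locally_integrable (\<lambda>x. (g x)\<^sup>2)"
  shows "locally_integrable (\<lambda>x. f x * g x)"
  unfolding locally_integrable_def
proof (intro conjI allI)
  fix r :: real
  have i: "integrable lborel (\<lambda>x. indicat_real (cball 0 r) x * (f x)\<^sup>2 + indicat_real (cball 0 r) x * (g x)\<^sup>2)"
    using f g by (simp add: locally_integrable_def)
  have "\<bar>f x * g x\<bar> \<le> (f x)\<^sup>2 + (g x)\<^sup>2" for x
  proof -
    have "\<bar>f x * g x\<bar> \<le> 2 * \<bar>f x\<bar> * \<bar>g x\<bar>" by (simp add: abs_mult)
    also have "\<dots> \<le> \<bar>f x\<bar>\<^sup>2 + \<bar>g x\<bar>\<^sup>2" by (rule sum_squares_bound)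
    finally show ?thesis by simp
  qed
  then have le: "norm (indicat_real (cball 0 r) x * (f x * g x))
      \<le> norm (indicat_real (cball 0 r) x * (f x)\<^sup>2 + indicat_real (cball 0 r) x * (g x)\<^sup>2)" for x
    by (cases "x \<in> cball 0 r") simp_all
  have [measurable]: "cball (0::'a) r \<in> sets borel" by simp
  show "integrable lborel (\<lambda>x. indicat_real (cball 0 r) x * (f x * g x))"
    by (rule Bochner_Integration.integrable_bound[OF i _ AE_I2[OF le]]) measurable
qed simp

lemma locally_integrable_of_square:
  assumes "f \<in> borel_measurable borel" "locally_integrable (\<lambda>x. (f x)\<^sup>2)"
  shows "locally_integrable f"
  using locally_integrable_mult_L2loc[of f "\<lambda>_. 1"] assms locally_integrable_const[of 1] by simp

lemma segment_avg_linear_combination: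
  fixes g :: "'i \<Rightarrow> 'a::euclidean_space \<Rightarrow> real"
  assumes "finite I" and g: "\<And>i. i \<in> I \<Longrightarrow> locally_integrable (g i)"
  shows "AE x in lborel. segment_avg (\<lambda>x. \<Sum>i\<in>I. c i * g i x) h x = (\<Sum>i\<in>I. c i * segment_avg (g i) h x)"
proof -
  have "AE x in lborel. \<forall>i\<in>I. integrable lborel (\<lambda>s. indicat_real {0..1} s * g i (x + s *\<^sub>R h))"
    using assms by (intro AE_finite_allI AE_integrable_segment)
  then show ?thesis
  proof (rule AE_mp, intro AE_I2 impI)
    fix x assume i: "\<forall>i\<in>I. integrable lborel (\<lambda>s. indicat_real {0..1} s * g i (x + s *\<^sub>R h))"
    have "segment_avg (\<lambda>x. \<Sum>i\<in>I. c i * g i x) h x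
        = (\<integral>s. (\<Sum>j\<in>I. c j * (indicat_real {0..1} s * g j (x + s *\<^sub>R h))) \<partial>lborel)"
      unfolding segment_avg_def by (rule arg_cong[where f="integral\<^sup>L lborel"]) (simp add: fun_eq_iff sum_distrib_left mult_ac)
    also have "\<dots> = (\<Sum>j\<in>I. \<integral>s. c j * (indicat_real {0..1} s * g j (x + s *\<^sub>R h)) \<partial>lborel)"
      using i by (intro Bochner_Integration.integral_sum integrable_mult_right) auto
    also have "\<dots> = (\<Sum>i\<in>I. c i * segment_avg (g i) h x)" by (simp add: segment_avg_def)
    finally show "segment_avg (\<lambda>x. \<Sum>i\<in>I. c i * g i x) h x = (\<Sum>i\<in>I. c i * segment_avg (g i) h x)" .
  qed
qed

lemma axis_Basis: "axis j (1::real) \<in> (Basis :: (real^'n) set)"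
  by (simp add: axis_in_Basis_iff)

abbreviation pd :: "'n \<Rightarrow> (real^'n \<Rightarrow> real) \<Rightarrow> real^'n \<Rightarrow> real" where
  "pd i f \<equiv> dderiv f (axis i 1)"

text \<open>The increment is split along the axes so that each partial derivative is averaged
  separately with the scalar weight \<open>h $ j\<close>; in the commutator this weight meets the
  derivative of the mollifier.\<close>

lemma weak_pderiv_difference_coord:
  fixes u :: "real^'n \<Rightarrow> real" and g :: "'n \<Rightarrow> real^'n \<Rightarrow> real"
  assumes u: "locally_integrable u" and g: "\<And>j. locally_integrable (g j)" and w: "\<And>j. weak_pderiv u (axis j 1) (g j)"
  shows "AE x in lborel. u (x + h) - u x = (\<Sum>j\<in>UNIV. h $ j * segment_avg (g j) h x)"
proof -
  have "weak_pderiv u (\<Sum>j\<in>UNIV. h $ j *\<^sub>R axis j 1) (\<lambda>x. \<Sum>j\<in>UNIV. h $ j * g j x)"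
    by (intro weak_pderiv_sum u finite locally_integrable_cmult g weak_pderiv_cmult w)
  moreover have "(\<Sum>j\<in>UNIV. h $ j *\<^sub>R axis j 1) = h"
    by (simp add: vec_eq_iff axis_def if_distrib cong: if_cong)
  ultimately have w': "weak_pderiv u h (\<lambda>x. \<Sum>j\<in>UNIV. h $ j * g j x)" by simp
  have li: "locally_integrable (\<lambda>x. \<Sum>j\<in>UNIV. h $ j * g j x)"
  proof -
    have "locally_integrable (\<lambda>x. \<Sum>j\<in>I. h $ j * g j x)" for I
    proof (induction I rule: infinite_finite_induct)
      case (insert i I)
      then show ?case
        using locally_integrable_add[OF locally_integrable_cmult[OF g[of i], of "h $ i"] insert.IH] by simp
    qed (simp_all add: locally_integrable_const[of 0])
    then show ?thesis .
  qed
  from weak_pderiv_difference[OF u li w'] segment_avg_linear_combination[OF finite g, where c="\<lambda>j. h $ j" and h=h and I=UNIV]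
  show ?thesis by eventually_elim simp
qed

text \<open>Integration by parts. For \<rho> of total mass 1 this is what turns a first-order
  expansion of v inside the commutator into the trace of its gradient.\<close>

lemma integral_coord_pd:
  fixes \<rho> :: "real^'n \<Rightarrow> real"
  assumes \<rho>: "test_fn UNIV \<rho>"
  shows "(\<integral>h. h $ j * pd i \<rho> h \<partial>lborel) = (if i = j then - (\<integral>h. \<rho> h \<partial>lborel) else 0)"
    and "cc_fn (\<lambda>h. h $ j * pd i \<rho> h)"
proof -
  note cc = test_fn_cc[OF \<rho>] and cc' = test_fn_dderiv_cc[OF \<rho>]
  show c1: "cc_fn (\<lambda>h. h $ j * pd i \<rho> h)"
    by (intro cc_fn_mult cc' continuous_intros)
  have c0: "cc_fn (\<lambda>h. h $ j * \<rho> h)" by (intro cc_fn_mult cc continuous_intros)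
  have c2: "cc_fn (\<lambda>h. (if j = i then 1 else 0) * \<rho> h)" by (intro cc_fn_mult cc continuous_intros)
  have "(\<integral>h. (if j = i then 1 else 0) * \<rho> h + h $ j * pd i \<rho> h \<partial>lborel) = 0"
    by (rule integral_pderiv_eq_0[OF c0 cc_fn_add[OF c2 c1] has_pderiv_mult[OF has_pderiv_coord smooth_fn_has_pderiv[OF test_fn_smooth[OF \<rho>]]]])
  then have "(\<integral>h. (if j = i then 1 else 0) * \<rho> h \<partial>lborel) + (\<integral>h. h $ j * pd i \<rho> h \<partial>lborel) = 0"
    by (subst (asm) Bochner_Integration.integral_add) (use integrable_cc c1 c2 in blast)+
  then show "(\<integral>h. h $ j * pd i \<rho> h \<partial>lborel) = (if i = j then - (\<integral>h. \<rho> h \<partial>lborel) else 0)"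
    by (auto split: if_splits)
qed

text \<open>The derivatives of \<open>\<rho>\<close> differentiate the convolutions: the first
  summand is v . grad of the mollified a, in non-divergence form, and the second is the divergence
  of the mollified product a v.\<close>

definition commutator :: "(real^'n \<Rightarrow> real) \<Rightarrow> (real^'n \<Rightarrow> real) \<Rightarrow> ('n \<Rightarrow> real^'n \<Rightarrow> real) \<Rightarrow> real^'n \<Rightarrow> real" where
  "commutator \<rho> a v x = (\<Sum>i\<in>UNIV. v i x * conv a (pd i \<rho>) x - conv (\<lambda>y. a y * v i y) (pd i \<rho>) x)"

lemma conv_reflect:
  assumes f: "locally_integrable f" and \<rho>: "cc_fn \<rho>"
  shows "conv f \<rho> x = (\<integral>h. f (x - h) * \<rho> h \<partial>lborel)" "integrable lborel (\<lambda>h. f (x - h) * \<rho> h)"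
proof -
  have [measurable]: "f \<in> borel_measurable borel" "\<rho> \<in> borel_measurable borel"
    using locally_integrable_measurable[OF f] cc_fn_measurable[OF \<rho>] by auto
  show "conv f \<rho> x = (\<integral>h. f (x - h) * \<rho> h \<partial>lborel)"
    using integral_reflect[of "\<lambda>h. f (x - h) * \<rho> h" x] by (simp add: conv_def)
  show "integrable lborel (\<lambda>h. f (x - h) * \<rho> h)"
    using integrable_reflect[of "\<lambda>h. f (x - h) * \<rho> h" x] integrable_mult_cc[OF f cc_fn_reflect[OF \<rho>, of x]] by simp
qed

lemma ennreal_abs_integral_le: "ennreal \<bar>\<integral>h. f h \<partial>M\<bar> \<le> (\<integral>\<^sup>+h. ennreal \<bar>f h\<bar> \<partial>M)" for f :: "'a \<Rightarrow> real"
proof (cases "integrable M f")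
  case True
  from integral_norm_bound_ennreal[OF True] show ?thesis by simp
qed (simp add: not_integrable_integral_eq)

text \<open>Boundedness would not be enough; the limit has to be 0. Therefore a(x) times the
  first-order Taylor term of v is subtracted from the integrand. Its integral against the
  derivatives of \<open>\<rho>\<close> is, up to sign, a(x) times the trace of the gradient, which
  is 0 by \<open>tr\<close>. The remaining integrand compares a(x - h) times the averaged gradient
  with the value of this product at h = 0.\<close>

lemma commutator_bound:
  fixes a :: "real^'n \<Rightarrow> real" and v :: "'n \<Rightarrow> real^'n \<Rightarrow> real" and G :: "'n \<Rightarrow> 'n \<Rightarrow> real^'n \<Rightarrow> real"
  assumes a: "L2_fn a" and v[measurable]: "\<And>i. v i \<in> borel_measurable borel"
    and v2: "\<And>i. locally_integrable (\<lambda>x. (v i x)\<^sup>2)"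
    and G: "\<And>i j. L2_fn (G i j)" and w: "\<And>i j. weak_pderiv (v i) (axis j 1) (G i j)"
    and tr: "AE x in lborel. (\<Sum>i\<in>UNIV. G i i x) = 0"
    and \<rho>: "test_fn UNIV \<rho>" and \<rho>1: "(\<integral>x. \<rho> x \<partial>lborel) = 1"
  shows "(\<integral>\<^sup>+x. ennreal \<bar>commutator \<rho> a v x\<bar> \<partial>lborel) \<le>
    (\<integral>\<^sup>+h. (\<Sum>i\<in>UNIV. \<Sum>j\<in>UNIV. ennreal \<bar>h $ j * pd i \<rho> h\<bar> *
       (\<integral>\<^sup>+x. ennreal \<bar>a (x - h) * segment_avg (G i j) (- h) x - a x * G i j x\<bar> \<partial>lborel)) \<partial>lborel)"
proof -
  have [measurable]: "a \<in> borel_measurable borel" by (rule L2_fn_measurable[OF a])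
  have [measurable]: "G i j \<in> borel_measurable borel" for i j by (rule L2_fn_measurable[OF G])
  have cc: "cc_fn (pd i \<rho>)" for i by (rule test_fn_dderiv_cc[OF \<rho>])
  have [measurable]: "pd i \<rho> \<in> borel_measurable borel" for i by (rule cc_fn_measurable[OF cc])
  have vl: "locally_integrable (v i)" for i by (rule locally_integrable_of_square[OF v v2])
  have a2: "locally_integrable (\<lambda>x. (a x)\<^sup>2)"
    by (rule integrable_imp_locally_integrable[OF L2_fn_integrable[OF a]])
  have al: "locally_integrable a" by (rule L2_fn_locally_integrable[OF a])
  have avl: "locally_integrable (\<lambda>y. a y * v i y)" for i
    by (rule locally_integrable_mult_L2loc[OF _ _ a2 v2]) auto
  define K where "K h x = (\<Sum>i\<in>UNIV. pd i \<rho> h * (a (x - h) * (v i x - v i (x - h)) - a x * (\<Sum>j\<in>UNIV. h $ j * G i j x)))" for h x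
  have ae: "AE x in lborel. commutator \<rho> a v x = (\<integral>h. K h x \<partial>lborel)"
    using tr
  proof eventually_elim
    fix x assume tr0: "(\<Sum>i\<in>UNIV. G i i x) = 0"
    note i1 = conv_reflect[OF al cc, where x=x] and i2 = conv_reflect[OF avl cc, where x=x]
    note i3 = integrable_cc[OF integral_coord_pd(2)[OF \<rho>]]
    have K: "K h x = (\<Sum>i\<in>UNIV. v i x * (a (x - h) * pd i \<rho> h) - a (x - h) * v i (x - h) * pd i \<rho> h)
        - (\<Sum>i\<in>UNIV. \<Sum>j\<in>UNIV. a x * G i j x * (h $ j * pd i \<rho> h))" for h
      unfolding K_def sum_subtractf[symmetric]
      by (rule sum.cong) (simp_all add: algebra_simps sum_distrib_left)
    have "(\<integral>h. K h x \<partial>lborel) =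
      (\<Sum>i\<in>UNIV. v i x * (\<integral>h. a (x - h) * pd i \<rho> h \<partial>lborel) - (\<integral>h. a (x - h) * v i (x - h) * pd i \<rho> h \<partial>lborel))
        - (\<Sum>i\<in>UNIV. \<Sum>j\<in>UNIV. a x * G i j x * (\<integral>h. h $ j * pd i \<rho> h \<partial>lborel))"
      unfolding K using i1(2) i2(2) i3 by simp
    also have "(\<Sum>i\<in>UNIV. \<Sum>j\<in>UNIV. a x * G i j x * (\<integral>h. h $ j * pd i \<rho> h \<partial>lborel)) = - a x * (\<Sum>i\<in>UNIV. G i i x)"
      by (simp add: integral_coord_pd(1)[OF \<rho>] \<rho>1 sum_distrib_left if_distrib sum_negf cong: if_cong)
    finally show "commutator \<rho> a v x = (\<integral>h. K h x \<partial>lborel)"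
      by (simp add: tr0 commutator_def i1(1) i2(1))
  qed
  have [measurable]: "(\<lambda>h::real^'n. h $ j) \<in> borel_measurable borel" for j
    by (intro borel_measurable_continuous_onI continuous_intros)
  have Km: "(\<lambda>(x, h). ennreal \<bar>K h x\<bar>) \<in> borel_measurable (lborel \<Otimes>\<^sub>M lborel)"
    unfolding K_def case_prod_beta' by measurable
  have "(\<integral>\<^sup>+x. ennreal \<bar>commutator \<rho> a v x\<bar> \<partial>lborel) = (\<integral>\<^sup>+x. ennreal \<bar>\<integral>h. K h x \<partial>lborel\<bar> \<partial>lborel)"
    by (rule nn_integral_cong_AE, rule AE_mp[OF ae], intro AE_I2 impI) simp
  also have "\<dots> \<le> (\<integral>\<^sup>+x. \<integral>\<^sup>+h. ennreal \<bar>K h x\<bar> \<partial>lborel \<partial>lborel)"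
    by (intro nn_integral_mono ennreal_abs_integral_le)
  \<comment> \<open>The difference formula for v holds for almost every x with h fixed, so h has to
    become the outer variable.\<close>
  also have "\<dots> = (\<integral>\<^sup>+h. \<integral>\<^sup>+x. ennreal \<bar>K h x\<bar> \<partial>lborel \<partial>lborel)"
    by (rule lborel_pair.Fubini'[OF Km, symmetric])
  also have "\<dots> \<le> (\<integral>\<^sup>+h. (\<Sum>i\<in>UNIV. \<Sum>j\<in>UNIV. ennreal \<bar>h $ j * pd i \<rho> h\<bar> *
       (\<integral>\<^sup>+x. ennreal \<bar>a (x - h) * segment_avg (G i j) (- h) x - a x * G i j x\<bar> \<partial>lborel)) \<partial>lborel)"
  proof (rule nn_integral_mono)
    fix h :: "real^'n"
    let ?\<Theta> = "\<lambda>i j x. a (x - h) * segment_avg (G i j) (- h) x - a x * G i j x"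
    have "AE x in lborel. \<forall>i\<in>UNIV. v i (x + (- h)) - v i x = (\<Sum>j\<in>UNIV. (- h) $ j * segment_avg (G i j) (- h) x)"
      by (intro AE_finite_allI finite weak_pderiv_difference_coord vl w L2_fn_locally_integrable[OF G])
    then have "AE x in lborel. ennreal \<bar>K h x\<bar> \<le> (\<Sum>i\<in>UNIV. \<Sum>j\<in>UNIV. ennreal \<bar>h $ j * pd i \<rho> h\<bar> * ennreal \<bar>?\<Theta> i j x\<bar>)"
    proof eventually_elim
      fix x assume *: "\<forall>i\<in>UNIV. v i (x + (- h)) - v i x = (\<Sum>j\<in>UNIV. (- h) $ j * segment_avg (G i j) (- h) x)"
      have d: "v i x - v i (x - h) = (\<Sum>j\<in>UNIV. h $ j * segment_avg (G i j) (- h) x)" for i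
        using *[rule_format, of i] by (simp add: sum_negf)
      have "K h x = (\<Sum>i\<in>UNIV. \<Sum>j\<in>UNIV. (h $ j * pd i \<rho> h) * ?\<Theta> i j x)"
        unfolding K_def d
        by (rule sum.cong) (simp_all add: sum_distrib_left sum_subtractf right_diff_distrib mult_ac)
      then have "\<bar>K h x\<bar> \<le> (\<Sum>i\<in>UNIV. \<Sum>j\<in>UNIV. \<bar>h $ j * pd i \<rho> h\<bar> * \<bar>?\<Theta> i j x\<bar>)"
        by (simp only: abs_mult[symmetric]) (intro order_trans[OF sum_abs] sum_mono sum_abs)
      then have "ennreal \<bar>K h x\<bar> \<le> ennreal (\<Sum>i\<in>UNIV. \<Sum>j\<in>UNIV. \<bar>h $ j * pd i \<rho> h\<bar> * \<bar>?\<Theta> i j x\<bar>)"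
        by (rule ennreal_leI)
      also have "\<dots> = (\<Sum>i\<in>UNIV. \<Sum>j\<in>UNIV. ennreal \<bar>h $ j * pd i \<rho> h\<bar> * ennreal \<bar>?\<Theta> i j x\<bar>)"
        by (simp add: sum_nonneg ennreal_mult flip: sum_ennreal)
      finally show "ennreal \<bar>K h x\<bar> \<le> (\<Sum>i\<in>UNIV. \<Sum>j\<in>UNIV. ennreal \<bar>h $ j * pd i \<rho> h\<bar> * ennreal \<bar>?\<Theta> i j x\<bar>)" .
    qed
    then have "(\<integral>\<^sup>+x. ennreal \<bar>K h x\<bar> \<partial>lborel) \<le> (\<integral>\<^sup>+x. (\<Sum>i\<in>UNIV. \<Sum>j\<in>UNIV. ennreal \<bar>h $ j * pd i \<rho> h\<bar> * ennreal \<bar>?\<Theta> i j x\<bar>) \<partial>lborel)"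
      by (rule nn_integral_mono_AE)
    also have "\<dots> = (\<Sum>i\<in>UNIV. \<Sum>j\<in>UNIV. ennreal \<bar>h $ j * pd i \<rho> h\<bar> * (\<integral>\<^sup>+x. ennreal \<bar>?\<Theta> i j x\<bar> \<partial>lborel))"
      by (simp add: nn_integral_sum nn_integral_cmult)
    finally show "(\<integral>\<^sup>+x. ennreal \<bar>K h x\<bar> \<partial>lborel) \<le> \<dots>" .
  qed
  finally show ?thesis .
qed

section \<open>The renormalised inequality at a fixed time\<close>

text \<open>The left side is the spatial part of the mollified equation, multiplied by
  \<open>renorm'\<close> of the mollified function and by the cut-off. Written with the commutator,
  it splits into diffusion, transport and error: diffusion loses a nonnegative term with
  \<open>renorm''\<close>, transport is integrated by parts using that v has no divergence, and the
  commutator is multiplied by at most 1 in modulus.\<close>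

lemma slice_inequality:
  fixes a :: "real^'n \<Rightarrow> real" and v :: "'n \<Rightarrow> real^'n \<Rightarrow> real" and G :: "'n \<Rightarrow> 'n \<Rightarrow> real^'n \<Rightarrow> real"
  assumes a: "L2_fn a" and v[measurable]: "\<And>i. v i \<in> borel_measurable borel"
    and v2: "\<And>i. locally_integrable (\<lambda>x. (v i x)\<^sup>2)"
    and G: "\<And>i j. L2_fn (G i j)" and w: "\<And>i j. weak_pderiv (v i) (axis j 1) (G i j)"
    and tr: "AE x in lborel. (\<Sum>i\<in>UNIV. G i i x) = 0"
    and \<rho>: "test_fn UNIV \<rho>" and R: "R > 0"
    and fin: "(\<integral>\<^sup>+x. ennreal \<bar>commutator \<rho> a v x\<bar> \<partial>lborel) < \<infinity>"
  shows "(\<integral>x. renorm' (conv a \<rho> x) * cutoff R x *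
      (\<Sum>i\<in>UNIV. conv a (pd i (pd i \<rho>)) x - conv (\<lambda>y. a y * v i y) (pd i \<rho>) x) \<partial>lborel)
    \<le> (\<integral>x. renorm (conv a \<rho> x) * (\<Sum>i\<in>UNIV. ddcutoff R i x + v i x * dcutoff R i x) \<partial>lborel)
      + enn2real (\<integral>\<^sup>+x. ennreal \<bar>commutator \<rho> a v x\<bar> \<partial>lborel)"
proof -
  have [measurable]: "a \<in> borel_measurable borel" by (rule L2_fn_measurable[OF a])
  have \<rho>': "test_fn UNIV (pd i \<rho>)" for i by (rule test_fn_dderiv[OF \<rho> axis_Basis])
  have cc: "cc_fn \<rho>" "cc_fn (pd i \<rho>)" "cc_fn (pd i (pd i \<rho>))" for i
    by (rule test_fn_cc[OF \<rho>] test_fn_dderiv_cc[OF \<rho>] test_fn_dderiv_cc[OF \<rho>'])+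
  have vl: "locally_integrable (v i)" for i by (rule locally_integrable_of_square[OF v v2])
  have a2: "locally_integrable (\<lambda>x. (a x)\<^sup>2)"
    by (rule integrable_imp_locally_integrable[OF L2_fn_integrable[OF a]])
  have al: "locally_integrable a" by (rule L2_fn_locally_integrable[OF a])
  have avl: "locally_integrable (\<lambda>y. a y * v i y)" for i
    by (rule locally_integrable_mult_L2loc[OF _ _ a2 v2]) auto
  define W where "W = conv a \<rho>"
  define W1 where "W1 i = conv a (pd i \<rho>)" for i
  define W2 where "W2 i = conv a (pd i (pd i \<rho>))" for i
  define V where "V i = conv (\<lambda>y. a y * v i y) (pd i \<rho>)" for i
  have cW: "continuous_on UNIV W" "continuous_on UNIV (W1 i)" "continuous_on UNIV (W2 i)" "continuous_on UNIV (V i)" for i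
    unfolding W_def W1_def W2_def V_def by (intro conv_continuous al avl cc)+
  have dW: "has_pderiv W (axis i 1) (W1 i)" "has_pderiv (W1 i) (axis i 1) (W2 i)" for i
    unfolding W_def W1_def W2_def
    by (intro conv_has_pderiv al cc smooth_fn_has_pderiv test_fn_smooth[OF \<rho>] test_fn_smooth[OF \<rho>'])+
  have cr: "continuous_on UNIV (\<lambda>x. renorm (W x))" "continuous_on UNIV (\<lambda>x. renorm' (W x))" "continuous_on UNIV (\<lambda>x. renorm'' (W x))"
    by (intro continuous_on_compose2[OF continuous_renorm(1) cW(1)] continuous_on_compose2[OF continuous_renorm(2) cW(1)]
        continuous_on_compose2[OF continuous_renorm(3) cW(1)] subset_UNIV)+
  have dr: "has_pderiv (\<lambda>x. renorm (W x)) (axis i 1) (\<lambda>x. renorm' (W x) * W1 i x)"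
    "has_pderiv (\<lambda>x. renorm' (W x)) (axis i 1) (\<lambda>x. renorm'' (W x) * W1 i x)" for i
    by (intro has_pderiv_compose DERIV_renorm DERIV_renorm' dW)+
  note cb = cc_fn_cutoff[OF R] cc_fn_dcutoff[OF R] cc_fn_ddcutoff[OF R]
  have ccprod: "cc_fn (\<lambda>x. f x * cutoff R x)" "cc_fn (\<lambda>x. f x * dcutoff R i x)" "cc_fn (\<lambda>x. f x * ddcutoff R i x)"
    if "continuous_on UNIV f" for f i
    by (intro cc_fn_mult that cb)+
  have T1: "(\<integral>x. renorm' (W x) * W2 i x * cutoff R x \<partial>lborel) \<le> (\<integral>x. renorm (W x) * ddcutoff R i x \<partial>lborel)" for i
  proof -
    \<comment> \<open>In the derivative of this combination the mixed terms
      \<open>renorm' (W x) * W1 i x * dcutoff R i x\<close> cancel, so that one integration moves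
      both derivatives from W to the cut-off.\<close>
    let ?Q = "\<lambda>x. renorm' (W x) * W1 i x * cutoff R x + (- 1) * (renorm (W x) * dcutoff R i x)"
    have d: "has_pderiv ?Q (axis i 1) (\<lambda>x. ((renorm'' (W x) * W1 i x * W1 i x + renorm' (W x) * W2 i x) * cutoff R x
        + renorm' (W x) * W1 i x * dcutoff R i x)
        + (0 * (renorm (W x) * dcutoff R i x) + (- 1) * (renorm' (W x) * W1 i x * dcutoff R i x + renorm (W x) * ddcutoff R i x)))"
      by (intro has_pderiv_add has_pderiv_mult has_pderiv_const dr dW has_pderiv_cutoff has_pderiv_dcutoff)
    let ?P1 = "\<lambda>x. renorm' (W x) * W2 i x * cutoff R x" and ?P2 = "\<lambda>x. renorm'' (W x) * W1 i x * W1 i x * cutoff R x"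
      and ?P3 = "\<lambda>x. renorm (W x) * ddcutoff R i x"
    have eq: "(\<lambda>x. ((renorm'' (W x) * W1 i x * W1 i x + renorm' (W x) * W2 i x) * cutoff R x
        + renorm' (W x) * W1 i x * dcutoff R i x)
        + (0 * (renorm (W x) * dcutoff R i x) + (- 1) * (renorm' (W x) * W1 i x * dcutoff R i x + renorm (W x) * ddcutoff R i x)))
       = (\<lambda>x. ?P1 x + ?P2 x + - ?P3 x)"
      by (simp add: fun_eq_iff algebra_simps)
    have cP: "cc_fn ?P1" "cc_fn ?P2" "cc_fn ?P3"
      by (intro ccprod continuous_intros cr cW)+
    have cQ: "cc_fn ?Q"
    proof -
      have "cc_fn (\<lambda>x. renorm' (W x) * W1 i x * cutoff R x + - (renorm (W x) * dcutoff R i x))"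
        by (intro cc_fn_add cc_fn_minus ccprod continuous_intros cr cW)
      then show ?thesis by simp
    qed
    have "(\<integral>x. ?P1 x + ?P2 x + - ?P3 x \<partial>lborel) = 0"
      by (rule integral_pderiv_eq_0[OF cQ _ d[unfolded eq]]) (intro cc_fn_add cc_fn_minus cP)
    then have "(\<integral>x. ?P1 x \<partial>lborel) + (\<integral>x. ?P2 x \<partial>lborel) - (\<integral>x. ?P3 x \<partial>lborel) = 0"
      using cP[THEN integrable_cc] by simp
    moreover have "(\<integral>x. ?P2 x \<partial>lborel) \<ge> 0"
    proof (intro integral_nonneg_AE AE_I2)
      fix x
      have "0 \<le> renorm'' (W x) * (cutoff R x * (W1 i x)\<^sup>2)" by (simp add: renorm''_nonneg cutoff_nonneg)
      then show "0 \<le> ?P2 x" by (simp add: power2_eq_square mult_ac)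
    qed
    ultimately show ?thesis by simp
  qed
  \<comment> \<open>Each single i leaves a remainder with \<open>G i i\<close>; only the sum over i
    is free of it, since only the trace vanishes.\<close>
  have T2: "(\<Sum>i\<in>UNIV. \<integral>x. v i x * (renorm' (W x) * W1 i x * cutoff R x) \<partial>lborel)
      = - (\<Sum>i\<in>UNIV. \<integral>x. v i x * (renorm (W x) * dcutoff R i x) \<partial>lborel)"
  proof -
    let ?\<Psi> = "\<lambda>x. renorm (W x) * cutoff R x"
    have c\<Psi>: "cc_fn ?\<Psi>" by (intro ccprod cr)
    have c1: "cc_fn (\<lambda>x. renorm' (W x) * W1 i x * cutoff R x)" "cc_fn (\<lambda>x. renorm (W x) * dcutoff R i x)" for i
      by (intro ccprod continuous_intros cr cW)+
    have "(\<integral>x. v i x * (renorm' (W x) * W1 i x * cutoff R x) \<partial>lborel) + (\<integral>x. v i x * (renorm (W x) * dcutoff R i x) \<partial>lborel)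
        = - (\<integral>x. G i i x * ?\<Psi> x \<partial>lborel)" for i
    proof -
      have "(\<integral>x. v i x * (renorm' (W x) * W1 i x * cutoff R x + renorm (W x) * dcutoff R i x) \<partial>lborel) = - (\<integral>x. G i i x * ?\<Psi> x \<partial>lborel)"
        by (intro weak_pderiv_integral[OF vl L2_fn_locally_integrable[OF G] w c\<Psi>] cc_fn_add c1 has_pderiv_mult dr has_pderiv_cutoff)
      then show ?thesis
        using integrable_mult_cc[OF vl c1(1)] integrable_mult_cc[OF vl c1(2)] by (simp add: distrib_left)
    qed
    then have "(\<Sum>i\<in>UNIV. (\<integral>x. v i x * (renorm' (W x) * W1 i x * cutoff R x) \<partial>lborel) + (\<integral>x. v i x * (renorm (W x) * dcutoff R i x) \<partial>lborel))
        = - (\<Sum>i\<in>UNIV. \<integral>x. G i i x * ?\<Psi> x \<partial>lborel)"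
      by (simp add: sum_negf)
    also have "(\<Sum>i\<in>UNIV. \<integral>x. G i i x * ?\<Psi> x \<partial>lborel) = (\<integral>x. (\<Sum>i\<in>UNIV. G i i x * ?\<Psi> x) \<partial>lborel)"
      by (intro Bochner_Integration.integral_sum[symmetric] integrable_mult_cc[OF L2_fn_locally_integrable[OF G] c\<Psi>])
    also have "\<dots> = (\<integral>x. 0 \<partial>(lborel :: (real^'n) measure))"
    proof (rule integral_cong_AE)
      have [measurable]: "G i i \<in> borel_measurable borel" for i by (rule L2_fn_measurable[OF G])
      have [measurable]: "?\<Psi> \<in> borel_measurable borel" by (rule cc_fn_measurable[OF c\<Psi>])
      show "(\<lambda>x. \<Sum>i\<in>UNIV. G i i x * ?\<Psi> x) \<in> borel_measurable lborel" by measurable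
      show "AE x in lborel. (\<Sum>i\<in>UNIV. G i i x * ?\<Psi> x) = 0"
        using tr by eventually_elim (simp flip: sum_distrib_right)
    qed simp
    finally show ?thesis by (simp add: sum.distrib)
  qed
  have comm: "commutator \<rho> a v x = (\<Sum>i\<in>UNIV. v i x * W1 i x - V i x)" for x
    by (simp add: commutator_def W1_def V_def)
  have [measurable]: "W \<in> borel_measurable borel" "W1 i \<in> borel_measurable borel" "V i \<in> borel_measurable borel" for i
    by (intro borel_measurable_continuous_onI cW)+
  have cm[measurable]: "commutator \<rho> a v \<in> borel_measurable borel"
    unfolding comm[abs_def] by measurable
  have ci: "integrable lborel (commutator \<rho> a v)"
    using fin by (simp add: integrable_iff_bounded)
  have cn: "enn2real (\<integral>\<^sup>+x. ennreal \<bar>commutator \<rho> a v x\<bar> \<partial>lborel) = (\<integral>x. \<bar>commutator \<rho> a v x\<bar> \<partial>lborel)"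
    by (subst integral_eq_nn_integral) auto
  have [measurable]: "cutoff R \<in> borel_measurable (borel :: (real^'n) measure)" by (rule cc_fn_measurable[OF cb(1)])
  have wle: "\<bar>renorm' (W x) * cutoff R x\<bar> \<le> 1" for x
    using mult_mono[OF abs_renorm'_le[of "W x"] cutoff_le_1[of R x]] by (simp add: abs_mult cutoff_nonneg)
  have ci': "integrable lborel (\<lambda>x. renorm' (W x) * cutoff R x * commutator \<rho> a v x)"
  proof (rule Bochner_Integration.integrable_bound[OF ci _ AE_I2])
    show "norm (renorm' (W x) * cutoff R x * commutator \<rho> a v x) \<le> norm (commutator \<rho> a v x)" for x
      using mult_right_mono[OF wle[of x], of "\<bar>commutator \<rho> a v x\<bar>"] by (simp add: abs_mult)
  qed measurable
  have T3: "(\<integral>x. renorm' (W x) * cutoff R x * commutator \<rho> a v x \<partial>lborel) \<le> (\<integral>x. \<bar>commutator \<rho> a v x\<bar> \<partial>lborel)"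
  proof (rule integral_mono[OF ci' integrable_abs[OF ci]])
    fix x
    have "renorm' (W x) * cutoff R x * commutator \<rho> a v x \<le> \<bar>renorm' (W x) * cutoff R x\<bar> * \<bar>commutator \<rho> a v x\<bar>"
      by (metis abs_ge_self abs_mult)
    also have "\<dots> \<le> 1 * \<bar>commutator \<rho> a v x\<bar>" by (intro mult_right_mono wle) simp
    finally show "renorm' (W x) * cutoff R x * commutator \<rho> a v x \<le> \<bar>commutator \<rho> a v x\<bar>" by simp
  qed
  have iA: "integrable lborel (\<lambda>x. renorm' (W x) * W2 i x * cutoff R x)" for i
    by (intro integrable_cc ccprod continuous_intros cr cW)
  have iB: "integrable lborel (\<lambda>x. v i x * (renorm' (W x) * W1 i x * cutoff R x))" for i
    by (intro integrable_mult_cc[OF vl] ccprod continuous_intros cr cW)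
  have iD: "integrable lborel (\<lambda>x. renorm (W x) * ddcutoff R i x)" for i
    by (intro integrable_cc ccprod cr)
  have iE: "integrable lborel (\<lambda>x. v i x * (renorm (W x) * dcutoff R i x))" for i
    by (intro integrable_mult_cc[OF vl] ccprod cr)
  have "(\<integral>x. renorm' (W x) * cutoff R x * (\<Sum>i\<in>UNIV. W2 i x - V i x) \<partial>lborel)
     = (\<integral>x. (\<Sum>i\<in>UNIV. renorm' (W x) * W2 i x * cutoff R x) - (\<Sum>i\<in>UNIV. v i x * (renorm' (W x) * W1 i x * cutoff R x))
       + renorm' (W x) * cutoff R x * commutator \<rho> a v x \<partial>lborel)"
    by (rule arg_cong[where f="integral\<^sup>L lborel"])
       (simp add: comm fun_eq_iff sum_distrib_left sum_subtractf right_diff_distrib mult_ac)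
  also have "\<dots> = (\<Sum>i\<in>UNIV. \<integral>x. renorm' (W x) * W2 i x * cutoff R x \<partial>lborel)
     - (\<Sum>i\<in>UNIV. \<integral>x. v i x * (renorm' (W x) * W1 i x * cutoff R x) \<partial>lborel)
     + (\<integral>x. renorm' (W x) * cutoff R x * commutator \<rho> a v x \<partial>lborel)"
    using iA iB ci' by simp
  also have "\<dots> \<le> (\<Sum>i\<in>UNIV. \<integral>x. renorm (W x) * ddcutoff R i x \<partial>lborel)
     + (\<Sum>i\<in>UNIV. \<integral>x. v i x * (renorm (W x) * dcutoff R i x) \<partial>lborel) + (\<integral>x. \<bar>commutator \<rho> a v x\<bar> \<partial>lborel)"
  proof -
    have "(\<Sum>i\<in>UNIV. \<integral>x. renorm' (W x) * W2 i x * cutoff R x \<partial>lborel) \<le> (\<Sum>i\<in>UNIV. \<integral>x. renorm (W x) * ddcutoff R i x \<partial>lborel)"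
      by (intro sum_mono T1)
    then show ?thesis unfolding T2 using T3 by linarith
  qed
  also have "(\<Sum>i\<in>UNIV. \<integral>x. renorm (W x) * ddcutoff R i x \<partial>lborel)
     + (\<Sum>i\<in>UNIV. \<integral>x. v i x * (renorm (W x) * dcutoff R i x) \<partial>lborel)
     = (\<integral>x. (\<Sum>i\<in>UNIV. renorm (W x) * ddcutoff R i x) + (\<Sum>i\<in>UNIV. v i x * (renorm (W x) * dcutoff R i x)) \<partial>lborel)"
    using iD iE by simp
  also have "\<dots> = (\<integral>x. renorm (W x) * (\<Sum>i\<in>UNIV. ddcutoff R i x + v i x * dcutoff R i x) \<partial>lborel)"
    by (rule arg_cong[where f="integral\<^sup>L lborel"])
       (simp add: fun_eq_iff sum_distrib_left sum.distrib distrib_left mult_ac)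
  finally show ?thesis unfolding cn by (simp add: W_def W2_def V_def)
qed

section \<open>Evolution in time\<close>

lemma abs_mult_le_right: "\<bar>x\<bar> \<le> 1 \<Longrightarrow> \<bar>x * y\<bar> \<le> \<bar>y\<bar>" for x y :: real
  unfolding abs_mult by (rule mult_left_le_one_le) auto

text \<open>Nothing is known about \<open>f\<close> outside the window \<open>A\<close>, not even
  measurability; the integrand on the smaller window is therefore written as a bounded factor times
  \<open>f\<close> cut off to \<open>A\<close>.\<close>

lemma integrable_restrict:
  fixes f :: "'a::euclidean_space \<Rightarrow> real"
  assumes f: "integrable lborel (\<lambda>s. indicat_real A s * f s)" and B: "B \<in> sets borel" "B \<subseteq> A"
    and g[measurable]: "g \<in> borel_measurable borel" "\<And>x. \<bar>g x\<bar> \<le> 1"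
  shows "integrable lborel (\<lambda>s. indicat_real B s * (g s * f s))"
proof -
  have eq: "indicat_real B s * (g s * f s) = (indicat_real B s * g s) * (indicat_real A s * f s)" for s
    using B(2) by (auto simp: indicator_def)
  have "norm ((indicat_real B s * g s) * (indicat_real A s * f s)) \<le> norm (indicat_real A s * f s)" for s
    unfolding norm_mult using g(2)[of s] by (intro mult_left_le_one_le) (auto simp: indicator_def)
  then have "integrable lborel (\<lambda>s. (indicat_real B s * g s) * (indicat_real A s * f s))"
  proof (intro Bochner_Integration.integrable_bound[OF f] AE_I2)
    have "(\<lambda>s. indicat_real B s * g s) \<in> borel_measurable lborel" using B(1) by simp
    from borel_measurable_times[OF this borel_measurable_integrable[OF f]]
    show "(\<lambda>s. (indicat_real B s * g s) * (indicat_real A s * f s)) \<in> borel_measurable lborel" .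
  qed simp
  then show ?thesis by (simp only: eq)
qed

text \<open>Convexity makes the chain rule for the absolutely continuous \<open>u\<close> an inequality that survives
  the passage from a partition of \<open>{0..t}\<close> to the limit; evaluating \<open>renorm'\<close> at right end points gives its direction.\<close>

lemma renorm_chain_inequality:
  fixes u f :: "real \<Rightarrow> real"
  assumes u: "continuous_on UNIV u"
    and f: "integrable lborel (\<lambda>s. indicat_real {0<..T} s * f s)"
    and rep: "\<And>t. 0 \<le> t \<Longrightarrow> t \<le> T \<Longrightarrow> u t = (\<integral>s. indicat_real {0<..t} s * f s \<partial>lborel)"
    and t: "0 \<le> t" "t \<le> T"
  shows "renorm (u t) \<le> (\<integral>s. indicat_real {0<..t} s * (renorm' (u s) * f s) \<partial>lborel)"
proof (cases "t = 0")
  case True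
  then show ?thesis using rep[of 0] t by (simp add: renorm_0)
next
  case False
  with t have tp: "t > 0" by simp
  have [measurable]: "u \<in> borel_measurable borel" by (rule borel_measurable_continuous_onI[OF u])
  \<comment> \<open>Rounds s up to the next node of the partition of {0..t} into n equal parts, so
    that a single integrand evaluates \<open>renorm'\<close> at all right end points.\<close>
  define e where "e n s = t * of_int \<lceil>s * real n / t\<rceil> / real n" for n :: nat and s :: real
  have [measurable]: "e n \<in> borel_measurable borel" for n unfolding e_def[abs_def] by measurable
  let ?g = "\<lambda>n s. renorm' (u (e n s))"
  have gm: "?g n \<in> borel_measurable borel" for n by measurable
  have int: "integrable lborel (\<lambda>s. indicat_real {r<..r'} s * (?g n s * f s))" if "0 \<le> r" "r' \<le> T" for n r r'
    by (rule integrable_restrict[OF f _ _ gm abs_renorm'_le]) (use that in auto)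
  have int0: "integrable lborel (\<lambda>s. indicat_real {r<..r'} s * f s)" if "0 \<le> r" "r' \<le> T" for r r'
  proof -
    have "{r<..r'} \<subseteq> {0<..T}" using that by auto
    from integrable_restrict[OF f _ this, of "\<lambda>_. 1"] show ?thesis by simp
  qed
  have diff: "u r' - u r = (\<integral>s. indicat_real {r<..r'} s * f s \<partial>lborel)" if "0 \<le> r" "r \<le> r'" "r' \<le> T" for r r'
  proof -
    have "u r' = (\<integral>s. indicat_real {0<..r} s * f s + indicat_real {r<..r'} s * f s \<partial>lborel)"
      using that by (subst rep) (auto intro!: arg_cong[where f="integral\<^sup>L lborel"] simp: fun_eq_iff indicator_def)
    also have "\<dots> = u r + (\<integral>s. indicat_real {r<..r'} s * f s \<partial>lborel)"
      using that int0 by (subst Bochner_Integration.integral_add) (auto simp: rep)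
    finally show ?thesis by simp
  qed
  have step: "renorm (u (t * real k / real n)) \<le> (\<integral>s. indicat_real {0<..t * real k / real n} s * (?g n s * f s) \<partial>lborel)"
    if "n > 0" "k \<le> n" for n k
    using that(2)
  proof (induction k)
    case 0
    then show ?case using rep[of 0] t by (simp add: renorm_0)
  next
    case (Suc k)
    let ?r = "t * real k / real n" and ?r' = "t * real (Suc k) / real n"
    have r: "0 \<le> ?r" "?r \<le> ?r'" "?r' \<le> t"
      using tp that(1) Suc.prems by (auto simp: divide_simps mult_left_mono)
    have e: "e n s = ?r'" if s: "s \<in> {?r<..?r'}" for s
    proof -
      have "real k < s * real n / t" "s * real n / t \<le> real (Suc k)"
        using s tp \<open>n > 0\<close> by (auto simp: field_simps)
      then have "\<lceil>s * real n / t\<rceil> = int (Suc k)" by (intro ceiling_unique) auto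
      then show ?thesis by (simp add: e_def)
    qed
    have "renorm (u ?r') \<le> renorm (u ?r) + renorm' (u ?r') * (u ?r' - u ?r)"
      using renorm_tangent[of "u ?r'" "u ?r"] by simp
    also have "renorm' (u ?r') * (u ?r' - u ?r) = (\<integral>s. renorm' (u ?r') * (indicat_real {?r<..?r'} s * f s) \<partial>lborel)"
      using diff[of ?r ?r'] r t by simp
    also have "\<dots> = (\<integral>s. indicat_real {?r<..?r'} s * (?g n s * f s) \<partial>lborel)"
      by (rule arg_cong[where f="integral\<^sup>L lborel"], rule ext) (auto simp: indicator_def e)
    also have "renorm (u ?r) + \<dots> \<le> (\<integral>s. indicat_real {0<..?r} s * (?g n s * f s) \<partial>lborel) + \<dots>"
      using Suc by simp
    also have "\<dots> = (\<integral>s. indicat_real {0<..?r} s * (?g n s * f s) + indicat_real {?r<..?r'} s * (?g n s * f s) \<partial>lborel)"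
      using r t by (intro Bochner_Integration.integral_add[symmetric] int) auto
    also have "\<dots> = (\<integral>s. indicat_real {0<..?r'} s * (?g n s * f s) \<partial>lborel)"
      using r by (intro arg_cong[where f="integral\<^sup>L lborel"]) (auto simp: fun_eq_iff indicator_def)
    finally show ?case .
  qed
  have e_lim: "(\<lambda>n. e (Suc n) s) \<longlonglongrightarrow> s" for s
  proof -
    have "\<bar>e (Suc n) s - s\<bar> \<le> t * (1 / real (Suc n))" for n
    proof -
      define N where "N = real (Suc n)"
      have N: "N > 0" by (simp add: N_def)
      have "e (Suc n) s - s = t / N * (of_int \<lceil>s * N / t\<rceil> - s * N / t)"
        unfolding e_def N_def[symmetric] using tp N by (simp add: field_simps)
      also have "\<bar>\<dots>\<bar> \<le> t / N * 1"
        unfolding abs_mult using tp N by (intro mult_mono) (auto, linarith)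
      finally show ?thesis by (simp add: N_def)
    qed
    then have "\<And>n. norm (e (Suc n) s - s) \<le> t * (1 / real (Suc n))" by simp
    from Lim_null_comparison[OF always_eventually[OF allI[OF this]] tendsto_mult_right_zero[OF LIMSEQ_Suc[OF lim_1_over_n]]]
    have "(\<lambda>n. e (Suc n) s - s) \<longlonglongrightarrow> 0" .
    then show ?thesis by (simp add: LIM_zero_iff)
  qed
  have "(\<lambda>n. \<integral>s. indicat_real {0<..t} s * (?g (Suc n) s * f s) \<partial>lborel) \<longlonglongrightarrow> (\<integral>s. indicat_real {0<..t} s * (renorm' (u s) * f s) \<partial>lborel)"
  proof (rule integral_dominated_convergence[where w="\<lambda>s. \<bar>indicat_real {0<..T} s * f s\<bar>"])
    show "AE s in lborel. (\<lambda>n. indicat_real {0<..t} s * (?g (Suc n) s * f s)) \<longlonglongrightarrow> indicat_real {0<..t} s * (renorm' (u s) * f s)"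
      by (intro AE_I2 tendsto_intros continuous_on_tendsto_compose[OF continuous_renorm(2)] continuous_on_tendsto_compose[OF u] e_lim) auto
    show "AE s in lborel. norm (indicat_real {0<..t} s * (?g (Suc n) s * f s)) \<le> \<bar>indicat_real {0<..T} s * f s\<bar>" for n
    proof (rule AE_I2)
      fix s
      have "\<bar>?g (Suc n) s\<bar> * \<bar>f s\<bar> \<le> 1 * \<bar>f s\<bar>" by (intro mult_right_mono abs_renorm'_le) simp
      then show "norm (indicat_real {0<..t} s * (?g (Suc n) s * f s)) \<le> \<bar>indicat_real {0<..T} s * f s\<bar>"
        using t by (auto simp: indicator_def abs_mult)
    qed
    show "(\<lambda>s. indicat_real {0<..t} s * (?g (Suc n) s * f s)) \<in> borel_measurable lborel" for n
      using borel_measurable_integrable[OF int[of 0 t]] t by simp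
    show "(\<lambda>s. indicat_real {0<..t} s * (renorm' (u s) * f s)) \<in> borel_measurable lborel"
      by (rule borel_measurable_integrable, rule integrable_restrict[OF f _ _ _ abs_renorm'_le]) (use t in auto)
  qed (use f in auto)
  moreover have "renorm (u t) \<le> (\<integral>s. indicat_real {0<..t} s * (?g (Suc n) s * f s) \<partial>lborel)" for n
    using step[of "Suc n" "Suc n"] by simp
  ultimately show ?thesis by (intro LIMSEQ_le_const) auto
qed

lemma smooth_fn_realI:
  fixes f :: "real \<Rightarrow> real"
  assumes "\<And>x. (f has_real_derivative f' x) (at x)" "smooth_fn f'"
  shows "smooth_fn f" "dderiv f 1 = f'"
proof -
  have D: "(f has_derivative (*) (f' x)) (at x)" for x using assms(1)[of x] by (simp add: has_field_derivative_def)
  show e: "dderiv f 1 = f'" by (rule ext) (simp add: dderiv_eq[OF D])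
  show "smooth_fn f"
    by (subst smooth_fn_unfold) (use D e assms(2) in \<open>auto simp: differentiable_def\<close>)
qed

lemma smooth_step:
  obtains P \<eta> :: "real \<Rightarrow> real" where "\<And>x. (P has_real_derivative \<eta> x) (at x)" "smooth_fn \<eta>"
    "\<And>x. x \<le> 0 \<Longrightarrow> P x = 0" "\<And>x. x \<ge> 1 \<Longrightarrow> P x = 1" "\<And>x. 0 \<le> P x" "\<And>x. P x \<le> 1"
    "cc_fn \<eta>" "\<And>x. x \<notin> {0..1} \<Longrightarrow> \<eta> x = 0" "(\<integral>x. \<eta> x \<partial>lborel) = 1" "\<And>x. 0 \<le> \<eta> x"
proof -
  let ?b = "box_bump (0::real) 1 1"
  have t: "test_fn UNIV ?b" by (rule test_fn_box_bump) simp
  note cc = test_fn_cc[OF t]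
  have cont: "continuous_on S ?b" for S by (rule continuous_on_subset[OF cc_fn_continuous[OF cc]]) simp
  have b0: "?b x = 0" if "x \<notin> {0<..<1}" for x by (rule box_bump_eq_0) (use that in \<open>simp add: box_real\<close>)
  \<comment> \<open>The lower limit -1 lies to the left of the support of the bump, so that for x
    \<ge> 0 the point x is interior to the interval and the derivative is two-sided.\<close>
  define Q where "Q x = integral {-1..x} ?b" for x
  have Q0: "Q x = 0" if "x \<le> 0" for x
  proof -
    have "integral {-1..x} ?b = integral {-1..x} (\<lambda>_. 0)"
      by (rule Henstock_Kurzweil_Integration.integral_cong) (use that b0 in auto)
    then show ?thesis by (simp add: Q_def)
  qed
  have DQ: "(Q has_real_derivative ?b x) (at x)" for x
  proof (cases "x < 0")
    case True
    have "((\<lambda>_. 0) has_real_derivative ?b x) (at x)" using b0[of x] True by simp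
    then show ?thesis
    proof (rule has_field_derivative_transform_within_open[where S="{..<0}"])
      show "0 = Q y" if "y \<in> {..<0}" for y
        using Q0[of y] that by simp
    qed (use True in auto)
  next
    case False
    have "(Q has_real_derivative ?b x) (at x within {-1..x+1})"
      unfolding Q_def[abs_def] by (rule integral_has_real_derivative[OF cont]) (use False in auto)
    moreover have "at x within {-1..x+1} = at x"
      by (rule at_within_interior) (use False in \<open>simp add: interior_atLeastAtMost_real\<close>)
    ultimately show ?thesis by simp
  qed
  have mono: "Q x \<le> Q y" if "x \<le> y" for x y
    by (rule DERIV_nonneg_imp_nondecreasing[OF that]) (use DQ box_bump_nonneg in blast)
  have i: "integrable lborel ?b" by (rule integrable_cc[OF cc])
  define Z where "Z = Q 1"
  have ind: "indicat_real {0..y} s *\<^sub>R ?b s = ?b s" if "y \<ge> 1" for s y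
    using b0[of s] that by (cases "s \<in> {0<..<1}") (auto simp: indicator_def)
  have Q1: "Q y = (\<integral>x. ?b x \<partial>lborel)" if "y \<ge> 1" for y
  proof -
    have "(\<integral>x. indicat_real {0..y} x *\<^sub>R ?b x \<partial>lborel) = Q y - Q 0"
    proof (rule integral_FTC_atLeastAtMost)
      show "(Q has_vector_derivative ?b x) (at x within {0..y})" for x
        by (rule has_vector_derivative_at_within, rule DQ[unfolded has_real_derivative_iff_has_vector_derivative])
    qed (use that cont in simp_all)
    then show ?thesis unfolding ind[OF that] using Q0[of 0] by simp
  qed
  have Zpos: "Z > 0"
  proof -
    have "\<exists>z. 0 < z \<and> z < 1 \<and> Q 1 - Q 0 = (1 - 0) * ?b z"
      by (rule MVT2) (use DQ in auto)
    then obtain z where z: "0 < z" "z < 1" "Q 1 - Q 0 = ?b z" by auto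
    have "?b z > 0" by (rule box_bump_pos) (use z in \<open>simp_all add: box_real\<close>)
    then show ?thesis using z Q0[of 0] by (simp add: Z_def)
  qed
  show thesis
  proof (rule that[of "\<lambda>x. Q x / Z" "\<lambda>x. ?b x * (1 / Z)"])
    show "((\<lambda>x. Q x / Z) has_real_derivative ?b x * (1 / Z)) (at x)" for x
      using DERIV_cdivide[OF DQ[of x], of Z] by simp
    show "smooth_fn (\<lambda>x. ?b x * (1 / Z))"
      by (intro smooth_fn_mult smooth_box_bump smooth_fn_const)
    show "cc_fn (\<lambda>x. ?b x * (1 / Z))"
      using cc_fn_mult[OF continuous_on_const[of _ "1 / Z"] cc] by (simp add: mult.commute)
    show "Q x / Z = 0" if "x \<le> 0" for x using Q0[OF that] by simp
    show "Q x / Z = 1" if "x \<ge> 1" for x using Q1[OF that] Q1[of 1] Zpos by (simp add: Z_def)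
    show "0 \<le> Q x / Z" for x using mono[of "min x 0" x] Q0[of "min x 0"] Zpos by simp
    show "Q x / Z \<le> 1" for x
      using mono[of x "max x 1"] Q1[of "max x 1"] Q1[of 1] Zpos by (simp add: Z_def)
    show "?b x * (1 / Z) = 0" if "x \<notin> {0..1}" for x using b0[of x] that by auto
    show "(\<integral>x. ?b x * (1 / Z) \<partial>lborel) = 1" using Q1[of 1] Zpos by (simp add: Z_def)
    show "0 \<le> ?b x * (1 / Z)" for x using box_bump_nonneg[of 0 1 1 x] Zpos by simp
  qed
qed

text \<open>The test function is a smoothed indicator of the interval from s to t. Its derivative is
  the difference of two approximate identities concentrated just after s and t, so the first
  integral tends to \<alpha> s - \<alpha> t by continuity. Because the steps rise to the right of
  the end points, the limit is the indicator of the half-open interval.\<close>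

lemma weak_time_derivative_increment:
  fixes \<alpha> f :: "real \<Rightarrow> real"
  assumes \<alpha>: "continuous_on UNIV \<alpha>"
    and f: "\<And>T. integrable lborel (\<lambda>s. indicat_real {0<..T} s * f s)"
    and weak: "\<And>\<theta>. test_fn {0<..} \<theta> \<Longrightarrow>
      (\<integral>s. \<alpha> s * dderiv \<theta> 1 s \<partial>lborel) + (\<integral>s. \<theta> s * f s \<partial>lborel) = 0"
    and st: "0 < s" "s < t"
  shows "\<alpha> t - \<alpha> s = (\<integral>\<tau>. indicat_real {s<..t} \<tau> * f \<tau> \<partial>lborel)"
proof -
  obtain P \<eta> :: "real \<Rightarrow> real" where P: "\<And>x. (P has_real_derivative \<eta> x) (at x)" "smooth_fn \<eta>"
    "\<And>x. x \<le> 0 \<Longrightarrow> P x = 0" "\<And>x. x \<ge> 1 \<Longrightarrow> P x = 1" "\<And>x. 0 \<le> P x" "\<And>x. P x \<le> 1"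
    "cc_fn \<eta>" "\<And>x. x \<notin> {0..1} \<Longrightarrow> \<eta> x = 0" "(\<integral>x. \<eta> x \<partial>lborel) = 1" "\<And>x. 0 \<le> \<eta> x"
    by (rule smooth_step) blast
  have [measurable]: "\<alpha> \<in> borel_measurable borel" by (rule borel_measurable_continuous_onI[OF \<alpha>])
  have [measurable]: "\<eta> \<in> borel_measurable borel" by (rule cc_fn_measurable[OF P(7)])
  have contP: "continuous_on UNIV P" using P(1) by (auto intro!: continuous_at_imp_continuous_on DERIV_isCont)
  have [measurable]: "P \<in> borel_measurable borel" by (rule borel_measurable_continuous_onI[OF contP])
  define N where "N n = real (Suc n)" for n
  have N: "N n > 0" "N n \<ge> 1" for n by (simp_all add: N_def)
  define \<theta> where "\<theta> n \<tau> = P (N n * (\<tau> - s)) - P (N n * (\<tau> - t))" for n \<tau>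
  define \<theta>' where "\<theta>' n \<tau> = N n * \<eta> (N n * (\<tau> - s)) - N n * \<eta> (N n * (\<tau> - t))" for n \<tau>
  have D: "(\<theta> n has_real_derivative \<theta>' n \<tau>) (at \<tau>)" for n \<tau>
    unfolding \<theta>_def[abs_def] \<theta>'_def
    by (auto intro!: derivative_eq_intros DERIV_chain2[OF P(1)])
  have sm\<eta>: "smooth_fn (\<lambda>\<tau>. \<eta> (N n *\<^sub>R \<tau> + d))" for n d by (rule smooth_fn_affine[OF P(2)])
  have sm: "smooth_fn (\<theta>' n)" for n
  proof -
    have "smooth_fn (\<lambda>\<tau>. N n * \<eta> (N n *\<^sub>R \<tau> + (- (N n * s))) + (- N n) * \<eta> (N n *\<^sub>R \<tau> + (- (N n * t))))"
      by (intro smooth_fn_add smooth_fn_mult smooth_fn_const sm\<eta>)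
    then show ?thesis by (simp add: \<theta>'_def[abs_def] right_diff_distrib)
  qed
  note sm\<theta> = smooth_fn_realI[OF D sm]
  \<comment> \<open>\<open>N n \<ge> 1\<close> keeps the second step within distance 1 of t, so all
    supports lie in one compact set of positive times.\<close>
  have supp: "\<theta> n \<tau> = 0" if "\<tau> \<notin> {s..t + 1}" for n \<tau>
  proof (cases "\<tau> < s")
    case True
    then have "N n * (\<tau> - s) \<le> 0" "N n * (\<tau> - t) \<le> 0" using st N[of n] by (auto intro!: mult_nonneg_nonpos)
    then show ?thesis by (simp add: \<theta>_def P(3))
  next
    case False
    with that have "\<tau> - t \<ge> 1" "\<tau> - s \<ge> 1" using st by auto
    then have "N n * (\<tau> - t) \<ge> 1 * 1" "N n * (\<tau> - s) \<ge> 1 * 1" using N[of n] by (intro mult_mono; auto)+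
    then show ?thesis by (simp add: \<theta>_def P(4))
  qed
  have test: "test_fn {0<..} (\<theta> n)" for n
    by (rule test_fn_supportI[of _ "{s..t + 1}"]) (use st supp sm\<theta> in auto)
  have eq: "(\<integral>\<tau>. \<alpha> \<tau> * \<theta>' n \<tau> \<partial>lborel) + (\<integral>\<tau>. \<theta> n \<tau> * f \<tau> \<partial>lborel) = 0" for n
    using weak[OF test] by (simp add: sm\<theta>(2))
  have bound: "\<exists>B. \<forall>x\<in>{r..r+1}. \<bar>\<alpha> x\<bar> \<le> B" for r
  proof -
    have "bounded (\<alpha> ` {r..r+1})"
      by (intro compact_imp_bounded compact_continuous_image continuous_on_subset[OF \<alpha>]) auto
    then show ?thesis unfolding bounded_iff by auto
  qed
  have N\<eta>: "(\<integral>\<tau>. \<alpha> \<tau> * (N n * \<eta> (N n * (\<tau> - r))) \<partial>lborel) = (\<integral>x. \<alpha> (r + x / N n) * \<eta> x \<partial>lborel)"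
    "integrable lborel (\<lambda>\<tau>. \<alpha> \<tau> * (N n * \<eta> (N n * (\<tau> - r))))" for n r
  proof -
    have "(\<integral>\<tau>. \<alpha> \<tau> * (N n * \<eta> (N n * (\<tau> - r))) \<partial>lborel) = \<bar>1 / N n\<bar> *\<^sub>R (\<integral>x. \<alpha> (r + (1 / N n) * x) * (N n * \<eta> (N n * (r + (1 / N n) * x - r))) \<partial>lborel)"
      by (rule lborel_integral_real_affine) (use N[of n] in auto)
    also have "\<dots> = (1 / N n) * (\<integral>x. N n * (\<alpha> (r + x / N n) * \<eta> x) \<partial>lborel)"
      using N[of n] by (simp add: mult.left_commute)
    finally show "(\<integral>\<tau>. \<alpha> \<tau> * (N n * \<eta> (N n * (\<tau> - r))) \<partial>lborel) = (\<integral>x. \<alpha> (r + x / N n) * \<eta> x \<partial>lborel)"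
      using N[of n] by simp
    have "cc_fn (\<lambda>\<tau>. \<alpha> \<tau> * (N n * \<eta> (N n * (\<tau> - r))))"
      unfolding cc_fn_def
    proof (intro conjI exI[of _ "\<bar>r\<bar> + 1"] allI impI)
      show "continuous_on UNIV (\<lambda>\<tau>. \<alpha> \<tau> * (N n * \<eta> (N n * (\<tau> - r))))"
        by (intro continuous_intros \<alpha> continuous_on_compose2[OF cc_fn_continuous[OF P(7)]]) auto
      fix \<tau> :: real assume "norm \<tau> > \<bar>r\<bar> + 1"
      then have "\<tau> - r > 1 \<or> \<tau> - r < 0" by auto
      then have "N n * (\<tau> - r) > 1 \<or> N n * (\<tau> - r) < 0"
        using N[of n] mult_strict_mono'[of 1 "N n" 1 "\<tau> - r"] by (auto simp: mult_less_0_iff) (smt (verit) mult_le_cancel_right1)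
      then show "\<alpha> \<tau> * (N n * \<eta> (N n * (\<tau> - r))) = 0" using P(8)[of "N n * (\<tau> - r)"] by auto
    qed
    then show "integrable lborel (\<lambda>\<tau>. \<alpha> \<tau> * (N n * \<eta> (N n * (\<tau> - r))))" by (rule integrable_cc)
  qed
  have invN: "(\<lambda>n. x / N n) \<longlonglongrightarrow> 0" for x
    using tendsto_mult_right_zero[OF LIMSEQ_Suc[OF lim_1_over_n], of x] by (simp add: N_def)
  have limA: "(\<lambda>n. \<integral>x. \<alpha> (r + x / N n) * \<eta> x \<partial>lborel) \<longlonglongrightarrow> \<alpha> r" for r
  proof -
    obtain B where B: "\<And>x. x \<in> {r..r+1} \<Longrightarrow> \<bar>\<alpha> x\<bar> \<le> B" using bound[of r] by blast
    have "(\<lambda>n. \<integral>x. \<alpha> (r + x / N n) * \<eta> x \<partial>lborel) \<longlonglongrightarrow> (\<integral>x. \<alpha> r * \<eta> x \<partial>lborel)"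
    proof (rule integral_dominated_convergence[where w="\<lambda>x. B * \<bar>\<eta> x\<bar>"])
      show "integrable lborel (\<lambda>x. B * \<bar>\<eta> x\<bar>)" using integrable_cc[OF P(7)] by simp
      show "AE x in lborel. (\<lambda>n. \<alpha> (r + x / N n) * \<eta> x) \<longlonglongrightarrow> \<alpha> r * \<eta> x"
      proof (rule AE_I2)
        fix x
        have "(\<lambda>n. r + x / N n) \<longlonglongrightarrow> r + 0" by (intro tendsto_intros invN)
        then show "(\<lambda>n. \<alpha> (r + x / N n) * \<eta> x) \<longlonglongrightarrow> \<alpha> r * \<eta> x"
          by (intro tendsto_mult_right continuous_on_tendsto_compose[OF \<alpha>]) auto
      qed
      show "AE x in lborel. norm (\<alpha> (r + x / N n) * \<eta> x) \<le> B * \<bar>\<eta> x\<bar>" for n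
      proof (rule AE_I2)
        fix x :: real
        show "norm (\<alpha> (r + x / N n) * \<eta> x) \<le> B * \<bar>\<eta> x\<bar>"
        proof (cases "x \<in> {0..1}")
          case True
          then have "0 \<le> x / N n" "x / N n \<le> 1" using N[of n] by (auto simp: divide_le_eq)
          then show ?thesis using B[of "r + x / N n"] by (auto simp: abs_mult intro!: mult_right_mono)
        qed (simp add: P(8))
      qed
    qed auto
    then show ?thesis using P(9) by simp
  qed
  have "(\<integral>\<tau>. \<alpha> \<tau> * \<theta>' n \<tau> \<partial>lborel) = (\<integral>x. \<alpha> (s + x / N n) * \<eta> x \<partial>lborel) - (\<integral>x. \<alpha> (t + x / N n) * \<eta> x \<partial>lborel)" for n
    unfolding N\<eta>(1)[symmetric] \<theta>'_def right_diff_distrib by (rule Bochner_Integration.integral_diff[OF N\<eta>(2) N\<eta>(2), unfolded right_diff_distrib])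
  then have lim1: "(\<lambda>n. \<integral>\<tau>. \<alpha> \<tau> * \<theta>' n \<tau> \<partial>lborel) \<longlonglongrightarrow> \<alpha> s - \<alpha> t"
    using tendsto_diff[OF limA limA, of s t] by simp
  have Plim: "(\<lambda>n. P (N n * y)) \<longlonglongrightarrow> (if y > 0 then 1 else 0)" for y
  proof (cases "y > 0")
    case True
    obtain M :: nat where M: "1 / y < real M" using reals_Archimedean2 by blast
    have "P (N n * y) = 1" if "n \<ge> M" for n
    proof (rule P(4))
      have "1 / y \<le> N n" using M that by (simp add: N_def)
      then show "1 \<le> N n * y" using True by (simp add: divide_le_eq)
    qed
    then show ?thesis using True by (intro tendsto_eventually) (auto simp: eventually_sequentially)
  next
    case False
    then have "P (N n * y) = 0" for n using N[of n] by (intro P(3)) (simp add: mult_nonneg_nonpos)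
    with False show ?thesis by simp
  qed
  have lim2: "(\<lambda>n. \<integral>\<tau>. \<theta> n \<tau> * f \<tau> \<partial>lborel) \<longlonglongrightarrow> (\<integral>\<tau>. indicat_real {s<..t} \<tau> * f \<tau> \<partial>lborel)"
  proof -
    let ?f = "\<lambda>\<tau>. indicat_real {0<..t + 1} \<tau> * f \<tau>"
    have fi: "integrable lborel ?f" by (rule f)
    have [measurable]: "?f \<in> borel_measurable borel" using borel_measurable_integrable[OF fi] by simp
    have "(\<lambda>n. \<integral>\<tau>. \<theta> n \<tau> * ?f \<tau> \<partial>lborel) \<longlonglongrightarrow> (\<integral>\<tau>. indicat_real {s<..t} \<tau> * ?f \<tau> \<partial>lborel)"
    proof (rule integral_dominated_convergence[where w="\<lambda>\<tau>. \<bar>?f \<tau>\<bar>"])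
      show "(\<lambda>\<tau>. \<theta> n \<tau> * ?f \<tau>) \<in> borel_measurable lborel" for n unfolding \<theta>_def by measurable
      show "AE \<tau> in lborel. (\<lambda>n. \<theta> n \<tau> * ?f \<tau>) \<longlonglongrightarrow> indicat_real {s<..t} \<tau> * ?f \<tau>"
      proof (rule AE_I2)
        fix \<tau>
        have "(\<lambda>n. \<theta> n \<tau>) \<longlonglongrightarrow> (if \<tau> - s > 0 then 1 else 0) - (if \<tau> - t > 0 then 1 else 0)"
          unfolding \<theta>_def by (intro tendsto_diff Plim)
        also have "(if \<tau> - s > 0 then 1 else 0) - (if \<tau> - t > 0 then 1 else 0) = indicat_real {s<..t} \<tau>"
          using st by (auto simp: indicator_def)
        finally show "(\<lambda>n. \<theta> n \<tau> * ?f \<tau>) \<longlonglongrightarrow> indicat_real {s<..t} \<tau> * ?f \<tau>" by (rule tendsto_mult_right)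
      qed
      show "AE \<tau> in lborel. norm (\<theta> n \<tau> * ?f \<tau>) \<le> \<bar>?f \<tau>\<bar>" for n
      proof (rule AE_I2)
        fix \<tau>
        have "\<bar>\<theta> n \<tau>\<bar> \<le> 1"
          using P(5)[of "N n * (\<tau> - s)"] P(5)[of "N n * (\<tau> - t)"] P(6)[of "N n * (\<tau> - s)"] P(6)[of "N n * (\<tau> - t)"]
          unfolding \<theta>_def by linarith
        then show "norm (\<theta> n \<tau> * ?f \<tau>) \<le> \<bar>?f \<tau>\<bar>" unfolding real_norm_def by (rule abs_mult_le_right)
      qed
    qed (use fi in auto)
    moreover have "\<theta> n \<tau> * ?f \<tau> = \<theta> n \<tau> * f \<tau>" for n \<tau>
      using supp[of \<tau> n] st by (cases "\<tau> \<in> {s..t+1}") auto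
    moreover have "indicat_real {s<..t} \<tau> * ?f \<tau> = indicat_real {s<..t} \<tau> * f \<tau>" for \<tau>
      using st by (auto simp: indicator_def)
    ultimately show ?thesis by simp
  qed
  have "(\<lambda>n::nat. 0) \<longlonglongrightarrow> (\<alpha> s - \<alpha> t) + (\<integral>\<tau>. indicat_real {s<..t} \<tau> * f \<tau> \<partial>lborel)"
    using tendsto_add[OF lim1 lim2] by (simp add: eq)
  then show ?thesis by (simp add: LIMSEQ_const_iff)
qed

text \<open>Test functions that live in positive times determine increments only. The initial value
  enters by letting the left end point tend to 0, where \<alpha> is continuous with value 0.\<close>

lemma weak_time_derivative_representation:
  fixes \<alpha> f :: "real \<Rightarrow> real"
  assumes \<alpha>: "continuous_on UNIV \<alpha>" and \<alpha>0: "\<alpha> 0 = 0"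
    and f: "\<And>T. integrable lborel (\<lambda>s. indicat_real {0<..T} s * f s)"
    and weak: "\<And>\<theta>. test_fn {0<..} \<theta> \<Longrightarrow>
      (\<integral>s. \<alpha> s * dderiv \<theta> 1 s \<partial>lborel) + (\<integral>s. \<theta> s * f s \<partial>lborel) = 0"
    and t: "0 \<le> t"
  shows "\<alpha> t = (\<integral>\<tau>. indicat_real {0<..t} \<tau> * f \<tau> \<partial>lborel)"
proof (cases "t = 0")
  case True
  then show ?thesis by (simp add: \<alpha>0)
next
  case False
  with t have tp: "t > 0" by simp
  \<comment> \<open>Two successors, so that the point is strictly below t already for n = 0.\<close>
  let ?s = "\<lambda>n. t / real (Suc (Suc n))"
  have "(\<lambda>n. t * (1 / real (Suc (Suc n)))) \<longlonglongrightarrow> t * 0"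
    by (intro tendsto_intros LIMSEQ_Suc LIMSEQ_Suc[OF lim_1_over_n])
  then have s0: "?s \<longlonglongrightarrow> 0" by simp
  have s: "0 < ?s n" "?s n < t" for n using tp by (auto simp: divide_less_eq)
  let ?f = "\<lambda>\<tau>. indicat_real {0<..t} \<tau> * f \<tau>"
  have fi: "integrable lborel ?f" by (rule f)
  have [measurable]: "?f \<in> borel_measurable borel" using borel_measurable_integrable[OF fi] by simp
  have "(\<lambda>n. \<integral>\<tau>. indicat_real {?s n<..t} \<tau> * ?f \<tau> \<partial>lborel) \<longlonglongrightarrow> (\<integral>\<tau>. ?f \<tau> \<partial>lborel)"
  proof (rule integral_dominated_convergence[where w="\<lambda>\<tau>. \<bar>?f \<tau>\<bar>"])
    show "AE \<tau> in lborel. (\<lambda>n. indicat_real {?s n<..t} \<tau> * ?f \<tau>) \<longlonglongrightarrow> ?f \<tau>"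
    proof (rule AE_I2)
      fix \<tau>
      show "(\<lambda>n. indicat_real {?s n<..t} \<tau> * ?f \<tau>) \<longlonglongrightarrow> ?f \<tau>"
      proof (cases "\<tau> \<in> {0<..t}")
        case True
        then have ev: "eventually (\<lambda>n. ?s n < \<tau>) sequentially" using order_tendstoD(2)[OF s0, of \<tau>] by simp
        show ?thesis
        proof (rule tendsto_eventually, rule eventually_mono[OF ev])
          fix n assume "?s n < \<tau>"
          with True have "indicat_real {?s n<..t} \<tau> = 1" by (simp del: of_nat_Suc)
          then show "indicat_real {?s n<..t} \<tau> * ?f \<tau> = ?f \<tau>" by simp
        qed
      qed simp
    qed
  qed (use fi in \<open>auto simp: indicator_def\<close>)
  moreover have "(\<integral>\<tau>. indicat_real {?s n<..t} \<tau> * ?f \<tau> \<partial>lborel) = \<alpha> t - \<alpha> (?s n)" for n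
  proof -
    have "(\<integral>\<tau>. indicat_real {?s n<..t} \<tau> * ?f \<tau> \<partial>lborel) = (\<integral>\<tau>. indicat_real {?s n<..t} \<tau> * f \<tau> \<partial>lborel)"
      using s(1)[of n] by (intro arg_cong[where f="integral\<^sup>L lborel"]) (auto simp: fun_eq_iff indicator_def)
    then show ?thesis using weak_time_derivative_increment[OF \<alpha> f weak s(1)[of n] s(2)[of n]] by simp
  qed
  moreover have "(\<lambda>n. \<alpha> t - \<alpha> (?s n)) \<longlonglongrightarrow> \<alpha> t - \<alpha> 0"
    by (intro tendsto_intros continuous_on_tendsto_compose[OF \<alpha> s0]) auto
  ultimately have "(\<integral>\<tau>. ?f \<tau> \<partial>lborel) = \<alpha> t - \<alpha> 0" by (simp add: LIMSEQ_unique)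
  then show ?thesis by (simp add: \<alpha>0)
qed

section \<open>Functions of time and space\<close>

lemma fst_borel[measurable]: "(fst :: 'a::euclidean_space \<times> 'b::euclidean_space \<Rightarrow> 'a) \<in> borel_measurable borel"
  and snd_borel[measurable]: "(snd :: 'a::euclidean_space \<times> 'b::euclidean_space \<Rightarrow> 'b) \<in> borel_measurable borel"
  by (intro borel_measurable_continuous_onI continuous_intros)+

lemma slice_measurable:
  fixes f :: "'a::euclidean_space \<times> 'b::euclidean_space \<Rightarrow> 'c::topological_space"
  assumes "f \<in> borel_measurable borel"
  shows "(\<lambda>x. f (t, x)) \<in> borel_measurable borel"
  by (rule measurable_compose[OF _ assms]) (intro borel_measurable_continuous_onI continuous_intros)

lemma prod_measurable:
  fixes f :: "'a::euclidean_space \<times> 'b::euclidean_space \<Rightarrow> 'c::topological_space"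
  assumes "f \<in> borel_measurable borel"
  shows "f \<in> borel_measurable (lborel \<Otimes>\<^sub>M lborel)"
  using assms by (simp add: lborel_prod)

lemma nn_integral_prod:
  fixes f :: "'a::euclidean_space \<times> 'b::euclidean_space \<Rightarrow> ennreal"
  assumes "f \<in> borel_measurable borel"
  shows "(\<integral>\<^sup>+p. f p \<partial>lborel) = (\<integral>\<^sup>+t. \<integral>\<^sup>+x. f (t, x) \<partial>lborel \<partial>lborel)"
  using lborel.nn_integral_fst[OF prod_measurable[OF assms]] by (simp add: lborel_prod)

lemma nn_integral_slice_measurable:
  fixes f :: "'a::euclidean_space \<times> 'b::euclidean_space \<Rightarrow> ennreal"
  assumes "f \<in> borel_measurable borel"
  shows "(\<lambda>t. \<integral>\<^sup>+x. f (t, x) \<partial>lborel) \<in> borel_measurable borel"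
  using lborel.borel_measurable_nn_integral_fst[OF prod_measurable[OF assms]] by simp

lemma
  fixes f :: "'a::euclidean_space \<times> 'b::euclidean_space \<Rightarrow> real"
  assumes "integrable lborel f"
  shows AE_integrable_slice: "AE t in lborel. integrable lborel (\<lambda>x. f (t, x))"
    and integrable_slice_integral: "integrable lborel (\<lambda>t. \<integral>x. f (t, x) \<partial>lborel)"
    and integral_prod: "(\<integral>p. f p \<partial>lborel) = (\<integral>t. \<integral>x. f (t, x) \<partial>lborel \<partial>lborel)"
proof -
  have "integrable (lborel \<Otimes>\<^sub>M lborel) f" using assms by (simp add: lborel_prod)
  then show "AE t in lborel. integrable lborel (\<lambda>x. f (t, x))" "integrable lborel (\<lambda>t. \<integral>x. f (t, x) \<partial>lborel)"
    "(\<integral>p. f p \<partial>lborel) = (\<integral>t. \<integral>x. f (t, x) \<partial>lborel \<partial>lborel)"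
    using lborel_pair.AE_integrable_fst' lborel_pair.integrable_fst' lborel_pair.integral_fst'[of f, symmetric]
    by (auto simp: lborel_prod)
qed

lemma integral_prod_swap:
  fixes f :: "'a::euclidean_space \<times> 'b::euclidean_space \<Rightarrow> real"
  assumes "integrable lborel f"
  shows "integrable lborel (\<lambda>x. \<integral>t. f (t, x) \<partial>lborel)"
    and "(\<integral>x. \<integral>t. f (t, x) \<partial>lborel \<partial>lborel) = (\<integral>t. \<integral>x. f (t, x) \<partial>lborel \<partial>lborel)"
proof -
  have i: "integrable (lborel \<Otimes>\<^sub>M lborel) (case_prod (\<lambda>t x. f (t, x)))" using assms by (simp add: lborel_prod)
  show "integrable lborel (\<lambda>x. \<integral>t. f (t, x) \<partial>lborel)" by (rule lborel_pair.integrable_snd[OF i])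
  show "(\<integral>x. \<integral>t. f (t, x) \<partial>lborel \<partial>lborel) = (\<integral>t. \<integral>x. f (t, x) \<partial>lborel \<partial>lborel)"
    by (rule lborel_pair.Fubini_integral[OF i])
qed

lemma AE_prod:
  fixes P :: "'a::euclidean_space \<times> 'b::euclidean_space \<Rightarrow> bool"
  assumes "AE p in lborel. P p"
  shows "AE t in lborel. AE x in lborel. P (t, x)"
  by (rule lborel_pair.AE_pair) (use assms in \<open>simp only: lborel_prod\<close>)

lemma L2_fn_slice:
  fixes f :: "'a::euclidean_space \<times> 'b::euclidean_space \<Rightarrow> real"
  assumes "L2_fn f"
  shows "AE t in lborel. L2_fn (\<lambda>x. f (t, x))"
  using AE_integrable_slice[OF L2_fn_integrable[OF assms]]
  by eventually_elim (simp add: L2_fn_def slice_measurable[OF L2_fn_measurable[OF assms]])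

lemma L2_norm_slice:
  fixes f :: "'a::euclidean_space \<times> 'b::euclidean_space \<Rightarrow> real"
  assumes "L2_fn f"
  shows "(\<integral>\<^sup>+t. ennreal ((L2_norm (\<lambda>x. f (t, x)))\<^sup>2) \<partial>lborel) = ennreal ((L2_norm f)\<^sup>2)"
proof -
  have [measurable]: "f \<in> borel_measurable borel" by (rule L2_fn_measurable[OF assms])
  have "(\<integral>\<^sup>+t. ennreal ((L2_norm (\<lambda>x. f (t, x)))\<^sup>2) \<partial>lborel) = (\<integral>\<^sup>+t. \<integral>\<^sup>+x. ennreal ((f (t, x))\<^sup>2) \<partial>lborel \<partial>lborel)"
    by (rule nn_integral_cong_AE, rule AE_mp[OF L2_fn_slice[OF assms]], intro AE_I2 impI)
       (simp add: L2_norm_nn_integral[symmetric])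
  also have "\<dots> = ennreal ((L2_norm f)\<^sup>2)"
    by (subst nn_integral_prod[symmetric]) (simp_all add: L2_norm_nn_integral[OF assms])
  finally show ?thesis .
qed

section \<open>Mollifiers\<close>

lemma integral_scaleR:
  fixes f :: "'a::euclidean_space \<Rightarrow> real"
  assumes [measurable]: "f \<in> borel_measurable borel" and k: "k > 0"
  shows "(\<integral>x. f x \<partial>lborel) = k ^ DIM('a) * (\<integral>x. f (k *\<^sub>R x) \<partial>lborel)"
proof -
  have "(\<integral>x. f x \<partial>lborel) = (\<integral>x. f x \<partial>density (distr lborel borel (\<lambda>x. 0 + k *\<^sub>R x)) (\<lambda>_. ennreal (\<bar>k\<bar> ^ DIM('a))))"
    using lborel_affine[of k "0::'a"] k by (simp add: ennreal_power)
  also have "\<dots> = k ^ DIM('a) * (\<integral>x. f (k *\<^sub>R x) \<partial>lborel)"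
    using k by (subst integral_density) (auto simp: integral_distr)
  finally show ?thesis .
qed

text \<open>The integrals of |h_j d_i \<rho>(h)| do not change when \<rho> is replaced by k^d
  \<rho>(k x): the derivative gains a factor k and the coordinate loses it. Hence one
  \<open>M\<close> serves mollifiers with arbitrarily small support, and the commutator bound does
  not blow up.\<close>

lemma mollifiers:
  obtains M :: real where "M \<ge> 0"
    "\<And>r. r > 0 \<Longrightarrow> \<exists>\<rho> :: real^'n \<Rightarrow> real. test_fn UNIV \<rho> \<and> (\<forall>x. 0 \<le> \<rho> x) \<and> (\<integral>x. \<rho> x \<partial>lborel) = 1 \<and>
       (\<forall>x. norm x > r \<longrightarrow> \<rho> x = 0) \<and> (\<Sum>i\<in>UNIV. \<Sum>j\<in>UNIV. \<integral>h. \<bar>h $ j * pd i \<rho> h\<bar> \<partial>lborel) \<le> M"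
proof -
  define b where "b = (box_bump (- One) One 1 :: real^'n \<Rightarrow> real)"
  have t: "test_fn UNIV b" unfolding b_def by (rule test_fn_box_bump) simp
  have b0: "b x \<ge> 0" for x unfolding b_def by (rule box_bump_nonneg)
  note cc = test_fn_cc[OF t]
  have [measurable]: "b \<in> borel_measurable borel" by (rule cc_fn_measurable[OF cc])
  have [measurable]: "pd i b \<in> borel_measurable borel" for i by (rule cc_fn_measurable[OF test_fn_dderiv_cc[OF t]])
  have [measurable]: "(\<lambda>h::real^'n. h $ j) \<in> borel_measurable borel" for j
    by (intro borel_measurable_continuous_onI continuous_intros)
  define Z where "Z = (\<integral>x. b x \<partial>lborel)"
  have Z: "Z > 0"
  proof (rule ccontr)
    assume "\<not> Z > 0"
    moreover have "Z \<ge> 0" unfolding Z_def by (intro integral_nonneg_AE AE_I2 b0)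
    ultimately have "Z = 0" by simp
    then have "AE x in lborel. b x = 0"
      unfolding Z_def by (subst (asm) integral_nonneg_eq_0_iff_AE) (auto simp: integrable_cc[OF cc] b0)
    then have "AE x in lborel. x \<notin> box (- One) (One :: real^'n)"
      unfolding b_def by eventually_elim (metis box_bump_pos less_irrefl zero_less_one)
    then have "emeasure lborel (box (- One) (One :: real^'n)) = 0"
      by (subst (asm) AE_iff_measurable[OF _ refl]) auto
    moreover have "emeasure lborel (box (- One) (One :: real^'n)) = ennreal (\<Prod>b\<in>Basis. (One - (- One) :: real^'n) \<bullet> b)"
      by (rule emeasure_lborel_box) simp
    moreover have "0 < (\<Prod>b\<in>Basis. (One - (- One) :: real^'n) \<bullet> b)"
      unfolding inner_diff_left inner_minus_left by (intro prod_pos) simp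
    ultimately show False by (metis ennreal_eq_0_iff not_le)
  qed
  obtain r0 where r0: "r0 \<ge> 0" "\<And>x. norm x > r0 \<Longrightarrow> b x = 0" using cc_fn_support[OF cc] by blast
  define M where "M = (\<Sum>i\<in>UNIV. \<Sum>j\<in>UNIV. \<integral>h. \<bar>h $ j * pd i b h\<bar> \<partial>lborel) / Z"
  show thesis
  proof (rule that[of M])
    show "M \<ge> 0" unfolding M_def using Z by (intro divide_nonneg_pos sum_nonneg integral_nonneg_AE AE_I2) auto
    fix r :: real assume r: "r > 0"
    \<comment> \<open>\<open>b\<close> vanishes beyond radius \<open>r0\<close>, so the rescaled
      function vanishes beyond \<open>r\<close>; the 1 keeps k positive even if \<open>r0\<close> is
      0.\<close>
    define k where "k = (r0 + 1) / r"
    have k: "k > 0" using r r0(1) by (simp add: k_def)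
    let ?D = "DIM(real^'n)"
    let ?\<rho> = "\<lambda>x. k ^ ?D / Z * b (k *\<^sub>R x)"
    have tk: "test_fn UNIV (\<lambda>x. b (k *\<^sub>R x))" using test_fn_affine[OF t, of k 0] k by simp
    have t\<rho>: "test_fn UNIV ?\<rho>"
    proof -
      obtain K where K: "compact K" "K \<subseteq> UNIV" "\<And>x. x \<notin> K \<Longrightarrow> b (k *\<^sub>R x) = 0"
        using test_fn_support[OF tk] by blast
      show ?thesis by (rule test_fn_supportI[OF smooth_fn_mult[OF smooth_fn_const test_fn_smooth[OF tk]] K(1,2)]) (simp add: K(3))
    qed
    have pd: "pd i ?\<rho> h = k ^ ?D / Z * (k * pd i b (k *\<^sub>R h))" for i h
    proof -
      have "(b has_derivative frechet_derivative b (at (k *\<^sub>R h))) (at (k *\<^sub>R h))"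
        by (rule has_derivative_frechet[OF smooth_fn_differentiable[OF test_fn_smooth[OF t]]])
      moreover have "((\<lambda>x. k *\<^sub>R x) has_derivative (\<lambda>x. k *\<^sub>R x)) (at h)"
        by (rule bounded_linear_imp_has_derivative[OF bounded_linear_scaleR_right])
      ultimately have "((\<lambda>x. b (k *\<^sub>R x)) has_derivative (\<lambda>x. frechet_derivative b (at (k *\<^sub>R h)) (k *\<^sub>R x))) (at h)"
        using diff_chain_at[of "\<lambda>x. k *\<^sub>R x" "\<lambda>x. k *\<^sub>R x" h b] by (simp only: o_def)
      from has_derivative_mult_right[OF this, of "k ^ ?D / Z"]
      have "pd i ?\<rho> h = k ^ ?D / Z * dderiv b (k *\<^sub>R axis i 1) (k *\<^sub>R h)"
        by (simp add: dderiv_eq dderiv_def[of b])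
      then show ?thesis using linear_cmul[OF smooth_dderiv_linear[OF test_fn_smooth[OF t]]] by simp
    qed
    have int: "(\<integral>x. ?\<rho> x \<partial>lborel) = 1"
    proof -
      have e: "k ^ ?D * (\<integral>x. b (k *\<^sub>R x) \<partial>lborel) = Z"
        unfolding Z_def by (rule integral_scaleR[symmetric]) (use k in simp_all)
      have "(\<integral>x. ?\<rho> x \<partial>lborel) = k ^ ?D * (\<integral>x. b (k *\<^sub>R x) \<partial>lborel) / Z" by simp
      also have "\<dots> = 1" unfolding e using Z by simp
      finally show ?thesis .
    qed
    have "(\<integral>h. \<bar>h $ j * pd i ?\<rho> h\<bar> \<partial>lborel) = (\<integral>h. \<bar>h $ j * pd i b h\<bar> \<partial>lborel) / Z" for i j
    proof -
      have "(\<integral>h. \<bar>h $ j * pd i ?\<rho> h\<bar> \<partial>lborel) = (\<integral>h. k ^ ?D / Z * \<bar>(k *\<^sub>R h) $ j * pd i b (k *\<^sub>R h)\<bar> \<partial>lborel)"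
        unfolding pd using k Z by (intro arg_cong[where f="integral\<^sup>L lborel"]) (simp add: fun_eq_iff abs_mult mult_ac)
      also have "\<dots> = k ^ ?D / Z * (\<integral>h. \<bar>(k *\<^sub>R h) $ j * pd i b (k *\<^sub>R h)\<bar> \<partial>lborel)"
        by (rule integral_mult_right_zero)
      also have "\<dots> = (\<integral>h. \<bar>h $ j * pd i b h\<bar> \<partial>lborel) / Z"
        using integral_scaleR[of "\<lambda>h. \<bar>h $ j * pd i b h\<bar>" k] k by simp
      finally show ?thesis .
    qed
    then have "(\<Sum>i\<in>UNIV. \<Sum>j\<in>UNIV. \<integral>h. \<bar>h $ j * pd i ?\<rho> h\<bar> \<partial>lborel) = M"
      by (simp add: M_def sum_divide_distrib)
    moreover have "?\<rho> x = 0" if "norm x > r" for x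
    proof -
      have "norm (k *\<^sub>R x) > r0"
      proof -
        have "k * norm x > k * r" using that k by simp
        moreover have "norm (k *\<^sub>R x) = k * norm x" using k by simp
        moreover have "k * r = r0 + 1" using r by (simp add: k_def)
        ultimately show ?thesis by linarith
      qed
      then show ?thesis by (simp add: r0(2))
    qed
    moreover have "0 \<le> ?\<rho> x" for x using Z k by (simp add: b0)
    ultimately show "\<exists>\<rho> :: real^'n \<Rightarrow> real. test_fn UNIV \<rho> \<and> (\<forall>x. 0 \<le> \<rho> x) \<and> (\<integral>x. \<rho> x \<partial>lborel) = 1 \<and>
       (\<forall>x. norm x > r \<longrightarrow> \<rho> x = 0) \<and> (\<Sum>i\<in>UNIV. \<Sum>j\<in>UNIV. \<integral>h. \<bar>h $ j * pd i \<rho> h\<bar> \<partial>lborel) \<le> M"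
      using t\<rho> int by (intro exI[of _ ?\<rho>]) auto
  qed
qed

lemma cc_conv:
  assumes f: "cc_fn f" and g: "cc_fn g"
  shows "cc_fn (conv f g)"
proof -
  obtain r s where r: "\<And>x. norm x > r \<Longrightarrow> f x = 0" and s: "\<And>x. norm x > s \<Longrightarrow> g x = 0"
    using cc_fn_support[OF f] cc_fn_support[OF g] by metis
  have "conv f g x = 0" if "norm x > r + s" for x
  proof -
    have "f y * g (x - y) = 0" for y
    proof (cases "norm y > r")
      case False
      then have "norm (x - y) > s" using that norm_triangle_ineq2[of x y] by linarith
      then show ?thesis by (simp add: s)
    qed (simp add: r)
    then have "(\<lambda>y. f y * g (x - y)) = (\<lambda>_. 0)" by (rule ext)
    then show ?thesis by (simp add: conv_def)
  qed
  then show ?thesis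
    using conv_continuous[OF integrable_imp_locally_integrable[OF integrable_cc[OF f]] g] by (auto simp: cc_fn_def)
qed

definition conv_x :: "(real \<times> 'a::euclidean_space \<Rightarrow> real) \<Rightarrow> ('a \<Rightarrow> real) \<Rightarrow> real \<times> 'a \<Rightarrow> real" where
  "conv_x f \<rho> p = conv (\<lambda>y. f (fst p, y)) \<rho> (snd p)"

lemma conv_x_measurable[measurable]:
  fixes f :: "real \<times> 'a::euclidean_space \<Rightarrow> real"
  assumes [measurable]: "f \<in> borel_measurable borel" "\<rho> \<in> borel_measurable borel"
  shows "conv_x f \<rho> \<in> borel_measurable borel"
proof -
  have "(\<lambda>p. \<integral>y. f (fst p, y) * \<rho> (snd p - y) \<partial>lborel) \<in> borel_measurable (borel :: (real \<times> 'a) measure)"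
  proof (rule lborel.borel_measurable_lebesgue_integral)
    have 1: "(\<lambda>q::(real \<times> 'a) \<times> 'a. (fst (fst q), snd q)) \<in> borel_measurable borel"
      "(\<lambda>q::(real \<times> 'a) \<times> 'a. snd (fst q) - snd q) \<in> borel_measurable borel"
      by (intro borel_measurable_continuous_onI continuous_intros)+
    have "(\<lambda>q::(real \<times> 'a) \<times> 'a. f (fst (fst q), snd q) * \<rho> (snd (fst q) - snd q)) \<in> borel_measurable borel"
      by (intro borel_measurable_times measurable_compose[OF 1(1)] measurable_compose[OF 1(2)]) simp_all
    moreover have "sets (borel :: ((real \<times> 'a) \<times> 'a) measure) = sets (borel \<Otimes>\<^sub>M lborel)"
      by (metis borel_prod sets_lborel sets_pair_measure_cong)
    ultimately show "(\<lambda>(p, y). f (fst p, y) * \<rho> (snd p - y)) \<in> borel_measurable ((borel :: (real \<times> 'a) measure) \<Otimes>\<^sub>M lborel)"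
      using measurable_cong_sets[of borel "borel \<Otimes>\<^sub>M lborel"] by (auto simp: case_prod_beta')
  qed
  then show ?thesis by (simp add: conv_x_def[abs_def] conv_def)
qed

text \<open>Tonelli moves the convolution from \<open>f\<close> to the weight: the absolute values
  of \<open>\<zeta>\<close> and of the reflected kernel convolve to \<open>\<kappa>\<close>, again
  continuous with compact support, and against such functions \<open>f\<close> is integrable by
  assumption.\<close>

lemma conv_x_integrable:
  fixes f :: "real \<times> 'a::euclidean_space \<Rightarrow> real"
  assumes [measurable]: "f \<in> borel_measurable borel"
    and f: "\<And>\<phi>. cc_fn \<phi> \<Longrightarrow> integrable lborel (\<lambda>p. f p * \<phi> (snd p))"
    and \<rho>: "cc_fn \<rho>" and \<zeta>: "cc_fn \<zeta>"
  shows "integrable lborel (\<lambda>p. conv_x f \<rho> p * \<zeta> (snd p))"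
proof -
  have [measurable]: "\<rho> \<in> borel_measurable borel" "\<zeta> \<in> borel_measurable borel"
    using \<rho> \<zeta> by (simp_all add: cc_fn_measurable)
  define \<kappa> where "\<kappa> = conv (\<lambda>x. \<bar>\<zeta> x\<bar>) (\<lambda>z. \<bar>\<rho> (0 - z)\<bar>)"
  have c\<kappa>: "cc_fn \<kappa>" unfolding \<kappa>_def by (intro cc_conv cc_fn_abs \<zeta> cc_fn_reflect[OF \<rho>])
  have \<kappa>0: "\<kappa> y \<ge> 0" for y unfolding \<kappa>_def conv_def by (intro integral_nonneg_AE AE_I2) simp
  have \<kappa>_eq: "(\<integral>\<^sup>+x. ennreal (\<bar>\<zeta> x\<bar> * \<bar>\<rho> (x - y)\<bar>) \<partial>lborel) = ennreal (\<kappa> y)" for y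
  proof -
    have "cc_fn (\<lambda>x. \<bar>\<rho> (x - y)\<bar>)" using cc_fn_abs[OF cc_fn_shift[OF \<rho>, of "- y"]] by simp
    from integrable_cc[OF cc_fn_mult[OF cc_fn_continuous[OF cc_fn_abs[OF \<zeta>]] this]]
    have "integrable lborel (\<lambda>x. \<bar>\<zeta> x\<bar> * \<bar>\<rho> (x - y)\<bar>)" .
    from nn_integral_eq_integral[OF this] show ?thesis by (simp add: \<kappa>_def conv_def)
  qed
  have "(\<integral>\<^sup>+p. ennreal \<bar>conv_x f \<rho> p * \<zeta> (snd p)\<bar> \<partial>lborel)
      = (\<integral>\<^sup>+t. \<integral>\<^sup>+x. ennreal \<bar>conv (\<lambda>y. f (t, y)) \<rho> x * \<zeta> x\<bar> \<partial>lborel \<partial>lborel)"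
    by (subst nn_integral_prod, simp, simp add: conv_x_def)
  also have "\<dots> \<le> (\<integral>\<^sup>+t. \<integral>\<^sup>+y. ennreal (\<bar>f (t, y)\<bar> * \<kappa> y) \<partial>lborel \<partial>lborel)"
  proof (rule nn_integral_mono)
    fix t :: real
    have [measurable]: "(\<lambda>y. f (t, y)) \<in> borel_measurable borel" by (rule slice_measurable) simp
    have "(\<integral>\<^sup>+x. ennreal \<bar>conv (\<lambda>y. f (t, y)) \<rho> x * \<zeta> x\<bar> \<partial>lborel)
        \<le> (\<integral>\<^sup>+x. \<integral>\<^sup>+y. ennreal (\<bar>f (t, y)\<bar> * (\<bar>\<zeta> x\<bar> * \<bar>\<rho> (x - y)\<bar>)) \<partial>lborel \<partial>lborel)"
    proof (rule nn_integral_mono)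
      fix x
      have "ennreal \<bar>conv (\<lambda>y. f (t, y)) \<rho> x * \<zeta> x\<bar> = ennreal \<bar>\<integral>y. f (t, y) * \<rho> (x - y) * \<zeta> x \<partial>lborel\<bar>"
        by (simp add: conv_def)
      also have "\<dots> \<le> (\<integral>\<^sup>+y. ennreal \<bar>f (t, y) * \<rho> (x - y) * \<zeta> x\<bar> \<partial>lborel)" by (rule ennreal_abs_integral_le)
      finally show "ennreal \<bar>conv (\<lambda>y. f (t, y)) \<rho> x * \<zeta> x\<bar> \<le> (\<integral>\<^sup>+y. ennreal (\<bar>f (t, y)\<bar> * (\<bar>\<zeta> x\<bar> * \<bar>\<rho> (x - y)\<bar>)) \<partial>lborel)"
        by (simp add: abs_mult mult_ac)
    qed
    also have "\<dots> = (\<integral>\<^sup>+y. \<integral>\<^sup>+x. ennreal (\<bar>f (t, y)\<bar> * (\<bar>\<zeta> x\<bar> * \<bar>\<rho> (x - y)\<bar>)) \<partial>lborel \<partial>lborel)"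
      by (rule lborel_pair.Fubini'[symmetric]) (unfold case_prod_beta', measurable)
    also have "\<dots> = (\<integral>\<^sup>+y. ennreal (\<bar>f (t, y)\<bar> * \<kappa> y) \<partial>lborel)"
    proof (rule nn_integral_cong)
      fix y
      have "(\<integral>\<^sup>+x. ennreal (\<bar>f (t, y)\<bar> * (\<bar>\<zeta> x\<bar> * \<bar>\<rho> (x - y)\<bar>)) \<partial>lborel)
          = (\<integral>\<^sup>+x. ennreal \<bar>f (t, y)\<bar> * ennreal (\<bar>\<zeta> x\<bar> * \<bar>\<rho> (x - y)\<bar>) \<partial>lborel)"
        by (intro nn_integral_cong ennreal_mult) auto
      also have "\<dots> = ennreal \<bar>f (t, y)\<bar> * ennreal (\<kappa> y)"
        unfolding \<kappa>_eq[symmetric] by (rule nn_integral_cmult) simp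
      also have "\<dots> = ennreal (\<bar>f (t, y)\<bar> * \<kappa> y)"
        by (rule ennreal_mult[symmetric]) (simp_all only: \<kappa>0 abs_ge_zero)
      finally show "(\<integral>\<^sup>+x. ennreal (\<bar>f (t, y)\<bar> * (\<bar>\<zeta> x\<bar> * \<bar>\<rho> (x - y)\<bar>)) \<partial>lborel) = ennreal (\<bar>f (t, y)\<bar> * \<kappa> y)" .
    qed
    finally show "(\<integral>\<^sup>+x. ennreal \<bar>conv (\<lambda>y. f (t, y)) \<rho> x * \<zeta> x\<bar> \<partial>lborel) \<le> (\<integral>\<^sup>+y. ennreal (\<bar>f (t, y)\<bar> * \<kappa> y) \<partial>lborel)" .
  qed
  also have "\<dots> = (\<integral>\<^sup>+p. ennreal \<bar>f p * \<kappa> (snd p)\<bar> \<partial>lborel)"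
  proof -
    have [measurable]: "\<kappa> \<in> borel_measurable borel" by (rule cc_fn_measurable[OF c\<kappa>])
    show ?thesis by (subst nn_integral_prod) (simp_all add: abs_mult \<kappa>0)
  qed
  also have "\<dots> < \<infinity>" using f[OF c\<kappa>] by (simp add: integrable_iff_bounded)
  finally show ?thesis by (simp add: integrable_iff_bounded)
qed

text \<open>Jensen for the probability density \<open>\<rho>\<close>: the squared error is at most a
  mean of squared translation errors, and only shifts in the support of \<open>\<rho>\<close> count.
  The shift acts on space alone, hence the vector (0, - h).\<close>

lemma conv_x_L2:
  fixes f :: "real \<times> 'a::euclidean_space \<Rightarrow> real"
  assumes f: "L2_fn f" and \<rho>: "cc_fn \<rho>" "\<And>x. 0 \<le> \<rho> x" "(\<integral>x. \<rho> x \<partial>lborel) = 1"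
    and \<eta>: "\<And>h. \<rho> h \<noteq> 0 \<Longrightarrow> L2_norm (\<lambda>p. f (p + (0, - h)) - f p) \<le> \<eta>" and \<eta>0: "\<eta> \<ge> 0"
  shows "L2_fn (\<lambda>p. conv_x f \<rho> p - f p)" "L2_norm (\<lambda>p. conv_x f \<rho> p - f p) \<le> \<eta>"
proof -
  have [measurable]: "f \<in> borel_measurable borel" by (rule L2_fn_measurable[OF f])
  have [measurable]: "\<rho> \<in> borel_measurable borel" by (rule cc_fn_measurable[OF \<rho>(1)])
  have i\<rho>: "integrable lborel \<rho>" by (rule integrable_cc[OF \<rho>(1)])
  have d: "L2_fn (\<lambda>p. f (p + (0, - h)) - f p)" for h :: 'a by (intro L2_fn_diff L2_fn_translate f)
  have "(\<integral>\<^sup>+p. ennreal ((conv_x f \<rho> p - f p)\<^sup>2) \<partial>lborel)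
      = (\<integral>\<^sup>+t. \<integral>\<^sup>+x. ennreal ((conv (\<lambda>y. f (t, y)) \<rho> x - f (t, x))\<^sup>2) \<partial>lborel \<partial>lborel)"
    by (subst nn_integral_prod, simp, simp add: conv_x_def)
  also have "\<dots> \<le> (\<integral>\<^sup>+t. \<integral>\<^sup>+x. \<integral>\<^sup>+h. ennreal (\<rho> h * (f (t, x - h) - f (t, x))\<^sup>2) \<partial>lborel \<partial>lborel \<partial>lborel)"
  proof (rule nn_integral_mono_AE, rule AE_mp[OF L2_fn_slice[OF f]], intro AE_I2 impI nn_integral_mono)
    fix t x assume L: "L2_fn (\<lambda>x. f (t, x))"
    have [measurable]: "(\<lambda>y. f (t, y)) \<in> borel_measurable borel" by (rule slice_measurable) simp
    have "(\<lambda>h. f (t, x - h)) \<in> borel_measurable borel"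
      by (rule measurable_compose[OF _ \<open>(\<lambda>y. f (t, y)) \<in> borel_measurable borel\<close>]) simp
    note [measurable] = this
    note cr = conv_reflect[OF L2_fn_locally_integrable[OF L] \<rho>(1), of x]
    have "conv (\<lambda>y. f (t, y)) \<rho> x - f (t, x) = (\<integral>h. f (t, x - h) * \<rho> h \<partial>lborel) - f (t, x) * (\<integral>h. \<rho> h \<partial>lborel)"
      by (simp add: cr(1) \<rho>(3))
    also have "\<dots> = (\<integral>h. f (t, x - h) * \<rho> h - f (t, x) * \<rho> h \<partial>lborel)"
      using cr(2) i\<rho> by simp
    also have "\<dots> = (\<integral>h. \<rho> h * (f (t, x - h) - f (t, x)) \<partial>lborel)"
      by (simp add: algebra_simps)
    finally show "ennreal ((conv (\<lambda>y. f (t, y)) \<rho> x - f (t, x))\<^sup>2) \<le> (\<integral>\<^sup>+h. ennreal (\<rho> h * (f (t, x - h) - f (t, x))\<^sup>2) \<partial>lborel)"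
      using square_integral_Jensen[of "\<lambda>h. f (t, x - h) - f (t, x)" lborel \<rho>] i\<rho> \<rho> by simp
  qed
  also have "\<dots> = (\<integral>\<^sup>+p. \<integral>\<^sup>+h. ennreal (\<rho> h * (f (p + (0, - h)) - f p)\<^sup>2) \<partial>lborel \<partial>lborel)"
    by (subst nn_integral_prod) (simp_all add: lborel.borel_measurable_nn_integral case_prod_beta')
  also have "\<dots> = (\<integral>\<^sup>+h. \<integral>\<^sup>+p. ennreal (\<rho> h * (f (p + (0, - h)) - f p)\<^sup>2) \<partial>lborel \<partial>lborel)"
    by (rule lborel_pair.Fubini'[symmetric]) (simp add: case_prod_beta')
  also have "\<dots> \<le> (\<integral>\<^sup>+h. ennreal (\<rho> h) * ennreal (\<eta>\<^sup>2) \<partial>lborel)"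
  proof (rule nn_integral_mono)
    fix h :: 'a
    have "(\<integral>\<^sup>+p. ennreal (\<rho> h * (f (p + (0, - h)) - f p)\<^sup>2) \<partial>lborel) = ennreal (\<rho> h) * ennreal ((L2_norm (\<lambda>p. f (p + (0, - h)) - f p))\<^sup>2)"
      using \<rho>(2) by (simp add: ennreal_mult nn_integral_cmult L2_norm_nn_integral[OF d])
    also have "\<dots> \<le> ennreal (\<rho> h) * ennreal (\<eta>\<^sup>2)"
      using \<eta>[of h] by (cases "\<rho> h = 0") (auto intro!: mult_left_mono ennreal_leI power_mono L2_norm_nonneg)
    finally show "(\<integral>\<^sup>+p. ennreal (\<rho> h * (f (p + (0, - h)) - f p)\<^sup>2) \<partial>lborel) \<le> ennreal (\<rho> h) * ennreal (\<eta>\<^sup>2)" .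
  qed
  also have "\<dots> = ennreal (\<eta>\<^sup>2)"
    using nn_integral_eq_integral[OF i\<rho>] \<rho> by (simp add: nn_integral_multc)
  finally have le: "(\<integral>\<^sup>+p. ennreal ((conv_x f \<rho> p - f p)\<^sup>2) \<partial>lborel) \<le> ennreal (\<eta>\<^sup>2)" .
  show L: "L2_fn (\<lambda>p. conv_x f \<rho> p - f p)"
    using le by (subst L2_fn_nn_integral) (auto intro: le_less_trans)
  show "L2_norm (\<lambda>p. conv_x f \<rho> p - f p) \<le> \<eta>"
    using le unfolding L2_norm_nn_integral[OF L]
    by (simp add: ennreal_le_iff L2_norm_nonneg power_mono_iff \<eta>0)
qed

section \<open>The transport-diffusion equation with Borel data\<close>

lemma sqrt_japanese: "sqrt (japanese x) * sqrt (1 + (norm x)\<^sup>2) = 1"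
  by (simp add: japanese_def real_sqrt_inverse add_nonneg_eq_0_iff)

lemma cc_fn_weight:
  assumes "cc_fn \<phi>"
  shows "cc_fn (\<lambda>x::real^'n. sqrt (1 + (norm x)\<^sup>2) * \<phi> x)"
  by (intro cc_fn_mult assms continuous_intros)

lemma cc_fn_prod:
  fixes \<theta> :: "'a::euclidean_space \<Rightarrow> real" and \<phi> :: "'b::euclidean_space \<Rightarrow> real"
  assumes \<theta>: "cc_fn \<theta>" and \<phi>: "cc_fn \<phi>"
  shows "cc_fn (\<lambda>p. \<theta> (fst p) * \<phi> (snd p))"
proof -
  obtain r s where r: "r \<ge> 0" "\<And>x. norm x > r \<Longrightarrow> \<theta> x = 0" and s: "s \<ge> 0" "\<And>x. norm x > s \<Longrightarrow> \<phi> x = 0"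
    using cc_fn_support[OF \<theta>] cc_fn_support[OF \<phi>] by metis
  have "\<theta> (fst p) * \<phi> (snd p) = 0" if "norm p > r + s" for p :: "'a \<times> 'b"
  proof -
    have "norm p \<le> norm (fst p) + norm (snd p)" using norm_Pair_le[of "fst p" "snd p"] by simp
    then have "norm (fst p) > r \<or> norm (snd p) > s" using that by linarith
    then show ?thesis using r s by auto
  qed
  then show ?thesis using assms unfolding cc_fn_def
    by (intro conjI exI[of _ "r + s"])
       (auto intro!: continuous_intros continuous_on_compose2[of UNIV \<theta>] continuous_on_compose2[of UNIV \<phi>])
qed

lemma L2_fn_window:
  fixes \<phi> :: "'b::euclidean_space \<Rightarrow> real" and T :: real
  assumes \<phi>: "cc_fn \<phi>"
  shows "L2_fn (\<lambda>p. indicat_real {0<..T} (fst p) * \<phi> (snd p))"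
proof -
  \<comment> \<open>A tent that is at least 1 on the window, so that the discontinuous indicator
    inherits square integrability from a continuous function with compact support.\<close>
  define \<Theta> where "\<Theta> t = max 0 (T + 1 - \<bar>t\<bar>)" for t :: real
  have "cc_fn \<Theta>"
    unfolding cc_fn_def \<Theta>_def by (intro conjI exI[of _ "T + 1"]) (auto intro!: continuous_intros)
  then have "L2_fn (\<lambda>p. \<Theta> (fst p) * \<phi> (snd p))" by (intro cc_fn_L2 cc_fn_prod \<phi>)
  then show ?thesis
  proof (rule L2_fn_bound[where c=1])
    have [measurable]: "\<phi> \<in> borel_measurable borel" by (rule cc_fn_measurable[OF \<phi>])
    show "(\<lambda>p. indicat_real {0<..T} (fst p) * \<phi> (snd p)) \<in> borel_measurable borel" by measurable
    fix p :: "real \<times> 'b"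
    have "indicat_real {0<..T} (fst p) \<le> \<bar>\<Theta> (fst p)\<bar>" by (auto simp: indicator_def \<Theta>_def)
    then show "\<bar>indicat_real {0<..T} (fst p) * \<phi> (snd p)\<bar> \<le> 1 * \<bar>\<Theta> (fst p) * \<phi> (snd p)\<bar>"
      by (simp add: abs_mult mult_right_mono)
  qed
qed

lemma integrable_bounded_mult:
  fixes f g :: "'a::euclidean_space \<Rightarrow> real"
  assumes f: "integrable lborel f" and [measurable]: "g \<in> borel_measurable borel" and B: "\<And>x. \<bar>g x\<bar> \<le> B"
  shows "integrable lborel (\<lambda>x. g x * f x)"
proof -
  have [measurable]: "f \<in> borel_measurable borel" using borel_measurable_integrable[OF f] by simp
  have "integrable lborel (\<lambda>x. B * f x)" using f by simp
  then show ?thesis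
  proof (rule Bochner_Integration.integrable_bound)
    have "\<bar>g x\<bar> \<le> \<bar>B\<bar>" for x using B[of x] by linarith
    then show "AE x in lborel. norm (g x * f x) \<le> norm (B * f x)"
      by (intro AE_I2) (simp add: abs_mult mult_right_mono)
  qed simp
qed

lemma box_prod:
  fixes c d :: "'a::euclidean_space \<times> 'b::euclidean_space"
  shows "box c d = box (fst c) (fst d) \<times> box (snd c) (snd d)"
  by (rule set_eqI) (auto simp: mem_box Basis_prod_def ball_Un inner_prod_def mem_Times_iff)

text \<open>The hypotheses in the form in which the argument uses them: scalar components that are
  Borel measurable on all of space-time, so that every slice at a fixed time is Borel measurable,
  and equations tested with products \<theta>(t) \<psi>(x). Such products suffice because time is
  treated by a primitive in t for each \<psi>, and because boxes of space-time are products.\<close>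

locale transport_data =
  fixes a :: "real \<times> (real^3) \<Rightarrow> real" and v :: "3 \<Rightarrow> real \<times> (real^3) \<Rightarrow> real"
    and G :: "3 \<Rightarrow> 3 \<Rightarrow> real \<times> (real^3) \<Rightarrow> real" and A :: "real \<Rightarrow> (real^3 \<Rightarrow> real) \<Rightarrow> real"
  assumes a_L2: "L2_fn a"
    and v_meas[measurable]: "\<And>i. v i \<in> borel_measurable borel"
    and G_L2: "\<And>i j. L2_fn (G i j)"
    and v_L6: "AE t in lborel. \<forall>i. integrable lborel (\<lambda>x. (v i (t, x)) ^ 6)"
    and v_weak: "AE t in lborel. \<forall>i j. weak_pderiv (\<lambda>x. v i (t, x)) (axis j 1) (\<lambda>x. G i j (t, x))"
    and G_past: "\<And>i j t x. t \<le> 0 \<Longrightarrow> G i j (t, x) = 0"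
    and a_past: "\<And>t x. t \<le> 0 \<Longrightarrow> a (t, x) = 0"
    and v_div: "\<And>\<theta> \<psi>. test_fn {0<..} \<theta> \<Longrightarrow> test_fn UNIV \<psi> \<Longrightarrow>
      (\<integral>p. (\<Sum>i\<in>UNIV. v i p * (\<theta> (fst p) * pd i \<psi> (snd p))) \<partial>lborel) = 0"
    and a_eq: "\<And>\<theta> \<psi>. test_fn {0<..} \<theta> \<Longrightarrow> test_fn UNIV \<psi> \<Longrightarrow>
      (\<integral>p. a p * (dderiv \<theta> 1 (fst p) * \<psi> (snd p) + (\<Sum>i\<in>UNIV. v i p * (\<theta> (fst p) * pd i \<psi> (snd p)))
        + \<theta> (fst p) * (\<Sum>i\<in>UNIV. pd i (pd i \<psi>) (snd p))) \<partial>lborel) = 0"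
    and A_cont: "\<And>\<psi>. test_fn UNIV \<psi> \<Longrightarrow> continuous_on {0..} (\<lambda>t. A t \<psi>)"
    and A_0: "\<And>\<psi>. test_fn UNIV \<psi> \<Longrightarrow> A 0 \<psi> = 0"
    and A_a: "AE t in lborel. t > 0 \<longrightarrow> (\<forall>\<psi>. test_fn UNIV \<psi> \<longrightarrow> A t \<psi> = (\<integral>x. a (t, x) * \<psi> x \<partial>lborel))"
begin

section \<open>Integrability of the velocity and the trace of its gradient\<close>

lemma a_meas[measurable]: "a \<in> borel_measurable borel"
  by (rule L2_fn_measurable[OF a_L2])

lemma G_meas[measurable]: "G i j \<in> borel_measurable borel"
  by (rule L2_fn_measurable[OF G_L2])

lemma v_slice_meas: "(\<lambda>x. v i (t, x)) \<in> borel_measurable borel"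
  by (rule slice_measurable) simp

lemma G_slice_L2: "AE t in lborel. \<forall>i j. L2_fn (\<lambda>x. G i j (t, x))"
proof -
  have "AE t in lborel. \<forall>i\<in>UNIV. \<forall>j\<in>UNIV. L2_fn (\<lambda>x. G i j (t, x))"
    by (intro AE_finite_allI finite L2_fn_slice G_L2)
  then show ?thesis by simp
qed

text \<open>Hardy's inequality at almost every time, integrated in time. Through this bound v enters
  the space-time integrals: together with \<open>a_L2\<close> it makes a v / sqrt(1 + |x|^2)
  integrable.\<close>

lemma v_weighted_L2: "L2_fn (\<lambda>p. v i p * sqrt (japanese (snd p)))"
proof -
  have jm[measurable]: "japanese \<in> borel_measurable (borel :: (real^3) measure)"
    by (rule borel_measurable_continuous_onI[OF japanese_continuous])
  have sq: "(v i p * sqrt (japanese (snd p)))\<^sup>2 = (v i p)\<^sup>2 * japanese (snd p)" for p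
    by (simp add: power_mult_distrib japanese_pos less_imp_le)
  have m: "(\<lambda>p. v i p * sqrt (japanese (snd p))) \<in> borel_measurable borel" by measurable
  have mN: "(\<lambda>t. ennreal ((L2_norm (\<lambda>x. G i j (t, x)))\<^sup>2)) \<in> borel_measurable lborel" for j
  proof -
    have "(\<lambda>t. \<integral>x. (G i j (t, x))\<^sup>2 \<partial>lborel) \<in> borel_measurable lborel"
      by (rule borel_measurable_integrable[OF integrable_slice_integral[OF L2_fn_integrable[OF G_L2]]])
    then show ?thesis unfolding L2_norm_power2 by simp
  qed
  have "(\<integral>\<^sup>+p. ennreal ((v i p * sqrt (japanese (snd p)))\<^sup>2) \<partial>lborel)
      = (\<integral>\<^sup>+t. \<integral>\<^sup>+x. ennreal ((v i (t, x))\<^sup>2 * japanese x) \<partial>lborel \<partial>lborel)"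
    unfolding sq by (subst nn_integral_prod) simp_all
  also have "\<dots> \<le> (\<integral>\<^sup>+t. (\<Sum>j\<in>UNIV. 12 * ennreal ((L2_norm (\<lambda>x. G i j (t, x)))\<^sup>2)) \<partial>lborel)"
  proof (rule nn_integral_mono_AE)
    show "AE t in lborel. (\<integral>\<^sup>+x. ennreal ((v i (t, x))\<^sup>2 * japanese x) \<partial>lborel)
        \<le> (\<Sum>j\<in>UNIV. 12 * ennreal ((L2_norm (\<lambda>x. G i j (t, x)))\<^sup>2))"
      using v_L6 v_weak G_slice_L2
    proof eventually_elim
      fix t assume "\<forall>i. integrable lborel (\<lambda>x. (v i (t, x)) ^ 6)"
        "\<forall>i j. weak_pderiv (\<lambda>x. v i (t, x)) (axis j 1) (\<lambda>x. G i j (t, x))" "\<forall>i j. L2_fn (\<lambda>x. G i j (t, x))"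
      then have "(\<integral>\<^sup>+x. ennreal ((v i (t, x))\<^sup>2 * japanese x) \<partial>lborel)
          \<le> ennreal (4 * (\<Sum>j\<in>UNIV. L2_norm (\<lambda>x. G i j (t, x)))\<^sup>2)"
        by (intro Hardy[of "\<lambda>x. v i (t, x)" "\<lambda>j x. G i j (t, x)"] v_slice_meas) auto
      \<comment> \<open>The squared sum of three norms costs a factor 3, hence 12 from the 4 in
        Hardy's inequality.\<close>
      also have "(\<Sum>j\<in>UNIV. 1 * L2_norm (\<lambda>x. G i j (t, x)))\<^sup>2 \<le> (\<Sum>j\<in>(UNIV::3 set). 1\<^sup>2) * (\<Sum>j\<in>UNIV. (L2_norm (\<lambda>x. G i j (t, x)))\<^sup>2)"
        by (rule Cauchy_Schwarz_ineq_sum)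
      then have "ennreal (4 * (\<Sum>j\<in>UNIV. L2_norm (\<lambda>x. G i j (t, x)))\<^sup>2) \<le> ennreal (12 * (\<Sum>j\<in>UNIV. (L2_norm (\<lambda>x. G i j (t, x)))\<^sup>2))"
        by (intro ennreal_leI) simp
      also have "\<dots> = (\<Sum>j\<in>UNIV. 12 * ennreal ((L2_norm (\<lambda>x. G i j (t, x)))\<^sup>2))"
        by (simp add: ennreal_mult' sum_distrib_left flip: sum_ennreal)
      finally show "(\<integral>\<^sup>+x. ennreal ((v i (t, x))\<^sup>2 * japanese x) \<partial>lborel)
        \<le> (\<Sum>j\<in>UNIV. 12 * ennreal ((L2_norm (\<lambda>x. G i j (t, x)))\<^sup>2))" .
    qed
  qed
  also have "\<dots> = (\<Sum>j\<in>UNIV. 12 * ennreal ((L2_norm (G i j))\<^sup>2))"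
    using mN by (simp add: nn_integral_sum nn_integral_cmult L2_norm_slice[OF G_L2])
  also have "\<dots> < \<infinity>" by (simp add: ennreal_mult_less_top)
  finally show ?thesis by (subst L2_fn_nn_integral[OF m]) auto
qed

text \<open>On each ball the weight of \<open>v_weighted_L2\<close> is bounded below. Local square
  integrability of v at a fixed time is what makes a v locally integrable there.\<close>

lemma v_slice_L2loc: "AE t in lborel. \<forall>i. locally_integrable (\<lambda>x. (v i (t, x))\<^sup>2)"
proof -
  have "AE t in lborel. \<forall>i\<in>UNIV. integrable lborel (\<lambda>x. (v i (t, x) * sqrt (japanese x))\<^sup>2)"
    using AE_integrable_slice[OF L2_fn_integrable[OF v_weighted_L2]] by (intro AE_finite_allI finite) simp
  then show ?thesis
  proof eventually_elim
    fix t assume *: "\<forall>i\<in>UNIV. integrable lborel (\<lambda>x. (v i (t, x) * sqrt (japanese x))\<^sup>2)"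
    show "\<forall>i. locally_integrable (\<lambda>x. (v i (t, x))\<^sup>2)"
    proof
      fix i
      have [measurable]: "(\<lambda>x. v i (t, x)) \<in> borel_measurable borel" by (rule v_slice_meas)
      have li: "locally_integrable (\<lambda>x. (v i (t, x) * sqrt (japanese x))\<^sup>2)"
        by (rule integrable_imp_locally_integrable) (use * in simp)
      have "integrable lborel (\<lambda>x. (v i (t, x) * sqrt (japanese x))\<^sup>2 * (indicat_real (cball 0 r) x * (1 + (norm x)\<^sup>2)))" for r
      proof (rule locally_integrable_mult_bound[OF li, of _ "1 + r\<^sup>2" r])
        have [measurable]: "cball (0::real^3) r \<in> sets borel" by simp
        show "(\<lambda>x::real^3. indicat_real (cball 0 r) x * (1 + (norm x)\<^sup>2)) \<in> borel_measurable borel" by measurable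
        fix x :: "real^3"
        show "\<bar>indicat_real (cball 0 r) x * (1 + (norm x)\<^sup>2)\<bar> \<le> 1 + r\<^sup>2"
          by (cases "norm x \<le> r") (auto intro!: power_mono)
      qed auto
      moreover have "(v i (t, x) * sqrt (japanese x))\<^sup>2 * (indicat_real (cball 0 r) x * (1 + (norm x)\<^sup>2))
          = indicat_real (cball 0 r) x * (v i (t, x))\<^sup>2" for x r
      proof -
        have "(sqrt (japanese x))\<^sup>2 * (1 + (norm x)\<^sup>2) = 1"
          using norm2_japanese[of x] by (simp add: japanese_pos less_imp_le algebra_simps)
        then show ?thesis by (simp add: power_mult_distrib mult_ac)
      qed
      ultimately show "locally_integrable (\<lambda>x. (v i (t, x))\<^sup>2)" by (simp add: locally_integrable_def)
    qed
  qed
qed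

text \<open>The compactly supported factor pays for the growing weight sqrt(1 + |x|^2); what is left
  is a product of two square integrable functions, \<open>a\<close> and the weighted v, with no
  restriction in time.\<close>

lemma integrable_av:
  assumes \<phi>: "cc_fn \<phi>"
  shows "integrable lborel (\<lambda>p. a p * v i p * \<phi> (snd p))"
proof -
  have c: "cc_fn (\<lambda>x::real^3. sqrt (1 + (norm x)\<^sup>2) * \<phi> x)" by (rule cc_fn_weight[OF \<phi>])
  note [measurable] = cc_fn_measurable[OF \<phi>]
  obtain B where "\<And>x. \<bar>sqrt (1 + (norm x)\<^sup>2) * \<phi> x\<bar> \<le> B" using cc_fn_bounded[OF c] by blast
  then have i: "integrable lborel (\<lambda>p. (sqrt (1 + (norm (snd p))\<^sup>2) * \<phi> (snd p)) * (a p * (v i p * sqrt (japanese (snd p)))))"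
    by (intro integrable_bounded_mult[OF L2_mult_integrable[OF a_L2 v_weighted_L2], where B=B])
       simp_all
  have "(sqrt (1 + (norm (snd p))\<^sup>2) * \<phi> (snd p)) * (a p * (v i p * sqrt (japanese (snd p)))) = a p * v i p * \<phi> (snd p)" for p
    using sqrt_japanese[of "snd p"] by (simp add: mult_ac)
  with i show ?thesis by simp
qed

lemma integrable_v:
  assumes \<theta>: "cc_fn \<theta>" and \<phi>: "cc_fn \<phi>"
  shows "integrable lborel (\<lambda>p. v i p * (\<theta> (fst p) * \<phi> (snd p)))"
proof -
  have L: "L2_fn (\<lambda>p. \<theta> (fst p) * (sqrt (1 + (norm (snd p))\<^sup>2) * \<phi> (snd p)))"
    by (intro cc_fn_L2 cc_fn_prod[OF \<theta> cc_fn_weight[OF \<phi>]])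
  have i: "integrable lborel (\<lambda>p. (v i p * sqrt (japanese (snd p))) * (\<theta> (fst p) * (sqrt (1 + (norm (snd p))\<^sup>2) * \<phi> (snd p))))"
    by (rule L2_mult_integrable[OF v_weighted_L2 L])
  have "(v i p * sqrt (japanese (snd p))) * (\<theta> (fst p) * (sqrt (1 + (norm (snd p))\<^sup>2) * \<phi> (snd p))) = v i p * (\<theta> (fst p) * \<phi> (snd p))" for p
    using sqrt_japanese[of "snd p"] by (simp add: mult_ac)
  with i show ?thesis by simp
qed

lemma integrable_a_window:
  assumes \<phi>: "cc_fn \<phi>"
  shows "integrable lborel (\<lambda>p. indicat_real {0<..T} (fst p) * a p * \<phi> (snd p))"
  using L2_mult_integrable[OF a_L2 L2_fn_window[OF \<phi>, of T]] by (simp add: mult_ac)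

lemma v_weak_integral:
  assumes \<theta>: "test_fn {0<..} \<theta>" and \<psi>: "test_fn UNIV \<psi>"
  shows "(\<integral>p. v i p * (\<theta> (fst p) * pd j \<psi> (snd p)) \<partial>lborel) = - (\<integral>p. G i j p * (\<theta> (fst p) * \<psi> (snd p)) \<partial>lborel)"
proof -
  note c = test_fn_cc[OF \<theta>] test_fn_cc[OF \<psi>] test_fn_dderiv_cc[OF \<psi>]
  have iG: "integrable lborel (\<lambda>p. G i j p * (\<theta> (fst p) * \<psi> (snd p)))"
    by (rule integrable_mult_cc[OF L2_fn_locally_integrable[OF G_L2] cc_fn_prod[OF c(1,2)]])
  note iv = integrable_v[OF c(1,3), of i "axis j 1"]
  have "(\<integral>p. v i p * (\<theta> (fst p) * pd j \<psi> (snd p)) \<partial>lborel) = (\<integral>t. \<integral>x. v i (t, x) * (\<theta> t * pd j \<psi> x) \<partial>lborel \<partial>lborel)"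
    by (subst integral_prod[OF iv]) simp
  also have "\<dots> = (\<integral>t. - (\<integral>x. G i j (t, x) * (\<theta> t * \<psi> x) \<partial>lborel) \<partial>lborel)"
  proof (rule integral_cong_AE)
    show "(\<lambda>t. \<integral>x. v i (t, x) * (\<theta> t * pd j \<psi> x) \<partial>lborel) \<in> borel_measurable lborel"
      using integrable_slice_integral[OF iv] by simp
    show "(\<lambda>t. - (\<integral>x. G i j (t, x) * (\<theta> t * \<psi> x) \<partial>lborel)) \<in> borel_measurable lborel"
      using integrable_slice_integral[OF iG] by simp
    show "AE t in lborel. (\<integral>x. v i (t, x) * (\<theta> t * pd j \<psi> x) \<partial>lborel) = - (\<integral>x. G i j (t, x) * (\<theta> t * \<psi> x) \<partial>lborel)"
      using v_weak
    proof eventually_elim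
      fix t assume "\<forall>i j. weak_pderiv (\<lambda>x. v i (t, x)) (axis j 1) (\<lambda>x. G i j (t, x))"
      then have "(\<integral>x. v i (t, x) * pd j \<psi> x \<partial>lborel) = - (\<integral>x. G i j (t, x) * \<psi> x \<partial>lborel)"
        using \<psi> by (simp add: weak_pderiv_def)
      then show "(\<integral>x. v i (t, x) * (\<theta> t * pd j \<psi> x) \<partial>lborel) = - (\<integral>x. G i j (t, x) * (\<theta> t * \<psi> x) \<partial>lborel)"
        by (simp add: mult.left_commute[of _ "\<theta> t"])
    qed
  qed
  also have "\<dots> = - (\<integral>p. G i j p * (\<theta> (fst p) * \<psi> (snd p)) \<partial>lborel)"
    by (subst integral_prod[OF iG]) simp
  finally show ?thesis .
qed

text \<open>The trace of the gradient is a square integrable function, and the divergence condition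
  says that it is orthogonal to all products \<theta>(t) \<psi>(x). Products of bumps approximate
  the indicators of boxes, and a function with vanishing box integrals is 0 almost
  everywhere.\<close>

lemma trace_zero: "AE p in lborel. (\<Sum>i\<in>UNIV. G i i p) = 0"
proof -
  define g where "g p = (\<Sum>i\<in>UNIV. G i i p)" for p
  have gL: "L2_fn g" unfolding g_def[abs_def] by (intro L2_fn_sum finite G_L2)
  have [measurable]: "g \<in> borel_measurable borel" by (rule L2_fn_measurable[OF gL])
  have weak: "(\<integral>p. g p * (\<theta> (fst p) * \<psi> (snd p)) \<partial>lborel) = 0"
    if \<theta>: "test_fn {0<..} \<theta>" and \<psi>: "test_fn UNIV \<psi>" for \<theta> \<psi>
  proof -
    note c = test_fn_cc[OF \<theta>] test_fn_cc[OF \<psi>] test_fn_dderiv_cc[OF \<psi>]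
    have "0 = (\<Sum>i\<in>UNIV. \<integral>p. v i p * (\<theta> (fst p) * pd i \<psi> (snd p)) \<partial>lborel)"
      using v_div[OF \<theta> \<psi>] integrable_v[OF c(1,3)] by simp
    also have "\<dots> = - (\<Sum>i\<in>UNIV. \<integral>p. G i i p * (\<theta> (fst p) * \<psi> (snd p)) \<partial>lborel)"
      by (simp add: v_weak_integral[OF \<theta> \<psi>] sum_negf)
    also have "(\<Sum>i\<in>UNIV. \<integral>p. G i i p * (\<theta> (fst p) * \<psi> (snd p)) \<partial>lborel) = (\<integral>p. (\<Sum>i\<in>UNIV. G i i p * (\<theta> (fst p) * \<psi> (snd p))) \<partial>lborel)"
      by (intro Bochner_Integration.integral_sum[symmetric] integrable_mult_cc[OF L2_fn_locally_integrable[OF G_L2] cc_fn_prod[OF c(1,2)]])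
    finally show ?thesis by (simp add: g_def sum_distrib_right)
  qed
  \<comment> \<open>A bump in time is an admissible test function only if its closed support avoids
    t = 0; hence the restriction to times beyond \<delta>, removed at the end with countably many
    \<delta>.\<close>
  have late: "AE p in lborel. g p * indicat_real {\<delta><..} (fst p) = 0" if \<delta>: "\<delta> > 0" for \<delta>
  proof (rule AE_eq_0_if_box_integrals_eq_0)
    have "L2_fn (\<lambda>p. g p * indicat_real {\<delta><..} (fst p))"
      by (rule L2_fn_bound[OF gL, of _ 1]) (auto simp: indicator_def)
    then show "locally_integrable (\<lambda>p. g p * indicat_real {\<delta><..} (fst p))" by (rule L2_fn_locally_integrable)
    fix c d :: "real \<times> (real^3)"
    let ?b1 = "box_bump (max (fst c) \<delta>) (fst d)" and ?b2 = "box_bump (snd c) (snd d)"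
    obtain r where r: "box (max (fst c) \<delta>) (fst d) \<times> box (snd c) (snd d) \<subseteq> cball 0 r"
      using bounded_Times[OF bounded_box bounded_box, of "max (fst c) \<delta>" "fst d" "snd c" "snd d"]
      unfolding bounded_iff by fastforce
    have "(\<lambda>n. \<integral>p. g p * (?b1 n (fst p) * ?b2 n (snd p)) \<partial>lborel)
      \<longlonglongrightarrow> (\<integral>p. g p * (indicat_real (box (max (fst c) \<delta>) (fst d)) (fst p) * indicat_real (box (snd c) (snd d)) (snd p)) \<partial>lborel)"
    proof (rule integral_tendsto_locally_integrable[OF L2_fn_locally_integrable[OF gL]])
      have [measurable]: "?b1 n \<in> borel_measurable borel" "?b2 n \<in> borel_measurable borel" for n
        by (intro borel_measurable_continuous_onI smooth_fn_continuous smooth_box_bump)+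
      show "(\<lambda>p. ?b1 n (fst p) * ?b2 n (snd p)) \<in> borel_measurable borel" for n by measurable
      show "(\<lambda>n. ?b1 n (fst p) * ?b2 n (snd p)) \<longlonglongrightarrow>
          indicat_real (box (max (fst c) \<delta>) (fst d)) (fst p) * indicat_real (box (snd c) (snd d)) (snd p)" for p
        by (intro tendsto_mult box_bump_tendsto)
      show "\<bar>?b1 n (fst p) * ?b2 n (snd p)\<bar> \<le> 1" for n p
        using mult_mono[OF box_bump_le_1[of "max (fst c) \<delta>" "fst d" n "fst p"] box_bump_le_1[of "snd c" "snd d" n "snd p"]]
        by (simp add: abs_mult box_bump_nonneg)
      show "?b1 n (fst p) * ?b2 n (snd p) = 0" if "norm p > r" for n p
      proof -
        have "p \<notin> box (max (fst c) \<delta>) (fst d) \<times> box (snd c) (snd d)" using that r by auto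
        then have "fst p \<notin> box (max (fst c) \<delta>) (fst d) \<or> snd p \<notin> box (snd c) (snd d)" by (simp only: mem_Times_iff) blast
        then show ?thesis by (elim disjE) (simp_all only: box_bump_eq_0 mult_zero_left mult_zero_right not_False_eq_True)
      qed
    qed
    moreover have "(\<integral>p. g p * (?b1 n (fst p) * ?b2 n (snd p)) \<partial>lborel) = 0" for n
      by (rule weak) (use \<delta> in \<open>auto intro!: test_fn_box_bump\<close>)
    ultimately have z: "(\<integral>p. g p * (indicat_real (box (max (fst c) \<delta>) (fst d)) (fst p) * indicat_real (box (snd c) (snd d)) (snd p)) \<partial>lborel) = 0"
      by (simp add: LIMSEQ_const_iff)
    have "indicat_real {\<delta><..} (fst p) * indicat_real (box c d) p
        = indicat_real (box (max (fst c) \<delta>) (fst d)) (fst p) * indicat_real (box (snd c) (snd d)) (snd p)" for p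
    proof -
      have "box c d = box (fst c) (fst d) \<times> box (snd c) (snd d)" by (rule box_prod)
      then show ?thesis by (auto simp: indicator_def mem_Times_iff box_real)
    qed
    with z show "(\<integral>p. g p * indicat_real {\<delta><..} (fst p) * indicat_real (box c d) p \<partial>lborel) = 0"
      by (simp add: mult.assoc)
  qed
  have "AE p in lborel. \<forall>n::nat. g p * indicat_real {1 / real (Suc n)<..} (fst p) = 0"
    unfolding AE_all_countable by (intro allI late) simp
  then have "AE p in lborel. g p = 0"
  proof eventually_elim
    fix p assume *: "\<forall>n::nat. g p * indicat_real {1 / real (Suc n)<..} (fst p) = 0"
    show "g p = 0"
    proof (cases "fst p > 0")
      case True
      then obtain n where "1 / real (Suc n) < fst p" using reals_Archimedean by (auto simp: inverse_eq_divide)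
      with *[rule_format, of n] show ?thesis by simp
    next
      case False
      then show ?thesis using G_past[of "fst p" _ _ "snd p"] by (simp add: g_def)
    qed
  qed
  then show ?thesis by (simp add: g_def)
qed

lemma trace_slice: "AE t in lborel. AE x in lborel. (\<Sum>i\<in>UNIV. G i i (t, x)) = 0"
  by (rule AE_prod[OF trace_zero])

section \<open>The equation integrated in time against a function of space\<close>

definition flux :: "(real^3 \<Rightarrow> real) \<Rightarrow> real \<times> (real^3) \<Rightarrow> real" where
  "flux \<psi> p = (\<Sum>i\<in>UNIV. a p * v i p * pd i \<psi> (snd p) + a p * pd i (pd i \<psi>) (snd p))"

lemma flux_window:
  assumes \<psi>: "test_fn UNIV \<psi>"
  shows "integrable lborel (\<lambda>p. indicat_real {0<..T} (fst p) * flux \<psi> p)"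
proof -
  note \<psi>' = test_fn_dderiv[OF \<psi> axis_Basis]
  note c = test_fn_dderiv_cc[OF \<psi>] test_fn_dderiv_cc[OF \<psi>']
  have "integrable lborel (\<lambda>p. \<Sum>i\<in>UNIV. indicat_real {0<..T} (fst p) * (a p * v i p * pd i \<psi> (snd p))
      + indicat_real {0<..T} (fst p) * a p * pd i (pd i \<psi>) (snd p))"
    by (intro Bochner_Integration.integrable_sum Bochner_Integration.integrable_add integrable_a_window c
         integrable_bounded_mult[where B=1] integrable_av) (auto simp: indicator_def)
  then show ?thesis by (simp add: flux_def sum_distrib_left distrib_left mult.assoc)
qed

lemma integrable_window_mult:
  fixes F :: "real \<times> (real^3) \<Rightarrow> real"
  assumes F: "\<And>T. integrable lborel (\<lambda>p. indicat_real {0<..T} (fst p) * F p)" and \<theta>: "test_fn {0<..} \<theta>"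
  shows "integrable lborel (\<lambda>p. \<theta> (fst p) * F p)"
proof -
  obtain K where K: "compact K" "K \<subseteq> {0<..}" "\<And>x. x \<notin> K \<Longrightarrow> \<theta> x = 0" using test_fn_support[OF \<theta>] by blast
  obtain T where T: "\<And>x. x \<in> K \<Longrightarrow> norm x \<le> T" using compact_imp_bounded[OF K(1)] by (auto simp: bounded_iff)
  obtain B where B: "\<And>x. \<bar>\<theta> x\<bar> \<le> B" using cc_fn_bounded[OF test_fn_cc[OF \<theta>]] by blast
  have [measurable]: "\<theta> \<in> borel_measurable borel" by (rule cc_fn_measurable[OF test_fn_cc[OF \<theta>]])
  have "integrable lborel (\<lambda>p. \<theta> (fst p) * (indicat_real {0<..T} (fst p) * F p))"
    by (rule integrable_bounded_mult[OF F, where B=B]) (use B in auto)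
  moreover have "\<theta> t * (indicat_real {0<..T} t * y) = \<theta> t * y" for t y
    using K(2) K(3)[of t] T[of t] by (cases "t \<in> K") (auto simp: indicator_def)
  ultimately show ?thesis by simp
qed

text \<open>Tested with \<theta>(t) \<psi>(x) and integrated over x, the equation says that the
  space integral of \<open>flux \<psi>\<close> is the weak time derivative of
  \<open>A t \<psi>\<close>. Continuity and the initial value 0 then determine
  \<open>A t \<psi>\<close> at every t, not just at almost every one.\<close>

lemma A_representation:
  assumes \<psi>: "test_fn UNIV \<psi>" and t: "0 \<le> t"
  shows "A t \<psi> = (\<integral>s. indicat_real {0<..t} s * (\<integral>x. flux \<psi> (s, x) \<partial>lborel) \<partial>lborel)"
proof -
  have c: "cc_fn \<psi>" by (rule test_fn_cc[OF \<psi>])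
  have "A (max 0 t) \<psi> = (\<integral>s. indicat_real {0<..t} s * (\<integral>x. flux \<psi> (s, x) \<partial>lborel) \<partial>lborel)"
  \<comment> \<open>The maximum continues \<open>A t \<psi>\<close> to negative times by its initial
    value, which gives a continuous function on the whole line.\<close>
  proof (rule weak_time_derivative_representation[where \<alpha>="\<lambda>t. A (max 0 t) \<psi>", OF _ _ _ _ t])
    show "continuous_on UNIV (\<lambda>t. A (max 0 t) \<psi>)"
      by (rule continuous_on_compose2[OF A_cont[OF \<psi>]]) (auto intro!: continuous_intros)
    show "A (max 0 0) \<psi> = 0" using A_0[OF \<psi>] by simp
    show "integrable lborel (\<lambda>s. indicat_real {0<..T} s * (\<integral>x. flux \<psi> (s, x) \<partial>lborel))" for T
      using integrable_slice_integral[OF flux_window[OF \<psi>, of T]] by simp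
    fix \<theta> :: "real \<Rightarrow> real" assume \<theta>: "test_fn {0<..} \<theta>"
    have \<theta>': "test_fn {0<..} (dderiv \<theta> 1)" by (rule test_fn_dderiv[OF \<theta>]) simp
    have i1: "integrable lborel (\<lambda>p. dderiv \<theta> 1 (fst p) * (a p * \<psi> (snd p)))"
      by (rule integrable_window_mult[OF _ \<theta>']) (use integrable_a_window[OF c] in \<open>simp add: mult.assoc\<close>)
    have i2: "integrable lborel (\<lambda>p. \<theta> (fst p) * flux \<psi> p)"
      by (rule integrable_window_mult[OF flux_window[OF \<psi>] \<theta>])
    have "0 = (\<integral>p. dderiv \<theta> 1 (fst p) * (a p * \<psi> (snd p)) + \<theta> (fst p) * flux \<psi> p \<partial>lborel)"
      using a_eq[OF \<theta> \<psi>] by (simp add: flux_def sum_distrib_left sum.distrib distrib_left mult_ac add.assoc)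
    also have "\<dots> = (\<integral>p. dderiv \<theta> 1 (fst p) * (a p * \<psi> (snd p)) \<partial>lborel) + (\<integral>p. \<theta> (fst p) * flux \<psi> p \<partial>lborel)"
      by (rule Bochner_Integration.integral_add[OF i1 i2])
    also have "(\<integral>p. \<theta> (fst p) * flux \<psi> p \<partial>lborel) = (\<integral>s. \<theta> s * (\<integral>x. flux \<psi> (s, x) \<partial>lborel) \<partial>lborel)"
      by (subst integral_prod[OF i2]) simp
    also have "(\<integral>p. dderiv \<theta> 1 (fst p) * (a p * \<psi> (snd p)) \<partial>lborel) = (\<integral>s. \<integral>x. dderiv \<theta> 1 s * (a (s, x) * \<psi> x) \<partial>lborel \<partial>lborel)"
      by (subst integral_prod[OF i1]) simp
    also have "\<dots> = (\<integral>s. A (max 0 s) \<psi> * dderiv \<theta> 1 s \<partial>lborel)"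
    proof (rule integral_cong_AE)
      show "(\<lambda>s. \<integral>x. dderiv \<theta> 1 s * (a (s, x) * \<psi> x) \<partial>lborel) \<in> borel_measurable lborel"
        using integrable_slice_integral[OF i1] by simp
      have "continuous_on UNIV (\<lambda>t. A (max 0 t) \<psi>)"
        by (rule continuous_on_compose2[OF A_cont[OF \<psi>]]) (auto intro!: continuous_intros)
      then show "(\<lambda>s. A (max 0 s) \<psi> * dderiv \<theta> 1 s) \<in> borel_measurable lborel"
        using cc_fn_measurable[OF test_fn_cc[OF \<theta>']] borel_measurable_continuous_onI[of "\<lambda>t. A (max 0 t) \<psi>"] by simp
      show "AE s in lborel. (\<integral>x. dderiv \<theta> 1 s * (a (s, x) * \<psi> x) \<partial>lborel) = A (max 0 s) \<psi> * dderiv \<theta> 1 s"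
        using A_a
      proof eventually_elim
        fix s assume *: "s > 0 \<longrightarrow> (\<forall>\<psi>. test_fn UNIV \<psi> \<longrightarrow> A s \<psi> = (\<integral>x. a (s, x) * \<psi> x \<partial>lborel))"
        show "(\<integral>x. dderiv \<theta> 1 s * (a (s, x) * \<psi> x) \<partial>lborel) = A (max 0 s) \<psi> * dderiv \<theta> 1 s"
        proof (cases "s > 0")
          case True
          then show ?thesis using * \<psi> by simp
        next
          case False
          obtain K where K: "compact K" "K \<subseteq> {0<..}" "\<And>x. x \<notin> K \<Longrightarrow> dderiv \<theta> 1 x = 0"
            using test_fn_support[OF \<theta>'] by blast
          have "s \<notin> K" using False K(2) by auto
          then have "dderiv \<theta> 1 s = 0" by (rule K(3))
          then show ?thesis by simp
        qed
      qed
    qed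
    finally show "(\<integral>s. A (max 0 s) \<psi> * dderiv \<theta> 1 s \<partial>lborel) + (\<integral>s. \<theta> s * (\<integral>x. flux \<psi> (s, x) \<partial>lborel) \<partial>lborel) = 0" by simp
  qed
  then show ?thesis using t by simp
qed

end

lemma smooth_dderiv_reflect:
  assumes "smooth_fn \<psi>"
  shows "dderiv (\<lambda>y. \<psi> (x - y)) e y = - dderiv \<psi> e (x - y)"
proof -
  have "(\<psi> has_derivative frechet_derivative \<psi> (at (x - y))) (at (x - y))"
    by (rule has_derivative_frechet[OF smooth_fn_differentiable[OF assms]])
  moreover have "((\<lambda>y. x - y) has_derivative (\<lambda>z. 0 - z)) (at y)"
    by (rule has_derivative_diff[OF has_derivative_const has_derivative_ident])
  then have "((\<lambda>y. x - y) has_derivative (\<lambda>z. - z)) (at y)" by simp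
  ultimately have "((\<lambda>y. \<psi> (x - y)) has_derivative (\<lambda>z. frechet_derivative \<psi> (at (x - y)) (- z))) (at y)"
    using diff_chain_at[of "\<lambda>y. x - y" "\<lambda>z. - z" y \<psi>] by (simp only: o_def)
  from dderiv_eq[OF this] have "dderiv (\<lambda>y. \<psi> (x - y)) e y = dderiv \<psi> (- e) (x - y)"
    by (simp add: dderiv_def)
  also have "\<dots> = - dderiv \<psi> e (x - y)"
    using linear_neg[OF smooth_dderiv_linear[OF assms]] by simp
  finally show ?thesis .
qed

lemma dderiv_minus:
  assumes "smooth_fn \<psi>"
  shows "dderiv (\<lambda>y. - \<psi> y) e y = - dderiv \<psi> e y"
  using dderiv_eq[OF has_derivative_minus[OF has_derivative_frechet[OF smooth_fn_differentiable[OF assms]]]]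
  by (simp add: dderiv_def)

lemma test_fn_reflect: "test_fn UNIV \<rho> \<Longrightarrow> test_fn UNIV (\<lambda>y. \<rho> (x - y))"
  using test_fn_affine[of \<rho> "-1" x] by simp

context transport_data
begin

section \<open>The mollified equation and its renormalisation\<close>

definition mollified_flux :: "(real^3 \<Rightarrow> real) \<Rightarrow> real \<times> (real^3) \<Rightarrow> real" where
  "mollified_flux \<rho> p = (\<Sum>i\<in>UNIV. conv_x a (pd i (pd i \<rho>)) p - conv_x (\<lambda>p. a p * v i p) (pd i \<rho>) p)"

lemma a_slice_L2: "AE t in lborel. L2_fn (\<lambda>x. a (t, x))"
  by (rule L2_fn_slice[OF a_L2])

lemma av_slice_locally_integrable: "AE t in lborel. \<forall>i. locally_integrable (\<lambda>x. a (t, x) * v i (t, x))"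
  using a_slice_L2 v_slice_L2loc
proof eventually_elim
  fix t assume *: "L2_fn (\<lambda>x. a (t, x))" "\<forall>i. locally_integrable (\<lambda>x. (v i (t, x))\<^sup>2)"
  show "\<forall>i. locally_integrable (\<lambda>x. a (t, x) * v i (t, x))"
    by (intro allI locally_integrable_mult_L2loc integrable_imp_locally_integrable[OF L2_fn_integrable[OF *(1)]] slice_measurable v_meas a_meas)
       (use * in auto)
qed

text \<open>The mollified function at x is \<open>a\<close> tested with y -> \<rho>(x - y). Under
  this reflection the first derivative changes sign and the second does not, hence the minus sign in
  \<open>mollified_flux\<close>.\<close>

lemma flux_reflect:
  assumes \<rho>: "test_fn UNIV \<rho>"
  shows "AE t in lborel. \<forall>x. (\<integral>y. flux (\<lambda>y. \<rho> (x - y)) (t, y) \<partial>lborel) = mollified_flux \<rho> (t, x)"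
  using a_slice_L2 av_slice_locally_integrable
proof eventually_elim
  fix t assume a: "L2_fn (\<lambda>x. a (t, x))" and av: "\<forall>i. locally_integrable (\<lambda>x. a (t, x) * v i (t, x))"
  show "\<forall>x. (\<integral>y. flux (\<lambda>y. \<rho> (x - y)) (t, y) \<partial>lborel) = mollified_flux \<rho> (t, x)"
  proof
    fix x
    note s = test_fn_smooth[OF \<rho>]
    have \<rho>': "test_fn UNIV (pd i \<rho>)" for i by (rule test_fn_dderiv[OF \<rho> axis_Basis])
    have p1: "pd i (\<lambda>y. \<rho> (x - y)) = (\<lambda>y. - pd i \<rho> (x - y))" for i
      by (rule ext) (rule smooth_dderiv_reflect[OF s])
    have p2: "pd i (pd i (\<lambda>y. \<rho> (x - y))) = (\<lambda>y. pd i (pd i \<rho>) (x - y))" for i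
    proof
      fix y
      have "smooth_fn (\<lambda>y. pd i \<rho> (x - y))" by (rule test_fn_smooth[OF test_fn_reflect[OF \<rho>']])
      then show "pd i (pd i (\<lambda>y. \<rho> (x - y))) y = pd i (pd i \<rho>) (x - y)"
        unfolding p1 by (simp add: dderiv_minus smooth_dderiv_reflect[OF test_fn_smooth[OF \<rho>']])
    qed
    have i1: "integrable lborel (\<lambda>y. a (t, y) * pd i (pd i \<rho>) (x - y))" for i
      by (intro integrable_mult_cc[OF L2_fn_locally_integrable[OF a]] cc_fn_reflect test_fn_dderiv_cc[OF \<rho>'])
    have i2: "integrable lborel (\<lambda>y. a (t, y) * v i (t, y) * pd i \<rho> (x - y))" for i
      by (intro integrable_mult_cc[OF av[rule_format]] cc_fn_reflect test_fn_dderiv_cc[OF \<rho>])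
    have "(\<integral>y. flux (\<lambda>y. \<rho> (x - y)) (t, y) \<partial>lborel)
       = (\<integral>y. (\<Sum>i\<in>UNIV. a (t, y) * pd i (pd i \<rho>) (x - y) - a (t, y) * v i (t, y) * pd i \<rho> (x - y)) \<partial>lborel)"
      unfolding flux_def p2 unfolding p1 by simp
    also have "\<dots> = (\<Sum>i\<in>UNIV. (\<integral>y. a (t, y) * pd i (pd i \<rho>) (x - y) \<partial>lborel) - (\<integral>y. a (t, y) * v i (t, y) * pd i \<rho> (x - y) \<partial>lborel))"
      using i1 i2 by simp
    finally show "(\<integral>y. flux (\<lambda>y. \<rho> (x - y)) (t, y) \<partial>lborel) = mollified_flux \<rho> (t, x)"
      by (simp add: mollified_flux_def conv_x_def conv_def)
  qed
qed

text \<open>With x as a parameter, the mollified function is a scalar function of time with an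
  integrable derivative, to which the convex chain rule applies. The exceptional times are those at
  which \<open>A\<close> and \<open>a\<close> may differ; they do not depend on x, so that the
  inequality can be integrated over x.\<close>

lemma pointwise_inequality:
  assumes \<rho>: "test_fn UNIV \<rho>"
  shows "AE t in lborel. t > 0 \<longrightarrow> (\<forall>x. renorm (conv_x a \<rho> (t, x))
    \<le> (\<integral>s. indicat_real {0<..t} s * (renorm' (conv_x a \<rho> (s, x)) * mollified_flux \<rho> (s, x)) \<partial>lborel))"
  using A_a
proof eventually_elim
  fix t assume A: "t > 0 \<longrightarrow> (\<forall>\<psi>. test_fn UNIV \<psi> \<longrightarrow> A t \<psi> = (\<integral>x. a (t, x) * \<psi> x \<partial>lborel))"
  show "t > 0 \<longrightarrow> (\<forall>x. renorm (conv_x a \<rho> (t, x))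
    \<le> (\<integral>s. indicat_real {0<..t} s * (renorm' (conv_x a \<rho> (s, x)) * mollified_flux \<rho> (s, x)) \<partial>lborel))"
  proof (intro impI allI)
    fix x assume t: "t > 0"
    let ?\<psi> = "\<lambda>y. \<rho> (x - y)"
    have \<psi>: "test_fn UNIV ?\<psi>" by (rule test_fn_reflect[OF \<rho>])
    let ?u = "\<lambda>s. A (max 0 s) ?\<psi>" and ?f = "\<lambda>s. \<integral>y. flux ?\<psi> (s, y) \<partial>lborel"
    have cu: "continuous_on UNIV ?u"
      by (rule continuous_on_compose2[OF A_cont[OF \<psi>]]) (auto intro!: continuous_intros)
    have fi: "integrable lborel (\<lambda>s. indicat_real {0<..t} s * ?f s)"
      using integrable_slice_integral[OF flux_window[OF \<psi>, of t]] by simp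
    have "conv_x a \<rho> (t, x) = ?u t" using A \<psi> t by (simp add: conv_x_def conv_def)
    also have "renorm \<dots> \<le> (\<integral>s. indicat_real {0<..t} s * (renorm' (?u s) * ?f s) \<partial>lborel)"
      by (rule renorm_chain_inequality[OF cu fi]) (use t A_representation[OF \<psi>] in auto)
    also have "\<dots> = (\<integral>s. indicat_real {0<..t} s * (renorm' (conv_x a \<rho> (s, x)) * mollified_flux \<rho> (s, x)) \<partial>lborel)"
    proof (rule integral_cong_AE)
      show "(\<lambda>s. indicat_real {0<..t} s * (renorm' (?u s) * ?f s)) \<in> borel_measurable lborel"
        by (rule borel_measurable_integrable, rule integrable_restrict[OF fi _ _ _ abs_renorm'_le])
           (auto intro!: measurable_compose[OF borel_measurable_continuous_onI[OF cu] renorm_measurable(2)])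
      have [measurable]: "\<rho> \<in> borel_measurable borel" "pd i \<rho> \<in> borel_measurable borel" "pd i (pd i \<rho>) \<in> borel_measurable borel" for i
        using \<rho> by (auto intro!: cc_fn_measurable test_fn_cc test_fn_dderiv axis_Basis)
      have [measurable]: "(\<lambda>s. (s, x)) \<in> borel_measurable borel"
        by (intro borel_measurable_continuous_onI continuous_intros)
      have "conv_x a \<rho> \<in> borel_measurable borel" "mollified_flux \<rho> \<in> borel_measurable borel"
        unfolding mollified_flux_def[abs_def] by measurable
      note [measurable] = measurable_compose[OF \<open>(\<lambda>s. (s, x)) \<in> borel_measurable borel\<close> this(1)]
        measurable_compose[OF \<open>(\<lambda>s. (s, x)) \<in> borel_measurable borel\<close> this(2)]
      show "(\<lambda>s. indicat_real {0<..t} s * (renorm' (conv_x a \<rho> (s, x)) * mollified_flux \<rho> (s, x))) \<in> borel_measurable lborel"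
        by measurable
      show "AE s in lborel. indicat_real {0<..t} s * (renorm' (?u s) * ?f s)
         = indicat_real {0<..t} s * (renorm' (conv_x a \<rho> (s, x)) * mollified_flux \<rho> (s, x))"
        using A_a flux_reflect[OF \<rho>]
      proof eventually_elim
        fix s assume "s > 0 \<longrightarrow> (\<forall>\<psi>. test_fn UNIV \<psi> \<longrightarrow> A s \<psi> = (\<integral>x. a (s, x) * \<psi> x \<partial>lborel))"
          "\<forall>x. (\<integral>y. flux (\<lambda>y. \<rho> (x - y)) (s, y) \<partial>lborel) = mollified_flux \<rho> (s, x)"
        then show "indicat_real {0<..t} s * (renorm' (?u s) * ?f s)
         = indicat_real {0<..t} s * (renorm' (conv_x a \<rho> (s, x)) * mollified_flux \<rho> (s, x))"
          using \<psi> by (cases "s \<in> {0<..t}") (simp_all add: conv_x_def conv_def)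
      qed
    qed
    finally show "renorm (conv_x a \<rho> (t, x)) \<le> (\<integral>s. indicat_real {0<..t} s * (renorm' (conv_x a \<rho> (s, x)) * mollified_flux \<rho> (s, x)) \<partial>lborel)" .
  qed
qed

text \<open>A majorant of the terms in which derivatives fall on the cut-off. With absolute values
  the resulting integrand is nonnegative, so that the estimate up to time t can be replaced by the
  one up to T.\<close>

definition spread :: "real \<Rightarrow> real \<times> (real^3) \<Rightarrow> real" where
  "spread R p = (\<Sum>i\<in>UNIV. \<bar>ddcutoff R i (snd p)\<bar> + \<bar>v i p\<bar> * \<bar>dcutoff R i (snd p)\<bar>)"

lemma spread_nonneg: "spread R p \<ge> 0"
  unfolding spread_def by (intro sum_nonneg add_nonneg_nonneg mult_nonneg_nonneg) auto

lemma spread_L2: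
  assumes R: "R > 0"
  shows "L2_fn (\<lambda>p. indicat_real {0<..T} (fst p) * spread R p)"
proof -
  have 1: "L2_fn (\<lambda>p. indicat_real {0<..T} (fst p) * \<bar>ddcutoff R i (snd p)\<bar>)" for i :: 3
    by (rule L2_fn_window[OF cc_fn_abs[OF cc_fn_ddcutoff[OF R]]])
  have 2: "L2_fn (\<lambda>p. indicat_real {0<..T} (fst p) * (\<bar>v i p\<bar> * \<bar>dcutoff R i (snd p)\<bar>))" for i
  proof -
    have c: "cc_fn (\<lambda>x::real^3. sqrt (1 + (norm x)\<^sup>2) * dcutoff R i x)" by (rule cc_fn_weight[OF cc_fn_dcutoff[OF R]])
    obtain B where B: "\<And>x. \<bar>sqrt (1 + (norm x)\<^sup>2) * dcutoff R i x\<bar> \<le> B" using cc_fn_bounded[OF c] by blast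
    have [measurable]: "dcutoff R i \<in> borel_measurable (borel :: (real^3) measure)" by (rule cc_fn_measurable[OF cc_fn_dcutoff[OF R]])
    show ?thesis
    proof (rule L2_fn_bound[OF v_weighted_L2[of i], where c=B])
      fix p :: "real \<times> (real^3)"
      have eq: "\<bar>v i p\<bar> * \<bar>dcutoff R i (snd p)\<bar> = \<bar>sqrt (1 + (norm (snd p))\<^sup>2) * dcutoff R i (snd p)\<bar> * \<bar>v i p * sqrt (japanese (snd p))\<bar>"
      proof -
        have "\<bar>v i p\<bar> * \<bar>dcutoff R i (snd p)\<bar> = (sqrt (japanese (snd p)) * sqrt (1 + (norm (snd p))\<^sup>2)) * (\<bar>v i p\<bar> * \<bar>dcutoff R i (snd p)\<bar>)"
          by (simp only: sqrt_japanese mult_1)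
        then show ?thesis by (simp add: abs_mult mult_ac japanese_pos less_imp_le)
      qed
      have "\<bar>indicat_real {0<..T} (fst p) * (\<bar>v i p\<bar> * \<bar>dcutoff R i (snd p)\<bar>)\<bar> \<le> \<bar>v i p\<bar> * \<bar>dcutoff R i (snd p)\<bar>"
        by (simp add: indicator_def)
      also have "\<dots> \<le> B * \<bar>v i p * sqrt (japanese (snd p))\<bar>"
        unfolding eq by (intro mult_right_mono B) simp
      finally show "\<bar>indicat_real {0<..T} (fst p) * (\<bar>v i p\<bar> * \<bar>dcutoff R i (snd p)\<bar>)\<bar> \<le> B * \<bar>v i p * sqrt (japanese (snd p))\<bar>" .
    qed measurable
  qed
  have "L2_fn (\<lambda>p. \<Sum>i\<in>UNIV. indicat_real {0<..T} (fst p) * \<bar>ddcutoff R i (snd p)\<bar> + indicat_real {0<..T} (fst p) * (\<bar>v i p\<bar> * \<bar>dcutoff R i (snd p)\<bar>))"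
    by (intro L2_fn_sum finite L2_fn_add 1 2)
  then show ?thesis by (simp add: spread_def sum_distrib_left distrib_left)
qed

definition commutator_x :: "(real^3 \<Rightarrow> real) \<Rightarrow> real \<times> (real^3) \<Rightarrow> real" where
  "commutator_x \<rho> p = commutator \<rho> (\<lambda>x. a (fst p, x)) (\<lambda>i x. v i (fst p, x)) (snd p)"

lemma commutator_x_measurable:
  assumes \<rho>: "test_fn UNIV \<rho>"
  shows "commutator_x \<rho> \<in> borel_measurable borel"
proof -
  have [measurable]: "pd i \<rho> \<in> borel_measurable borel" for i
    using \<rho> by (auto intro!: cc_fn_measurable test_fn_cc test_fn_dderiv axis_Basis)
  have "commutator_x \<rho> = (\<lambda>p. \<Sum>i\<in>UNIV. v i p * conv_x a (pd i \<rho>) p - conv_x (\<lambda>p. a p * v i p) (pd i \<rho>) p)"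
    by (simp add: commutator_x_def[abs_def] commutator_def conv_x_def)
  then show ?thesis by simp
qed

text \<open>The pointwise inequality is multiplied by the cut-off and integrated over x; after
  exchanging the integrals, \<open>slice_inequality\<close> applies at almost every time s. The
  resulting bound is independent of t, so integration over the window costs the factor
  \<open>T\<close>, and no Gronwall argument is involved.\<close>

lemma renormalised_estimate:
  assumes \<rho>: "test_fn UNIV \<rho>" and R: "R > 0" and T: "T > 0"
    and W: "L2_fn (conv_x a \<rho>)"
    and K: "(\<integral>\<^sup>+t. \<integral>\<^sup>+x. ennreal \<bar>commutator_x \<rho> (t, x)\<bar> \<partial>lborel \<partial>lborel) \<le> ennreal K" and K0: "K \<ge> 0"
  shows "(\<integral>p. indicat_real {0<..T} (fst p) * (renorm (conv_x a \<rho> p) * cutoff R (snd p)) \<partial>lborel)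
    \<le> T * ((\<integral>p. indicat_real {0<..T} (fst p) * (renorm (conv_x a \<rho> p) * spread R p) \<partial>lborel) + K)"
proof -
  let ?W = "conv_x a \<rho>" and ?F = "mollified_flux \<rho>" and ?I = "indicat_real {0<..T}"
  have \<rho>': "test_fn UNIV (pd i \<rho>)" for i by (rule test_fn_dderiv[OF \<rho> axis_Basis])
  note cc = test_fn_cc[OF \<rho>] test_fn_dderiv_cc[OF \<rho>] test_fn_dderiv_cc[OF \<rho>'] cc_fn_cutoff[OF R]
  have [measurable]: "?W \<in> borel_measurable borel" by (rule L2_fn_measurable[OF W])
  have [measurable]: "cutoff R \<in> borel_measurable (borel :: (real^3) measure)" by (rule cc_fn_measurable[OF cc(4)])
  have Wr: "L2_fn (\<lambda>p. renorm (?W p))"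
    by (rule L2_fn_bound[OF W, of _ 1]) (use renorm_le_abs renorm_nonneg in auto)
  have iF0: "integrable lborel (\<lambda>p. ?I (fst p) * (?F p * cutoff R (snd p)))"
  proof -
    \<comment> \<open>Square integrability over an unbounded time interval does not give
      integrability, so the window is needed; depending on time only, it passes through the
      convolution in space.\<close>
    have w: "conv_x (\<lambda>p. ?I (fst p) * a p) r p = ?I (fst p) * conv_x a r p" for r p
      by (simp add: conv_x_def conv_def mult.assoc)
    have i1: "integrable lborel (\<lambda>p. ?I (fst p) * conv_x a (pd i (pd i \<rho>)) p * cutoff R (snd p))" for i
      using conv_x_integrable[of "\<lambda>p. ?I (fst p) * a p", OF _ integrable_a_window cc(3) cc(4)] by (simp add: w)
    have i2: "integrable lborel (\<lambda>p. conv_x (\<lambda>p. a p * v i p) (pd i \<rho>) p * cutoff R (snd p))" for i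
      by (rule conv_x_integrable[OF _ integrable_av cc(2) cc(4)]) simp
    have "integrable lborel (\<lambda>p. \<Sum>i\<in>UNIV. ?I (fst p) * conv_x a (pd i (pd i \<rho>)) p * cutoff R (snd p)
        - ?I (fst p) * (conv_x (\<lambda>p. a p * v i p) (pd i \<rho>) p * cutoff R (snd p)))"
      by (intro Bochner_Integration.integrable_sum Bochner_Integration.integrable_diff i1 integrable_bounded_mult[OF i2, where B=1])
         (auto simp: indicator_def)
    then show ?thesis
      by (simp add: mollified_flux_def sum_distrib_left sum_distrib_right left_diff_distrib right_diff_distrib mult.assoc)
  qed
  define Q where "Q p = renorm' (?W p) * cutoff R (snd p) * ?F p" for p
  have iQ: "integrable lborel (\<lambda>p. indicat_real {0<..t} (fst p) * Q p)" if "t \<le> T" for t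
  proof -
    have "integrable lborel (\<lambda>p. (indicat_real {0<..t} (fst p) * renorm' (?W p)) * (?I (fst p) * (?F p * cutoff R (snd p))))"
    proof (rule integrable_bounded_mult[OF iF0, where B=1])
      show "\<bar>indicat_real {0<..t} (fst p) * renorm' (?W p)\<bar> \<le> 1" for p
        using abs_renorm'_le[of "?W p"] by (simp add: indicator_def)
    qed measurable
    moreover have "(indicat_real {0<..t} (fst p) * renorm' (?W p)) * (?I (fst p) * (?F p * cutoff R (snd p))) = indicat_real {0<..t} (fst p) * Q p" for p
      using that by (auto simp: Q_def indicator_def)
    ultimately show ?thesis by simp
  qed
  have iB: "integrable lborel (\<lambda>p. ?I (fst p) * (renorm (?W p) * spread R p))"
    using L2_mult_integrable[OF Wr spread_L2[OF R, of T]] by (simp add: mult_ac)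
  have iL: "integrable lborel (\<lambda>p. ?I (fst p) * (renorm (?W p) * cutoff R (snd p)))"
    using L2_mult_integrable[OF Wr L2_fn_window[OF cc(4), of T]] by (simp add: mult_ac)
  define N where "N s = (\<integral>\<^sup>+x. ennreal \<bar>commutator_x \<rho> (s, x)\<bar> \<partial>lborel)" for s
  have [measurable]: "commutator_x \<rho> \<in> borel_measurable borel" by (rule commutator_x_measurable[OF \<rho>])
  have Nm[measurable]: "N \<in> borel_measurable borel"
    unfolding N_def[abs_def] by (rule nn_integral_slice_measurable[of "\<lambda>p. ennreal \<bar>commutator_x \<rho> p\<bar>"]) simp
  have Nfin: "(\<integral>\<^sup>+s. N s \<partial>lborel) < \<infinity>" using K by (auto simp: N_def intro: le_less_trans)
  have NAE: "AE s in lborel. N s \<noteq> \<infinity>" by (rule nn_integral_PInf_AE) (use Nfin in auto)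
  \<comment> \<open>The conversion to a real number sends an infinite norm to 0; by
    \<open>NAE\<close> this happens only on a null set of times.\<close>
  define k where "k s = enn2real (N s)" for s
  have km[measurable]: "k \<in> borel_measurable borel" unfolding k_def[abs_def] by measurable
  have kn: "(\<integral>\<^sup>+s. ennreal (k s) \<partial>lborel) = (\<integral>\<^sup>+s. N s \<partial>lborel)"
    by (rule nn_integral_cong_AE, rule AE_mp[OF NAE], intro AE_I2 impI) (simp add: k_def less_top)
  have ki: "integrable lborel k"
    by (rule integrableI_nonneg) (use Nfin kn in \<open>auto simp: k_def\<close>)
  have kK: "(\<integral>s. k s \<partial>lborel) \<le> K"
  proof -
    have "ennreal (\<integral>s. k s \<partial>lborel) = (\<integral>\<^sup>+s. ennreal (k s) \<partial>lborel)"
      by (rule nn_integral_eq_integral[symmetric, OF ki]) (simp add: k_def)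
    also have "\<dots> \<le> ennreal K" unfolding kn using K by (simp add: N_def[abs_def])
    finally show ?thesis using K0 by (simp add: ennreal_le_iff)
  qed
  have slice: "AE s in lborel. s \<in> {0<..T} \<longrightarrow> (\<integral>x. Q (s, x) \<partial>lborel) \<le> (\<integral>x. renorm (?W (s, x)) * spread R (s, x) \<partial>lborel) + k s"
    using a_slice_L2 v_slice_L2loc G_slice_L2 v_weak trace_slice NAE AE_integrable_slice[OF iB]
  proof eventually_elim
    fix s assume *: "L2_fn (\<lambda>x. a (s, x))" "\<forall>i. locally_integrable (\<lambda>x. (v i (s, x))\<^sup>2)"
      "\<forall>i j. L2_fn (\<lambda>x. G i j (s, x))" "\<forall>i j. weak_pderiv (\<lambda>x. v i (s, x)) (axis j 1) (\<lambda>x. G i j (s, x))"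
      "AE x in lborel. (\<Sum>i\<in>UNIV. G i i (s, x)) = 0" "N s \<noteq> \<infinity>"
      "integrable lborel (\<lambda>x. ?I (fst (s, x)) * (renorm (?W (s, x)) * spread R (s, x)))"
    show "s \<in> {0<..T} \<longrightarrow> (\<integral>x. Q (s, x) \<partial>lborel) \<le> (\<integral>x. renorm (?W (s, x)) * spread R (s, x) \<partial>lborel) + k s"
    proof
      assume s: "s \<in> {0<..T}"
      have Ns: "N s = (\<integral>\<^sup>+x. ennreal \<bar>commutator \<rho> (\<lambda>x. a (s, x)) (\<lambda>i x. v i (s, x)) x\<bar> \<partial>lborel)"
        by (simp add: N_def commutator_x_def)
      have "(\<integral>x. Q (s, x) \<partial>lborel) = (\<integral>x. renorm' (conv (\<lambda>x. a (s, x)) \<rho> x) * cutoff R x *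
          (\<Sum>i\<in>UNIV. conv (\<lambda>x. a (s, x)) (pd i (pd i \<rho>)) x - conv (\<lambda>y. a (s, y) * v i (s, y)) (pd i \<rho>) x) \<partial>lborel)"
        by (simp add: Q_def mollified_flux_def conv_x_def)
      also have "\<dots> \<le> (\<integral>x. renorm (conv (\<lambda>x. a (s, x)) \<rho> x) * (\<Sum>i\<in>UNIV. ddcutoff R i x + v i (s, x) * dcutoff R i x) \<partial>lborel) + k s"
        unfolding k_def Ns using * Ns
        by (intro slice_inequality[where G="\<lambda>i j x. G i j (s, x)"] \<rho> R v_slice_meas) (auto simp: less_top)
      also have "(\<integral>x. renorm (conv (\<lambda>x. a (s, x)) \<rho> x) * (\<Sum>i\<in>UNIV. ddcutoff R i x + v i (s, x) * dcutoff R i x) \<partial>lborel)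
          \<le> (\<integral>x. renorm (?W (s, x)) * spread R (s, x) \<partial>lborel)"
      proof (rule integral_mono')
        show "integrable lborel (\<lambda>x. renorm (?W (s, x)) * spread R (s, x))" using *(7) s by simp
        fix x
        have "(\<Sum>i\<in>UNIV. ddcutoff R i x + v i (s, x) * dcutoff R i x) \<le> spread R (s, x)"
          unfolding spread_def by (intro sum_mono add_mono) (auto simp: abs_mult[symmetric])
        then show "renorm (conv (\<lambda>x. a (s, x)) \<rho> x) * (\<Sum>i\<in>UNIV. ddcutoff R i x + v i (s, x) * dcutoff R i x)
            \<le> renorm (?W (s, x)) * spread R (s, x)"
          by (simp add: conv_x_def mult_left_mono renorm_nonneg)
        show "0 \<le> renorm (?W (s, x)) * spread R (s, x)" by (simp add: renorm_nonneg spread_nonneg)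
      qed
      finally show "(\<integral>x. Q (s, x) \<partial>lborel) \<le> (\<integral>x. renorm (?W (s, x)) * spread R (s, x) \<partial>lborel) + k s" by simp
    qed
  qed
  define M where "M = (\<integral>p. ?I (fst p) * (renorm (?W p) * spread R p) \<partial>lborel) + K"
  have M_bound: "(\<integral>s. indicat_real {0<..t} s * (\<integral>x. Q (s, x) \<partial>lborel) \<partial>lborel) \<le> M" if t: "t \<le> T" for t
  proof -
    have i3: "integrable lborel (\<lambda>s. ?I s * (\<integral>x. renorm (?W (s, x)) * spread R (s, x) \<partial>lborel))"
      using integrable_slice_integral[OF iB] by simp
    have "(\<integral>s. indicat_real {0<..t} s * (\<integral>x. Q (s, x) \<partial>lborel) \<partial>lborel)
        \<le> (\<integral>s. ?I s * (\<integral>x. renorm (?W (s, x)) * spread R (s, x) \<partial>lborel) + k s \<partial>lborel)"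
    proof (rule integral_mono_AE')
      show "integrable lborel (\<lambda>s. ?I s * (\<integral>x. renorm (?W (s, x)) * spread R (s, x) \<partial>lborel) + k s)"
        using i3 ki by simp
      have nn: "0 \<le> ?I s * (\<integral>x. renorm (?W (s, x)) * spread R (s, x) \<partial>lborel) + k s" for s
        by (intro add_nonneg_nonneg mult_nonneg_nonneg integral_nonneg_AE AE_I2) (auto simp: renorm_nonneg spread_nonneg k_def)
      then show "AE s in lborel. 0 \<le> ?I s * (\<integral>x. renorm (?W (s, x)) * spread R (s, x) \<partial>lborel) + k s" by simp
      show "AE s in lborel. indicat_real {0<..t} s * (\<integral>x. Q (s, x) \<partial>lborel) \<le> ?I s * (\<integral>x. renorm (?W (s, x)) * spread R (s, x) \<partial>lborel) + k s"
        using slice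
      proof eventually_elim
        fix s assume "s \<in> {0<..T} \<longrightarrow> (\<integral>x. Q (s, x) \<partial>lborel) \<le> (\<integral>x. renorm (?W (s, x)) * spread R (s, x) \<partial>lborel) + k s"
        then show "indicat_real {0<..t} s * (\<integral>x. Q (s, x) \<partial>lborel) \<le> ?I s * (\<integral>x. renorm (?W (s, x)) * spread R (s, x) \<partial>lborel) + k s"
          using nn[of s] t by (cases "s \<in> {0<..t}") auto
      qed
    qed
    also have "\<dots> = (\<integral>s. ?I s * (\<integral>x. renorm (?W (s, x)) * spread R (s, x) \<partial>lborel) \<partial>lborel) + (\<integral>s. k s \<partial>lborel)"
      by (rule Bochner_Integration.integral_add[OF i3 ki])
    also have "(\<integral>s. ?I s * (\<integral>x. renorm (?W (s, x)) * spread R (s, x) \<partial>lborel) \<partial>lborel) = (\<integral>p. ?I (fst p) * (renorm (?W p) * spread R p) \<partial>lborel)"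
      by (subst integral_prod[OF iB]) simp
    finally show ?thesis using kK by (simp add: M_def)
  qed
  have key: "AE t in lborel. ?I t * (\<integral>x. renorm (?W (t, x)) * cutoff R x \<partial>lborel) \<le> ?I t * M"
    using pointwise_inequality[OF \<rho>]
  proof eventually_elim
    fix t assume *: "t > 0 \<longrightarrow> (\<forall>x. renorm (?W (t, x)) \<le> (\<integral>s. indicat_real {0<..t} s * (renorm' (?W (s, x)) * ?F (s, x)) \<partial>lborel))"
    show "?I t * (\<integral>x. renorm (?W (t, x)) * cutoff R x \<partial>lborel) \<le> ?I t * M"
    proof (cases "t \<in> {0<..T}")
      case True
      then have t: "t > 0" "t \<le> T" by auto
      have le: "renorm (?W (t, x)) * cutoff R x \<le> (\<integral>s. indicat_real {0<..t} (fst (s, x)) * Q (s, x) \<partial>lborel)" for x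
      proof -
        have "renorm (?W (t, x)) * cutoff R x \<le> (\<integral>s. indicat_real {0<..t} s * (renorm' (?W (s, x)) * ?F (s, x)) \<partial>lborel) * cutoff R x"
          using * t by (intro mult_right_mono cutoff_nonneg) auto
        also have "\<dots> = (\<integral>s. indicat_real {0<..t} s * (renorm' (?W (s, x)) * ?F (s, x)) * cutoff R x \<partial>lborel)"
          by simp
        finally show ?thesis by (simp add: Q_def mult_ac)
      qed
      have "(\<integral>x. renorm (?W (t, x)) * cutoff R x \<partial>lborel) \<le> (\<integral>x. \<integral>s. indicat_real {0<..t} (fst (s, x)) * Q (s, x) \<partial>lborel \<partial>lborel)"
      proof (rule integral_mono'[OF integral_prod_swap(1)[OF iQ[OF t(2)]] le])
        fix x
        have "0 \<le> renorm (?W (t, x)) * cutoff R x" by (simp add: renorm_nonneg cutoff_nonneg)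
        with le[of x] show "0 \<le> (\<integral>s. indicat_real {0<..t} (fst (s, x)) * Q (s, x) \<partial>lborel)" by linarith
      qed
      also have "\<dots> = (\<integral>s. \<integral>x. indicat_real {0<..t} (fst (s, x)) * Q (s, x) \<partial>lborel \<partial>lborel)"
        by (rule integral_prod_swap(2)[OF iQ[OF t(2)]])
      also have "\<dots> \<le> M" using M_bound[OF t(2)] by simp
      finally show ?thesis using True by simp
    qed simp
  qed
  have "(\<integral>p. ?I (fst p) * (renorm (?W p) * cutoff R (snd p)) \<partial>lborel) = (\<integral>t. ?I t * (\<integral>x. renorm (?W (t, x)) * cutoff R x \<partial>lborel) \<partial>lborel)"
    by (subst integral_prod[OF iL]) simp
  also have "\<dots> \<le> (\<integral>t. ?I t * M \<partial>lborel)"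
  proof (rule integral_mono_AE[OF _ _ key])
    show "integrable lborel (\<lambda>t. ?I t * (\<integral>x. renorm (?W (t, x)) * cutoff R x \<partial>lborel))"
      using integrable_slice_integral[OF iL] by simp
    show "integrable lborel (\<lambda>t. ?I t * M)"
      by (intro integrable_mult_left integrable_real_indicator) (use T in auto)
  qed
  also have "\<dots> = T * M" using T by simp
  finally show ?thesis by (simp add: M_def)
qed

end

section \<open>Vanishing of the commutator and removal of the mollifier\<close>

lemma segment_avg_joint_measurable:
  fixes g :: "'a::euclidean_space \<Rightarrow> real" and P H :: "'q::euclidean_space \<Rightarrow> 'a"
  assumes [measurable]: "g \<in> borel_measurable borel" "P \<in> borel_measurable borel" "H \<in> borel_measurable borel"
  shows "(\<lambda>q. segment_avg g (H q) (P q)) \<in> borel_measurable borel"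
  unfolding segment_avg_def
  by (rule lborel.borel_measurable_lebesgue_integral) (simp add: case_prod_beta')

text \<open>\<open>renorm\<close> is Lipschitz with constant 1, so closeness of the arguments in L^2
  suffices against a weight in L^2; this carries the inequality from the mollified function to
  \<open>a\<close>.\<close>

lemma renorm_integral_diff:
  assumes f: "L2_fn f" and g: "L2_fn g" and h: "L2_fn h"
  shows "\<bar>(\<integral>p. renorm (f p) * h p \<partial>lborel) - (\<integral>p. renorm (g p) * h p \<partial>lborel)\<bar> \<le> L2_norm (\<lambda>p. f p - g p) * L2_norm h"
proof -
  have [measurable]: "f \<in> borel_measurable borel" "g \<in> borel_measurable borel"
    using L2_fn_measurable f g by auto
  have rf: "L2_fn (\<lambda>p. renorm (f p))" by (rule L2_fn_bound[OF f, of _ 1]) (use renorm_le_abs renorm_nonneg in auto)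
  have rg: "L2_fn (\<lambda>p. renorm (g p))" by (rule L2_fn_bound[OF g, of _ 1]) (use renorm_le_abs renorm_nonneg in auto)
  have "(\<integral>p. renorm (f p) * h p \<partial>lborel) - (\<integral>p. renorm (g p) * h p \<partial>lborel) = (\<integral>p. renorm (f p) * h p - renorm (g p) * h p \<partial>lborel)"
    by (rule Bochner_Integration.integral_diff[symmetric, OF L2_mult_integrable[OF rf h] L2_mult_integrable[OF rg h]])
  also have "\<bar>\<dots>\<bar> \<le> (\<integral>p. \<bar>renorm (f p) * h p - renorm (g p) * h p\<bar> \<partial>lborel)" by (rule integral_abs_bound)
  also have "\<dots> \<le> (\<integral>p. \<bar>(f p - g p) * h p\<bar> \<partial>lborel)"
  proof (rule integral_mono')
    show "integrable lborel (\<lambda>p. \<bar>(f p - g p) * h p\<bar>)"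
      by (intro integrable_abs L2_mult_integrable L2_fn_diff f g h)
    show "\<bar>renorm (f p) * h p - renorm (g p) * h p\<bar> \<le> \<bar>(f p - g p) * h p\<bar>" for p
      unfolding left_diff_distrib[symmetric] abs_mult by (intro mult_right_mono renorm_lipschitz) simp
  qed simp
  also have "\<dots> \<le> L2_norm (\<lambda>p. f p - g p) * L2_norm h" by (intro L2_mult_le L2_fn_diff f g h)
  finally show ?thesis .
qed

context transport_data
begin

text \<open>\<open>commutator_bound\<close> is integrated in time, which turns its inner integrals
  into L^1 norms over space-time. There the difference of products is (translate of a minus a) times
  the averaged gradient, plus a times (averaged gradient minus gradient); Cauchy-Schwarz bounds it
  by \<open>\<epsilon> * (\<Gamma> + L2_norm a)\<close>. The weights have total mass at most
  \<open>M\<close>.\<close>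

lemma commutator_small:
  assumes \<rho>: "test_fn UNIV \<rho>" and \<rho>1: "(\<integral>x. \<rho> x \<partial>lborel) = 1"
    and supp: "\<And>x. norm x > \<delta> \<Longrightarrow> \<rho> x = 0"
    and M: "(\<Sum>i\<in>UNIV. \<Sum>j\<in>UNIV. \<integral>h. \<bar>h $ j * pd i \<rho> h\<bar> \<partial>lborel) \<le> M"
    and \<epsilon>a: "\<And>h. norm h \<le> \<delta> \<Longrightarrow> L2_norm (\<lambda>p. a (p + (0, - h)) - a p) \<le> \<epsilon>"
    and \<epsilon>G: "\<And>i j h. norm h \<le> \<delta> \<Longrightarrow> L2_norm (\<lambda>p. G i j (p + (0, - h)) - G i j p) \<le> \<epsilon>"
    and \<epsilon>: "\<epsilon> \<ge> 0" and \<Gamma>: "\<And>i j. L2_norm (G i j) \<le> \<Gamma>"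
  shows "(\<integral>\<^sup>+t. \<integral>\<^sup>+x. ennreal \<bar>commutator_x \<rho> (t, x)\<bar> \<partial>lborel \<partial>lborel) \<le> ennreal (M * (\<epsilon> * (\<Gamma> + L2_norm a)))"
proof -
  define E where "E = \<epsilon> * (\<Gamma> + L2_norm a)"
  have \<Gamma>0: "\<Gamma> \<ge> 0" using \<Gamma> L2_norm_nonneg order_trans by blast
  have E0: "E \<ge> 0" unfolding E_def by (intro mult_nonneg_nonneg add_nonneg_nonneg L2_norm_nonneg \<epsilon> \<Gamma>0)
  \<comment> \<open>The translation (0, - h) acts on whole functions of time and space, so that a
    single smallness condition on h covers all times at once.\<close>
  define \<Theta> where "\<Theta> i j h p = a (p + (0, - h)) * segment_avg (G i j) (0, - h) p - a p * G i j p" for i j h p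
  define c where "c i j h = ennreal \<bar>h $ j * pd i \<rho> h\<bar>" for i j and h :: "real^3"
  have [measurable]: "(\<lambda>h::real^3. h $ j) \<in> borel_measurable borel" for j
    by (intro borel_measurable_continuous_onI continuous_intros)
  have [measurable]: "pd i \<rho> \<in> borel_measurable borel" for i
    by (rule cc_fn_measurable[OF test_fn_dderiv_cc[OF \<rho>]])
  have cm[measurable]: "c i j \<in> borel_measurable borel" for i j unfolding c_def[abs_def] by measurable
  have \<Theta>m: "(\<lambda>q. ennreal \<bar>\<Theta> i j (snd (fst q)) (fst (fst q), snd q)\<bar>) \<in> borel_measurable (borel :: ((real \<times> (real^3)) \<times> (real^3)) measure)" for i j
  proof -
    have P[measurable]: "(\<lambda>q::(real \<times> (real^3)) \<times> (real^3). (fst (fst q), snd q)) \<in> borel_measurable borel"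
      "(\<lambda>q::(real \<times> (real^3)) \<times> (real^3). (0::real, - snd (fst q))) \<in> borel_measurable borel"
      by (intro borel_measurable_continuous_onI continuous_intros)+
    have "(\<lambda>q. a ((fst (fst q), snd q) + (0, - snd (fst q)))) \<in> borel_measurable (borel :: ((real \<times> (real^3)) \<times> (real^3)) measure)"
      "(\<lambda>q. a (fst (fst q), snd q)) \<in> borel_measurable (borel :: ((real \<times> (real^3)) \<times> (real^3)) measure)"
      "(\<lambda>q. G i j (fst (fst q), snd q)) \<in> borel_measurable (borel :: ((real \<times> (real^3)) \<times> (real^3)) measure)"
      by (rule measurable_compose[OF borel_measurable_add[OF P] a_meas] measurable_compose[OF P(1) a_meas] measurable_compose[OF P(1) G_meas])+
    moreover have "(\<lambda>q. segment_avg (G i j) (0, - snd (fst q)) (fst (fst q), snd q)) \<in> borel_measurable (borel :: ((real \<times> (real^3)) \<times> (real^3)) measure)"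
      by (rule segment_avg_joint_measurable[OF G_meas P])
    ultimately show ?thesis
      unfolding \<Theta>_def by (intro measurable_compose[OF _ measurable_ennreal] borel_measurable_abs borel_measurable_diff borel_measurable_times)
  qed
  have \<Theta>m1: "(\<lambda>p. ennreal \<bar>\<Theta> i j h p\<bar>) \<in> borel_measurable borel" for i j h
    unfolding \<Theta>_def by measurable
  have tm: "(\<lambda>(t, h). \<Sum>i\<in>UNIV. \<Sum>j\<in>UNIV. c i j h * (\<integral>\<^sup>+x. ennreal \<bar>\<Theta> i j h (t, x)\<bar> \<partial>lborel)) \<in> borel_measurable (lborel \<Otimes>\<^sub>M lborel)"
  proof -
    have m: "(\<lambda>q. \<integral>\<^sup>+x. ennreal \<bar>\<Theta> i j (snd q) (fst q, x)\<bar> \<partial>lborel) \<in> borel_measurable (lborel \<Otimes>\<^sub>M lborel)" for i j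
      using nn_integral_slice_measurable[OF \<Theta>m] by (simp add: lborel_prod)
    have m2: "(\<lambda>q::real \<times> (real^3). c i j (snd q)) \<in> borel_measurable (lborel \<Otimes>\<^sub>M lborel)" for i j
      by (simp add: lborel_prod)
    show ?thesis unfolding case_prod_beta' by (intro borel_measurable_sum borel_measurable_times_ennreal m m2)
  qed
  have bound: "c i j h * (\<integral>\<^sup>+p. ennreal \<bar>\<Theta> i j h p\<bar> \<partial>lborel) \<le> c i j h * ennreal E" for i j h
  proof (cases "norm h \<le> \<delta>")
    case False
    have "pd i \<rho> h = 0"
      by (rule dderiv_eq_0[where K="cball 0 \<delta>"]) (use supp False in auto)
    then show ?thesis by (simp add: c_def)
  next
    case True
    let ?avg = "segment_avg (G i j) (0, - h)"
    have L: "L2_fn (\<lambda>p. a (p + (0, - h)) - a p)" "L2_fn ?avg" "L2_fn (\<lambda>p. ?avg p - G i j p)"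
      by (intro L2_fn_diff L2_fn_translate L2_fn_segment_avg a_L2 G_L2)+
    have avgd: "L2_norm (\<lambda>p. ?avg p - G i j p) \<le> \<epsilon>"
    proof (rule segment_avg_diff_L2[OF G_L2])
      fix s :: real assume s: "0 \<le> s" "s \<le> 1"
      have "norm (s *\<^sub>R h) \<le> norm h" using s by (simp add: mult_left_le_one_le)
      then have "L2_norm (\<lambda>p. G i j (p + (0, - (s *\<^sub>R h))) - G i j p) \<le> \<epsilon>" using True by (intro \<epsilon>G) simp
      then show "L2_norm (\<lambda>p. G i j (p + s *\<^sub>R (0, - h)) - G i j p) \<le> \<epsilon>" by simp
    qed
    have \<Theta>eq: "\<Theta> i j h p = (a (p + (0, - h)) - a p) * ?avg p + a p * (?avg p - G i j p)" for p
      by (simp add: \<Theta>_def algebra_simps)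
    have i: "integrable lborel (\<Theta> i j h)"
      unfolding \<Theta>eq[abs_def] by (intro Bochner_Integration.integrable_add L2_mult_integrable L a_L2)
    have "(\<integral>p. \<bar>\<Theta> i j h p\<bar> \<partial>lborel) \<le> (\<integral>p. \<bar>(a (p + (0, - h)) - a p) * ?avg p\<bar> + \<bar>a p * (?avg p - G i j p)\<bar> \<partial>lborel)"
      unfolding \<Theta>eq
      by (intro integral_mono integrable_abs Bochner_Integration.integrable_add L2_mult_integrable L a_L2 abs_triangle_ineq)
    also have "\<dots> = (\<integral>p. \<bar>(a (p + (0, - h)) - a p) * ?avg p\<bar> \<partial>lborel) + (\<integral>p. \<bar>a p * (?avg p - G i j p)\<bar> \<partial>lborel)"
      by (intro Bochner_Integration.integral_add integrable_abs L2_mult_integrable L a_L2)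
    also have "\<dots> \<le> L2_norm (\<lambda>p. a (p + (0, - h)) - a p) * L2_norm ?avg + L2_norm a * L2_norm (\<lambda>p. ?avg p - G i j p)"
      by (intro add_mono L2_mult_le L a_L2)
    also have "\<dots> \<le> \<epsilon> * \<Gamma> + L2_norm a * \<epsilon>"
      by (intro add_mono mult_mono \<epsilon>a True avgd order_trans[OF L2_norm_segment_avg_le[OF G_L2] \<Gamma>] \<epsilon> L2_norm_nonneg order_refl)
    finally have "(\<integral>p. \<bar>\<Theta> i j h p\<bar> \<partial>lborel) \<le> E" by (simp add: E_def algebra_simps)
    moreover have "(\<integral>\<^sup>+p. ennreal \<bar>\<Theta> i j h p\<bar> \<partial>lborel) = ennreal (\<integral>p. \<bar>\<Theta> i j h p\<bar> \<partial>lborel)"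
      by (rule nn_integral_eq_integral[OF integrable_abs[OF i]]) simp
    ultimately show ?thesis by (simp add: mult_left_mono ennreal_leI)
  qed
  have "(\<integral>\<^sup>+t. \<integral>\<^sup>+x. ennreal \<bar>commutator_x \<rho> (t, x)\<bar> \<partial>lborel \<partial>lborel)
      \<le> (\<integral>\<^sup>+t. \<integral>\<^sup>+h. (\<Sum>i\<in>UNIV. \<Sum>j\<in>UNIV. c i j h * (\<integral>\<^sup>+x. ennreal \<bar>\<Theta> i j h (t, x)\<bar> \<partial>lborel)) \<partial>lborel \<partial>lborel)"
  proof (rule nn_integral_mono_AE)
    show "AE t in lborel. (\<integral>\<^sup>+x. ennreal \<bar>commutator_x \<rho> (t, x)\<bar> \<partial>lborel)
        \<le> (\<integral>\<^sup>+h. (\<Sum>i\<in>UNIV. \<Sum>j\<in>UNIV. c i j h * (\<integral>\<^sup>+x. ennreal \<bar>\<Theta> i j h (t, x)\<bar> \<partial>lborel)) \<partial>lborel)"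
      using a_slice_L2 v_slice_L2loc G_slice_L2 v_weak trace_slice
    proof eventually_elim
      fix t assume *: "L2_fn (\<lambda>x. a (t, x))" "\<forall>i. locally_integrable (\<lambda>x. (v i (t, x))\<^sup>2)"
        "\<forall>i j. L2_fn (\<lambda>x. G i j (t, x))" "\<forall>i j. weak_pderiv (\<lambda>x. v i (t, x)) (axis j 1) (\<lambda>x. G i j (t, x))"
        "AE x in lborel. (\<Sum>i\<in>UNIV. G i i (t, x)) = 0"
      have "(\<integral>\<^sup>+x. ennreal \<bar>commutator \<rho> (\<lambda>x. a (t, x)) (\<lambda>i x. v i (t, x)) x\<bar> \<partial>lborel)
        \<le> (\<integral>\<^sup>+h. (\<Sum>i\<in>UNIV. \<Sum>j\<in>UNIV. ennreal \<bar>h $ j * pd i \<rho> h\<bar> *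
         (\<integral>\<^sup>+x. ennreal \<bar>a (t, x - h) * segment_avg (\<lambda>x. G i j (t, x)) (- h) x - a (t, x) * G i j (t, x)\<bar> \<partial>lborel)) \<partial>lborel)"
        by (rule commutator_bound[where v="\<lambda>i x. v i (t, x)" and G="\<lambda>i j x. G i j (t, x)"]) (use * \<rho> \<rho>1 v_slice_meas in auto)
      then show "(\<integral>\<^sup>+x. ennreal \<bar>commutator_x \<rho> (t, x)\<bar> \<partial>lborel)
        \<le> (\<integral>\<^sup>+h. (\<Sum>i\<in>UNIV. \<Sum>j\<in>UNIV. c i j h * (\<integral>\<^sup>+x. ennreal \<bar>\<Theta> i j h (t, x)\<bar> \<partial>lborel)) \<partial>lborel)"
        by (simp add: commutator_x_def c_def \<Theta>_def segment_avg_def)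
    qed
  qed
  \<comment> \<open>With h as the outer variable, the integrals over t and x join to one over
    space-time for each h.\<close>
  also have "\<dots> = (\<integral>\<^sup>+h. \<integral>\<^sup>+t. (\<Sum>i\<in>UNIV. \<Sum>j\<in>UNIV. c i j h * (\<integral>\<^sup>+x. ennreal \<bar>\<Theta> i j h (t, x)\<bar> \<partial>lborel)) \<partial>lborel \<partial>lborel)"
    by (rule lborel_pair.Fubini'[OF tm, symmetric])
  also have "\<dots> = (\<integral>\<^sup>+h. (\<Sum>i\<in>UNIV. \<Sum>j\<in>UNIV. c i j h * (\<integral>\<^sup>+p. ennreal \<bar>\<Theta> i j h p\<bar> \<partial>lborel)) \<partial>lborel)"
  proof (rule nn_integral_cong)
    fix h :: "real^3"
    have m: "(\<lambda>t. \<integral>\<^sup>+x. ennreal \<bar>\<Theta> i j h (t, x)\<bar> \<partial>lborel) \<in> borel_measurable lborel" for i j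
      using nn_integral_slice_measurable[OF \<Theta>m1] by simp
    show "(\<integral>\<^sup>+t. (\<Sum>i\<in>UNIV. \<Sum>j\<in>UNIV. c i j h * (\<integral>\<^sup>+x. ennreal \<bar>\<Theta> i j h (t, x)\<bar> \<partial>lborel)) \<partial>lborel)
        = (\<Sum>i\<in>UNIV. \<Sum>j\<in>UNIV. c i j h * (\<integral>\<^sup>+p. ennreal \<bar>\<Theta> i j h p\<bar> \<partial>lborel))"
      using m by (simp add: nn_integral_sum nn_integral_cmult nn_integral_prod[OF \<Theta>m1])
  qed
  also have "\<dots> \<le> (\<integral>\<^sup>+h. (\<Sum>i\<in>UNIV. \<Sum>j\<in>UNIV. c i j h * ennreal E) \<partial>lborel)"
    by (intro nn_integral_mono sum_mono bound)
  also have "\<dots> = (\<Sum>i\<in>UNIV. \<Sum>j\<in>UNIV. (\<integral>\<^sup>+h. c i j h \<partial>lborel) * ennreal E)"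
    by (simp add: nn_integral_sum nn_integral_multc)
  also have "\<dots> = (\<Sum>i\<in>UNIV. \<Sum>j\<in>UNIV. ennreal (\<integral>h. \<bar>h $ j * pd i \<rho> h\<bar> \<partial>lborel) * ennreal E)"
    unfolding c_def
    by (intro sum.cong refl arg_cong2[where f="(*)"] nn_integral_eq_integral integrable_abs integrable_cc integral_coord_pd(2)[OF \<rho>]) simp
  also have "\<dots> = ennreal ((\<Sum>i\<in>UNIV. \<Sum>j\<in>UNIV. \<integral>h. \<bar>h $ j * pd i \<rho> h\<bar> \<partial>lborel) * E)"
  proof -
    define J where "J i j = (\<integral>h. \<bar>h $ j * pd i \<rho> h\<bar> \<partial>lborel)" for i j
    have J0: "J i j \<ge> 0" for i j unfolding J_def by (intro integral_nonneg_AE AE_I2) simp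
    have "ennreal ((\<Sum>i\<in>UNIV. \<Sum>j\<in>UNIV. J i j) * E) = ennreal (\<Sum>i\<in>UNIV. \<Sum>j\<in>UNIV. J i j * E)"
      by (simp only: sum_distrib_right)
    also have "\<dots> = (\<Sum>i\<in>UNIV. ennreal (\<Sum>j\<in>UNIV. J i j * E))"
      by (rule sum_ennreal[symmetric]) (intro sum_nonneg mult_nonneg_nonneg J0 E0)
    also have "\<dots> = (\<Sum>i\<in>UNIV. \<Sum>j\<in>UNIV. ennreal (J i j * E))"
      by (intro sum.cong refl sum_ennreal[symmetric] mult_nonneg_nonneg J0 E0)
    also have "\<dots> = (\<Sum>i\<in>UNIV. \<Sum>j\<in>UNIV. ennreal (J i j) * ennreal E)"
      by (intro sum.cong refl ennreal_mult J0 E0)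
    finally show ?thesis by (simp only: J_def)
  qed
  also have "\<dots> \<le> ennreal (M * E)"
    by (intro ennreal_leI mult_right_mono M E0)
  finally show ?thesis by (simp add: E_def)
qed

lemma good_mollifier:
  assumes \<eta>: "\<eta> > 0"
  obtains \<rho> where "test_fn UNIV \<rho>" "L2_fn (conv_x a \<rho>)" "L2_norm (\<lambda>p. conv_x a \<rho> p - a p) \<le> \<eta>"
    "(\<integral>\<^sup>+t. \<integral>\<^sup>+x. ennreal \<bar>commutator_x \<rho> (t, x)\<bar> \<partial>lborel \<partial>lborel) \<le> ennreal \<eta>"
proof -
  obtain M where M: "M \<ge> 0" "\<And>r. r > 0 \<Longrightarrow> \<exists>\<rho> :: real^3 \<Rightarrow> real. test_fn UNIV \<rho> \<and> (\<forall>x. 0 \<le> \<rho> x) \<and> (\<integral>x. \<rho> x \<partial>lborel) = 1 \<and>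
       (\<forall>x. norm x > r \<longrightarrow> \<rho> x = 0) \<and> (\<Sum>i\<in>UNIV. \<Sum>j\<in>UNIV. \<integral>h. \<bar>h $ j * pd i \<rho> h\<bar> \<partial>lborel) \<le> M"
    using mollifiers[where 'n=3] by blast
  define \<Gamma> where "\<Gamma> = (\<Sum>i\<in>UNIV. \<Sum>j\<in>UNIV. L2_norm (G i j))"
  have \<Gamma>: "L2_norm (G i j) \<le> \<Gamma>" for i j
  proof -
    have "L2_norm (G i j) \<le> (\<Sum>j\<in>UNIV. L2_norm (G i j))" by (rule member_le_sum) (auto simp: L2_norm_nonneg)
    also have "\<dots> \<le> \<Gamma>" unfolding \<Gamma>_def
      by (rule member_le_sum[where f="\<lambda>i. \<Sum>j\<in>UNIV. L2_norm (G i j)"]) (auto simp: L2_norm_nonneg sum_nonneg)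
    finally show ?thesis .
  qed
  have \<Gamma>0: "\<Gamma> \<ge> 0" using \<Gamma>[of 0 0] L2_norm_nonneg[of "G 0 0"] by linarith
  \<comment> \<open>The 1 makes \<open>\<epsilon> = \<eta> / D\<close> at most
    \<open>\<eta>\<close>, as the L^2 error requires, while \<open>D - 1\<close> is the factor of
    \<epsilon> in the commutator bound.\<close>
  define D where "D = 1 + M * (\<Gamma> + L2_norm a)"
  have "0 \<le> M * (\<Gamma> + L2_norm a)" by (intro mult_nonneg_nonneg add_nonneg_nonneg L2_norm_nonneg M(1) \<Gamma>0)
  then have D: "D \<ge> 1" by (simp add: D_def)
  define \<epsilon> where "\<epsilon> = \<eta> / D"
  have \<epsilon>: "\<epsilon> > 0" "\<epsilon> \<le> \<eta>" using \<eta> D by (simp_all add: \<epsilon>_def divide_le_eq)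
  have \<epsilon>M: "M * (\<epsilon> * (\<Gamma> + L2_norm a)) \<le> \<eta>"
  proof -
    have "M * (\<epsilon> * (\<Gamma> + L2_norm a)) = \<epsilon> * (D - 1)" by (simp add: D_def)
    also have "\<dots> \<le> \<epsilon> * D" using \<epsilon>(1) by simp
    also have "\<dots> = \<eta>" using D by (simp add: \<epsilon>_def)
    finally show ?thesis .
  qed
  obtain \<delta>a where \<delta>a: "\<delta>a > 0" "\<And>h. norm h \<le> \<delta>a \<Longrightarrow> L2_norm (\<lambda>x. a (x + h) - a x) \<le> \<epsilon>"
    by (rule L2_translation_eps[OF a_L2 \<epsilon>(1)]) blast
  have "\<forall>i j. \<exists>\<delta>>0. \<forall>h. norm h \<le> \<delta> \<longrightarrow> L2_norm (\<lambda>x. G i j (x + h) - G i j x) \<le> \<epsilon>"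
    using L2_translation_eps[OF G_L2 \<epsilon>(1)] by metis
  then obtain \<delta>G where \<delta>G: "\<And>i j. \<delta>G i j > 0" "\<And>i j h. norm h \<le> \<delta>G i j \<Longrightarrow> L2_norm (\<lambda>x. G i j (x + h) - G i j x) \<le> \<epsilon>"
    by metis
  \<comment> \<open>A minimum of finitely many radii: one for \<open>a\<close> and one for each of
    the nine entries of the gradient.\<close>
  define \<delta> where "\<delta> = min \<delta>a (Min (range (\<lambda>(i, j). \<delta>G i j)))"
  have \<delta>: "\<delta> > 0" using \<delta>a(1) \<delta>G(1) by (auto simp: \<delta>_def)
  have \<delta>le: "\<delta> \<le> \<delta>a" "\<delta> \<le> \<delta>G i j" for i j
    unfolding \<delta>_def by (auto intro!: min.coboundedI2 Min_le)
  obtain \<rho> :: "real^3 \<Rightarrow> real" where \<rho>': "test_fn UNIV \<rho> \<and> (\<forall>x. 0 \<le> \<rho> x) \<and> (\<integral>x. \<rho> x \<partial>lborel) = 1 \<and>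
       (\<forall>x. norm x > \<delta> \<longrightarrow> \<rho> x = 0) \<and> (\<Sum>i\<in>UNIV. \<Sum>j\<in>UNIV. \<integral>h. \<bar>h $ j * pd i \<rho> h\<bar> \<partial>lborel) \<le> M"
    using M(2)[OF \<delta>] by (rule exE)
  have \<rho>: "test_fn UNIV \<rho>" "\<And>x. 0 \<le> \<rho> x" "(\<integral>x. \<rho> x \<partial>lborel) = 1" "\<And>x. norm x > \<delta> \<Longrightarrow> \<rho> x = 0"
     "(\<Sum>i\<in>UNIV. \<Sum>j\<in>UNIV. \<integral>h. \<bar>h $ j * pd i \<rho> h\<bar> \<partial>lborel) \<le> M"
    using \<rho>' by simp_all
  have ea: "L2_norm (\<lambda>p. a (p + (0, - h)) - a p) \<le> \<epsilon>" if "norm h \<le> \<delta>" for h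
    by (rule \<delta>a(2)) (use that \<delta>le(1) in \<open>simp add: norm_Pair\<close>)
  have eG: "L2_norm (\<lambda>p. G i j (p + (0, - h)) - G i j p) \<le> \<epsilon>" if "norm h \<le> \<delta>" for i j h
    by (rule \<delta>G(2)) (use that \<delta>le(2)[of i j] in \<open>simp add: norm_Pair\<close>)
  have es: "L2_norm (\<lambda>p. a (p + (0, - h)) - a p) \<le> \<epsilon>" if "\<rho> h \<noteq> 0" for h
  proof (rule ea)
    show "norm h \<le> \<delta>" using \<rho>(4)[of h] that by (cases "norm h \<le> \<delta>") auto
  qed
  have W: "L2_fn (\<lambda>p. conv_x a \<rho> p - a p)" "L2_norm (\<lambda>p. conv_x a \<rho> p - a p) \<le> \<epsilon>"
    using conv_x_L2[OF a_L2 test_fn_cc[OF \<rho>(1)] \<rho>(2,3) es less_imp_le[OF \<epsilon>(1)]] by blast+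
  show thesis
  proof (rule that[OF \<rho>(1)])
    show "L2_fn (conv_x a \<rho>)" using L2_fn_add[OF W(1) a_L2] by simp
    show "L2_norm (\<lambda>p. conv_x a \<rho> p - a p) \<le> \<eta>" using W(2) \<epsilon>(2) by linarith
    have "(\<integral>\<^sup>+t. \<integral>\<^sup>+x. ennreal \<bar>commutator_x \<rho> (t, x)\<bar> \<partial>lborel \<partial>lborel) \<le> ennreal (M * (\<epsilon> * (\<Gamma> + L2_norm a)))"
      by (rule commutator_small[OF \<rho>(1,3,4,5) ea eG _ \<Gamma>]) (use \<epsilon> in auto)
    also have "\<dots> \<le> ennreal \<eta>" by (intro ennreal_leI \<epsilon>M)
    finally show "(\<integral>\<^sup>+t. \<integral>\<^sup>+x. ennreal \<bar>commutator_x \<rho> (t, x)\<bar> \<partial>lborel \<partial>lborel) \<le> ennreal \<eta>" .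
  qed
qed

text \<open>The mollifier is removed while R and T are kept fixed, since the two weights have to lie
  in L^2 for \<open>renorm_integral_diff\<close>.\<close>

lemma renormalised_inequality:
  assumes R: "R > 0" and T: "T > 0"
  shows "(\<integral>p. renorm (a p) * (indicat_real {0<..T} (fst p) * cutoff R (snd p)) \<partial>lborel)
    \<le> T * (\<integral>p. renorm (a p) * (indicat_real {0<..T} (fst p) * spread R p) \<partial>lborel)"
proof (rule field_le_epsilon)
  fix e :: real assume e: "e > 0"
  let ?c = "\<lambda>p. indicat_real {0<..T} (fst p) * cutoff R (snd p :: real^3)" and ?s = "\<lambda>p. indicat_real {0<..T} (fst p) * spread R p"
  have L: "L2_fn ?c" "L2_fn ?s" by (rule L2_fn_window[OF cc_fn_cutoff[OF R]] spread_L2[OF R])+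
  \<comment> \<open>Collects the factors of \<eta>: the replacement error on the left, and T times
    the replacement error on the right plus the commutator norm.\<close>
  define D where "D = L2_norm ?c + T * (L2_norm ?s + 1)"
  have D: "D > 0" unfolding D_def using T L2_norm_nonneg[of ?c] L2_norm_nonneg[of ?s] by (intro add_nonneg_pos mult_pos_pos) auto
  define \<eta> where "\<eta> = e / D"
  have \<eta>: "\<eta> > 0" using e D by (simp add: \<eta>_def)
  obtain \<rho> where \<rho>: "test_fn UNIV \<rho>" "L2_fn (conv_x a \<rho>)" "L2_norm (\<lambda>p. conv_x a \<rho> p - a p) \<le> \<eta>"
    "(\<integral>\<^sup>+t. \<integral>\<^sup>+x. ennreal \<bar>commutator_x \<rho> (t, x)\<bar> \<partial>lborel \<partial>lborel) \<le> ennreal \<eta>"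
    by (rule good_mollifier[OF \<eta>])
  let ?W = "conv_x a \<rho>"
  have d: "\<bar>(\<integral>p. renorm (?W p) * h p \<partial>lborel) - (\<integral>p. renorm (a p) * h p \<partial>lborel)\<bar> \<le> \<eta> * L2_norm h" if "L2_fn h" for h
    using renorm_integral_diff[OF \<rho>(2) a_L2 that] mult_right_mono[OF \<rho>(3) L2_norm_nonneg[of h]] by linarith
  have "(\<integral>p. renorm (?W p) * ?c p \<partial>lborel) \<le> T * ((\<integral>p. renorm (?W p) * ?s p \<partial>lborel) + \<eta>)"
    using renormalised_estimate[OF \<rho>(1) R T \<rho>(2,4)] \<eta> by (simp add: mult_ac)
  also have "\<dots> \<le> T * ((\<integral>p. renorm (a p) * ?s p \<partial>lborel) + \<eta> * L2_norm ?s + \<eta>)"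
    using d[OF L(2)] T by (intro mult_left_mono) auto
  finally have "(\<integral>p. renorm (a p) * ?c p \<partial>lborel) \<le> T * ((\<integral>p. renorm (a p) * ?s p \<partial>lborel) + \<eta> * L2_norm ?s + \<eta>) + \<eta> * L2_norm ?c"
    using d[OF L(1)] by linarith
  also have "\<dots> = T * (\<integral>p. renorm (a p) * ?s p \<partial>lborel) + \<eta> * D" by (simp add: D_def algebra_simps)
  also have "\<eta> * D = e" using D by (simp add: \<eta>_def)
  finally show "(\<integral>p. renorm (a p) * ?c p \<partial>lborel) \<le> T * (\<integral>p. renorm (a p) * ?s p \<partial>lborel) + e" .
qed

section \<open>Removal of the cut-off\<close>

lemma abs_dcutoff_le_japanese:
  fixes x :: "real^3"
  assumes "R \<ge> 1"
  shows "\<bar>dcutoff R j x\<bar> \<le> 12 * sqrt (japanese x)"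
proof (cases "norm x \<le> R")
  case True
  have j: "sqrt (japanese x) = 1 / sqrt (1 + (norm x)\<^sup>2)"
    using sqrt_japanese[of x] by (simp add: eq_divide_eq add_nonneg_eq_0_iff)
  have q: "sqrt (1 + (norm x)\<^sup>2) > 0" using one_plus_square_pos by simp
  \<comment> \<open>Since |x| \<le> R and R \<ge> 1, the bracket is at most 2 R, and 6 |x| / R^2 is
    at most 12 divided by the bracket: the gradient of the cut-off decays like the square root of
    the Hardy weight, uniformly in R.\<close>
  have "sqrt (1 + (norm x)\<^sup>2) \<le> sqrt ((2 * R)\<^sup>2)"
  proof (rule real_sqrt_le_mono)
    have "(norm x)\<^sup>2 \<le> R\<^sup>2" using True by (intro power_mono) auto
    moreover have "1 \<le> R\<^sup>2" using assms by (simp add: one_le_power)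
    ultimately show "1 + (norm x)\<^sup>2 \<le> (2 * R)\<^sup>2" by (simp add: power_mult_distrib)
  qed
  also have "sqrt ((2 * R)\<^sup>2) = 2 * R" using assms by (simp only: real_sqrt_abs)
  finally have "sqrt (1 + (norm x)\<^sup>2) \<le> 2 * R" .
  then have "norm x * sqrt (1 + (norm x)\<^sup>2) \<le> R * (2 * R)" using True assms by (intro mult_mono) auto
  then have n: "6 / R\<^sup>2 * norm x * sqrt (1 + (norm x)\<^sup>2) \<le> 12"
    using assms by (simp add: divide_le_eq power2_eq_square mult_ac)
  have "\<bar>dcutoff R j x\<bar> \<le> 6 / R\<^sup>2 * norm x"
    using abs_dcutoff_le[of R j x] assms True by simp
  also have "\<dots> \<le> 12 / sqrt (1 + (norm x)\<^sup>2)" using n q by (simp add: le_divide_eq)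
  finally show ?thesis by (simp add: j)
next
  case False
  then have "\<bar>dcutoff R j x\<bar> \<le> 0" using abs_dcutoff_le[of R j x] assms by simp
  then show ?thesis by (simp add: japanese_pos less_imp_le)
qed

text \<open>As R grows, the left side of \<open>renormalised_inequality\<close> tends to the
  integral of \<open>renorm (a p)\<close> over the window, and the right side tends to 0: the
  derivatives of the cut-off vanish pointwise in the limit, and there is a majorant independent of
  R.\<close>

lemma a_zero: "AE p in lborel. a p = 0"
proof -
  have window: "AE p in lborel. fst p \<in> {0<..T} \<longrightarrow> a p = 0" if T: "T > 0" for T :: real
  proof -
    let ?I = "indicat_real {0<..T}" and ?R = "\<lambda>n. real (Suc n)"
    have a2: "integrable lborel (\<lambda>p. (a p)\<^sup>2)" by (rule L2_fn_integrable[OF a_L2])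
    have [measurable]: "cutoff (?R n) \<in> borel_measurable (borel :: (real^3) measure)" for n
      by (rule cc_fn_measurable[OF cc_fn_cutoff]) simp
    have sm: "(\<lambda>p. ?I (fst p) * spread (?R n) p) \<in> borel_measurable borel" for n
      by (rule L2_fn_measurable[OF spread_L2]) simp
    have L: "(\<lambda>n. \<integral>p. renorm (a p) * (?I (fst p) * cutoff (?R n) (snd p)) \<partial>lborel) \<longlonglongrightarrow> (\<integral>p. renorm (a p) * (?I (fst p) * 1) \<partial>lborel)"
    proof (rule integral_dominated_convergence[OF _ _ a2])
      show "(\<lambda>p. renorm (a p) * (?I (fst p) * cutoff (?R n) (snd p))) \<in> borel_measurable lborel" for n
        by (simp del: of_nat_Suc)
      show "AE p in lborel. (\<lambda>n. renorm (a p) * (?I (fst p) * cutoff (?R n) (snd p))) \<longlonglongrightarrow> renorm (a p) * (?I (fst p) * 1)"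
        by (intro AE_I2 tendsto_intros cutoff_tendsto_1)
      show "AE p in lborel. norm (renorm (a p) * (?I (fst p) * cutoff (?R n) (snd p))) \<le> (a p)\<^sup>2" for n
      proof (rule AE_I2)
        fix p :: "real \<times> (real^3)"
        have "?I (fst p) * cutoff (?R n) (snd p) \<le> 1 * 1"
          by (intro mult_mono cutoff_le_1 cutoff_nonneg) (auto simp: indicator_def)
        then have "renorm (a p) * (?I (fst p) * cutoff (?R n) (snd p)) \<le> (a p)\<^sup>2 * 1"
          by (intro mult_mono renorm_le_square mult_nonneg_nonneg cutoff_nonneg) auto
        then show "norm (renorm (a p) * (?I (fst p) * cutoff (?R n) (snd p))) \<le> (a p)\<^sup>2"
          by (simp add: renorm_nonneg cutoff_nonneg del: of_nat_Suc)
      qed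
    qed simp
    \<comment> \<open>Each of the two bounds on \<open>renorm\<close> serves one term: a^2 against
      the second derivatives of the cut-off, bounded by 30, and |a| against v times the first
      derivatives, where 12 and the weight come from \<open>abs_dcutoff_le_japanese\<close>.\<close>
    let ?w = "\<lambda>p. \<Sum>i\<in>UNIV. 30 * (a p)\<^sup>2 + 12 * \<bar>a p * (v i p * sqrt (japanese (snd p)))\<bar>"
    have w: "integrable lborel ?w"
      by (intro Bochner_Integration.integrable_sum Bochner_Integration.integrable_add integrable_mult_right integrable_abs a2
          L2_mult_integrable a_L2 v_weighted_L2)
    have S: "(\<lambda>n. \<integral>p. renorm (a p) * (?I (fst p) * spread (?R n) p) \<partial>lborel) \<longlonglongrightarrow> (\<integral>p. 0 \<partial>(lborel :: (real \<times> (real^3)) measure))"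
    proof (rule integral_dominated_convergence[OF _ _ w])
      show "(\<lambda>p. renorm (a p) * (?I (fst p) * spread (?R n) p)) \<in> borel_measurable lborel" for n
        using sm[of n] by (simp del: of_nat_Suc)
      show "AE p in lborel. (\<lambda>n. renorm (a p) * (?I (fst p) * spread (?R n) p)) \<longlonglongrightarrow> 0"
      proof (rule AE_I2)
        fix p :: "real \<times> (real^3)"
        let ?g = "\<lambda>n. \<Sum>i\<in>(UNIV :: 3 set). 30 * (1 / ?R n)\<^sup>2 + \<bar>v i p\<bar> * (6 * norm (snd p) * (1 / ?R n)\<^sup>2)"
        have "?g \<longlonglongrightarrow> (\<Sum>i\<in>(UNIV :: 3 set). 30 * 0\<^sup>2 + \<bar>v i p\<bar> * (6 * norm (snd p) * 0\<^sup>2))"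
          by (intro tendsto_intros LIMSEQ_Suc[OF lim_1_over_n])
        then have g: "?g \<longlonglongrightarrow> 0" by simp
        have "(\<lambda>n. spread (?R n) p) \<longlonglongrightarrow> 0"
        proof (rule null_sandwich[OF g spread_nonneg])
          fix n
          have R: "?R n > 0" by simp
          have "\<bar>dcutoff (?R n) i (snd p)\<bar> \<le> 6 * norm (snd p) * (1 / ?R n)\<^sup>2" for i
          proof -
            have "\<bar>dcutoff (?R n) i (snd p)\<bar> \<le> 6 / (?R n)\<^sup>2 * norm (snd p) * indicat_real (cball 0 (?R n)) (snd p)"
              by (rule abs_dcutoff_le[OF R])
            also have "\<dots> \<le> 6 / (?R n)\<^sup>2 * norm (snd p) * 1" by (intro mult_left_mono) (auto simp: indicator_def)
            finally show ?thesis by (simp add: power_divide del: of_nat_Suc)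
          qed
          then show "spread (?R n) p \<le> ?g n"
            unfolding spread_def using abs_ddcutoff_le[OF R]
            by (intro sum_mono add_mono mult_left_mono) (auto simp: power_divide simp del: of_nat_Suc)
        qed
        from tendsto_mult_right_zero[OF tendsto_mult_right_zero[OF this]]
        show "(\<lambda>n. renorm (a p) * (?I (fst p) * spread (?R n) p)) \<longlonglongrightarrow> 0" .
      qed
      show "AE p in lborel. norm (renorm (a p) * (?I (fst p) * spread (?R n) p)) \<le> ?w p" for n
      proof (rule AE_I2)
        fix p :: "real \<times> (real^3)"
        have R: "?R n > 0" "?R n \<ge> 1" by simp_all
        have "norm (renorm (a p) * (?I (fst p) * spread (?R n) p)) = renorm (a p) * (?I (fst p) * spread (?R n) p)"
          by (simp add: renorm_nonneg spread_nonneg del: of_nat_Suc)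
        also have "\<dots> \<le> renorm (a p) * (1 * spread (?R n) p)"
          by (intro mult_left_mono mult_right_mono spread_nonneg renorm_nonneg) (auto simp: indicator_def)
        also have "\<dots> = (\<Sum>i\<in>UNIV. renorm (a p) * \<bar>ddcutoff (?R n) i (snd p)\<bar> + renorm (a p) * (\<bar>v i p\<bar> * \<bar>dcutoff (?R n) i (snd p)\<bar>))"
          by (simp add: spread_def sum_distrib_left distrib_left del: of_nat_Suc)
        also have "\<dots> \<le> ?w p"
        proof (intro sum_mono add_mono)
          fix i :: 3
          have "\<bar>ddcutoff (?R n) i (snd p)\<bar> \<le> 30 / (?R n)\<^sup>2" by (rule abs_ddcutoff_le[OF R(1)])
          also have "\<dots> \<le> 30" using one_le_power[OF R(2), of 2] by (simp add: divide_le_eq del: of_nat_Suc)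
          finally have "renorm (a p) * \<bar>ddcutoff (?R n) i (snd p)\<bar> \<le> (a p)\<^sup>2 * 30"
            by (intro mult_mono renorm_le_square) auto
          then show "renorm (a p) * \<bar>ddcutoff (?R n) i (snd p)\<bar> \<le> 30 * (a p)\<^sup>2" by simp
          have "renorm (a p) * (\<bar>v i p\<bar> * \<bar>dcutoff (?R n) i (snd p)\<bar>) \<le> \<bar>a p\<bar> * (\<bar>v i p\<bar> * (12 * sqrt (japanese (snd p))))"
            by (intro mult_mono renorm_le_abs abs_dcutoff_le_japanese R) auto
          then show "renorm (a p) * (\<bar>v i p\<bar> * \<bar>dcutoff (?R n) i (snd p)\<bar>) \<le> 12 * \<bar>a p * (v i p * sqrt (japanese (snd p)))\<bar>"
            by (simp add: abs_mult japanese_pos less_imp_le mult_ac)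
        qed
        finally show "norm (renorm (a p) * (?I (fst p) * spread (?R n) p)) \<le> ?w p" .
      qed
    qed simp
    have "(\<integral>p. renorm (a p) * (?I (fst p) * 1) \<partial>lborel) \<le> T * (\<integral>p. 0 \<partial>(lborel :: (real \<times> (real^3)) measure))"
      by (rule LIMSEQ_le[OF L tendsto_mult_left[OF S]]) (use renormalised_inequality[OF _ T] in auto)
    moreover have i: "integrable lborel (\<lambda>p. renorm (a p) * ?I (fst p))"
    proof (rule Bochner_Integration.integrable_bound[OF a2 _ AE_I2])
      fix p :: "real \<times> (real^3)"
      show "norm (renorm (a p) * ?I (fst p)) \<le> norm ((a p)\<^sup>2)"
        using renorm_le_square[of "a p"] by (simp add: renorm_nonneg indicator_def)
    qed simp
    moreover have "0 \<le> (\<integral>p. renorm (a p) * ?I (fst p) \<partial>lborel)" by (intro integral_nonneg_AE AE_I2) (simp add: renorm_nonneg)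
    ultimately have "(\<integral>p. renorm (a p) * ?I (fst p) \<partial>lborel) = 0" by simp
    then have "AE p in lborel. renorm (a p) * ?I (fst p) = 0"
      by (subst (asm) integral_nonneg_eq_0_iff_AE[OF i]) (auto simp: renorm_nonneg)
    then show ?thesis by eventually_elim (auto simp: renorm_eq_0)
  qed
  \<comment> \<open>The windows exhaust the positive times; on the rest a vanishes by
    \<open>a_past\<close>.\<close>
  have "AE p in lborel. \<forall>n. fst p \<in> {0<..real (Suc n)} \<longrightarrow> a p = 0"
    unfolding AE_all_countable by (intro allI window) simp
  then show ?thesis
  proof eventually_elim
    fix p assume *: "\<forall>n. fst p \<in> {0<..real (Suc n)} \<longrightarrow> a p = 0"
    show "a p = 0"
    proof (cases "fst p > 0")
      case True
      obtain n :: nat where "fst p \<le> real n" using real_arch_simple by blast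
      then have "fst p \<in> {0<..real (Suc n)}" using True by simp
      with * show ?thesis by blast
    next
      case False
      then show ?thesis using a_past[of "fst p" "snd p"] by simp
    qed
  qed
qed

end

section \<open>Borel representatives of Lebesgue measurable data\<close>

text \<open>Lebesgue measure is complete, so \<open>f\<close> inherits measurability from its Borel
  representative, and its integral may be computed there.\<close>

lemma lebesgue_AE_eq_lborel:
  fixes f g :: "'a::euclidean_space \<Rightarrow> 'b::{banach, second_countable_topology}"
  assumes g: "g \<in> borel_measurable borel" and ae: "AE x in lborel. f x = g x"
  shows "f \<in> borel_measurable lebesgue"
    and "integrable lebesgue f \<longleftrightarrow> integrable lborel g"
    and "integral\<^sup>L lebesgue f = integral\<^sup>L lborel g"
proof -
  have gl: "g \<in> borel_measurable lborel" using g by simp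
  have gm: "g \<in> borel_measurable lebesgue" by (rule measurable_completion[OF gl])
  have ae': "AE x in lebesgue. f x = g x" by (rule AE_completion[OF ae])
  show fm: "f \<in> borel_measurable lebesgue"
  proof (rule measurableI)
    fix B :: "'b set" assume B: "B \<in> sets borel"
    have "f -` B \<inter> space lebesgue \<in> sets lebesgue"
    proof (rule completion.in_sets_AE)
      show "AE x in lebesgue. x \<in> g -` B \<inter> space lebesgue \<longleftrightarrow> x \<in> f -` B \<inter> space lebesgue"
        using ae' by eventually_elim auto
      show "g -` B \<inter> space lebesgue \<in> sets lebesgue" by (rule measurable_sets[OF gm B])
    qed auto
    then show "f -` B \<inter> space lebesgue \<in> sets lebesgue" .
  qed simp
  have "integrable lebesgue f \<longleftrightarrow> integrable lebesgue g"
    by (rule integrable_cong_AE[OF fm gm ae'])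
  then show "integrable lebesgue f \<longleftrightarrow> integrable lborel g"
    using integrable_completion[OF gl] by simp
  have "integral\<^sup>L lebesgue f = integral\<^sup>L lebesgue g"
    by (rule integral_cong_AE[OF fm gm ae'])
  then show "integral\<^sup>L lebesgue f = integral\<^sup>L lborel g"
    using integral_completion[OF gl] by simp
qed

lemma half_space_iff: "p \<in> half_space \<longleftrightarrow> fst p > 0"
  by (cases p) (simp add: half_space_def)

lemma half_space_borel [measurable]: "half_space \<in> sets borel"
proof -
  have "open half_space" unfolding half_space_def by (intro open_Times) auto
  then show ?thesis by simp
qed

text \<open>\<open>L\<close> extracts a scalar component, as Borel representatives are taken for
  real functions. Multiplication by the indicator sets the values at nonpositive times, where
  \<open>F\<close> is arbitrary, to 0.\<close>

lemma half_space_representative: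
  fixes F :: "real \<times> (real^3) \<Rightarrow> 'b::{banach, second_countable_topology}" and L :: "'b \<Rightarrow> real"
  assumes F: "set_borel_measurable lebesgue half_space F" and L: "bounded_linear L"
  obtains f where "f \<in> borel_measurable borel" "\<And>t x. t \<le> 0 \<Longrightarrow> f (t, x) = 0"
    "AE p in lborel. p \<in> half_space \<longrightarrow> L (F p) = f p"
proof -
  have "(\<lambda>p. L (indicator half_space p *\<^sub>R F p)) \<in> borel_measurable lebesgue"
    by (rule measurable_compose[OF F[unfolded set_borel_measurable_def]])
       (rule borel_measurable_continuous_onI[OF linear_continuous_on[OF L]])
  then obtain g where g: "g \<in> borel_measurable lborel" "AE p in lborel. L (indicator half_space p *\<^sub>R F p) = g p"
    using completion_ex_borel_measurable_real by blast
  show ?thesis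
  proof (rule that[of "\<lambda>p. indicator half_space p * g p"])
    show "(\<lambda>p. indicator half_space p * g p) \<in> borel_measurable borel" using g(1) by simp
    show "indicator half_space (t, x) * g (t, x) = 0" if "t \<le> 0" for t x
      using that by (simp add: half_space_iff indicator_def)
    show "AE p in lborel. p \<in> half_space \<longrightarrow> L (F p) = indicator half_space p * g p"
      using g(2) by eventually_elim auto
  qed
qed

section \<open>Product test functions on the half-space\<close>

lemma dderiv_fst_snd:
  fixes \<theta> :: "real \<Rightarrow> real" and \<psi> :: "'b::euclidean_space \<Rightarrow> real"
  assumes "smooth_fn \<theta>" "smooth_fn \<psi>"
  shows "dderiv (\<lambda>p. \<theta> (fst p) * \<psi> (snd p)) (s, w) p
    = s * dderiv \<theta> 1 (fst p) * \<psi> (snd p) + \<theta> (fst p) * dderiv \<psi> w (snd p)"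
proof -
  let ?D = "frechet_derivative \<theta> (at (fst p))" and ?E = "frechet_derivative \<psi> (at (snd p))"
  have D: "(\<theta> has_derivative ?D) (at (fst p))" and E: "(\<psi> has_derivative ?E) (at (snd p))"
    using assms by (auto intro!: has_derivative_frechet smooth_fn_differentiable)
  have 1: "((\<lambda>p. \<theta> (fst p)) has_derivative (\<lambda>h. ?D (fst h))) (at p)"
    by (rule has_derivative_compose[OF has_derivative_fst[OF has_derivative_ident] D])
  have 2: "((\<lambda>p. \<psi> (snd p)) has_derivative (\<lambda>h. ?E (snd h))) (at p)"
    by (rule has_derivative_compose[OF has_derivative_snd[OF has_derivative_ident] E])
  have "?D s = s * ?D 1"
    using linear_cmul[OF has_derivative_linear[OF D], of s 1] by simp
  then show ?thesis
    by (subst dderiv_eq[OF has_derivative_mult[OF 1 2]]) (simp add: dderiv_def)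
qed

lemma dderiv_zero_direction:
  assumes "f differentiable (at p)" shows "dderiv f 0 p = 0"
  unfolding dderiv_def using linear_0[OF linear_frechet_derivative[OF assms]] .

lemma half_space_test_fn_derivatives:
  fixes \<theta> :: "real \<Rightarrow> real" and \<psi> :: "real^3 \<Rightarrow> real"
  assumes "smooth_fn \<theta>" "smooth_fn \<psi>"
  defines "\<phi> \<equiv> \<lambda>p. \<theta> (fst p) * \<psi> (snd p)"
  shows "dt \<phi> p = dderiv \<theta> 1 (fst p) * \<psi> (snd p)"
    and "grad_x \<phi> p $ j = \<theta> (fst p) * pd j \<psi> (snd p)"
    and "lap_x \<phi> p = \<theta> (fst p) * (\<Sum>i\<in>UNIV. pd i (pd i \<psi>) (snd p))"
proof -
  have x: "dderiv \<phi> (0, axis j 1) = (\<lambda>p. \<theta> (fst p) * pd j \<psi> (snd p))" for j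
    unfolding \<phi>_def by (rule ext) (simp add: dderiv_fst_snd[OF assms(1,2)])
  show "dt \<phi> p = dderiv \<theta> 1 (fst p) * \<psi> (snd p)"
    unfolding dt_def \<phi>_def using assms(2)
    by (simp add: dderiv_fst_snd[OF assms(1,2)] dderiv_zero_direction smooth_fn_differentiable)
  show "grad_x \<phi> p $ j = \<theta> (fst p) * pd j \<psi> (snd p)" by (simp add: grad_x_def x)
  have "smooth_fn (pd i \<psi>)" for i by (rule smooth_fn_dderiv[OF assms(2) axis_Basis])
  then show "lap_x \<phi> p = \<theta> (fst p) * (\<Sum>i\<in>UNIV. pd i (pd i \<psi>) (snd p))"
    by (simp add: lap_x_def x dderiv_fst_snd[OF assms(1)] sum_distrib_left)
qed

lemma component_square_le: "((M :: real^'n^'m) $ i $ j)\<^sup>2 \<le> (norm M)\<^sup>2"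
proof -
  have "\<bar>M $ i $ j\<bar> \<le> norm M"
    using component_le_norm_cart[of "M $ i" j] Finite_Cartesian_Product.norm_nth_le[of M i] by linarith
  then show ?thesis by (simp add: abs_le_square_iff[symmetric])
qed

theorem theorem1:
  fixes v :: "real \<Rightarrow> real^3 \<Rightarrow> real^3" and a :: "real \<Rightarrow> real^3 \<Rightarrow> real"
  assumes "div_free v"
    and "L2_Hdot1 v"
    and "L2_spacetime a"
    and "weak_solution a v"
    and "zero_initial_value a"
  shows "AE p in lebesgue. p \<in> half_space \<longrightarrow> a (fst p) (snd p) = 0"
proof -
  obtain G where
    v_sm: "set_borel_measurable lebesgue half_space (\<lambda>(t, x). v t x)" and
    G_sm: "set_borel_measurable lebesgue half_space (\<lambda>(t, x). G t x)" and
    H: "AE t in lborel. t > 0 \<longrightarrow> Hdot1_grad (v t) (G t)" and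
    G_si: "set_integrable lebesgue half_space (\<lambda>(t, x). norm (G t x) ^ 2)"
    using assms(2) unfolding L2_Hdot1_def by blast
  obtain A where
    A0: "\<And>\<psi>. test_fn UNIV \<psi> \<Longrightarrow> continuous_on {0..} (\<lambda>t. A t \<psi>)" "\<And>\<psi>. test_fn UNIV \<psi> \<Longrightarrow> A 0 \<psi> = 0" and
    Aa: "AE t in lborel. t > 0 \<longrightarrow> (\<forall>\<psi>. test_fn UNIV \<psi> \<longrightarrow> A t \<psi> = (\<integral>x. a t x * \<psi> x \<partial>lebesgue))"
    using assms(5) unfolding zero_initial_value_def by blast
  have a_sm: "set_borel_measurable lebesgue half_space (\<lambda>(t, x). a t x)"
    and a_si: "set_integrable lebesgue half_space (\<lambda>(t, x). (a t x) ^ 2)"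
    using assms(3) unfolding L2_spacetime_def by auto
  obtain b where b: "b \<in> borel_measurable borel" "\<And>t x. t \<le> 0 \<Longrightarrow> b (t, x) = 0"
      "AE p in lborel. p \<in> half_space \<longrightarrow> a (fst p) (snd p) = b p"
    using half_space_representative[OF a_sm bounded_linear_ident] by (auto simp: case_prod_beta')
  have "\<forall>i. \<exists>f. f \<in> borel_measurable borel \<and> (\<forall>t x. t \<le> 0 \<longrightarrow> f (t, x) = 0) \<and>
      (AE p in lborel. p \<in> half_space \<longrightarrow> v (fst p) (snd p) $ i = f p)"
    using half_space_representative[OF v_sm bounded_linear_vec_nth] unfolding case_prod_beta' by blast
  from choice[OF this] obtain w where w: "\<And>i. w i \<in> borel_measurable borel" "\<And>i t x. t \<le> 0 \<Longrightarrow> w i (t, x) = 0"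
      "\<And>i. AE p in lborel. p \<in> half_space \<longrightarrow> v (fst p) (snd p) $ i = w i p"
    by blast
  have "\<forall>i j. \<exists>f. f \<in> borel_measurable borel \<and> (\<forall>t x. t \<le> 0 \<longrightarrow> f (t, x) = 0) \<and>
      (AE p in lborel. p \<in> half_space \<longrightarrow> G (fst p) (snd p) $ i $ j = f p)"
    using half_space_representative[OF G_sm bounded_linear_compose[OF bounded_linear_vec_nth bounded_linear_vec_nth]]
    unfolding case_prod_beta' by blast
  then have "\<forall>i. \<exists>f. \<forall>j. f j \<in> borel_measurable borel \<and> (\<forall>t x. t \<le> 0 \<longrightarrow> f j (t, x) = 0) \<and>
      (AE p in lborel. p \<in> half_space \<longrightarrow> G (fst p) (snd p) $ i $ j = f j p)"
    by (intro allI choice) simp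
  from choice[OF this] obtain D where D: "\<And>i j. D i j \<in> borel_measurable borel" "\<And>i j t x. t \<le> 0 \<Longrightarrow> D i j (t, x) = 0"
      "\<And>i j. AE p in lborel. p \<in> half_space \<longrightarrow> G (fst p) (snd p) $ i $ j = D i j p"
    by blast
  note [measurable] = b(1) w(1) D(1)
  have b_L2: "L2_fn b"
  proof -
    have "AE p in lborel. indicator half_space p *\<^sub>R (case p of (t, x) \<Rightarrow> (a t x)\<^sup>2) = (b p)\<^sup>2"
      using b(3) by eventually_elim (auto simp: case_prod_beta' b(2) half_space_iff indicator_def)
    from lebesgue_AE_eq_lborel(2)[OF _ this] a_si show ?thesis
      unfolding L2_fn_def set_integrable_def by simp
  qed
  have D_L2: "L2_fn (D i j)" for i j
  proof -
    \<comment> \<open>On the half-space an entry is dominated by the norm of the matrix, whose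
      square is integrable; elsewhere \<open>D i j\<close> is 0.\<close>
    have "integrable lebesgue (\<lambda>p. (D i j p)\<^sup>2)"
    proof (rule Bochner_Integration.integrable_bound[OF G_si[unfolded set_integrable_def]])
      show "AE p in lebesgue. norm ((D i j p)\<^sup>2) \<le> norm (indicator half_space p *\<^sub>R (case p of (t, x) \<Rightarrow> (norm (G t x))\<^sup>2))"
        using AE_completion[OF D(3)[of i j]]
      proof eventually_elim
        case (elim p)
        then show ?case using D(2)[of "fst p" i j "snd p"] component_square_le[of "G (fst p) (snd p)" i j]
          by (auto simp: case_prod_beta' half_space_iff indicator_def)
      qed
    qed (auto intro!: measurable_completion)
    then show ?thesis unfolding L2_fn_def using integrable_completion[of "\<lambda>p. (D i j p)\<^sup>2" lborel] by simp
  qed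
  \<comment> \<open>From almost every point of space-time to almost every x at almost every time,
    the form in which the slices are compared below.\<close>
  have bs: "AE t in lborel. AE x in lborel. t > 0 \<longrightarrow> a t x = b (t, x)"
    using AE_prod[OF b(3)] by (simp add: half_space_iff)
  have ws: "AE t in lborel. AE x in lborel. t > 0 \<longrightarrow> (\<forall>i. v t x $ i = w i (t, x))"
  proof -
    have "AE p in lborel. \<forall>i. p \<in> half_space \<longrightarrow> v (fst p) (snd p) $ i = w i p"
      unfolding AE_all_countable using w(3) by auto
    from AE_prod[OF this] show ?thesis by (simp add: half_space_iff)
  qed
  have Ds: "AE t in lborel. AE x in lborel. t > 0 \<longrightarrow> (\<forall>i j. G t x $ i $ j = D i j (t, x))"
  proof -
    have "AE p in lborel. \<forall>i j. p \<in> half_space \<longrightarrow> G (fst p) (snd p) $ i $ j = D i j p"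
      unfolding AE_all_countable using D(3) by auto
    from AE_prod[OF this] show ?thesis by (simp add: half_space_iff)
  qed
  have slice: "(\<lambda>x. b (t, x)) \<in> borel_measurable borel" "(\<lambda>x. w i (t, x)) \<in> borel_measurable borel"
    "(\<lambda>x. D i j (t, x)) \<in> borel_measurable borel" for t i j
    by (intro slice_measurable b(1) w(1) D(1))+
  have tm: "\<psi> \<in> borel_measurable borel" if "test_fn UNIV \<psi>" for \<psi> :: "real^3 \<Rightarrow> real"
    by (rule borel_measurable_continuous_onI[OF smooth_fn_continuous[OF test_fn_smooth[OF that]]])
  interpret transport_data b w D A
  proof
    show "L2_fn b" by (rule b_L2)
    show "w i \<in> borel_measurable borel" for i by (rule w(1))
    show "L2_fn (D i j)" for i j by (rule D_L2)
    show "AE t in lborel. \<forall>i. integrable lborel (\<lambda>x. (w i (t, x)) ^ 6)"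
      using H ws
    proof eventually_elim
      case (elim t)
      show ?case
      proof (cases "t > 0")
        case True
        with elim have h: "v t \<in> borel_measurable lebesgue" "integrable lebesgue (\<lambda>x. norm (v t x) ^ 6)"
          and e: "AE x in lborel. \<forall>i. v t x $ i = w i (t, x)" by (auto simp: Hdot1_grad_def)
        show ?thesis
        proof
          fix i
          have "integrable lebesgue (\<lambda>x. (w i (t, x)) ^ 6)"
          proof (rule Bochner_Integration.integrable_bound[OF h(2)])
            show "AE x in lebesgue. norm (w i (t, x) ^ 6) \<le> norm (norm (v t x) ^ 6)"
              using AE_completion[OF e]
            proof eventually_elim
              case (elim x)
              then show ?case using power_mono[OF component_le_norm_cart[of "v t x" i], of 6] by (simp add: power_abs)
            qed
            show "(\<lambda>x. w i (t, x) ^ 6) \<in> borel_measurable lebesgue"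
              using slice(2)[of i t] by (auto intro!: measurable_completion)
          qed
          then show "integrable lborel (\<lambda>x. (w i (t, x)) ^ 6)"
            using integrable_completion[of "\<lambda>x. (w i (t, x)) ^ 6" lborel] slice(2)[of i t] by simp
        qed
      qed (simp add: w(2))
    qed
    show "AE t in lborel. \<forall>i j. weak_pderiv (\<lambda>x. w i (t, x)) (axis j 1) (\<lambda>x. D i j (t, x))"
      using H ws Ds
    proof eventually_elim
      case (elim t)
      show ?case
      proof (cases "t > 0")
        case True
        with elim have h: "\<And>i. weak_grad (\<lambda>x. v t x $ i) (\<lambda>x. G t x $ i)"
          and e: "AE x in lborel. \<forall>i. v t x $ i = w i (t, x)" "AE x in lborel. \<forall>i j. G t x $ i $ j = D i j (t, x)"
          by (auto simp: Hdot1_grad_def)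
        show ?thesis unfolding weak_pderiv_def
        proof (intro allI impI)
          fix i j and \<psi> :: "real^3 \<Rightarrow> real" assume \<psi>: "test_fn UNIV \<psi>"
          have d\<psi>: "test_fn UNIV (pd j \<psi>)" by (rule test_fn_dderiv[OF \<psi> axis_Basis])
          have 1: "(\<integral>x. v t x $ i * pd j \<psi> x \<partial>lebesgue) = (\<integral>x. w i (t, x) * pd j \<psi> x \<partial>lborel)"
          proof (rule lebesgue_AE_eq_lborel(3))
            show "AE x in lborel. v t x $ i * pd j \<psi> x = w i (t, x) * pd j \<psi> x"
              using e(1) by eventually_elim simp
          qed (intro borel_measurable_times slice tm[OF d\<psi>])
          have 2: "(\<integral>x. G t x $ i $ j * \<psi> x \<partial>lebesgue) = (\<integral>x. D i j (t, x) * \<psi> x \<partial>lborel)"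
          proof (rule lebesgue_AE_eq_lborel(3))
            show "AE x in lborel. G t x $ i $ j * \<psi> x = D i j (t, x) * \<psi> x"
              using e(2) by eventually_elim simp
          qed (intro borel_measurable_times slice tm[OF \<psi>])
          show "(\<integral>x. w i (t, x) * pd j \<psi> x \<partial>lborel) = - (\<integral>x. D i j (t, x) * \<psi> x \<partial>lborel)"
            using h[of i] \<psi> unfolding weak_grad_def 1[symmetric] 2[symmetric] by blast
        qed
      \<comment> \<open>For t \<le> 0 both representatives vanish, and the zero function has weak
        derivative 0.\<close>
      qed (simp add: w(2) D(2) weak_pderiv_def)
    qed
    show "D i j (t, x) = 0" if "t \<le> 0" for i j t x by (rule D(2)[OF that])
    show "b (t, x) = 0" if "t \<le> 0" for t x by (rule b(2)[OF that])
    \<comment> \<open>For t \<le> 0 the given \<open>v\<close> and \<open>a\<close> are arbitrary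
      while their representatives are 0; the integrands agree there because the test function and
      its derivatives vanish.\<close>
    have past: "\<theta> t = 0" "dderiv \<theta> 1 t = 0" if \<theta>t: "test_fn {0<..} \<theta>" "t \<le> 0" for \<theta> :: "real \<Rightarrow> real" and t
    proof -
      obtain K where K: "compact K" "K \<subseteq> {0<..}" "\<And>x. x \<notin> K \<Longrightarrow> \<theta> x = 0"
        using test_fn_support[OF \<theta>t(1)] by blast
      have "t \<notin> K" using \<theta>t(2) K(2) by auto
      then show "\<theta> t = 0" "dderiv \<theta> 1 t = 0"
        using K dderiv_eq_0[of K \<theta> t 1] compact_imp_closed by auto
    qed
    have prod: "test_fn half_space (\<lambda>p. \<theta> (fst p) * \<psi> (snd p))"
      if "test_fn {0<..} \<theta>" "test_fn UNIV \<psi>" for \<theta> :: "real \<Rightarrow> real" and \<psi> :: "real^3 \<Rightarrow> real"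
      unfolding half_space_def by (rule test_fn_fst_snd[OF that])
    have t1m: "\<theta> \<in> borel_measurable borel" "dderiv \<theta> 1 \<in> borel_measurable borel"
      if "test_fn {0<..} \<theta>" for \<theta> :: "real \<Rightarrow> real"
      using smooth_fn_continuous[OF test_fn_smooth[OF that]] smooth_fn_continuous[OF smooth_fn_dderiv[OF test_fn_smooth[OF that], of 1]]
      by (auto intro: borel_measurable_continuous_onI)
    have wall: "AE p in lborel. \<forall>i. p \<in> half_space \<longrightarrow> v (fst p) (snd p) $ i = w i p"
      unfolding AE_all_countable using w(3) by auto
    fix \<theta> :: "real \<Rightarrow> real" and \<psi> :: "real^3 \<Rightarrow> real"
    assume \<theta>: "test_fn {0<..} \<theta>" and \<psi>: "test_fn UNIV \<psi>"
    note deriv = half_space_test_fn_derivatives[OF test_fn_smooth[OF \<theta>] test_fn_smooth[OF \<psi>]]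
    have [measurable]: "\<theta> \<in> borel_measurable borel" "dderiv \<theta> 1 \<in> borel_measurable borel" "\<psi> \<in> borel_measurable borel"
      "pd i \<psi> \<in> borel_measurable borel" "pd i (pd i \<psi>) \<in> borel_measurable borel" for i
      by (intro t1m \<theta> tm \<psi> test_fn_dderiv axis_Basis)+
    let ?\<phi> = "\<lambda>p. \<theta> (fst p) * \<psi> (snd p)"
    have "(\<integral>p. v (fst p) (snd p) \<bullet> grad_x ?\<phi> p \<partial>lebesgue) = (\<integral>p. (\<Sum>i\<in>UNIV. w i p * (\<theta> (fst p) * pd i \<psi> (snd p))) \<partial>lborel)"
    proof (rule lebesgue_AE_eq_lborel(3))
      show "AE p in lborel. v (fst p) (snd p) \<bullet> grad_x ?\<phi> p = (\<Sum>i\<in>UNIV. w i p * (\<theta> (fst p) * pd i \<psi> (snd p)))"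
        using wall
      proof eventually_elim
        case (elim p)
        then show ?case using past(1)[OF \<theta>, of "fst p"]
          by (cases "fst p > 0") (auto simp: inner_vec_def deriv half_space_iff)
      qed
    qed measurable
    then show "(\<integral>p. (\<Sum>i\<in>UNIV. w i p * (\<theta> (fst p) * pd i \<psi> (snd p))) \<partial>lborel) = 0"
      using assms(1) prod[OF \<theta> \<psi>] unfolding div_free_def by auto
    have "(\<integral>p. a (fst p) (snd p) * (dt ?\<phi> p + v (fst p) (snd p) \<bullet> grad_x ?\<phi> p + lap_x ?\<phi> p) \<partial>lebesgue)
      = (\<integral>p. b p * (dderiv \<theta> 1 (fst p) * \<psi> (snd p) + (\<Sum>i\<in>UNIV. w i p * (\<theta> (fst p) * pd i \<psi> (snd p)))
          + \<theta> (fst p) * (\<Sum>i\<in>UNIV. pd i (pd i \<psi>) (snd p))) \<partial>lborel)"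
    proof (rule lebesgue_AE_eq_lborel(3))
      show "AE p in lborel. a (fst p) (snd p) * (dt ?\<phi> p + v (fst p) (snd p) \<bullet> grad_x ?\<phi> p + lap_x ?\<phi> p)
        = b p * (dderiv \<theta> 1 (fst p) * \<psi> (snd p) + (\<Sum>i\<in>UNIV. w i p * (\<theta> (fst p) * pd i \<psi> (snd p)))
          + \<theta> (fst p) * (\<Sum>i\<in>UNIV. pd i (pd i \<psi>) (snd p)))"
        using wall b(3)
      proof eventually_elim
        case (elim p)
        then show ?case using past[OF \<theta>, of "fst p"]
          by (cases "fst p > 0") (auto simp: inner_vec_def deriv half_space_iff)
      qed
    qed measurable
    then show "(\<integral>p. b p * (dderiv \<theta> 1 (fst p) * \<psi> (snd p) + (\<Sum>i\<in>UNIV. w i p * (\<theta> (fst p) * pd i \<psi> (snd p)))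
          + \<theta> (fst p) * (\<Sum>i\<in>UNIV. pd i (pd i \<psi>) (snd p))) \<partial>lborel) = 0"
      using assms(4) prod[OF \<theta> \<psi>] unfolding weak_solution_def by auto
  next
    show "continuous_on {0..} (\<lambda>t. A t \<psi>)" "A 0 \<psi> = 0" if "test_fn UNIV \<psi>" for \<psi>
      using A0 that by auto
    show "AE t in lborel. t > 0 \<longrightarrow> (\<forall>\<psi>. test_fn UNIV \<psi> \<longrightarrow> A t \<psi> = (\<integral>x. b (t, x) * \<psi> x \<partial>lborel))"
      using Aa bs
    proof eventually_elim
      case (elim t)
      show ?case
      proof (intro impI allI)
        fix \<psi> :: "real^3 \<Rightarrow> real" assume t: "t > 0" and \<psi>: "test_fn UNIV \<psi>"
        have "(\<integral>x. a t x * \<psi> x \<partial>lebesgue) = (\<integral>x. b (t, x) * \<psi> x \<partial>lborel)"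
        proof (rule lebesgue_AE_eq_lborel(3))
          show "AE x in lborel. a t x * \<psi> x = b (t, x) * \<psi> x"
            using elim(2) t by (auto elim: eventually_mono)
        qed (intro borel_measurable_times slice tm[OF \<psi>])
        then show "A t \<psi> = (\<integral>x. b (t, x) * \<psi> x \<partial>lborel)" using elim(1) t \<psi> by simp
      qed
    qed
  qed
  have "AE p in lborel. p \<in> half_space \<longrightarrow> a (fst p) (snd p) = 0"
    using a_zero b(3) by eventually_elim simp
  then show ?thesis by (rule AE_completion)
qed

end
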